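(* Let $M$ be a complete Riemannian manifold with polynomial volume growth. Then for all integers $k\geq 1$, $$\dim \mathcal{P}_{2k}(M)\leq (k+1)\,\dim\mathcal{H}_{2k}(M).$$
   Context: $M$ is a connected complete Riemannian manifold (with time-independent metric), $\Delta$ is its Laplace–Beltrami operator, and $B_R(p)$ is the geodesic ball of radius $R$ about $p\in M$. $M$ has polynomial volume growth if there are constants $C$ and $d_V$ so that $\mathrm{Vol}(B_R(p)) \leq C(1+R)^{d_V}$ for some $p\in M$ and all $R>0$. For a constant $d\ge 0$, $\mathcal{H}_d(M)$ is the real vector space of harmonic functions $u:M\to\mathbb{R}$ ($\Delta u=0$) such that for some $p\in M$ and a constant $C_u$ depending on $u$, $\sup_{B_R(p)}|u|\leq C_u(1+R)^d$ for all $R>0$. For $d> 0$, $\mathcal{P}_d(M)$ is the real vector space of smooth ancient solutions $u:M\times(-\infty,0]\to\mathbb{R}$ of the heat equation $\partial_t u=\Delta u$ such that for some $p\in M$ and a constant $C_u$ depending on $u$, $\sup_{B_R(p)\times[-R^2,0]}|u|\leq C_u(1+R)^d$ for all $R>0$. Dimensions are real vector space dimensions and may be infinite, in which case the inequality is understood in $[0,\infty]$. *)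

theory Defs
  imports "HOL-Analysis.Analysis" "HOL-Library.Function_Algebras"
begin

section \<open>Smooth maps\<close>

text \<open>
  Derivatives are taken within \<open>S\<close>, so that on a set such as \<open>V \<times> {..0}\<close> with \<open>V\<close> open smoothness
  means smoothness up to the boundary. Only sets of this kind and open sets are used below; on them
  the derivative is unique.
\<close>

primrec Ck_on ::
  "nat \<Rightarrow> 'a::real_normed_vector set \<Rightarrow> ('a \<Rightarrow> 'b::real_normed_vector) \<Rightarrow> bool" where
  "Ck_on 0 S f \<longleftrightarrow> continuous_on S f"
| "Ck_on (Suc k) S f \<longleftrightarrow>
     (\<exists>f'. (\<forall>x\<in>S. (f has_derivative f' x) (at x within S)) \<and> (\<forall>v. Ck_on k S (\<lambda>x. f' x v)))"

definition smooth_on ::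
  "'a::real_normed_vector set \<Rightarrow> ('a \<Rightarrow> 'b::real_normed_vector) \<Rightarrow> bool" where
  "smooth_on S f \<longleftrightarrow> (\<forall>k. Ck_on k S f)"

definition partial_deriv :: "'n \<Rightarrow> (real ^ 'n \<Rightarrow> real) \<Rightarrow> real ^ 'n \<Rightarrow> real" where
  "partial_deriv i f x = frechet_derivative f (at x) (axis i 1)"


section \<open>Riemannian manifolds\<close>

text \<open>
  A chart is a pair \<open>(U, \<phi>)\<close>. The manifold is the whole type \<open>'a\<close>, its dimension is \<open>CARD('n)\<close>. A
  metric is given by its components: \<open>g (U, \<phi>) p $ i $ j\<close> is the inner product of the coordinate
  vectors \<open>\<partial>\<^sub>i\<close> and \<open>\<partial>\<^sub>j\<close> of \<open>\<phi>\<close> at \<open>p \<in> U\<close>.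
\<close>

type_synonym ('a, 'n) chart = "'a set \<times> ('a \<Rightarrow> real ^ 'n)"
type_synonym ('a, 'n) metric = "('a, 'n) chart \<Rightarrow> 'a \<Rightarrow> real ^ 'n ^ 'n"

locale riemannian_manifold =
  fixes A :: "('a::{t2_space, second_countable_topology}, 'n::finite) chart set"
    and g :: "('a, 'n) metric"
  assumes chart: "(U, \<phi>) \<in> A \<Longrightarrow>
      open U \<and> open (\<phi> ` U) \<and> homeomorphism U (\<phi> ` U) \<phi> (inv_into U \<phi>)"
    and cover: "(\<Union>(U, \<phi>)\<in>A. U) = UNIV"
    and compatible: "\<lbrakk>(U, \<phi>) \<in> A; (V, \<psi>) \<in> A\<rbrakk> \<Longrightarrow>
      smooth_on (\<phi> ` (U \<inter> V)) (\<psi> \<circ> inv_into U \<phi>)"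
    and metric_smooth: "(U, \<phi>) \<in> A \<Longrightarrow> smooth_on (\<phi> ` U) (g (U, \<phi>) \<circ> inv_into U \<phi>)"
    and metric_sym: "\<lbrakk>(U, \<phi>) \<in> A; p \<in> U\<rbrakk> \<Longrightarrow> transpose (g (U, \<phi>) p) = g (U, \<phi>) p"
    and metric_pos: "\<lbrakk>(U, \<phi>) \<in> A; p \<in> U; v \<noteq> 0\<rbrakk> \<Longrightarrow> v \<bullet> (g (U, \<phi>) p *v v) > 0"
    and metric_transform: "\<lbrakk>(U, \<phi>) \<in> A; (V, \<psi>) \<in> A; p \<in> U \<inter> V\<rbrakk> \<Longrightarrow>
      g (U, \<phi>) p =
        (let J = jacobian (\<psi> \<circ> inv_into U \<phi>) (at (\<phi> p))
         in transpose J ** g (V, \<psi>) p ** J)"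


section \<open>Distance, completeness, volume\<close>

text \<open>
  \<open>has_length A g \<gamma> L\<close>: the piecewise \<open>C\<^sup>1\<close> curve \<open>\<gamma> : [0,1] \<rightarrow> M\<close> has length \<open>L\<close>. The function \<open>s\<close> is the
  speed of \<open>\<gamma>\<close>, which does not depend on the chart it is computed in. As in
  \<open>piecewise_C1_differentiable_on\<close>, there is no condition at the finitely many points of \<open>T\<close>
  besides continuity of \<open>\<gamma>\<close>; the integral of \<open>s\<close> has to exist.
\<close>

definition has_length ::
  "('a::topological_space, 'n::finite) chart set \<Rightarrow> ('a, 'n) metric \<Rightarrow> (real \<Rightarrow> 'a) \<Rightarrow> real \<Rightarrow> bool" where
  "has_length A g \<gamma> L \<longleftrightarrow>
     continuous_on {0..1} \<gamma> \<and>
     (\<exists>T s. finite T \<and>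
        (\<forall>(U, \<phi>)\<in>A. (\<phi> \<circ> \<gamma>) C1_differentiable_on {t \<in> {0..1} - T. \<gamma> t \<in> U} \<and>
           (\<forall>t\<in>{0..1} - T. \<gamma> t \<in> U \<longrightarrow>
              (let v = vector_derivative (\<phi> \<circ> \<gamma>) (at t)
               in s t = sqrt (v \<bullet> (g (U, \<phi>) (\<gamma> t) *v v))))) \<and>
        (s has_integral L) {0..1})"

definition riem_dist ::
  "('a::topological_space, 'n::finite) chart set \<Rightarrow> ('a, 'n) metric \<Rightarrow> 'a \<Rightarrow> 'a \<Rightarrow> real" where
  "riem_dist A g p q = Inf {L. \<exists>\<gamma>. has_length A g \<gamma> L \<and> \<gamma> 0 = p \<and> \<gamma> 1 = q}"

definition geodesic_ball ::
  "('a::topological_space, 'n::finite) chart set \<Rightarrow> ('a, 'n) metric \<Rightarrow> 'a \<Rightarrow> real \<Rightarrow> 'a set" where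
  "geodesic_ball A g p R = {q. riem_dist A g p q < R}"

definition riem_complete ::
  "('a::topological_space, 'n::finite) chart set \<Rightarrow> ('a, 'n) metric \<Rightarrow> bool" where
  "riem_complete A g \<longleftrightarrow> Metric_space.mcomplete UNIV (riem_dist A g)"

text \<open>The unique Borel measure that is \<open>sqrt (det g) dx\<close> in every chart.\<close>

definition riem_volume ::
  "('a::topological_space, 'n::finite) chart set \<Rightarrow> ('a, 'n) metric \<Rightarrow> 'a measure" where
  "riem_volume A g = (THE \<mu>. sets \<mu> = sets borel \<and>
     (\<forall>(U, \<phi>)\<in>A. \<forall>E\<in>sets borel. E \<subseteq> U \<longrightarrow>
        emeasure \<mu> E =
          (\<integral>\<^sup>+x\<in>\<phi> ` E. ennreal (sqrt (det (g (U, \<phi>) (inv_into U \<phi> x)))) \<partial>lborel)))"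

definition polynomial_volume_growth ::
  "('a::topological_space, 'n::finite) chart set \<Rightarrow> ('a, 'n) metric \<Rightarrow> bool" where
  "polynomial_volume_growth A g \<longleftrightarrow>
     (\<exists>C d\<^sub>V :: real. \<exists>p. \<forall>R>0.
        emeasure (riem_volume A g) (geodesic_ball A g p R) \<le> ennreal (C * (1 + R) powr d\<^sub>V))"


section \<open>Harmonic functions and ancient caloric functions\<close>

text \<open>The Laplace--Beltrami operator in local coordinates,
  \<open>\<Delta>u = (det g)\<^sup>-\<^sup>1\<^sup>/\<^sup>2 \<Sum>i j. \<partial>\<^sub>i ((det g)\<^sup>1\<^sup>/\<^sup>2 g\<^sup>i\<^sup>j \<partial>\<^sub>j u)\<close>.\<close>

definition chart_laplacian ::
  "('a, 'n::finite) metric \<Rightarrow> ('a, 'n) chart \<Rightarrow> ('a \<Rightarrow> real) \<Rightarrow> 'a \<Rightarrow> real" where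
  "chart_laplacian g = (\<lambda>(U, \<phi>) u p.
     let G = g (U, \<phi>) \<circ> inv_into U \<phi>
     in (\<Sum>i\<in>UNIV. partial_deriv i
           (\<lambda>x. sqrt (det (G x)) *
              (\<Sum>j\<in>UNIV. matrix_inv (G x) $ i $ j * partial_deriv j (u \<circ> inv_into U \<phi>) x)) (\<phi> p))
        / sqrt (det (G (\<phi> p))))"

text \<open>
  \<open>has_laplacian A g u f\<close> says \<open>\<Delta>u = f\<close> on the manifold. The coordinate expression does not depend
  on the chart, so requiring the identity in every chart is the same as requiring it in one chart
  around each point.
\<close>

definition has_laplacian ::
  "('a, 'n::finite) chart set \<Rightarrow> ('a, 'n) metric \<Rightarrow> ('a \<Rightarrow> real) \<Rightarrow> ('a \<Rightarrow> real) \<Rightarrow> bool" where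
  "has_laplacian A g u f \<longleftrightarrow> (\<forall>(U, \<phi>)\<in>A. \<forall>p\<in>U. chart_laplacian g (U, \<phi>) u p = f p)"

definition harmonic ::
  "('a, 'n::finite) chart set \<Rightarrow> ('a, 'n) metric \<Rightarrow> ('a \<Rightarrow> real) \<Rightarrow> bool" where
  "harmonic A g u \<longleftrightarrow>
     (\<forall>(U, \<phi>)\<in>A. smooth_on (\<phi> ` U) (u \<circ> inv_into U \<phi>)) \<and> has_laplacian A g u (\<lambda>_. 0)"

definition harmonic_space ::
  "('a::topological_space, 'n::finite) chart set \<Rightarrow> ('a, 'n) metric \<Rightarrow> real \<Rightarrow> ('a \<Rightarrow> real) set"
  where
  "harmonic_space A g d =
     {u. harmonic A g u \<and>
         (\<exists>p C. \<forall>R>0. \<forall>q\<in>geodesic_ball A g p R. \<bar>u q\<bar> \<le> C * (1 + R) powr d)}"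

text \<open>
  A function on \<open>M \<times> (-\<infinity>,0]\<close> is represented by its extension by \<open>0\<close> to positive times. At time \<open>0\<close>
  the time derivative is one-sided.
\<close>

definition ancient_caloric ::
  "('a, 'n::finite) chart set \<Rightarrow> ('a, 'n) metric \<Rightarrow> ('a \<times> real \<Rightarrow> real) \<Rightarrow> bool" where
  "ancient_caloric A g u \<longleftrightarrow>
     (\<forall>p t. t > 0 \<longrightarrow> u (p, t) = 0) \<and>
     (\<forall>(U, \<phi>)\<in>A. smooth_on (\<phi> ` U \<times> {..0}) (\<lambda>(x, t). u (inv_into U \<phi> x, t))) \<and>
     (\<forall>t\<le>0. has_laplacian A g (\<lambda>p. u (p, t))
        (\<lambda>p. vector_derivative (\<lambda>s. u (p, s)) (at t within {..0})))"

definition ancient_space ::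
  "('a::topological_space, 'n::finite) chart set \<Rightarrow> ('a, 'n) metric \<Rightarrow> real \<Rightarrow>
     ('a \<times> real \<Rightarrow> real) set" where
  "ancient_space A g d =
     {u. ancient_caloric A g u \<and>
         (\<exists>p C. \<forall>R>0. \<forall>q\<in>geodesic_ball A g p R. \<forall>t\<in>{-(R\<^sup>2)..0}.
            \<bar>u (q, t)\<bar> \<le> C * (1 + R) powr d)}"


section \<open>Dimension of a space of real functions\<close>

global_interpretation fun_space: vector_space "\<lambda>(c::real) (f :: 'x \<Rightarrow> real) x. c * f x"
  by unfold_locales (auto simp: fun_eq_iff algebra_simps)

definition fun_dim :: "('x \<Rightarrow> real) set \<Rightarrow> enat" where
  "fun_dim V =
     (if \<exists>B\<subseteq>V. finite B \<and> V \<subseteq> fun_space.span B then enat (fun_space.dim V) else \<infinity>)"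

end

theory Submission imports Defs "HOL-Computational_Algebra.Polynomial" begin

text \<open>
  The idea is that an ancient solution \<open>u\<close> of polynomial growth is a polynomial in time, and that its
  leading coefficient is harmonic, so the space of ancient solutions is filtered by the degree in
  time with quotients that embed into spaces of harmonic functions.

  The first ingredient is a reverse Poincare inequality (\<open>energy_time_deriv\<close>): the space-time integral of
  \<open>(\<partial>\<^sub>t u)\<^sup>2\<close> over the parabolic cylinder of radius \<open>R\<close> is at most a universal constant times \<open>R\<^sup>-\<^sup>4\<close> times that of \<open>u\<^sup>2\<close>
  over the cylinder of radius \<open>2 R\<close>. It follows from Green's formula and from cutoff functions
  whose gradients are bounded by a constant over \<open>R\<close> and whose supports are compact by completeness. Polynomial growth
  of \<open>u\<close> and of the volume makes the energy of \<open>u\<close> over the cylinders grow polynomially. A finite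
  difference in time of \<open>u\<close> is again an ancient solution, and its energy grows with an exponent smaller by two
  (\<open>energy_growth_diff\<close>). After sufficiently many differences the exponent is negative and the solution vanishes. So \<open>u(p,\<cdot>)\<close> is a
  polynomial for each \<open>p\<close>. Its degree is at most \<open>k\<close> when \<open>u\<close> grows at most like the power \<open>2 k\<close> of the
  parabolic distance (\<open>ancient_space_polynomial_in_time\<close>).

  Let \<open>V\<^sub>j\<close> be the space of solutions of degree less than \<open>j\<close> in time. On \<open>V\<^sub>j\<^sub>+\<^sub>1\<close> the \<open>j\<close>-fold unit difference is
  constant in time, hence a harmonic function of the same growth, and it is zero only for elements of \<open>V\<^sub>j\<close>. So
  each of the \<open>k + 1\<close> steps from \<open>V\<^sub>0 = 0\<close> to \<open>V\<^sub>k\<^sub>+\<^sub>1\<close>, which is everything, adds at most the dimension of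
  the space of harmonic functions (\<open>ancient_degree_less_spanning\<close>). Differences are used in place of time
  derivatives because they visibly preserve smooth solutions and the growth condition.

  Underneath lie facts of Riemannian geometry for a metric that is given by its components in charts: existence
  and uniqueness of the volume measure, Green's formula, the topology defined by the distance, compactness of
  closed balls (Hopf and Rinow), and the smoothing of Lipschitz functions with control of the Lipschitz constant. Cutoffs
  and test functions of class \<open>C\<^sup>1\<close> suffice throughout.
\<close>

section \<open>Calculus of C1 functions\<close>

lemma Ck_on_imp_continuous_on: "Ck_on k S f \<Longrightarrow> continuous_on S f"
  by (cases k) (auto intro: has_derivative_continuous_on)

lemma Ck_on_cong:
  assumes "\<And>x. x \<in> S \<Longrightarrow> f x = h x" "Ck_on k S f" shows "Ck_on k S h"
proof (cases k)
  case 0 then show ?thesis using assms by (simp cong: continuous_on_cong)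
next
  case (Suc m)
  then obtain f' where f': "\<forall>x\<in>S. (f has_derivative f' x) (at x within S)" "\<forall>v. Ck_on m S (\<lambda>x. f' x v)"
    using assms(2) by auto
  have "(h has_derivative f' x) (at x within S)" if "x \<in> S" for x
    by (rule has_derivative_transform[OF that _ f'(1)[rule_format, OF that]]) (simp add: assms(1))
  then show ?thesis using f'(2) unfolding Suc Ck_on.simps by blast
qed

lemma Ck_on_lincomb:
  fixes f h :: "'a::real_normed_vector \<Rightarrow> 'b::real_normed_vector"
  assumes "Ck_on k S f" "Ck_on k S h" shows "Ck_on k S (\<lambda>x. a *\<^sub>R f x + b *\<^sub>R h x)"
  using assms
proof (induction k arbitrary: f h)
  case 0 then show ?case by (auto intro!: continuous_intros)
next
  case (Suc k)
  obtain f' where f': "\<forall>x\<in>S. (f has_derivative f' x) (at x within S)" "\<forall>v. Ck_on k S (\<lambda>x. f' x v)"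
    using Suc.prems by auto
  obtain h' where h': "\<forall>x\<in>S. (h has_derivative h' x) (at x within S)" "\<forall>v. Ck_on k S (\<lambda>x. h' x v)"
    using Suc.prems by auto
  have "\<forall>x\<in>S. ((\<lambda>x. a *\<^sub>R f x + b *\<^sub>R h x) has_derivative (\<lambda>x v. a *\<^sub>R f' x v + b *\<^sub>R h' x v) x) (at x within S)"
    using f'(1) h'(1) by (auto intro!: derivative_intros)
  moreover have "\<forall>v. Ck_on k S (\<lambda>x. (\<lambda>x v. a *\<^sub>R f' x v + b *\<^sub>R h' x v) x v)"
    using Suc.IH f'(2) h'(2) by auto
  ultimately show ?case unfolding Ck_on.simps by (intro exI conjI)
qed

text \<open>Every derivative of the composition is a derivative of \<open>f\<close> at the shifted point in a direction
  of the form \<open>B v\<close>, so the class is preserved one order at a time.\<close>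
lemma Ck_on_affine:
  assumes B: "bounded_linear B" and sub: "\<And>x. x \<in> T \<Longrightarrow> a + B x \<in> S" and f: "Ck_on k S f"
  shows "Ck_on k T (\<lambda>x. f (a + B x))"
  using f
proof (induction k arbitrary: f)
  case 0
  have "continuous_on T (\<lambda>x. a + B x)"
    by (intro continuous_intros linear_continuous_on B)
  then show ?case using 0 sub by (auto intro: continuous_on_compose2)
next
  case (Suc k)
  then obtain f' where f': "\<forall>x\<in>S. (f has_derivative f' x) (at x within S)" "\<forall>v. Ck_on k S (\<lambda>x. f' x v)"
    by auto
  have "((\<lambda>x. f (a + B x)) has_derivative (\<lambda>v. f' (a + B x) (B v))) (at x within T)" if "x \<in> T" for x
  proof -
    have "((\<lambda>x. a + B x) has_derivative B) (at x within T)"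
      using bounded_linear_imp_has_derivative[OF B] by (auto intro!: derivative_eq_intros simp: fun_eq_iff)
    moreover have "(f has_derivative f' (a + B x)) (at (a + B x) within (\<lambda>x. a + B x) ` T)"
      using f'(1) sub that by (auto intro: has_derivative_subset)
    ultimately show ?thesis by (rule has_derivative_in_compose)
  qed
  moreover have "Ck_on k T (\<lambda>x. f' (a + B x) (B v))" for v using Suc.IH f'(2) by auto
  ultimately show ?case unfolding Ck_on.simps by (intro exI[of _ "\<lambda>x v. f' (a + B x) (B v)"]) auto
qed

definition C1_on :: "'a::real_normed_vector set \<Rightarrow> ('a \<Rightarrow> 'b::real_normed_vector) \<Rightarrow> bool" where
  "C1_on S f \<longleftrightarrow> (\<exists>f'. (\<forall>x\<in>S. (f has_derivative f' x) (at x within S)) \<and> (\<forall>v. continuous_on S (\<lambda>x. f' x v)))"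

lemma C1_onI:
  "(\<And>x. x \<in> S \<Longrightarrow> (f has_derivative f' x) (at x within S)) \<Longrightarrow> (\<And>v. continuous_on S (\<lambda>x. f' x v)) \<Longrightarrow> C1_on S f"
  unfolding C1_on_def by blast

lemma Ck_on_imp_C1_on: "Ck_on k S f \<Longrightarrow> k > 0 \<Longrightarrow> C1_on S f"
  by (cases k) (auto simp: C1_on_def intro: Ck_on_imp_continuous_on)

lemma smooth_on_imp_C1_on: "smooth_on S f \<Longrightarrow> C1_on S f"
  unfolding smooth_on_def using Ck_on_imp_C1_on[of "Suc 0"] by blast

lemma C1_on_imp_continuous_on: "C1_on S f \<Longrightarrow> continuous_on S f"
  by (auto simp: C1_on_def intro: has_derivative_continuous_on)

lemma C1_on_subset: "C1_on S f \<Longrightarrow> T \<subseteq> S \<Longrightarrow> C1_on T f"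
  unfolding C1_on_def by (meson continuous_on_subset has_derivative_subset subsetD)

lemma C1_on_cong:
  assumes "\<And>x. x \<in> S \<Longrightarrow> f x = h x" shows "C1_on S f \<longleftrightarrow> C1_on S h"
proof -
  have "C1_on S g \<longleftrightarrow> Ck_on (Suc 0) S g" for g :: "'a \<Rightarrow> 'b" by (simp add: C1_on_def)
  then show ?thesis using Ck_on_cong[of S f h "Suc 0", OF assms] Ck_on_cong[of S h f "Suc 0", OF assms[symmetric]] by blast
qed

lemma C1_on_const: "C1_on S (\<lambda>x. c)"
  by (rule C1_onI[where f'="\<lambda>_ _. 0"]) auto

lemma C1_on_bounded_linear: "bounded_linear f \<Longrightarrow> C1_on S f"
  by (rule C1_onI[where f'="\<lambda>_. f"]) (auto intro: bounded_linear_imp_has_derivative)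

lemma C1_on_add: "C1_on S f \<Longrightarrow> C1_on S h \<Longrightarrow> C1_on S (\<lambda>x. f x + h x)"
proof -
  assume "C1_on S f" "C1_on S h"
  then obtain f' h' where "\<forall>x\<in>S. (f has_derivative f' x) (at x within S)" "\<forall>v. continuous_on S (\<lambda>x. f' x v)"
    "\<forall>x\<in>S. (h has_derivative h' x) (at x within S)" "\<forall>v. continuous_on S (\<lambda>x. h' x v)"
    unfolding C1_on_def by auto
  then show ?thesis by (intro C1_onI[where f'="\<lambda>x v. f' x v + h' x v"]) (auto intro!: derivative_intros continuous_intros)
qed

lemma C1_on_mult:
  fixes f h :: "'a::real_normed_vector \<Rightarrow> real"
  shows "C1_on S f \<Longrightarrow> C1_on S h \<Longrightarrow> C1_on S (\<lambda>x. f x * h x)"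
proof -
  assume fh: "C1_on S f" "C1_on S h"
  then obtain f' h' where "\<forall>x\<in>S. (f has_derivative f' x) (at x within S)" "\<forall>v. continuous_on S (\<lambda>x. f' x v)"
    "\<forall>x\<in>S. (h has_derivative h' x) (at x within S)" "\<forall>v. continuous_on S (\<lambda>x. h' x v)"
    unfolding C1_on_def by auto
  then show ?thesis using fh[THEN C1_on_imp_continuous_on]
    by (intro C1_onI[where f'="\<lambda>x v. f x * h' x v + f' x v * h x"]) (auto intro!: derivative_intros continuous_intros)
qed

lemma C1_on_sum:
  fixes f :: "'i \<Rightarrow> 'a::real_normed_vector \<Rightarrow> 'b::real_normed_vector"
  shows "(\<And>i. i \<in> I \<Longrightarrow> C1_on S (f i)) \<Longrightarrow> C1_on S (\<lambda>x. \<Sum>i\<in>I. f i x)"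
  by (induction I rule: infinite_finite_induct) (auto intro: C1_on_const C1_on_add)

lemma C1_on_prod:
  fixes f :: "'i \<Rightarrow> 'a::real_normed_vector \<Rightarrow> real"
  shows "(\<And>i. i \<in> I \<Longrightarrow> C1_on S (f i)) \<Longrightarrow> C1_on S (\<lambda>x. \<Prod>i\<in>I. f i x)"
  by (induction I rule: infinite_finite_induct) (auto intro: C1_on_const C1_on_mult)

lemma C1_on_cmult: "C1_on S f \<Longrightarrow> C1_on S (\<lambda>x. c * f x)" for f :: "'a::real_normed_vector \<Rightarrow> real"
  by (intro C1_on_mult C1_on_const)

lemma C1_on_diff: "C1_on S f \<Longrightarrow> C1_on S h \<Longrightarrow> C1_on S (\<lambda>x. f x - h x)" for f :: "'a::real_normed_vector \<Rightarrow> real"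
  using C1_on_add[of S f "\<lambda>x. (-1) * h x"] C1_on_cmult[of S h "-1"] by simp

text \<open>Directional derivatives are only assumed continuous one direction at a time; in finite
  dimension this suffices for the chain rule because the differential is a finite combination of
  the derivatives along a basis.\<close>
lemma C1_on_compose:
  fixes f :: "'b::euclidean_space \<Rightarrow> 'c::real_normed_vector"
  assumes t: "C1_on S t" and f: "C1_on T f" and sub: "t ` S \<subseteq> T"
  shows "C1_on S (\<lambda>x. f (t x))"
proof -
  obtain t' where t': "\<And>x. x \<in> S \<Longrightarrow> (t has_derivative t' x) (at x within S)" "\<And>v. continuous_on S (\<lambda>x. t' x v)"
    using t unfolding C1_on_def by auto
  obtain f' where f': "\<And>x. x \<in> T \<Longrightarrow> (f has_derivative f' x) (at x within T)" "\<And>v. continuous_on T (\<lambda>x. f' x v)"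
    using f unfolding C1_on_def by auto
  have ct: "continuous_on S t" using t by (rule C1_on_imp_continuous_on)
  show ?thesis
  proof (rule C1_onI[where f'="\<lambda>x v. f' (t x) (t' x v)"])
    fix x assume x: "x \<in> S"
    show "((\<lambda>x. f (t x)) has_derivative (\<lambda>v. f' (t x) (t' x v))) (at x within S)"
      using has_derivative_in_compose[OF t'(1)[OF x], of f "f' (t x)"] f'(1)[of "t x"] sub x
      by (auto intro: has_derivative_subset)
  next
    fix v
    have eq: "f' (t x) (t' x v) = (\<Sum>b\<in>Basis. (t' x v \<bullet> b) *\<^sub>R f' (t x) b)" if "x \<in> S" for x
    proof -
      interpret bounded_linear "f' (t x)" using f'(1) sub that by (blast intro: has_derivative_bounded_linear)
      have "f' (t x) (t' x v) = f' (t x) (\<Sum>b\<in>Basis. (t' x v \<bullet> b) *\<^sub>R b)" by (simp add: euclidean_representation)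
      then show ?thesis by (simp add: sum scaleR)
    qed
    have "continuous_on S (\<lambda>x. \<Sum>b\<in>Basis. (t' x v \<bullet> b) *\<^sub>R f' (t x) b)"
      using continuous_on_compose2[OF f'(2) ct sub] t'(2) by (auto intro!: continuous_intros)
    then show "continuous_on S (\<lambda>x. f' (t x) (t' x v))" using eq by (simp cong: continuous_on_cong)
  qed
qed

lemma C1_on_real_fun:
  fixes h :: "real \<Rightarrow> real"
  assumes "\<And>x. x \<in> S \<Longrightarrow> (h has_real_derivative h' x) (at x within S)" "continuous_on S h'"
  shows "C1_on S h"
  using assms by (intro C1_onI[where f'="\<lambda>x v. h' x * v"]) (auto simp: has_field_derivative_def intro!: continuous_intros)

text \<open>On an open set the derivative at a point depends only on a neighbourhood of it, so the local
  derivatives fit together.\<close>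
lemma C1_on_local:
  assumes "\<And>x. x \<in> S \<Longrightarrow> \<exists>W. open W \<and> x \<in> W \<and> C1_on (W \<inter> S) f" "open S"
  shows "C1_on S f"
proof -
  have loc: "\<exists>W. open W \<and> x \<in> W \<and> W \<subseteq> S \<and> C1_on W f" if "x \<in> S" for x
    using assms(1)[OF that] assms(2) that by (metis IntI Int_lower2 open_Int)
  have der: "(f has_derivative frechet_derivative f (at x)) (at x)"
       and ex: "\<exists>W. open W \<and> x \<in> W \<and> W \<subseteq> S \<and> (\<forall>v. continuous_on W (\<lambda>x. frechet_derivative f (at x) v))" if "x \<in> S" for x
  proof -
    obtain W where W: "open W" "x \<in> W" "W \<subseteq> S" "C1_on W f" using loc[OF \<open>x \<in> S\<close>] by blast
    then obtain f' where f': "\<And>x. x \<in> W \<Longrightarrow> (f has_derivative f' x) (at x within W)" "\<And>v. continuous_on W (\<lambda>x. f' x v)"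
      unfolding C1_on_def by auto
    have f1: "(f has_derivative f' y) (at y)" if "y \<in> W" for y
      using f'(1)[OF that] by (simp only: at_within_open[OF that W(1)])
    have f2: "f' y = frechet_derivative f (at y)" if "y \<in> W" for y
      by (rule frechet_derivative_at[OF f1[OF that]])
    show "(f has_derivative frechet_derivative f (at x)) (at x)" using f1[OF W(2)] f2[OF W(2)] by simp
    show "\<exists>W. open W \<and> x \<in> W \<and> W \<subseteq> S \<and> (\<forall>v. continuous_on W (\<lambda>x. frechet_derivative f (at x) v))"
      using W f'(2) f2 by (intro exI[of _ W]) (auto cong: continuous_on_cong)
  qed
  show ?thesis
  proof (rule C1_onI[where f'="\<lambda>x. frechet_derivative f (at x)"])
    show "(f has_derivative frechet_derivative f (at x)) (at x within S)" if "x \<in> S" for x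
      using der[OF that] by (rule has_derivative_at_withinI)
    show "continuous_on S (\<lambda>x. frechet_derivative f (at x) v)" for v
      unfolding continuous_on_eq_continuous_at[OF assms(2)]
      using ex by (metis continuous_on_eq_continuous_at)
  qed
qed

definition gradient :: "(real ^ 'n \<Rightarrow> real) \<Rightarrow> real ^ 'n \<Rightarrow> real ^ 'n::finite" where
  "gradient f x = (\<chi> i. partial_deriv i f x)"

lemma gradient_unique:
  fixes f :: "real ^ 'n::finite \<Rightarrow> real"
  assumes "(f has_derivative D) (at x)" shows "D v = gradient f x \<bullet> v"
proof -
  have D: "D = frechet_derivative f (at x)" by (rule frechet_derivative_at[OF assms])
  interpret bounded_linear D using assms by (rule has_derivative_bounded_linear)
  have "D v = D (\<Sum>i\<in>UNIV. (v $ i) *\<^sub>R axis i 1)" 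
    using basis_expansion[of v] by (simp add: scalar_mult_eq_scaleR)
  also have "\<dots> = (\<Sum>i\<in>UNIV. v $ i * D (axis i 1))" by (simp add: sum scaleR)
  finally show ?thesis by (simp add: D gradient_def partial_deriv_def inner_vec_def mult.commute)
qed

lemma has_derivative_gradient:
  fixes f :: "real ^ 'n::finite \<Rightarrow> real"
  assumes "f differentiable (at x)" shows "(f has_derivative (\<lambda>v. gradient f x \<bullet> v)) (at x)"
proof -
  obtain D where D: "(f has_derivative D) (at x)" using assms unfolding differentiable_def by blast
  moreover have "D = (\<lambda>v. gradient f x \<bullet> v)" using gradient_unique[OF D] by auto
  ultimately show ?thesis by simp
qed

lemma gradient_eqI:
  fixes f :: "real ^ 'n::finite \<Rightarrow> real"
  assumes "(f has_derivative (\<lambda>v. w \<bullet> v)) (at x)" shows "gradient f x = w"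
proof -
  have "\<forall>v. gradient f x \<bullet> v = w \<bullet> v" using gradient_unique[OF assms] by simp
  then show ?thesis by (simp only: vector_eq_rdot)
qed

lemma C1_on_differentiable: "C1_on S f \<Longrightarrow> open S \<Longrightarrow> x \<in> S \<Longrightarrow> f differentiable (at x)"
  by (auto simp: C1_on_def differentiable_def at_within_open_NO_MATCH)

lemma continuous_on_gradient:
  fixes f :: "real ^ 'n::finite \<Rightarrow> real"
  assumes "C1_on S f" "open S" shows "continuous_on S (gradient f)"
proof -
  obtain f' where f': "\<And>x. x \<in> S \<Longrightarrow> (f has_derivative f' x) (at x within S)" "\<And>v. continuous_on S (\<lambda>x. f' x v)"
    using assms unfolding C1_on_def by auto
  have "gradient f x = (\<chi> i. f' x (axis i 1))" if "x \<in> S" for x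
    using gradient_unique[of f "f' x" x] f'(1)[OF that] that assms(2)
    by (simp add: at_within_open_NO_MATCH vec_eq_iff inner_axis)
  moreover have "continuous_on S (\<lambda>x. \<chi> i. f' x (axis i 1))" using f'(2) by (intro continuous_intros)
  ultimately show ?thesis by (simp cong: continuous_on_cong)
qed

lemma gradient_cong:
  fixes f h :: "real ^ 'n::finite \<Rightarrow> real"
  assumes "open W" "x \<in> W" "\<And>y. y \<in> W \<Longrightarrow> f y = h y"
  shows "gradient f x = gradient h x"
proof -
  have "(f has_derivative D) (at x) = (h has_derivative D) (at x)" for D
    using has_derivative_transform_within_open[of f D x UNIV W h] has_derivative_transform_within_open[of h D x UNIV W f] assms
    by auto
  then show ?thesis by (simp add: gradient_def partial_deriv_def frechet_derivative_def)
qed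

lemma gradient_add: 
  fixes f h :: "real ^ 'n::finite \<Rightarrow> real"
  assumes "f differentiable (at x)" "h differentiable (at x)"
  shows "gradient (\<lambda>x. f x + h x) x = gradient f x + gradient h x"
  by (rule gradient_eqI) (auto intro!: derivative_eq_intros has_derivative_gradient assms simp: inner_add_left)

lemma gradient_mult: 
  fixes f h :: "real ^ 'n::finite \<Rightarrow> real"
  assumes "f differentiable (at x)" "h differentiable (at x)"
  shows "gradient (\<lambda>x. f x * h x) x = f x *\<^sub>R gradient h x + h x *\<^sub>R gradient f x"
  by (rule gradient_eqI) (auto intro!: derivative_eq_intros has_derivative_gradient assms simp: inner_add_left)

lemma gradient_const: "gradient (\<lambda>x. c) x = (0::real^'n::finite)"
  by (rule gradient_eqI) auto

lemma gradient_compose_real: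
  fixes f :: "real ^ 'n::finite \<Rightarrow> real"
  assumes "f differentiable (at x)" "(h has_real_derivative d) (at (f x))"
  shows "gradient (\<lambda>x. h (f x)) x = d *\<^sub>R gradient f x"
proof (rule gradient_eqI)
  have "(h has_derivative (\<lambda>v. d * v)) (at (f x))" using assms(2) by (simp add: has_field_derivative_def)
  from has_derivative_compose[OF has_derivative_gradient[OF assms(1)] this]
  show "((\<lambda>x. h (f x)) has_derivative (\<lambda>v. (d *\<^sub>R gradient f x) \<bullet> v)) (at x)" by simp
qed

lemma partial_deriv_gradient: "partial_deriv i f x = gradient f x $ i"
  by (simp add: gradient_def)

lemma C1_on_vec_nth: 
  fixes f :: "'a::real_normed_vector \<Rightarrow> 'b::euclidean_space ^ 'n::finite"
  assumes "C1_on S f" shows "C1_on S (\<lambda>x. f x $ i)"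
  using C1_on_compose[OF assms C1_on_bounded_linear[OF bounded_linear_vec_nth] subset_UNIV] by simp

lemma C1_on_det:
  fixes G :: "'a::real_normed_vector \<Rightarrow> real ^ 'n::finite ^ 'n"
  assumes "\<And>i j. C1_on S (\<lambda>x. G x $ i $ j)"
  shows "C1_on S (\<lambda>x. det (G x))"
  unfolding det_def by (intro C1_on_sum C1_on_mult C1_on_const C1_on_prod assms)

lemma C1_on_sqrt:
  assumes "C1_on S f" "\<And>x. x \<in> S \<Longrightarrow> f x > 0" shows "C1_on S (\<lambda>x. sqrt (f x))"
proof (rule C1_on_compose[OF assms(1), where T="{0<..}"])
  show "C1_on {0<..} sqrt"
    by (rule C1_on_real_fun[where h'="\<lambda>x. inverse (sqrt x) / 2"])
       (auto intro!: DERIV_real_sqrt[THEN has_field_derivative_at_within] continuous_intros)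
qed (use assms(2) in auto)

lemma C1_on_inverse:
  fixes f :: "'a::real_normed_vector \<Rightarrow> real"
  assumes "C1_on S f" "\<And>x. x \<in> S \<Longrightarrow> f x \<noteq> 0" shows "C1_on S (\<lambda>x. inverse (f x))"
proof (rule C1_on_compose[OF assms(1), where T="-{0}"])
  show "C1_on (-{0::real}) inverse"
    by (rule C1_on_real_fun[where h'="\<lambda>x. - (inverse x ^ 2)"])
       (auto intro!: DERIV_inverse[THEN has_field_derivative_at_within] derivative_eq_intros continuous_intros simp: power2_eq_square)
qed (use assms(2) in auto)

lemma matrix_mult_matrix_inv: 
  fixes B :: "real ^ 'n::finite ^ 'n"
  assumes "invertible B" shows "B ** matrix_inv B = mat 1"
  using someI_ex[of "\<lambda>C. B ** C = mat 1 \<and> C ** B = mat 1"] assms unfolding matrix_inv_def invertible_def by blast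

text \<open>Cramer's rule displays the entries of the inverse as rational functions of the entries of the
  matrix, which makes their regularity visible.\<close>
lemma matrix_inv_cramer:
  fixes B :: "real ^ 'n::finite ^ 'n"
  assumes "det B \<noteq> 0"
  shows "matrix_inv B $ i $ j = det (\<chi> k l. if l = i then (if k = j then 1 else 0) else B $ k $ l) * inverse (det B)"
proof -
  have "invertible B" using assms invertible_det_nz by blast
  then have "B *v (matrix_inv B *v axis j 1) = axis j 1"
    by (simp add: matrix_vector_mul_assoc matrix_mult_matrix_inv)
  then have "matrix_inv B *v axis j 1 = (\<chi> i. det (\<chi> k l. if l = i then axis j 1 $ k else B $ k $ l) / det B)"
    using cramer[OF assms] by blast
  moreover have "(matrix_inv B *v axis j 1) $ i = matrix_inv B $ i $ j"
    by (simp add: matrix_vector_mul_component inner_axis)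
  ultimately have "matrix_inv B $ i $ j = det (\<chi> k l. if l = i then axis j 1 $ k else B $ k $ l) / det B"
    by simp
  then show ?thesis unfolding divide_inverse by (simp only: axis_def vec_lambda_beta)
qed

lemma C1_on_matrix_inv:
  fixes G :: "'a::real_normed_vector \<Rightarrow> real ^ 'n::finite ^ 'n"
  assumes G: "\<And>i j. C1_on S (\<lambda>x. G x $ i $ j)" and d: "\<And>x. x \<in> S \<Longrightarrow> det (G x) \<noteq> 0"
  shows "C1_on S (\<lambda>x. matrix_inv (G x) $ i $ j)"
proof -
  have "C1_on S (\<lambda>x. det (\<chi> k l. if l = i then (if k = j then 1 else 0) else G x $ k $ l) * inverse (det (G x)))"
  proof (intro C1_on_mult C1_on_inverse C1_on_det G d)
    show "C1_on S (\<lambda>x. (\<chi> k l. if l = i then (if k = j then 1 else 0) else G x $ k $ l) $ ia $ ja)" for ia ja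
      by (cases "ja = i"; cases "ia = j") (auto intro: C1_on_const G)
  qed auto
  then show ?thesis by (subst C1_on_cong[OF matrix_inv_cramer]) (auto simp: d)
qed

text \<open>The determinant does not vanish on the segment from the identity to a positive definite
  matrix, so it keeps the sign that it has at the identity.\<close>
lemma det_pos_if_pos_def:
  fixes B :: "real ^ 'n::finite ^ 'n"
  assumes "\<And>v. v \<noteq> 0 \<Longrightarrow> v \<bullet> (B *v v) > 0"
  shows "det B > 0"
proof (rule ccontr)
  assume neg: "\<not> det B > 0"
  define M where "M s = (1 - s) *\<^sub>R mat 1 + s *\<^sub>R B" for s :: real
  have nz: "det (M s) \<noteq> 0" if "0 \<le> s" "s \<le> 1" for s
  proof
    assume "det (M s) = 0"
    then have "\<not> invertible (M s)" by (simp add: invertible_det_nz)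
    then obtain v where v: "v \<noteq> 0" "M s *v v = 0"
      using matrix_left_invertible_ker[of "M s"] invertible_left_inverse[of "M s"] by blast
    have "0 = v \<bullet> (M s *v v)" using v by simp
    also have "\<dots> = (1 - s) * (v \<bullet> v) + s * (v \<bullet> (B *v v))"
      by (simp add: M_def matrix_vector_mult_add_rdistrib scaleR_matrix_vector_assoc[symmetric] inner_add_right)
    also have "\<dots> > 0"
    proof (cases "s = 1")
      case True then show ?thesis using assms[OF v(1)] by simp
    next
      case False
      then have "(1 - s) * (v \<bullet> v) > 0" using that v by simp
      moreover have "s * (v \<bullet> (B *v v)) \<ge> 0" using that assms[OF v(1)] by simp
      ultimately show ?thesis by linarith
    qed
    finally show False by simp
  qed
  have "continuous_on {0..1} (\<lambda>s. det (M s))"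
    unfolding det_def M_def by (intro continuous_intros)
  moreover have "det (M 0) = 1" "det (M 1) = det B" by (auto simp: M_def)
  ultimately obtain s where "0 \<le> s" "s \<le> 1" "det (M s) = 0"
    using IVT2'[of "\<lambda>s. det (M s)" 1 0 0] neg by auto
  then show False using nz by blast
qed

lemma has_real_derivative_max0_sq: "((\<lambda>s. (max 0 s)\<^sup>2) has_real_derivative 2 * max 0 s) (at s)"
proof -
  have "((\<lambda>s. if s \<in> {0..} then s\<^sup>2 else 0) has_derivative (if s \<in> {0..} then (\<lambda>h. 2 * s * h) else (\<lambda>h. 0)))
          (at s within {0..} \<union> {..0})"
    by (rule has_derivative_If_within_closures[where f'="\<lambda>x h. 2 * x * h" and g'="\<lambda>x h. 0"])
       (auto intro!: derivative_eq_intros simp: fun_eq_iff)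
  moreover have "{0..} \<union> {..0::real} = UNIV" by auto
  moreover have "(\<lambda>s. if s \<in> {0..} then s\<^sup>2 else 0) = (\<lambda>s::real. (max 0 s)\<^sup>2)" by (auto simp: fun_eq_iff)
  moreover have "(if s \<in> {0..} then (\<lambda>h. 2 * s * h) else (\<lambda>h. 0)) = (\<lambda>h. 2 * max 0 s * h)" by (auto simp: fun_eq_iff)
  ultimately show ?thesis by (simp add: has_field_derivative_def)
qed

text \<open>A function of class \<open>C\<^sup>1\<close> that rises from 0 to 1 between 0 and 1; the truncated squares join
  with matching first derivatives. One derivative is all that cutoffs need here.\<close>
definition smooth_step :: "real \<Rightarrow> real" where
  "smooth_step s = 1 - (max 0 (1 - (max 0 s)\<^sup>2))\<^sup>2"

definition smooth_step' :: "real \<Rightarrow> real" where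
  "smooth_step' s = 2 * max 0 (1 - (max 0 s)\<^sup>2) * (2 * max 0 s)"

lemma smooth_step_deriv: "(smooth_step has_real_derivative smooth_step' s) (at s)"
proof -
  have 1: "((\<lambda>s. 1 - (max 0 s)\<^sup>2) has_real_derivative - (2 * max 0 s)) (at s)"
    by (rule DERIV_cong[OF DERIV_diff[OF DERIV_const has_real_derivative_max0_sq]]) simp
  have "((\<lambda>s. (max 0 (1 - (max 0 s)\<^sup>2))\<^sup>2) has_real_derivative 2 * max 0 (1 - (max 0 s)\<^sup>2) * - (2 * max 0 s)) (at s)"
    by (rule DERIV_chain2[OF has_real_derivative_max0_sq 1])
  from DERIV_diff[OF DERIV_const this, of 1] show ?thesis unfolding smooth_step_def[abs_def] smooth_step'_def
    by (rule DERIV_cong) simp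
qed

lemma smooth_step_0: "s \<le> 0 \<Longrightarrow> smooth_step s = 0" 
  and smooth_step_1: "s \<ge> 1 \<Longrightarrow> smooth_step s = 1"
  by (auto simp: smooth_step_def max_def not_le power2_eq_square) (metis mult_mono' mult_1 zero_le_one order_antisym)

lemma smooth_step_nonneg: "0 \<le> smooth_step s"
proof -
  have "(max 0 (1 - (max 0 s)\<^sup>2))\<^sup>2 \<le> 1\<^sup>2" by (intro power_mono) auto
  then show ?thesis unfolding smooth_step_def by simp
qed

lemma smooth_step_le1: "smooth_step s \<le> 1" by (simp add: smooth_step_def)

lemma abs_smooth_step': "\<bar>smooth_step' s\<bar> \<le> 4"
proof (cases "s \<le> 1")
  case True
  have "\<bar>smooth_step' s\<bar> = 2 * max 0 (1 - (max 0 s)\<^sup>2) * (2 * max 0 s)" by (simp add: smooth_step'_def)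
  also have "\<dots> \<le> 2 * 1 * (2 * 1)" using True by (intro mult_mono) auto
  finally show ?thesis by simp
next
  case False
  then have "1 * 1 \<le> s * s" by (intro mult_mono) auto
  then show ?thesis using False by (simp add: smooth_step'_def power2_eq_square max_def)
qed

lemma continuous_on_smooth_step': "continuous_on S smooth_step'"
  unfolding smooth_step'_def[abs_def] by (intro continuous_intros)

lemma C1_on_smooth_step: "C1_on S smooth_step"
  by (rule C1_on_real_fun[OF has_field_derivative_at_within[OF smooth_step_deriv] continuous_on_smooth_step'])

definition bump :: "'a::euclidean_space \<Rightarrow> real \<Rightarrow> 'a \<Rightarrow> real" where
  "bump c r x = smooth_step ((4 * r\<^sup>2 - (x - c) \<bullet> (x - c)) / (2 * r\<^sup>2))"

lemma C1_on_bump: "C1_on S (bump c r)"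
  unfolding bump_def[abs_def]
proof (rule C1_on_compose[OF _ C1_on_smooth_step subset_UNIV])
  have "C1_on S (\<lambda>x. (x - c) \<bullet> (x - c))"
    by (rule C1_onI[where f'="\<lambda>x v. (x - c) \<bullet> v + v \<bullet> (x - c)"]) (auto intro!: derivative_eq_intros continuous_intros)
  then show "C1_on S (\<lambda>x. (4 * r\<^sup>2 - (x - c) \<bullet> (x - c)) / (2 * r\<^sup>2))"
    unfolding divide_inverse by (intro C1_on_mult C1_on_diff C1_on_const)
qed

lemma bump_range: "0 \<le> bump c r x" "bump c r x \<le> 1"
  by (auto simp: bump_def smooth_step_nonneg smooth_step_le1)

lemma bump_eq_1: assumes "r > 0" "dist c x \<le> r" shows "bump c r x = 1"
proof -
  have "(x - c) \<bullet> (x - c) \<le> r\<^sup>2" using assms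
    by (metis dist_commute dist_norm power2_norm_eq_inner power_mono zero_le_dist)
  moreover have "0 \<le> r\<^sup>2" by simp
  ultimately have "(x - c) \<bullet> (x - c) \<le> 2 * r\<^sup>2" by linarith
  then have "1 \<le> (4 * r\<^sup>2 - (x - c) \<bullet> (x - c)) / (2 * r\<^sup>2)"
    using assms by (simp add: field_simps)
  then show ?thesis by (simp add: bump_def smooth_step_1)
qed

lemma bump_eq_0: assumes "r > 0" "dist c x \<ge> 2 * r" shows "bump c r x = 0"
proof -
  have "(2 * r)\<^sup>2 \<le> (x - c) \<bullet> (x - c)" using assms
    by (metis dist_commute dist_norm mult_nonneg_nonneg less_imp_le power2_norm_eq_inner power_mono zero_le_numeral)
  then have "(4 * r\<^sup>2 - (x - c) \<bullet> (x - c)) / (2 * r\<^sup>2) \<le> 0"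
    using assms by (simp add: field_simps)
  then show ?thesis by (simp add: bump_def smooth_step_0)
qed

text \<open>The integral of a difference quotient vanishes because Lebesgue measure is invariant under
  translations; the derivative is the dominated limit of the difference quotients.\<close>
lemma integral_directional_derivative_eq_0:
  fixes f :: "'a::euclidean_space \<Rightarrow> real"
  assumes der: "\<And>x. (f has_derivative f' x) (at x)" and cont: "\<And>v. continuous_on UNIV (\<lambda>x. f' x v)"
    and K: "compact K" and zero: "\<And>x. x \<notin> K \<Longrightarrow> f x = 0"
  shows "(\<integral>x. f' x e \<partial>lborel) = 0"
proof -
  have f'0: "f' x e = 0" if "x \<notin> K" for x
  proof -
    have "(f has_derivative (\<lambda>v. 0)) (at x)"
      by (rule has_derivative_transform_within_open[of "\<lambda>x. 0" _ _ _ "- K"])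
         (use K that zero in \<open>auto simp: compact_imp_closed open_Compl\<close>)
    then have "f' x = (\<lambda>v. 0)" using der has_derivative_unique by blast
    then show ?thesis by simp
  qed
  have "bounded ((\<lambda>x. f' x e) ` K)"
    by (intro compact_imp_bounded compact_continuous_image continuous_on_subset[OF cont] K) auto
  then obtain B where B: "\<And>x. x \<in> K \<Longrightarrow> \<bar>f' x e\<bar> \<le> B" "B > 0" unfolding bounded_pos by auto
  have B': "\<bar>f' x e\<bar> \<le> B" for x using B f'0 by (cases "x \<in> K") auto
  define q where "q n x = (f (x + (1 / real (Suc n)) *\<^sub>R e) - f x) * real (Suc n)" for n x
  define K' where "K' = (\<lambda>(x, s). x - s *\<^sub>R e) ` (K \<times> {0..1::real})"
  have K': "compact K'" unfolding K'_def
    by (intro compact_continuous_image compact_Times K) (auto simp: case_prod_unfold intro!: continuous_intros)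
  have qb: "\<bar>q n x\<bar> \<le> B * indicator K' x" for n x
  proof (cases "x \<in> K'")
    case False
    have "x = (x + s *\<^sub>R e) - s *\<^sub>R e" for s by simp
    then have "x + s *\<^sub>R e \<notin> K" if "s \<in> {0..1}" for s
      using False that unfolding K'_def by (metis (mono_tags, lifting) SigmaI case_prod_conv image_eqI)
    from this[of 0] this[of "1 / real (Suc n)"] have "f x = 0" "f (x + (1 / real (Suc n)) *\<^sub>R e) = 0"
      by (auto intro: zero)
    then show ?thesis using False by (simp add: q_def)
  next
    case True
    define h where "h = 1 / real (Suc n)"
    have h: "h > 0" by (simp add: h_def)
    have d: "((\<lambda>s. f (x + s *\<^sub>R e)) has_real_derivative f' (x + s *\<^sub>R e) e) (at s)" for s
    proof -
      have "((\<lambda>s. x + s *\<^sub>R e) has_derivative (\<lambda>s. s *\<^sub>R e)) (at s)" by (auto intro!: derivative_eq_intros)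
      from has_derivative_compose[OF this der] 
      have "((\<lambda>s. f (x + s *\<^sub>R e)) has_derivative (\<lambda>r. f' (x + s *\<^sub>R e) (r *\<^sub>R e))) (at s)" .
      then show ?thesis unfolding has_field_derivative_def
        by (simp add: linear_scale[OF has_derivative_linear[OF der]] mult.commute[of _ "f' _ _"])
    qed
    obtain z where z: "f (x + h *\<^sub>R e) - f (x + 0 *\<^sub>R e) = (h - 0) * f' (x + z *\<^sub>R e) e"
      using MVT2[OF h d] by blast
    have "q n x = f' (x + z *\<^sub>R e) e" using z h by (simp add: q_def h_def field_simps del: of_nat_Suc)
    then show ?thesis using B' True by simp
  qed
  have cf: "continuous_on UNIV f" using der by (meson has_derivative_continuous_on has_derivative_at_withinI)
  have fint: "integrable lborel f"
  proof -
    have "integrable lborel (\<lambda>x. indicator K x *\<^sub>R f x)"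
      by (rule borel_integrable_compact) (use K cf continuous_on_subset in auto)
    moreover have "(\<lambda>x. indicator K x *\<^sub>R f x) = f" using zero by (auto simp: fun_eq_iff indicator_def)
    ultimately show ?thesis by simp
  qed
  have shift: "integrable lborel (\<lambda>x. f (x + c))" "(\<integral>x. f (x + c) \<partial>lborel) = (\<integral>x. f x \<partial>lborel)" for c
  proof -
    have f_meas: "f \<in> borel_measurable borel" using cf by (rule borel_measurable_continuous_onI)
    have "lborel = distr lborel borel ((+) c)" by (rule lborel_distr_plus[symmetric])
    with fint have "integrable (distr lborel borel ((+) c)) f" by simp
    then show "integrable lborel (\<lambda>x. f (x + c))"
      by (subst (asm) integrable_distr_eq) (use f_meas in \<open>auto simp: add.commute\<close>)
    have "(\<integral>x. f x \<partial>distr lborel borel ((+) c)) = (\<integral>x. f (c + x) \<partial>lborel)"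
      by (rule integral_distr) (use f_meas in auto)
    then show "(\<integral>x. f (x + c) \<partial>lborel) = (\<integral>x. f x \<partial>lborel)"
      by (simp add: lborel_distr_plus add.commute)
  qed
  have q0: "(\<integral>x. q n x \<partial>lborel) = 0" for n
    unfolding q_def using shift fint by simp
  have "(\<lambda>n. \<integral>x. q n x \<partial>lborel) \<longlonglongrightarrow> (\<integral>x. f' x e \<partial>lborel)"
  proof (rule integral_dominated_convergence[where w="\<lambda>x. B * indicator K' x"])
    show "(\<lambda>x. f' x e) \<in> borel_measurable lborel"
      using borel_measurable_continuous_onI[OF cont] by simp
    show "q n \<in> borel_measurable lborel" for n
      unfolding q_def using shift(1) fint by (intro borel_measurable_times borel_measurable_diff borel_measurable_integrable borel_measurable_const)
    show "integrable lborel (\<lambda>x. B * indicator K' x)"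
      using K' by (auto intro!: integrable_real_indicator emeasure_compact_finite compact_imp_closed[THEN borel_closed] simp: emeasure_compact_finite)
    show "AE x in lborel. (\<lambda>n. q n x) \<longlonglongrightarrow> f' x e"
    proof (rule AE_I2)
      fix x
      have "((\<lambda>s. x + s *\<^sub>R e) has_derivative (\<lambda>s. s *\<^sub>R e)) (at 0)" by (auto intro!: derivative_eq_intros)
      from has_derivative_compose[OF this, of f "f' x"] der[of x]
      have "((\<lambda>s. f (x + s *\<^sub>R e)) has_derivative (\<lambda>r. f' x (r *\<^sub>R e))) (at 0)" by simp
      then have "((\<lambda>s. f (x + s *\<^sub>R e)) has_real_derivative f' x e) (at 0)" unfolding has_field_derivative_def
        by (simp add: linear_scale[OF has_derivative_linear[OF der]] mult.commute[of _ "f' _ _"])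
      then have lim: "((\<lambda>s. (f (x + s *\<^sub>R e) - f x) / s) \<longlongrightarrow> f' x e) (at 0)"
        by (simp add: has_field_derivative_iff)
      have "filterlim (\<lambda>n. 1 / real (Suc n)) (at 0) sequentially"
        by (auto simp: filterlim_at simp del: of_nat_Suc intro!: LIMSEQ_inverse_real_of_nat[unfolded inverse_eq_divide])
      from filterlim_compose[OF lim this]
      show "(\<lambda>n. q n x) \<longlonglongrightarrow> f' x e" by (simp add: q_def mult.commute del: of_nat_Suc)
    qed
    show "AE x in lborel. norm (q n x) \<le> B * indicator K' x" for n using qb by simp
  qed
  then show ?thesis by (simp add: q0 LIMSEQ_const_iff)
qed

text \<open>Convolution with a bump of small radius. The derivative falls on the bump, so continuity of \<open>F\<close>
  gives a \<open>C\<^sup>1\<close> function; the bound on differences of \<open>F\<close> survives averaging over translates and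
  passes to the difference quotients. The bound is allowed to be any positively homogeneous
  function \<open>N\<close>, because it will be the norm of the Riemannian metric and not the Euclidean one.\<close>
lemma mollify_lipschitz:
  fixes F :: "real ^ 'n::finite \<Rightarrow> real" and N :: "real ^ 'n \<Rightarrow> real"
  assumes F: "continuous_on UNIV F" and r: "r > 0" and d: "\<delta> > 0"
    and lip: "\<And>x y. x \<in> cball c (2 * r) \<Longrightarrow> y \<in> cball c (2 * r) \<Longrightarrow> \<bar>F x - F y\<bar> \<le> N (x - y)"
    and N: "\<And>s v. s \<ge> 0 \<Longrightarrow> N (s *\<^sub>R v) = s * N v"
  shows "\<exists>f. C1_on UNIV f \<and> (\<forall>x\<in>cball c r. \<bar>f x - F x\<bar> \<le> \<delta>) \<and> (\<forall>x\<in>ball c r. \<forall>v. \<bar>gradient f x \<bullet> v\<bar> \<le> N v)"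
proof -
  have "uniformly_continuous_on (cball c (2 * r)) F"
    by (intro compact_uniformly_continuous continuous_on_subset[OF F]) auto
  then obtain e0 where e0: "e0 > 0" 
    "\<And>x y. x \<in> cball c (2 * r) \<Longrightarrow> y \<in> cball c (2 * r) \<Longrightarrow> dist y x < e0 \<Longrightarrow> dist (F y) (F x) < \<delta>"
    using d unfolding uniformly_continuous_on_def by metis
  define e where "e = min (e0 / 2) r"
  have e: "0 < e" "e \<le> r" "e < e0" using e0 r by (auto simp: e_def)
  define k where "k z = (max 0 (e\<^sup>2 - z \<bullet> z))\<^sup>2" for z :: "real^'n"
  define k' where "k' z = (- 4 * max 0 (e\<^sup>2 - z \<bullet> z)) *\<^sub>R z" for z :: "real^'n"
  have k0: "k z = 0" if "norm z \<ge> e" for z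
    using that e power_mono[of e "norm z" 2] by (simp add: k_def power2_norm_eq_inner)
  have knn: "k z \<ge> 0" for z by (simp add: k_def)
  have kder: "(k has_derivative (\<lambda>v. k' z \<bullet> v)) (at z)" for z
  proof -
    have "((\<lambda>z. e\<^sup>2 - z \<bullet> z) has_derivative (\<lambda>v. - 2 * (z \<bullet> v))) (at z)"
      by (auto intro!: derivative_eq_intros simp: inner_commute)
    moreover have "((\<lambda>s. (max 0 s)\<^sup>2) has_derivative (\<lambda>h. 2 * max 0 (e\<^sup>2 - z \<bullet> z) * h)) (at (e\<^sup>2 - z \<bullet> z))"
      using has_real_derivative_max0_sq[of "e\<^sup>2 - z \<bullet> z"] unfolding has_field_derivative_def .
    ultimately have "((\<lambda>z. (max 0 (e\<^sup>2 - z \<bullet> z))\<^sup>2) has_derivative (\<lambda>v. 2 * max 0 (e\<^sup>2 - z \<bullet> z) * (- 2 * (z \<bullet> v)))) (at z)"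
      by (rule has_derivative_compose)
    then show ?thesis unfolding k_def[abs_def] k'_def by (simp add: mult_ac)
  qed
  have kc: "continuous_on S k" for S unfolding k_def[abs_def] by (intro continuous_intros)
  have k'c: "continuous_on S k'" for S unfolding k'_def[abs_def] by (intro continuous_intros)
  have kFint: "integrable lborel (\<lambda>z. k z * F (x - z))" for x
  proof -
    have "integrable lborel (\<lambda>z. indicator (cball 0 e) z *\<^sub>R (k z * F (x - z)))"
      by (intro borel_integrable_compact continuous_intros kc continuous_on_compose2[OF F]) auto
    moreover have "(\<lambda>z. indicator (cball 0 e) z *\<^sub>R (k z * F (x - z))) = (\<lambda>z. k z * F (x - z))"
      using k0 by (auto simp: fun_eq_iff indicator_def)
    ultimately show ?thesis by simp
  qed
  have kint: "integrable lborel k"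
  proof -
    have "integrable lborel (\<lambda>z. indicator (cball 0 e) z *\<^sub>R k z)"
      by (intro borel_integrable_compact kc) auto
    moreover have "(\<lambda>z. indicator (cball 0 e) z *\<^sub>R k z) = k"
      using k0 by (auto simp: fun_eq_iff indicator_def)
    ultimately show ?thesis by simp
  qed
  define \<kappa> where "\<kappa> = (\<integral>z. k z \<partial>lborel)"
  have \<kappa>: "\<kappa> > 0"
  proof -
    define b where "b = (e\<^sup>2 / 2)\<^sup>2"
    have b: "b > 0" using e by (simp add: b_def)
    have kb: "b * indicator (cball 0 (e/2)) z \<le> k z" for z :: "real^'n"
    proof (cases "z \<in> cball 0 (e / 2)")
      case True
      then have "z \<bullet> z \<le> (e / 2)\<^sup>2" using power_mono[of "norm z" "e/2" 2] by (simp add: power2_norm_eq_inner)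
      moreover have "(e / 2)\<^sup>2 \<le> e\<^sup>2 / 2" by (simp add: power_divide)
      ultimately have "e\<^sup>2 / 2 \<le> max 0 (e\<^sup>2 - z \<bullet> z)" by linarith
      then show ?thesis using True by (simp add: k_def b_def power_mono)
    qed (simp add: knn)
    have "0 < b * measure lborel (cball (0::real^'n) (e/2))"
      using b content_cball_pos[of "e/2" "0::real^'n"] e by (simp add: measure_lborel_cbox_eq)
    also have "\<dots> = (\<integral>z. b * indicator (cball 0 (e/2)) (z::real^'n) \<partial>lborel)"
      by simp
    also have "\<dots> \<le> \<kappa>" unfolding \<kappa>_def
      by (rule integral_mono[OF _ kint kb]) (auto intro!: integrable_real_indicator emeasure_compact_finite)
    finally show ?thesis .
  qed
  obtain a b where ab: "cball c (2 * r) \<subseteq> cbox a b"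
    using bounded_subset_cbox_symmetric[OF bounded_cball, of c "2*r"] by blast
  define f where "f x = integral (cbox a b) (\<lambda>y. k (x - y) * F y) / \<kappa>" for x
  define f' where "f' x v = integral (cbox a b) (\<lambda>y. (k' (x - y) \<bullet> v) * F y) / \<kappa>" for x v
  have f_der: "(f has_derivative f' x) (at x)" for x
  proof -
    define fx where "fx x y = F y *\<^sub>R blinfun_inner_right (k' (x - y))" for x y
    have cfx: "continuous_on S (\<lambda>(x, y). fx x y)" for S
      unfolding fx_def case_prod_unfold
      by (intro continuous_intros continuous_on_compose2[OF F] continuous_on_compose2[OF k'c]
           bounded_linear.continuous_on[OF bounded_linear_blinfun_inner_right]) auto
    have "((\<lambda>x. integral (cbox a b) (\<lambda>y. k (x - y) * F y)) has_derivative integral (cbox a b) (fx x)) (at x within UNIV)"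
    proof (rule leibniz_rule)
      fix x y :: "real^'n"
      have "((\<lambda>x. x - y) has_derivative (\<lambda>v. v)) (at x)" by (auto intro!: derivative_eq_intros)
      from has_derivative_compose[OF this kder[of "x - y"]] have "((\<lambda>x. k (x - y)) has_derivative (\<lambda>v. k' (x - y) \<bullet> v)) (at x)" .
      then have "((\<lambda>x. k (x - y) * F y) has_derivative (\<lambda>v. (k' (x - y) \<bullet> v) * F y)) (at x)"
        by (rule has_derivative_mult_left)
      moreover have "blinfun_apply (fx x y) = (\<lambda>v. (k' (x - y) \<bullet> v) * F y)"
        by (auto simp: fun_eq_iff fx_def blinfun.scaleR_left)
      ultimately show "((\<lambda>x. k (x - y) * F y) has_derivative blinfun_apply (fx x y)) (at x within UNIV)" by simp
      show "(\<lambda>y. k (x - y) * F y) integrable_on cbox a b"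
        by (intro integrable_continuous continuous_intros continuous_on_compose2[OF F] continuous_on_compose2[OF kc]) auto
    qed (auto intro: cfx)
    moreover have "blinfun_apply (integral (cbox a b) (fx x)) v = integral (cbox a b) (\<lambda>y. (k' (x - y) \<bullet> v) * F y)" for v
    proof -
      have "fx x integrable_on cbox a b"
      proof (rule integrable_continuous)
        have "continuous_on (cbox a b) (\<lambda>y. (x, y))" by (intro continuous_intros)
        from continuous_on_compose2[OF cfx[of UNIV] this]
        show "continuous_on (cbox a b) (fx x)" by auto
      qed
      then have "blinfun_apply (integral (cbox a b) (fx x)) v = integral (cbox a b) (\<lambda>y. blinfun_apply (fx x y) v)"
        using integral_linear[of "fx x" "cbox a b" "\<lambda>L. blinfun_apply L v"]
        by (simp add: o_def bounded_bilinear.bounded_linear_left[OF bounded_bilinear_blinfun_apply])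
      then show ?thesis by (simp add: fx_def blinfun.scaleR_left mult.commute)
    qed
    ultimately have "((\<lambda>x. integral (cbox a b) (\<lambda>y. k (x - y) * F y)) has_derivative (\<lambda>v. integral (cbox a b) (\<lambda>y. (k' (x - y) \<bullet> v) * F y))) (at x)"
      by (metis (no_types, lifting) ext)
    then show ?thesis unfolding f_def[abs_def] f'_def divide_inverse by (rule has_derivative_mult_left)
  qed
  have f'_cont: "continuous_on UNIV (\<lambda>x. f' x v)" for v
    unfolding f'_def
  proof (intro continuous_on_divide continuous_on_const)
    show "continuous_on UNIV (\<lambda>x. integral (cbox a b) (\<lambda>y. (k' (x - y) \<bullet> v) * F y))"
      by (rule integral_continuous_on_param)
         (auto simp: case_prod_unfold intro!: continuous_intros continuous_on_compose2[OF F] continuous_on_compose2[OF k'c])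
  qed (use \<kappa> in auto)
  have C1: "C1_on UNIV f" using f_der f'_cont by (intro C1_onI[where f'=f']) auto
  have feq: "f x = (\<integral>z. k z * F (x - z) \<partial>lborel) / \<kappa>" if x: "x \<in> cball c r" for x
  proof -
    let ?g = "\<lambda>y. k (x - y) * F y"
    have gm: "?g \<in> borel_measurable borel"
      by (intro borel_measurable_continuous_onI continuous_intros F continuous_on_compose2[OF kc]) auto
    have g0: "?g y = 0" if "y \<notin> cbox a b" for y
    proof -
      have "y \<notin> cball c (2 * r)" using that ab by auto
      then have "norm (x - y) \<ge> e" using x e norm_triangle_ineq[of "c - x" "x - y"] 
        by (auto simp: dist_norm)
      then show ?thesis by (simp add: k0)
    qed
    have "set_integrable lborel (cbox a b) ?g"
      unfolding set_integrable_def
      by (intro borel_integrable_compact continuous_intros continuous_on_compose2[OF F] continuous_on_compose2[OF kc]) auto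
    then have "(LINT y:cbox a b|lborel. ?g y) = integral (cbox a b) ?g"
      by (rule set_borel_integral_eq_integral(2))
    moreover have "(LINT y:cbox a b|lborel. ?g y) = (\<integral>y. ?g y \<partial>lborel)"
      unfolding set_lebesgue_integral_def using g0 by (intro Bochner_Integration.integral_cong) (auto simp: indicator_def)
    moreover have "(\<integral>y. ?g y \<partial>lborel) = (\<integral>z. k z * F (x - z) \<partial>lborel)"
    proof -
      have "distr lborel borel (\<lambda>z. x - z) = (lborel :: (real^'n) measure)"
        using lborel_affine[of "-1" x] by (simp add: density_1)
      then have "(\<integral>y. ?g y \<partial>lborel) = (\<integral>y. ?g y \<partial>distr lborel borel (\<lambda>z. x - z))" by simp
      also have "\<dots> = (\<integral>z. ?g (x - z) \<partial>lborel)" by (rule integral_distr) (use gm in auto)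
      finally show ?thesis by simp
    qed
    ultimately show ?thesis by (simp add: f_def)
  qed
  have est: "\<bar>f x - b\<bar> \<le> B" if x: "x \<in> cball c r" and le: "\<And>z. norm z < e \<Longrightarrow> \<bar>F (x - z) - G z\<bar> \<le> B"
    and G: "integrable lborel (\<lambda>z. k z * G z)" "(\<integral>z. k z * G z \<partial>lborel) = b * \<kappa>" for x b B G
  proof -
    have "\<bar>(\<integral>z. k z * F (x - z) \<partial>lborel) - b * \<kappa>\<bar> = \<bar>\<integral>z. k z * F (x - z) - k z * G z \<partial>lborel\<bar>"
      using kFint G by simp
    also have "\<dots> \<le> (\<integral>z. B * k z \<partial>lborel)"
    proof (rule integral_abs_bound_integral)
      show "\<bar>k z * F (x - z) - k z * G z\<bar> \<le> B * k z" for z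
      proof (cases "norm z < e")
        case True
        have "\<bar>k z * F (x - z) - k z * G z\<bar> = k z * \<bar>F (x - z) - G z\<bar>"
          using knn[of z] by (simp add: abs_mult right_diff_distrib[symmetric])
        also have "\<dots> \<le> k z * B" by (intro mult_left_mono le True knn)
        finally show ?thesis by (simp add: mult.commute)
      qed (simp add: k0)
    qed (use kFint G kint in auto)
    also have "\<dots> = B * \<kappa>" by (simp add: \<kappa>_def)
    finally have "\<bar>(\<integral>z. k z * F (x - z) \<partial>lborel) - b * \<kappa>\<bar> / \<kappa> \<le> B" using \<kappa> by (simp add: divide_le_eq)
    moreover have "f x - b = ((\<integral>z. k z * F (x - z) \<partial>lborel) - b * \<kappa>) / \<kappa>" using \<kappa> feq[OF x] by (simp add: field_simps)
    ultimately show ?thesis using \<kappa> by (simp add: abs_divide)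
  qed
  have shift_in: "x - z \<in> cball c (2 * r)" if "x \<in> cball c r" "norm z < e" for x z
  proof -
    have "norm (c - (x - z)) \<le> norm (c - x) + norm z" using norm_triangle_ineq[of "c - x" z] by (simp add: algebra_simps)
    then show ?thesis using that e by (auto simp: dist_norm)
  qed
  have close: "\<bar>f x - F x\<bar> \<le> \<delta>" if x: "x \<in> cball c r" for x
  proof (rule est[OF x, where G="\<lambda>z. F x"])
    fix z :: "real^'n" assume z: "norm z < e"
    have "dist (F (x - z)) (F x) < \<delta>"
    proof (rule e0(2))
      show "x \<in> cball c (2 * r)" using x r by auto
      show "x - z \<in> cball c (2 * r)" using shift_in[OF x z] .
      show "dist (x - z) x < e0" using z e by (simp add: dist_norm)
    qed
    then show "\<bar>F (x - z) - F x\<bar> \<le> \<delta>" by (simp add: dist_real_def)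
  qed (auto simp: kint \<kappa>_def)
  have flip: "\<bar>f x - f y\<bar> \<le> N (x - y)" if x: "x \<in> cball c r" "y \<in> cball c r" for x y
  proof (rule est[OF x(1), where G="\<lambda>z. F (y - z)"])
    fix z :: "real^'n" assume z: "norm z < e"
    have "\<bar>F (x - z) - F (y - z)\<bar> \<le> N ((x - z) - (y - z))"
      by (rule lip[OF shift_in[OF x(1) z] shift_in[OF x(2) z]])
    then show "\<bar>F (x - z) - F (y - z)\<bar> \<le> N (x - y)" by simp
  qed (use x \<kappa> kFint feq in auto)
  have grad: "\<bar>gradient f x \<bullet> v\<bar> \<le> N v" if x: "x \<in> ball c r" for x v
  proof -
    have fd: "f differentiable (at x)" using f_der differentiable_def by blast
    have "((\<lambda>s. x + s *\<^sub>R v) has_derivative (\<lambda>s. s *\<^sub>R v)) (at 0)" by (auto intro!: derivative_eq_intros)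
    from has_derivative_compose[OF this, of f "\<lambda>v. gradient f x \<bullet> v"] has_derivative_gradient[OF fd]
    have "((\<lambda>s. f (x + s *\<^sub>R v)) has_real_derivative gradient f x \<bullet> v) (at 0)"
      by (simp add: has_field_derivative_def mult.commute[of _ "gradient f x \<bullet> v"])
    then have lim: "((\<lambda>s. (f (x + s *\<^sub>R v) - f x) / s) \<longlongrightarrow> gradient f x \<bullet> v) (at_right 0)"
      by (auto simp: has_field_derivative_iff intro: tendsto_within_subset)
    have "((\<lambda>s. x + s *\<^sub>R v) \<longlongrightarrow> x + 0 *\<^sub>R v) (at_right 0)" by (intro tendsto_intros)
    then have "\<forall>\<^sub>F s in at_right 0. x + s *\<^sub>R v \<in> ball c r"
      using x by (intro topological_tendstoD) auto
    then have "\<forall>\<^sub>F s in at_right 0. \<bar>(f (x + s *\<^sub>R v) - f x) / s\<bar> \<le> N v"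
      using eventually_at_right_less[of "0::real"]
    proof eventually_elim
      case (elim s)
      have "\<bar>f (x + s *\<^sub>R v) - f x\<bar> \<le> N ((x + s *\<^sub>R v) - x)" using flip[of "x + s *\<^sub>R v" x] elim x by auto
      also have "\<dots> = s * N v" using N[of s v] elim by simp
      finally show ?case using elim by (simp add: abs_divide divide_le_eq mult.commute)
    qed
    with tendsto_rabs[OF lim] show ?thesis by (rule tendsto_upperbound) auto
  qed
  show ?thesis using C1 close grad by blast
qed

text \<open>Restricting the full derivative to the directions \<open>(v, 0)\<close> and \<open>(0, 1)\<close> gives the partial derivatives. Any
  derivative within the cylinder will do, which covers the terminal time, where there is no
  two-sided one.\<close>
lemma C1_on_cylinder_slices:
  fixes F :: "(real ^ 'n::finite) \<times> real \<Rightarrow> real"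
  assumes V: "open V" and F: "C1_on (V \<times> {..0}) F"
  shows "\<And>x t. x \<in> V \<Longrightarrow> t \<le> 0 \<Longrightarrow> ((\<lambda>s. F (x, s)) has_vector_derivative vector_derivative (\<lambda>s. F (x, s)) (at t within {..0})) (at t within {..0})"
    and "\<And>t. t \<le> 0 \<Longrightarrow> C1_on V (\<lambda>y. F (y, t))"
    and "continuous_on (V \<times> {..0}) (\<lambda>(y, s). vector_derivative (\<lambda>s. F (y, s)) (at s within {..0}))"
    and "continuous_on (V \<times> {..0}) (\<lambda>(y, s). gradient (\<lambda>z. F (z, s)) y)"
    and "\<And>F' x t. (\<forall>z\<in>V \<times> {..0}. (F has_derivative F' z) (at z within V \<times> {..0})) \<Longrightarrow> x \<in> V \<Longrightarrow> t \<le> 0 \<Longrightarrow>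
          vector_derivative (\<lambda>s. F (x, s)) (at t within {..0}) = F' (x, t) (0, 1) \<and>
          gradient (\<lambda>z. F (z, t)) x = (\<chi> i. F' (x, t) (axis i 1, 0))"
proof -
  have *: "((\<lambda>s. F (x, s)) has_vector_derivative F' (x, t) (0, 1)) (at t within {..0})"
      "((\<lambda>y. F (y, t)) has_derivative (\<lambda>v. F' (x, t) (v, 0))) (at x)"
    if F': "\<forall>z\<in>V \<times> {..0}. (F has_derivative F' z) (at z within V \<times> {..0})" and x: "x \<in> V" "t \<le> 0" for F' x t
  proof -
    have D: "(F has_derivative F' (x, t)) (at (x, t) within V \<times> {..0})" using F' x by auto
    interpret bounded_linear "F' (x, t)" using D by (rule has_derivative_bounded_linear)
    have "((\<lambda>s. (x, s)) has_derivative (\<lambda>r. (0, r))) (at t within {..0})" by (auto intro!: derivative_eq_intros)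
    from has_derivative_in_compose[OF this has_derivative_subset[OF D]] x
    have "((\<lambda>s. F (x, s)) has_derivative (\<lambda>r. F' (x, t) (0, r))) (at t within {..0})" by auto
    moreover have "(\<lambda>r. F' (x, t) (0, r)) = (\<lambda>r. r *\<^sub>R F' (x, t) (0, 1))"
    proof
      show "F' (x, t) (0, r) = r *\<^sub>R F' (x, t) (0, 1)" for r using scaleR[of r "(0, 1)"] by simp
    qed
    ultimately show "((\<lambda>s. F (x, s)) has_vector_derivative F' (x, t) (0, 1)) (at t within {..0})"
      by (simp only: has_vector_derivative_def)
    have "((\<lambda>y. (y, t)) has_derivative (\<lambda>v. (v, 0))) (at x within V)" by (auto intro!: derivative_eq_intros)
    from has_derivative_in_compose[OF this has_derivative_subset[OF D]] x
    have "((\<lambda>y. F (y, t)) has_derivative (\<lambda>v. F' (x, t) (v, 0))) (at x within V)" by auto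
    then show "((\<lambda>y. F (y, t)) has_derivative (\<lambda>v. F' (x, t) (v, 0))) (at x)"
      using V x by (simp add: at_within_open_NO_MATCH)
  qed
  have nb: "at t within {..0} \<noteq> bot" if "t \<le> 0" for t :: real
  proof -
    have "{..<t} \<subseteq> {..0}" using that by (intro subsetI) simp
    then show ?thesis using at_le[of "{..<t}" "{..0}" t] trivial_limit_at_left_real[of t]
      by (auto simp: bot_unique)
  qed
  show 5: "vector_derivative (\<lambda>s. F (x, s)) (at t within {..0}) = F' (x, t) (0, 1) \<and>
          gradient (\<lambda>z. F (z, t)) x = (\<chi> i. F' (x, t) (axis i 1, 0))"
    if F': "\<forall>z\<in>V \<times> {..0}. (F has_derivative F' z) (at z within V \<times> {..0})" and x: "x \<in> V" "t \<le> 0" for F' x t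
    using vector_derivative_within[OF nb[OF x(2)] *(1)[OF that]] gradient_unique[OF *(2)[OF that]]
    by (auto simp: vec_eq_iff inner_axis)
  obtain F' where F': "\<forall>z\<in>V \<times> {..0}. (F has_derivative F' z) (at z within V \<times> {..0})"
    and cF': "\<And>v. continuous_on (V \<times> {..0}) (\<lambda>z. F' z v)" using F unfolding C1_on_def by blast
  show "((\<lambda>s. F (x, s)) has_vector_derivative vector_derivative (\<lambda>s. F (x, s)) (at t within {..0})) (at t within {..0})"
    if "x \<in> V" "t \<le> 0" for x t
    using *(1)[OF F' that] 5[OF F' that] by simp
  show "C1_on V (\<lambda>y. F (y, t))" if t: "t \<le> 0" for t
  proof (rule C1_onI[where f'="\<lambda>x v. F' (x, t) (v, 0)"])
    show "((\<lambda>y. F (y, t)) has_derivative (\<lambda>v. F' (x, t) (v, 0))) (at x within V)" if "x \<in> V" for x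
      using *(2)[OF F' that t] by (rule has_derivative_at_withinI)
    show "continuous_on V (\<lambda>x. F' (x, t) (v, 0))" for v
      by (rule continuous_on_compose2[OF cF'[of "(v, 0)"], where f="\<lambda>x. (x, t)"]) (use t in \<open>auto intro!: continuous_intros\<close>)
  qed
  have "continuous_on (V \<times> {..0}) (\<lambda>z. F' z (0, 1))" by (rule cF')
  then show "continuous_on (V \<times> {..0}) (\<lambda>(y, s). vector_derivative (\<lambda>s. F (y, s)) (at s within {..0}))"
    by (rule continuous_on_eq) (use 5[OF F'] in auto)
  have "continuous_on (V \<times> {..0}) (\<lambda>z. \<chi> i. F' z (axis i 1, 0))" by (intro continuous_intros cF')
  then show "continuous_on (V \<times> {..0}) (\<lambda>(y, s). gradient (\<lambda>z. F (z, s)) y)"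
    by (rule continuous_on_eq) (use 5[OF F'] in auto)
qed

lemma C1_on_time_derivative:
  fixes F :: "(real ^ 'n::finite) \<times> real \<Rightarrow> real"
  assumes V: "open V" and F: "Ck_on (Suc (Suc 0)) (V \<times> {..0}) F"
  shows "C1_on (V \<times> {..0}) (\<lambda>(x, t). vector_derivative (\<lambda>s. F (x, s)) (at t within {..0}))"
    and "C1_on (V \<times> {..0}) (\<lambda>(x, t). gradient (\<lambda>y. F (y, t)) x $ i)"
proof -
  have F1: "C1_on (V \<times> {..0}) F" using F by (rule Ck_on_imp_C1_on) simp
  obtain F' where F': "\<forall>z\<in>V \<times> {..0}. (F has_derivative F' z) (at z within V \<times> {..0})"
    and cF': "\<And>v. C1_on (V \<times> {..0}) (\<lambda>z. F' z v)" using F Ck_on_imp_C1_on[of "Suc 0"] unfolding Ck_on.simps(2)[of "Suc 0"] by blast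
  note * = C1_on_cylinder_slices(5)[OF V F1 F']
  show "C1_on (V \<times> {..0}) (\<lambda>(x, t). vector_derivative (\<lambda>s. F (x, s)) (at t within {..0}))"
    by (subst C1_on_cong[where h="\<lambda>z. F' z (0, 1)"]) (use * cF' in auto)
  show "C1_on (V \<times> {..0}) (\<lambda>(x, t). gradient (\<lambda>y. F (y, t)) x $ i)"
    by (subst C1_on_cong[where h="\<lambda>z. F' z (axis i 1, 0)"]) (use * cF' in auto)
qed

text \<open>Differentiating \<open>F x t = F x a + \<integral>\<^sub>a\<^sup>t \<partial>\<^sub>s F x s ds\<close> in \<open>x\<close> under the integral and then in \<open>t\<close> shows
  that the derivatives commute also at the terminal time, where the time derivative is one-sided.\<close>
lemma time_derivative_gradient:
  fixes F :: "(real ^ 'n::finite) \<times> real \<Rightarrow> real"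
  assumes V: "open V" and F: "Ck_on (Suc (Suc 0)) (V \<times> {..0}) F" and x: "x \<in> V" and t: "t \<le> 0"
  shows "((\<lambda>s. gradient (\<lambda>y. F (y, s)) x) has_vector_derivative
           gradient (\<lambda>y. vector_derivative (\<lambda>s. F (y, s)) (at t within {..0})) x) (at t within {..0})"
proof -
  define Ft where "Ft y s = vector_derivative (\<lambda>s. F (y, s)) (at s within {..0})" for y s
  have F1: "C1_on (V \<times> {..0}) F" using F by (rule Ck_on_imp_C1_on) simp
  have Ft1: "C1_on (V \<times> {..0}) (\<lambda>(y, s). Ft y s)" unfolding Ft_def by (rule C1_on_time_derivative[OF V F])
  note sF = C1_on_cylinder_slices[OF V F1, folded Ft_def]
  note sFt = C1_on_cylinder_slices[OF V Ft1, simplified]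
  obtain \<delta> where \<delta>: "\<delta> > 0" "ball x \<delta> \<subseteq> V" using V x openE by blast
  define a where "a = t - 1"
  have comp: "((\<lambda>s. gradient (\<lambda>y. F (y, s)) x $ i) has_vector_derivative gradient (\<lambda>y. Ft y t) x $ i) (at t within {..0})" for i
  proof -
    let ?e = "axis i 1 :: real^'n"
    let ?U = "{-\<delta><..<\<delta>}"
    have inV: "x + r *\<^sub>R ?e \<in> V" if "r \<in> ?U" for r
      using \<delta> that by (auto simp: dist_norm intro!: subsetD[OF \<delta>(2)])
    have dir: "((\<lambda>r. h (x + r *\<^sub>R ?e)) has_field_derivative gradient h (x + r *\<^sub>R ?e) $ i) (at r)" 
      if "C1_on V h" "r \<in> ?U" for h r
    proof -
      have "((\<lambda>r. x + r *\<^sub>R ?e) has_derivative (\<lambda>r. r *\<^sub>R ?e)) (at r)" by (auto intro!: derivative_eq_intros)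
      from has_derivative_compose[OF this has_derivative_gradient[OF C1_on_differentiable[OF that(1) V inV[OF that(2)]]]]
      show ?thesis by (simp add: has_field_derivative_def inner_axis mult_commute_abs)
    qed
    define q where "q s = gradient (\<lambda>y. Ft y s) x $ i" for s
    have incr: "gradient (\<lambda>y. F (y, u)) x $ i - gradient (\<lambda>y. F (y, a)) x $ i = integral {a..u} q" if u: "a \<le> u" "u \<le> 0" for u
    proof -
      have a0: "a \<le> 0" using u by simp
      have eq: "F (y, u) - F (y, a) = integral {a..u} (Ft y)" if "y \<in> V" for y
      proof -
        have "(Ft y has_integral F (y, u) - F (y, a)) {a..u}"
          using u that by (intro fundamental_theorem_of_calculus has_vector_derivative_within_subset[OF sF(1)]) auto
        then show ?thesis by (simp add: integral_unique)
      qed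
      have "((\<lambda>r. integral (cbox a u) (Ft (x + r *\<^sub>R ?e))) has_field_derivative 
              integral (cbox a u) (\<lambda>s. gradient (\<lambda>y. Ft y s) (x + 0 *\<^sub>R ?e) $ i)) (at 0 within ?U)"
      proof (rule leibniz_rule_field_derivative)
        fix r s assume r: "r \<in> ?U" and "s \<in> cbox a u"
        then have "s \<le> 0" using u by simp
        from dir[OF sFt(2)[OF this] r] 
        show "((\<lambda>r. Ft (x + r *\<^sub>R ?e) s) has_field_derivative gradient (\<lambda>y. Ft y s) (x + r *\<^sub>R ?e) $ i) (at r within ?U)"
          by (rule has_field_derivative_at_within)
      next
        fix r assume r: "r \<in> ?U"
        have "continuous_on (cbox a u) (Ft (x + r *\<^sub>R ?e))"
        proof -
          have "continuous_on (cbox a u) (\<lambda>s. (\<lambda>(y, s). Ft y s) (x + r *\<^sub>R ?e, s))"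
            using sF(3) by (rule continuous_on_compose2) (use u inV[OF r] in \<open>auto intro!: continuous_intros\<close>)
          then show ?thesis by simp
        qed
        then show "Ft (x + r *\<^sub>R ?e) integrable_on cbox a u" by (rule integrable_continuous)
      next
        have "continuous_on (?U \<times> cbox a u) (\<lambda>z. (\<lambda>(y, s). gradient (\<lambda>y. Ft y s) y) (x + fst z *\<^sub>R ?e, snd z))"
          using sFt(4) by (rule continuous_on_compose2) (use u inV in \<open>auto intro!: continuous_intros\<close>)
        then show "continuous_on (?U \<times> cbox a u) (\<lambda>(r, s). gradient (\<lambda>y. Ft y s) (x + r *\<^sub>R ?e) $ i)"
          by (auto simp: case_prod_unfold intro!: continuous_intros)
      qed (use \<delta> in auto)
      then have 1: "((\<lambda>r. integral (cbox a u) (Ft (x + r *\<^sub>R ?e))) has_field_derivative integral {a..u} q) (at 0)"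
        using \<delta> by (simp add: at_within_open_NO_MATCH q_def[abs_def])
      have "((\<lambda>r. F (x + r *\<^sub>R ?e, u) - F (x + r *\<^sub>R ?e, a)) has_field_derivative
              gradient (\<lambda>y. F (y, u)) (x + 0 *\<^sub>R ?e) $ i - gradient (\<lambda>y. F (y, a)) (x + 0 *\<^sub>R ?e) $ i) (at 0)"
        using \<delta> by (intro DERIV_diff dir sF(2) u a0) auto
      then have "((\<lambda>r. integral (cbox a u) (Ft (x + r *\<^sub>R ?e))) has_field_derivative
              gradient (\<lambda>y. F (y, u)) x $ i - gradient (\<lambda>y. F (y, a)) x $ i) (at 0)"
        unfolding scaleR_zero_left add_0_right by (rule has_field_derivative_transform_within_open[where S="?U"])
           (use \<delta> eq inV in auto)
      then show ?thesis using 1 DERIV_unique by blast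
    qed
    have qc: "continuous_on {a..0} q"
    proof -
      have "continuous_on {a..0} (\<lambda>s. (\<lambda>(y, s). gradient (\<lambda>y. Ft y s) y) (x, s))"
        using sFt(4) by (rule continuous_on_compose2) (use x in \<open>auto intro!: continuous_intros\<close>)
      then show ?thesis by (auto simp: q_def intro!: continuous_intros)
    qed
    have "((\<lambda>u. integral {a..u} q) has_vector_derivative q t) (at t within {a..0})"
      by (rule integral_has_vector_derivative[OF qc]) (use t in \<open>simp add: a_def\<close>)
    then have "((\<lambda>u. gradient (\<lambda>y. F (y, a)) x $ i + integral {a..u} q) has_vector_derivative q t) (at t within {a..0})"
      by (auto intro!: derivative_eq_intros)
    then have "((\<lambda>u. gradient (\<lambda>y. F (y, u)) x $ i) has_vector_derivative q t) (at t within {a..0})"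
    proof (rule has_vector_derivative_transform[rotated 2])
      show "t \<in> {a..0}" using t by (simp add: a_def)
      show "gradient (\<lambda>y. F (y, u)) x $ i = gradient (\<lambda>y. F (y, a)) x $ i + integral {a..u} q" if "u \<in> {a..0}" for u
        using incr[of u] that by simp
    qed
    moreover have "at t within {a..0} = at t within {..0}"
      by (rule at_within_nhd[of _ "{a<..}"]) (auto simp: a_def)
    ultimately show ?thesis by (simp add: q_def)
  qed
  have "((\<lambda>s. \<Sum>i\<in>UNIV. (gradient (\<lambda>y. F (y, s)) x $ i) *\<^sub>R axis i 1) has_vector_derivative
           (\<Sum>i\<in>UNIV. (gradient (\<lambda>y. Ft y t) x $ i) *\<^sub>R (axis i 1 :: real^'n))) (at t within {..0})"
    using comp by (intro has_vector_derivative_sum has_vector_derivative_scaleR[where g'=0, simplified]) 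
      (auto simp: has_real_derivative_iff_has_vector_derivative)
  then show ?thesis unfolding Ft_def using basis_expansion[where 'n='n and 'a=real] by (simp add: scalar_mult_eq_scaleR)
qed

section \<open>Change of variables over an arbitrary finite index type\<close>

text \<open>A copy of a finite type, ordered through an arbitrary injection into the natural numbers. The
  change of variables theorem needs a well-ordered index type; the coordinates of a manifold carry
  no order.\<close>

typedef 'n ordered_copy = "UNIV :: 'n set" morphisms of_copy to_copy by auto

lemma of_copy_bij: "bij of_copy"
  by (metis UNIV_I bij_betw_def inj_on_def of_copy_inject surj_def to_copy_inverse)

instance ordered_copy :: (finite) finite
proof
  have "finite (range (to_copy :: 'a \<Rightarrow> 'a ordered_copy))" by simp
  moreover have "range (to_copy :: 'a \<Rightarrow> 'a ordered_copy) = UNIV" by (metis of_copy_inverse surj_def)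
  ultimately show "finite (UNIV :: 'a ordered_copy set)" by simp
qed

definition copy_index :: "'n::finite ordered_copy \<Rightarrow> nat" where
  "copy_index = (SOME f. inj f)"

lemma inj_copy_index: "inj copy_index"
proof -
  have "\<exists>f :: 'a ordered_copy \<Rightarrow> nat. inj f"
    using finite_imp_inj_to_nat_seg[OF finite[of "UNIV :: 'a ordered_copy set"]] by blast
  then show ?thesis unfolding copy_index_def by (rule someI_ex)
qed

instantiation ordered_copy :: (finite) wellorder
begin

definition less_eq_ordered_copy :: "'a ordered_copy \<Rightarrow> 'a ordered_copy \<Rightarrow> bool" where
  "x \<le> y \<longleftrightarrow> copy_index x \<le> copy_index y"
definition less_ordered_copy :: "'a ordered_copy \<Rightarrow> 'a ordered_copy \<Rightarrow> bool" where
  "x < y \<longleftrightarrow> copy_index x < copy_index y"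

instance
proof
  fix P :: "'a ordered_copy \<Rightarrow> bool" and a
  assume step: "\<And>x. (\<And>y. y < x \<Longrightarrow> P y) \<Longrightarrow> P x"
  show "P a"
    by (induction "copy_index a" arbitrary: a rule: less_induct) (auto intro: step simp: less_ordered_copy_def)
qed (use inj_copy_index in \<open>auto simp: less_eq_ordered_copy_def less_ordered_copy_def inj_def\<close>)

end

lemma det_reindex:
  fixes B :: "real ^ 'n::finite ^ 'n" and r :: "'m::finite \<Rightarrow> 'n"
  assumes r: "bij r"
  shows "det (\<chi> i j. B $ (r i) $ (r j)) = det B"
proof -
  have inj: "inj r" using r by (rule bij_is_inj)
  define h where "h p = (\<lambda>x. r (p (inv r x)))" for p :: "'m \<Rightarrow> 'm"
  have bij: "bij_betw h {p. p permutes UNIV} {p. p permutes UNIV}"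
    using bij_betw_permutations[of r UNIV UNIV] r unfolding h_def by simp
  have sgn: "sign (h p) = sign p" if "p permutes UNIV" for p
    using sign_map_permutation[OF inj that] bij_is_surj[OF r]
    by (simp add: map_permutation_def restrict_id_def h_def o_def)
  have pr: "(\<Prod>k\<in>UNIV. B $ k $ (h p k)) = (\<Prod>i\<in>UNIV. B $ (r i) $ (r (p i)))" for p
    using prod.reindex[OF inj, of "\<lambda>k. B $ k $ (h p k)"] bij_is_surj[OF r] inj by (simp add: h_def o_def inv_f_f)
  have "det B = (\<Sum>p | p permutes UNIV. of_int (sign (h p)) * (\<Prod>k\<in>UNIV. B $ k $ (h p k)))"
    unfolding det_def 
    by (rule sum.reindex_bij_betw[OF bij, of "\<lambda>q. of_int (sign q) * (\<Prod>k\<in>UNIV. B $ k $ (q k))", symmetric])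
  also have "\<dots> = det (\<chi> i j. B $ (r i) $ (r j))"
    unfolding det_def by (intro sum.cong) (auto simp: sgn pr)
  finally show ?thesis by simp
qed

definition reindex_vec :: "('m::finite \<Rightarrow> 'n::finite) \<Rightarrow> real ^ 'n \<Rightarrow> real ^ 'm" where
  "reindex_vec r x = (\<chi> i. x $ r i)"

lemma bounded_linear_reindex_vec: "bounded_linear (reindex_vec r)"
  unfolding linear_conv_bounded_linear[symmetric] by (auto simp: linear_iff reindex_vec_def vec_eq_iff)

lemma reindex_vec_inverse: "bij r \<Longrightarrow> reindex_vec (inv r) (reindex_vec r x) = x" "bij r \<Longrightarrow> reindex_vec r (reindex_vec (inv r) y) = y"
  by (auto simp: reindex_vec_def vec_eq_iff bij_is_inj bij_is_surj surj_f_inv_f)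

lemma distr_reindex_vec:
  fixes r :: "'m::finite \<Rightarrow> 'n::finite"
  assumes r: "bij r"
  shows "distr lborel borel (reindex_vec r) = (lborel :: (real ^ 'm) measure)"
proof (rule lborel_eqI[symmetric])
  have m: "reindex_vec r \<in> borel_measurable borel"
    by (intro borel_measurable_continuous_onI linear_continuous_on bounded_linear_reindex_vec)
  fix l u :: "real^'m" assume lu: "\<And>b. b \<in> Basis \<Longrightarrow> l \<bullet> b \<le> u \<bullet> b"
  have surj: "\<exists>i. k = r i" for k using bij_is_surj[OF r] by (metis surjD)
  have inv: "inv r (r i) = i" for i using bij_is_inj[OF r] by simp
  have 1: "l $ i \<le> u $ i" for i using lu[of "axis i 1"] by (auto simp: inner_axis Basis_vec_def)
  have "emeasure (distr lborel borel (reindex_vec r)) (box l u) = emeasure lborel (reindex_vec r -` box l u)"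
    using emeasure_distr[of "reindex_vec r" lborel borel "box l u"] m by simp
  also have "reindex_vec r -` box l u = box (reindex_vec (inv r) l) (reindex_vec (inv r) u)"
    by (auto simp: mem_box_cart reindex_vec_def) (metis inv surj)+
  also have "emeasure lborel \<dots> = ennreal (\<Prod>b\<in>Basis. (reindex_vec (inv r) u - reindex_vec (inv r) l) \<bullet> b)"
    by (rule emeasure_lborel_box) (auto simp: Basis_vec_def inner_axis reindex_vec_def 1)
  also have "(\<Prod>b\<in>Basis. (reindex_vec (inv r) u - reindex_vec (inv r) l) \<bullet> b) = (\<Prod>k\<in>UNIV. (u - l) $ inv r k)"
  proof -
    have inj: "inj (\<lambda>k::'n. axis k 1 :: real^'n)" by (auto simp: inj_def axis_eq_axis)
    have B: "(Basis :: (real^'n) set) = range (\<lambda>k. axis k 1)" by (auto simp: Basis_vec_def)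
    show ?thesis unfolding B prod.reindex[OF inj] by (simp add: inner_axis reindex_vec_def)
  qed
  also have "\<dots> = (\<Prod>i\<in>UNIV. (u - l) $ i)"
    by (rule prod.reindex_bij_betw) (use bij_betw_inv_into[OF r] in simp)
  also have "\<dots> = (\<Prod>b\<in>Basis. (u - l) \<bullet> b)"
  proof -
    have inj: "inj (\<lambda>k::'m. axis k 1 :: real^'m)" by (auto simp: inj_def axis_eq_axis)
    have B: "(Basis :: (real^'m) set) = range (\<lambda>k. axis k 1)" by (auto simp: Basis_vec_def)
    show ?thesis unfolding B prod.reindex[OF inj] by (simp add: inner_axis )
  qed
  finally show "emeasure (distr lborel borel (reindex_vec r)) (box l u) = ennreal (\<Prod>b\<in>Basis. (u - l) \<bullet> b)" .
qed simp

lemma nn_integral_absolutely_integrable: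
  fixes h :: "real ^ 'n::finite \<Rightarrow> real"
  assumes S: "S \<in> sets borel" and h: "(\<lambda>x. indicator S x * h x) \<in> borel_measurable borel" and nn: "\<And>x. x \<in> S \<Longrightarrow> h x \<ge> 0"
  shows "(\<integral>\<^sup>+x\<in>S. ennreal (h x) \<partial>lborel) = (if h absolutely_integrable_on S then ennreal (integral S h) else \<infinity>)"
proof -
  let ?f = "\<lambda>x. indicator S x * h x"
  have eq: "(\<integral>\<^sup>+x\<in>S. ennreal (h x) \<partial>lborel) = (\<integral>\<^sup>+x. ennreal (?f x) \<partial>lborel)"
    by (intro nn_integral_cong) (auto simp: indicator_def)
  have nnf: "AE x in lborel. 0 \<le> ?f x" using nn by (auto simp: indicator_def)
  have ai: "h absolutely_integrable_on S \<longleftrightarrow> integrable lborel ?f"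
    unfolding set_integrable_def using h by (simp add: integrable_completion)
  show ?thesis
  proof (cases "integrable lborel ?f")
    case True
    then have "(\<integral>\<^sup>+x. ennreal (?f x) \<partial>lborel) = ennreal (\<integral>x. ?f x \<partial>lborel)" using nnf by (rule nn_integral_eq_integral)
    also have "(\<integral>x. ?f x \<partial>lborel) = integral S h"
      using True set_borel_integral_eq_integral(2)[of S h] by (simp add: set_integrable_def set_lebesgue_integral_def)
    finally show ?thesis using eq ai True by simp
  next
    case False
    have fm: "?f \<in> borel_measurable lborel" using h by simp
    have "\<not> (\<integral>\<^sup>+x. ennreal (?f x) \<partial>lborel) < \<infinity>"
      using False integrableI_nonneg[OF fm nnf] by blast
    then have "(\<integral>\<^sup>+x. ennreal (?f x) \<partial>lborel) = \<infinity>" by (metis infinity_ennreal_def top.not_eq_extremum)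
    then show ?thesis using eq ai False by simp
  qed
qed

text \<open>The classical theorem speaks of absolutely integrable functions with values in a Euclidean space;
  for nonnegative functions the integrals agree also when one, and hence the other, is infinite.\<close>
lemma nn_integral_change_of_variables_wellorder:
  fixes T :: "real ^ 'n::{finite,wellorder} \<Rightarrow> real ^ 'n::_" and f :: "real ^ 'n::_ \<Rightarrow> real"
  assumes S: "S \<in> sets borel" "T ` S \<in> sets borel"
    and der: "\<And>x. x \<in> S \<Longrightarrow> (T has_derivative T' x) (at x within S)" and inj: "inj_on T S"
    and nn: "\<And>y. y \<in> T ` S \<Longrightarrow> f y \<ge> 0"
    and m1: "(\<lambda>y. indicator (T ` S) y * f y) \<in> borel_measurable borel"
    and m2: "(\<lambda>x. indicator S x * (\<bar>det (matrix (T' x))\<bar> * f (T x))) \<in> borel_measurable borel"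
  shows "(\<integral>\<^sup>+x\<in>S. ennreal (\<bar>det (matrix (T' x))\<bar> * f (T x)) \<partial>lborel) = (\<integral>\<^sup>+y\<in>T ` S. ennreal (f y) \<partial>lborel)"
proof -
  let ?D = "\<lambda>x. \<bar>det (matrix (T' x))\<bar> * f (T x)"
  let ?v = "vec :: real \<Rightarrow> real^1"
  have Sl: "S \<in> sets lebesgue" using S by simp
  have cov: "(\<lambda>x. \<bar>det (matrix (T' x))\<bar> *\<^sub>R ?v (f (T x))) absolutely_integrable_on S \<and>
      integral S (\<lambda>x. \<bar>det (matrix (T' x))\<bar> *\<^sub>R ?v (f (T x))) = b \<longleftrightarrow>
      (\<lambda>y. ?v (f y)) absolutely_integrable_on (T ` S) \<and> integral (T ` S) (\<lambda>y. ?v (f y)) = b" for b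
    using has_absolute_integral_change_of_variables[OF Sl der inj, of "\<lambda>y. ?v (f y)" b] by simp
  have v: "(\<lambda>x. ?v (h x)) absolutely_integrable_on X \<longleftrightarrow> h absolutely_integrable_on X" for h :: "real^'n::_ \<Rightarrow> real" and X
    by (subst absolutely_integrable_componentwise_iff) (simp add: Basis_vec_def inner_axis)
  have vi: "integral X (\<lambda>x. ?v (h x)) = ?v (integral X h)" if "h absolutely_integrable_on X" for h :: "real^'n::_ \<Rightarrow> real" and X
  proof -
    have "h integrable_on X" using that by (rule set_lebesgue_integral_eq_integral(1))
    then have "integral X (?v \<circ> h) = ?v (integral X h)"
      by (intro integral_linear) (auto simp: linear_conv_bounded_linear[symmetric] linear_iff vec_eq_iff)
    then show ?thesis by (simp add: o_def)
  qed
  have sv: "\<bar>det (matrix (T' x))\<bar> *\<^sub>R ?v (f (T x)) = ?v (?D x)" for x by (simp add: vec_eq_iff)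
  have iff: "?D absolutely_integrable_on S \<longleftrightarrow> f absolutely_integrable_on (T ` S)"
    using cov unfolding sv v by blast
  have int: "integral S ?D = integral (T ` S) f" if "f absolutely_integrable_on (T ` S)"
  proof -
    have "integral S (\<lambda>x. ?v (?D x)) = ?v (integral (T ` S) f)"
      using cov[of "?v (integral (T ` S) f)"] that vi unfolding sv v by blast
    then have "?v (integral S ?D) = ?v (integral (T ` S) f)" using vi iff that by metis
    then show ?thesis by (simp add: vec_eq_iff)
  qed
  show ?thesis
    using nn_integral_absolutely_integrable[OF S(1) m2] nn_integral_absolutely_integrable[OF S(2) m1] nn iff int
    by simp
qed

text \<open>Conjugation with the reindexing of the coordinates reduces to a well-ordered index type: it
  preserves Lebesgue measure, and it does not change the determinant of the derivative.\<close>
lemma nn_integral_change_of_variables: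
  fixes T :: "real ^ 'n::finite \<Rightarrow> real ^ 'n::finite" and f :: "real ^ 'n \<Rightarrow> real"
  assumes S: "S \<in> sets borel" "T ` S \<in> sets borel"
    and der: "\<And>x. x \<in> S \<Longrightarrow> (T has_derivative T' x) (at x within S)" and inj: "inj_on T S"
    and nn: "\<And>y. y \<in> T ` S \<Longrightarrow> f y \<ge> 0"
    and m1: "(\<lambda>y. indicator (T ` S) y * f y) \<in> borel_measurable borel"
    and m2: "(\<lambda>x. indicator S x * (\<bar>det (matrix (T' x))\<bar> * f (T x))) \<in> borel_measurable borel"
  shows "(\<integral>\<^sup>+x\<in>S. ennreal (\<bar>det (matrix (T' x))\<bar> * f (T x)) \<partial>lborel) = (\<integral>\<^sup>+y\<in>T ` S. ennreal (f y) \<partial>lborel)"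
proof -
  let ?r = "of_copy :: 'n ordered_copy \<Rightarrow> 'n"
  define P where "P = reindex_vec ?r"
  define Q where "Q = reindex_vec (inv ?r)"
  have QP: "Q (P x) = x" and PQ: "P (Q y) = y" for x y
    using reindex_vec_inverse[OF of_copy_bij] by (auto simp: P_def Q_def)
  have PS: "P ` X = Q -` X" for X
  proof
    show "P ` X \<subseteq> Q -` X" by (auto simp: QP)
    show "Q -` X \<subseteq> P ` X" using PQ by (metis imageI subsetI vimageE)
  qed
  have bl: "bounded_linear P" "bounded_linear Q" by (auto simp: P_def Q_def bounded_linear_reindex_vec)
  have mP: "P \<in> borel_measurable borel" and mQ: "Q \<in> borel_measurable borel"
    by (intro borel_measurable_continuous_onI linear_continuous_on bl)+
  have pull: "(\<integral>\<^sup>+x. g x \<partial>lborel) = (\<integral>\<^sup>+y. g (Q y) \<partial>lborel)" if "g \<in> borel_measurable borel" for g :: "real^'n \<Rightarrow> ennreal"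
  proof -
    have "distr lborel borel Q = lborel" unfolding Q_def
      by (rule distr_reindex_vec) (simp add: bij_imp_bij_inv of_copy_bij)
    then have "(\<integral>\<^sup>+x. g x \<partial>lborel) = (\<integral>\<^sup>+x. g x \<partial>distr lborel borel Q)" by simp
    also have "\<dots> = (\<integral>\<^sup>+y. g (Q y) \<partial>lborel)" by (rule nn_integral_distr) (use that mQ in auto)
    finally show ?thesis .
  qed
  define U where "U = P \<circ> T \<circ> Q"
  define U' where "U' y = (\<lambda>v. P (T' (Q y) (Q v)))" for y
  have QU: "Q (U y) = T (Q y)" for y by (simp add: U_def QP)
  have US: "U ` (P ` S) = P ` (T ` S)" by (auto simp: U_def QP image_image)
  have detU: "det (matrix (U' y)) = det (matrix (T' (Q y)))" for y
  proof -
    have "matrix (U' y) = (\<chi> i j. matrix (T' (Q y)) $ (?r i) $ (?r j))"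
    proof -
      have "inv ?r i = j \<longleftrightarrow> i = ?r j" for i j using bij_inv_eq_iff[OF of_copy_bij, of j i] by auto
      then have "Q (axis j 1) = axis (?r j) 1" for j
        by (auto simp: Q_def reindex_vec_def axis_def vec_eq_iff)
      then show ?thesis by (simp add: matrix_def U'_def P_def reindex_vec_def)
    qed
    then show ?thesis using det_reindex[OF of_copy_bij] by metis
  qed
  have sets: "P ` X \<in> sets borel" if "X \<in> sets borel" for X
    unfolding PS using measurable_sets[OF mQ that] by simp
  have ind: "indicator (P ` X) y = (indicator X (Q y) :: 'z::{zero_neq_one})" for X y
    unfolding PS by (simp add: indicator_def)
  have "(\<integral>\<^sup>+y\<in>P ` S. ennreal (\<bar>det (matrix (U' y))\<bar> * f (Q (U y))) \<partial>lborel) = (\<integral>\<^sup>+y\<in>U ` (P ` S). ennreal (f (Q y)) \<partial>lborel)"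
  proof (rule nn_integral_change_of_variables_wellorder)
    show "P ` S \<in> sets borel" "U ` (P ` S) \<in> sets borel" unfolding US by (auto intro: sets S)
    show "(U has_derivative U' y) (at y within P ` S)" if "y \<in> P ` S" for y
    proof -
      have y: "Q y \<in> S" using that QP by auto
      have 1: "(Q has_derivative Q) (at y within P ` S)" by (rule bounded_linear_imp_has_derivative[OF bl(2)])
      have "(T has_derivative T' (Q y)) (at (Q y) within Q ` P ` S)"
        using der[OF y] by (rule has_derivative_subset) (auto simp: QP)
      from has_derivative_in_compose[OF 1 this] 
      have "((\<lambda>y. T (Q y)) has_derivative (\<lambda>v. T' (Q y) (Q v))) (at y within P ` S)" .
      from bounded_linear.has_derivative[OF bl(1) this] show ?thesis by (simp add: U_def o_def U'_def[abs_def])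
    qed
    show "inj_on U (P ` S)"
      using inj unfolding inj_on_def U_def by (auto simp: QP) (metis QP)
    show "f (Q y) \<ge> 0" if "y \<in> U ` (P ` S)" for y using that nn unfolding US by (auto simp: QP)
    show "(\<lambda>y. indicator (U ` P ` S) y * f (Q y)) \<in> borel_measurable borel"
      unfolding US ind using measurable_compose[OF mQ m1] by simp
    show "(\<lambda>y. indicator (P ` S) y * (\<bar>det (matrix (U' y))\<bar> * f (Q (U y)))) \<in> borel_measurable borel"
      unfolding ind detU QU using measurable_compose[OF mQ m2] by simp
  qed
  moreover have "(\<integral>\<^sup>+x\<in>S. ennreal (\<bar>det (matrix (T' x))\<bar> * f (T x)) \<partial>lborel) = 
      (\<integral>\<^sup>+y\<in>P ` S. ennreal (\<bar>det (matrix (U' y))\<bar> * f (Q (U y))) \<partial>lborel)"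
  proof -
    have "(\<integral>\<^sup>+x\<in>S. ennreal (\<bar>det (matrix (T' x))\<bar> * f (T x)) \<partial>lborel) = (\<integral>\<^sup>+x. ennreal (indicator S x * (\<bar>det (matrix (T' x))\<bar> * f (T x))) \<partial>lborel)"
      by (intro nn_integral_cong) (auto simp: indicator_def)
    also have "\<dots> = (\<integral>\<^sup>+y. ennreal (indicator S (Q y) * (\<bar>det (matrix (T' (Q y)))\<bar> * f (T (Q y)))) \<partial>lborel)"
      by (rule pull) (use m2 in measurable)
    also have "\<dots> = (\<integral>\<^sup>+y\<in>P ` S. ennreal (\<bar>det (matrix (U' y))\<bar> * f (Q (U y))) \<partial>lborel)"
      unfolding ind detU QU by (intro nn_integral_cong) (auto simp: indicator_def)
    finally show ?thesis .
  qed
  moreover have "(\<integral>\<^sup>+y\<in>T ` S. ennreal (f y) \<partial>lborel) = (\<integral>\<^sup>+y\<in>U ` (P ` S). ennreal (f (Q y)) \<partial>lborel)"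
  proof -
    have "(\<integral>\<^sup>+y\<in>T ` S. ennreal (f y) \<partial>lborel) = (\<integral>\<^sup>+x. ennreal (indicator (T ` S) x * f x) \<partial>lborel)"
      by (intro nn_integral_cong) (auto simp: indicator_def)
    also have "\<dots> = (\<integral>\<^sup>+y. ennreal (indicator (T ` S) (Q y) * f (Q y)) \<partial>lborel)"
      by (rule pull) (use m1 in measurable)
    also have "\<dots> = (\<integral>\<^sup>+y\<in>U ` (P ` S). ennreal (f (Q y)) \<partial>lborel)"
      unfolding US ind by (intro nn_integral_cong) (auto simp: indicator_def)
    finally show ?thesis .
  qed
  ultimately show ?thesis by simp
qed

section \<open>C1 functions on a manifold and the inner product of gradients\<close>

abbreviation cinv :: "('a, 'n::finite) chart \<Rightarrow> real ^ 'n \<Rightarrow> 'a" where "cinv c \<equiv> inv_into (fst c) (snd c)"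
abbreviation crange :: "('a, 'n::finite) chart \<Rightarrow> (real ^ 'n) set" where "crange c \<equiv> snd c ` fst c"

definition chart_grad :: "('a, 'n::finite) chart \<Rightarrow> ('a \<Rightarrow> real) \<Rightarrow> 'a \<Rightarrow> real ^ 'n" where
  "chart_grad c f p = gradient (f \<circ> cinv c) (snd c p)"

lemma inner_transpose_mult: 
  fixes J :: "real ^ 'n::finite ^ 'm::finite"
  shows "v \<bullet> (transpose J *v w) = (J *v v) \<bullet> w"
  by (metis dot_lmul_matrix inner_commute transpose_matrix_vector)

context riemannian_manifold begin

lemma chart_open: "c \<in> A \<Longrightarrow> open (fst c)"
  and crange_open: "c \<in> A \<Longrightarrow> open (crange c)"
  and chart_cont: "c \<in> A \<Longrightarrow> continuous_on (fst c) (snd c)"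
  and cinv_cont: "c \<in> A \<Longrightarrow> continuous_on (crange c) (cinv c)"
  and cinv_chart: "c \<in> A \<Longrightarrow> p \<in> fst c \<Longrightarrow> cinv c (snd c p) = p"
  and chart_cinv: "c \<in> A \<Longrightarrow> x \<in> crange c \<Longrightarrow> snd c (cinv c x) = x"
  and cinv_in: "c \<in> A \<Longrightarrow> x \<in> crange c \<Longrightarrow> cinv c x \<in> fst c"
  using chart[of "fst c" "snd c"] unfolding homeomorphism_def
  by (auto simp: inv_into_into f_inv_into_f)

lemma ex_chart: "\<exists>c\<in>A. p \<in> fst c"
  using cover by (auto simp: case_prod_unfold)

lemma chart_image_eq: "c \<in> A \<Longrightarrow> W \<subseteq> fst c \<Longrightarrow> snd c ` W = crange c \<inter> cinv c -` W"
  by (auto simp: cinv_chart chart_cinv subset_eq)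

lemma chart_image_open: "c \<in> A \<Longrightarrow> open W \<Longrightarrow> W \<subseteq> fst c \<Longrightarrow> open (snd c ` W)"
  using chart_image_eq[of c W] continuous_open_preimage[OF cinv_cont crange_open] by simp

lemma cinv_image_open: 
  assumes "c \<in> A" "open X" "X \<subseteq> crange c" shows "open (cinv c ` X)"
proof -
  have "cinv c ` X = fst c \<inter> snd c -` X"
    using assms by (auto simp: cinv_in chart_cinv subset_eq) (metis cinv_chart image_eqI)
  then show ?thesis using continuous_open_preimage[OF chart_cont chart_open] assms by simp
qed

lemma cinv_image_compact: "c \<in> A \<Longrightarrow> compact K \<Longrightarrow> K \<subseteq> crange c \<Longrightarrow> compact (cinv c ` K)"
  using compact_continuous_image continuous_on_subset[OF cinv_cont] by blast

definition transition :: "('a, 'n) chart \<Rightarrow> ('a, 'n) chart \<Rightarrow> real ^ 'n \<Rightarrow> real ^ 'n" where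
  "transition c c' = snd c' \<circ> cinv c"

definition jac :: "('a, 'n) chart \<Rightarrow> ('a, 'n) chart \<Rightarrow> 'a \<Rightarrow> real ^ 'n ^ 'n" where
  "jac c c' p = jacobian (transition c c') (at (snd c p))"

lemma transition_C1: "c \<in> A \<Longrightarrow> c' \<in> A \<Longrightarrow> C1_on (snd c ` (fst c \<inter> fst c')) (transition c c')"
  using compatible[of "fst c" "snd c" "fst c'" "snd c'"] unfolding transition_def by (auto intro: smooth_on_imp_C1_on)

lemma overlap_open: "c \<in> A \<Longrightarrow> c' \<in> A \<Longrightarrow> open (snd c ` (fst c \<inter> fst c'))"
  by (rule chart_image_open) (auto intro: chart_open)

lemma transition_chart: "c \<in> A \<Longrightarrow> p \<in> fst c \<Longrightarrow> transition c c' (snd c p) = snd c' p"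
  by (simp add: transition_def cinv_chart)

lemma transition_derivative:
  assumes "c \<in> A" "c' \<in> A" "p \<in> fst c" "p \<in> fst c'"
  shows "(transition c c' has_derivative (\<lambda>v. jac c c' p *v v)) (at (snd c p))"
proof -
  have "transition c c' differentiable (at (snd c p))"
    using transition_C1[OF assms(1,2)] overlap_open[OF assms(1,2)] assms(3,4) unfolding C1_on_def differentiable_def
    by (metis IntI at_within_open imageI)
  then show ?thesis using jacobian_works by (auto simp: jac_def)
qed

lemma metric_jac:
  assumes "c \<in> A" "c' \<in> A" "p \<in> fst c" "p \<in> fst c'"
  shows "g c p = transpose (jac c c' p) ** g c' p ** jac c c' p"
  using metric_transform[of "fst c" "snd c" "fst c'" "snd c'" p] assms
  by (simp add: Let_def jac_def transition_def)

lemma metric_pos_def: "c \<in> A \<Longrightarrow> p \<in> fst c \<Longrightarrow> v \<noteq> 0 \<Longrightarrow> v \<bullet> (g c p *v v) > 0"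
  using metric_pos[of "fst c" "snd c"] by simp

lemma metric_nonneg: "c \<in> A \<Longrightarrow> p \<in> fst c \<Longrightarrow> v \<bullet> (g c p *v v) \<ge> 0"
  using metric_pos_def[of c p v] by (cases "v = 0") (auto simp: less_imp_le)

lemma metric_symmetric: "c \<in> A \<Longrightarrow> p \<in> fst c \<Longrightarrow> transpose (g c p) = g c p"
  using metric_sym[of "fst c" "snd c"] by simp

lemma metric_inner_commute: "c \<in> A \<Longrightarrow> p \<in> fst c \<Longrightarrow> v \<bullet> (g c p *v w) = w \<bullet> (g c p *v v)"
  using metric_symmetric[of c p] dot_lmul_matrix[of v "g c p" w] by (metis inner_commute transpose_matrix_vector)

lemma metric_norm_jac:
  assumes "c \<in> A" "c' \<in> A" "p \<in> fst c" "p \<in> fst c'"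
  shows "v \<bullet> (g c p *v v) = (jac c c' p *v v) \<bullet> (g c' p *v (jac c c' p *v v))"
  unfolding metric_jac[OF assms] by (simp only: matrix_vector_mul_assoc[symmetric] inner_transpose_mult)

text \<open>A kernel vector of the Jacobian matrix would have length zero for the metric.\<close>
lemma jac_inj:
  assumes "c \<in> A" "c' \<in> A" "p \<in> fst c" "p \<in> fst c'" "jac c c' p *v v = 0" shows "v = 0"
  using metric_norm_jac[OF assms(1-4), of v] metric_pos_def[OF assms(1,3), of v] assms(5) by fastforce

lemma jac_invertible: 
  assumes "c \<in> A" "c' \<in> A" "p \<in> fst c" "p \<in> fst c'" shows "invertible (jac c c' p)"
  using jac_inj[OF assms] matrix_left_invertible_ker[of "jac c c' p"] invertible_left_inverse by blast

lemma det_metric_pos: "c \<in> A \<Longrightarrow> p \<in> fst c \<Longrightarrow> det (g c p) > 0"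
  by (rule det_pos_if_pos_def) (rule metric_pos_def)

lemma metric_mult_inv: "c \<in> A \<Longrightarrow> p \<in> fst c \<Longrightarrow> g c p *v (matrix_inv (g c p) *v v) = v"
  using matrix_mult_matrix_inv[of "g c p"] det_metric_pos[of c p]
  by (simp add: matrix_vector_mul_assoc invertible_det_nz)

lemma metric_C1: "c \<in> A \<Longrightarrow> C1_on (crange c) (\<lambda>x. g c (cinv c x) $ i $ j)"
  using metric_smooth[of "fst c" "snd c"]
  by (auto dest!: smooth_on_imp_C1_on simp: o_def intro!: C1_on_vec_nth)

lemma density_C1: "c \<in> A \<Longrightarrow> C1_on (crange c) (\<lambda>x. sqrt (det (g c (cinv c x))))"
  by (intro C1_on_sqrt C1_on_det metric_C1 det_metric_pos) (auto intro: cinv_in)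

lemma metric_inv_C1: "c \<in> A \<Longrightarrow> C1_on (crange c) (\<lambda>x. matrix_inv (g c (cinv c x)) $ i $ j)"
  by (intro C1_on_matrix_inv metric_C1 less_imp_neq[THEN not_sym] det_metric_pos) (auto intro: cinv_in)

lemma continuous_on_chart_compose:
  assumes "c \<in> A" "continuous_on (crange c) F" shows "continuous_on (fst c) (\<lambda>p. F (snd c p))"
  using continuous_on_compose2[OF assms(2) chart_cont[OF assms(1)]] by blast

lemma metric_cont: 
  assumes "c \<in> A" shows "continuous_on (fst c) (\<lambda>p. g c p)"
proof -
  have "continuous_on (fst c) (\<lambda>p. g c (cinv c (snd c p)) $ i $ j)" for i j
    by (rule continuous_on_chart_compose[OF assms C1_on_imp_continuous_on[OF metric_C1[OF assms]]])
  then have "continuous_on (fst c) (\<lambda>p. \<chi> i. \<chi> j. g c (cinv c (snd c p)) $ i $ j)"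
    by (intro continuous_on_vec_lambda)
  then show ?thesis by (rule continuous_on_eq) (simp add: cinv_chart assms vec_eq_iff)
qed

lemma metric_inv_cont: 
  assumes "c \<in> A" shows "continuous_on (fst c) (\<lambda>p. matrix_inv (g c p))"
proof -
  have "continuous_on (fst c) (\<lambda>p. matrix_inv (g c (cinv c (snd c p))) $ i $ j)" for i j
    by (rule continuous_on_chart_compose[OF assms C1_on_imp_continuous_on[OF metric_inv_C1[OF assms]]])
  then have "continuous_on (fst c) (\<lambda>p. \<chi> i. \<chi> j. matrix_inv (g c (cinv c (snd c p))) $ i $ j)"
    by (intro continuous_on_vec_lambda)
  then show ?thesis by (rule continuous_on_eq) (simp add: cinv_chart assms vec_eq_iff)
qed

definition C1M :: "('a \<Rightarrow> real) \<Rightarrow> bool" where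
  "C1M f \<longleftrightarrow> (\<forall>c\<in>A. C1_on (crange c) (f \<circ> cinv c))"

lemma C1M_chart: "C1M f \<Longrightarrow> c \<in> A \<Longrightarrow> C1_on (crange c) (f \<circ> cinv c)"
  by (auto simp: C1M_def)

lemma C1M_differentiable: "C1M f \<Longrightarrow> c \<in> A \<Longrightarrow> p \<in> fst c \<Longrightarrow> (f \<circ> cinv c) differentiable (at (snd c p))"
  using C1_on_differentiable[OF C1M_chart crange_open] by blast

lemma C1M_continuous: assumes "C1M f" shows "continuous_on UNIV f"
proof -
  have "continuous_on (fst c) f" if "c \<in> A" for c
  proof -
    have "continuous_on (fst c) (\<lambda>p. (f \<circ> cinv c) (snd c p))"
      by (rule continuous_on_chart_compose[OF that C1_on_imp_continuous_on[OF C1M_chart[OF assms that]]])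
    then show ?thesis by (rule continuous_on_eq) (simp add: cinv_chart that)
  qed
  then have "continuous_on (\<Union>c\<in>A. fst c) f" by (intro continuous_on_open_UN) (auto simp: chart_open)
  moreover have "(\<Union>c\<in>A. fst c) = UNIV" using ex_chart by blast
  ultimately show ?thesis by simp
qed

lemma C1M_local:
  assumes "\<And>p. \<exists>c\<in>A. \<exists>W. open W \<and> p \<in> W \<and> W \<subseteq> fst c \<and> C1_on (snd c ` W) (f \<circ> cinv c)"
  shows "C1M f"
  unfolding C1M_def
proof
  fix c assume c: "c \<in> A"
  show "C1_on (crange c) (f \<circ> cinv c)"
  proof (rule C1_on_local[OF _ crange_open[OF c]])
    fix x assume x: "x \<in> crange c"
    obtain c' W where c': "c' \<in> A" "open W" "cinv c x \<in> W" "W \<subseteq> fst c'" "C1_on (snd c' ` W) (f \<circ> cinv c')"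
      using assms by blast
    let ?X = "snd c ` (W \<inter> fst c)"
    have "C1_on ?X (\<lambda>x. (f \<circ> cinv c') (transition c c' x))"
    proof (rule C1_on_compose[OF C1_on_subset[OF transition_C1[OF c c'(1)]] c'(5)])
      show "?X \<subseteq> snd c ` (fst c \<inter> fst c')" using c' by auto
      show "transition c c' ` ?X \<subseteq> snd c' ` W" using c by (auto simp: transition_chart)
    qed
    moreover have "(f \<circ> cinv c') (transition c c' x) = (f \<circ> cinv c) x" if "x \<in> ?X" for x
      using that c c' by (auto simp: transition_chart cinv_chart subset_eq)
    ultimately have "C1_on ?X (f \<circ> cinv c)" by (simp cong: C1_on_cong)
    moreover have "open ?X" using c c' by (intro chart_image_open) (auto intro: chart_open)
    moreover have "x \<in> ?X" using x c c' by (metis IntI chart_cinv cinv_in image_eqI)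
    moreover have "?X \<inter> crange c = ?X" by auto
    ultimately show "\<exists>W. open W \<and> x \<in> W \<and> C1_on (W \<inter> crange c) (f \<circ> cinv c)" by (intro exI[of _ ?X]) simp
  qed
qed

lemma C1M_const: "C1M (\<lambda>p. a)" by (auto simp: C1M_def o_def C1_on_const)
lemma C1M_diff: "C1M f \<Longrightarrow> C1M h \<Longrightarrow> C1M (\<lambda>p. f p - h p)" by (auto simp: C1M_def o_def intro: C1_on_diff)
lemma C1M_mult: "C1M f \<Longrightarrow> C1M h \<Longrightarrow> C1M (\<lambda>p. f p * h p)" by (auto simp: C1M_def o_def intro: C1_on_mult)
lemma C1M_sum: "(\<And>i. i \<in> I \<Longrightarrow> C1M (f i)) \<Longrightarrow> C1M (\<lambda>p. \<Sum>i\<in>I. f i p)" unfolding C1M_def o_def by (intro ballI C1_on_sum) blast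
lemma C1M_prod: "(\<And>i. i \<in> I \<Longrightarrow> C1M (f i)) \<Longrightarrow> C1M (\<lambda>p. \<Prod>i\<in>I. f i p)" unfolding C1M_def o_def by (intro ballI C1_on_prod) blast
lemma C1M_compose: "C1M f \<Longrightarrow> C1_on UNIV h \<Longrightarrow> C1M (\<lambda>p. h (f p))" 
  by (auto simp: C1M_def o_def intro: C1_on_compose[OF _ _ subset_UNIV])

text \<open>The domain of the chart and the complement of the compact image are open, cover the manifold,
  and the extension is of class \<open>C\<^sup>1\<close> on both.\<close>
lemma C1M_extend_by_0:
  assumes c: "c \<in> A" and F: "C1_on (crange c) F" and K: "compact K" "K \<subseteq> crange c" and zero: "\<And>x. x \<in> crange c - K \<Longrightarrow> F x = 0"
  shows "C1M (\<lambda>p. if p \<in> fst c then F (snd c p) else 0)" (is "C1M ?f")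
proof (rule C1M_local)
  fix p
  show "\<exists>c\<in>A. \<exists>W. open W \<and> p \<in> W \<and> W \<subseteq> fst c \<and> C1_on (snd c ` W) (?f \<circ> cinv c)"
  proof (cases "p \<in> fst c")
    case True
    have "C1_on (crange c) (?f \<circ> cinv c)"
      using F by (subst C1_on_cong[where h=F]) (auto simp: cinv_chart c)
    then show ?thesis using True c chart_open by blast
  next
    case False
    obtain c' where c': "c' \<in> A" "p \<in> fst c'" using ex_chart by blast
    have comp: "compact (cinv c ` K)" using c K by (rule cinv_image_compact)
    let ?W = "fst c' - cinv c ` K"
    have W: "open ?W" "p \<in> ?W" "?W \<subseteq> fst c'"
      using c' comp False c K by (auto intro: chart_open open_Diff compact_imp_closed dest: cinv_in)
    have z: "?f q = 0" if "q \<in> ?W" for q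
    proof (cases "q \<in> fst c")
      case True
      have "snd c q \<notin> K" using that True cinv_chart[OF c True] by (metis DiffD2 image_eqI)
      then show ?thesis using True zero[of "snd c q"] by simp
    qed simp
    have "(?f \<circ> cinv c') x = 0" if x: "x \<in> snd c' ` ?W" for x
    proof -
      obtain q where q: "q \<in> ?W" "x = snd c' q" using x by blast
      then have "cinv c' x = q" using c'(1) by (auto simp: cinv_chart)
      then show ?thesis using z[OF q(1)] by (simp only: o_def)
    qed
    then have "C1_on (snd c' ` ?W) (?f \<circ> cinv c')" by (rule C1_on_cong[THEN iffD2, OF _ C1_on_const])
    then show ?thesis using c' W by blast
  qed
qed

lemma chart_grad_change:
  assumes c: "c \<in> A" "c' \<in> A" "p \<in> fst c" "p \<in> fst c'" and f: "(f \<circ> cinv c') differentiable (at (snd c' p))"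
  shows "chart_grad c f p = transpose (jac c c' p) *v chart_grad c' f p"
  unfolding chart_grad_def
proof (rule gradient_eqI)
  let ?J = "jac c c' p"
  have 1: "((f \<circ> cinv c') has_derivative (\<lambda>v. gradient (f \<circ> cinv c') (snd c' p) \<bullet> v)) (at (transition c c' (snd c p)))"
    using has_derivative_gradient[OF f] by (simp add: transition_chart c)
  from has_derivative_compose[OF transition_derivative[OF c] 1]
  have "((\<lambda>x. (f \<circ> cinv c') (transition c c' x)) has_derivative (\<lambda>v. gradient (f \<circ> cinv c') (snd c' p) \<bullet> (?J *v v))) (at (snd c p))" .
  moreover have "w \<bullet> (?J *v v) = (transpose ?J *v w) \<bullet> v" for w v
    using inner_transpose_mult[of v ?J w] by (simp only: inner_commute)
  ultimately have "((\<lambda>x. (f \<circ> cinv c') (transition c c' x)) has_derivative (\<lambda>v. (transpose ?J *v gradient (f \<circ> cinv c') (snd c' p)) \<bullet> v)) (at (snd c p))"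
    by simp
  then show "((f \<circ> cinv c) has_derivative (\<lambda>v. (transpose ?J *v gradient (f \<circ> cinv c') (snd c' p)) \<bullet> v)) (at (snd c p))"
    by (rule has_derivative_transform_within_open[OF _ overlap_open[OF c(1,2)]])
       (use c in \<open>auto simp: transition_chart cinv_chart\<close>)
qed

definition chart_gamma :: "('a, 'n) chart \<Rightarrow> ('a \<Rightarrow> real) \<Rightarrow> ('a \<Rightarrow> real) \<Rightarrow> 'a \<Rightarrow> real" where
  "chart_gamma c f h p = chart_grad c f p \<bullet> (matrix_inv (g c p) *v chart_grad c h p)"

text \<open>The Riemannian inner product of the gradients of \<open>f\<close> and \<open>h\<close>.\<close>
definition gamma :: "('a \<Rightarrow> real) \<Rightarrow> ('a \<Rightarrow> real) \<Rightarrow> 'a \<Rightarrow> real" where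
  "gamma f h p = chart_gamma (SOME c. c \<in> A \<and> p \<in> fst c) f h p"

text \<open>The coordinate vectors of the gradient of \<open>h\<close> are related by the Jacobian matrix, because both
  solve the linear system of their chart and the two systems are conjugate.\<close>
lemma chart_gamma_change:
  assumes c: "c \<in> A" "c' \<in> A" "p \<in> fst c" "p \<in> fst c'" and f: "C1M f" and h: "C1M h"
  shows "chart_gamma c f h p = chart_gamma c' f h p"
proof -
  let ?J = "jac c c' p"
  define X where "X = matrix_inv (g c p) *v chart_grad c h p"
  define X' where "X' = matrix_inv (g c' p) *v chart_grad c' h p"
  note ch = chart_grad_change[OF c C1M_differentiable[OF _ c(2,4)]]
  obtain Ji where Ji: "Ji ** transpose ?J = mat 1"
    using jac_invertible[OF c] transpose_invertible invertible_left_inverse by blast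
  have "transpose ?J *v (g c' p *v (?J *v X)) = g c p *v X"
    unfolding metric_jac[OF c] by (simp add: matrix_vector_mul_assoc[symmetric])
  also have "\<dots> = transpose ?J *v chart_grad c' h p"
    using metric_mult_inv[OF c(1,3)] ch[OF h] by (simp add: X_def)
  finally have eq: "transpose ?J *v (g c' p *v (?J *v X)) = transpose ?J *v chart_grad c' h p" .
  have can: "Ji *v (transpose ?J *v w) = w" for w by (simp only: matrix_vector_mul_assoc Ji matrix_vector_mul_lid)
  have "g c' p *v (?J *v X) = chart_grad c' h p" using arg_cong[OF eq, of "\<lambda>w. Ji *v w"] by (simp only: can)
  then have "g c' p *v (?J *v X - X') = 0"
    using metric_mult_inv[OF c(2,4)] by (simp add: X'_def matrix_vector_mult_diff_distrib)
  then have "?J *v X = X'" using metric_pos_def[OF c(2,4), of "?J *v X - X'"] by fastforce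
  then have "chart_grad c f p \<bullet> X = chart_grad c' f p \<bullet> X'"
    unfolding ch[OF f] using inner_transpose_mult[of X ?J] by (simp only: inner_commute)
  then show ?thesis by (simp add: chart_gamma_def X_def X'_def)
qed

lemma gamma_chart:
  assumes "c \<in> A" "p \<in> fst c" "C1M f" "C1M h" shows "gamma f h p = chart_gamma c f h p"
proof -
  have "(SOME c. c \<in> A \<and> p \<in> fst c) \<in> A \<and> p \<in> fst (SOME c. c \<in> A \<and> p \<in> fst c)"
    using someI_ex[of "\<lambda>c. c \<in> A \<and> p \<in> fst c"] ex_chart by blast
  then show ?thesis unfolding gamma_def using chart_gamma_change[of _ c] assms by blast
qed

lemma chart_grad_add: "c \<in> A \<Longrightarrow> p \<in> fst c \<Longrightarrow> C1M f \<Longrightarrow> C1M h \<Longrightarrow> chart_grad c (\<lambda>q. f q + h q) p = chart_grad c f p + chart_grad c h p"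
  unfolding chart_grad_def using gradient_add[OF C1M_differentiable C1M_differentiable] by (simp add: o_def)

lemma chart_grad_mult: "c \<in> A \<Longrightarrow> p \<in> fst c \<Longrightarrow> C1M f \<Longrightarrow> C1M h \<Longrightarrow> chart_grad c (\<lambda>q. f q * h q) p = f p *\<^sub>R chart_grad c h p + h p *\<^sub>R chart_grad c f p"
  unfolding chart_grad_def using gradient_mult[OF C1M_differentiable C1M_differentiable] by (simp add: o_def cinv_chart)

lemma chart_grad_compose: "c \<in> A \<Longrightarrow> p \<in> fst c \<Longrightarrow> C1M f \<Longrightarrow> (h has_real_derivative d) (at (f p)) \<Longrightarrow> chart_grad c (\<lambda>q. h (f q)) p = d *\<^sub>R chart_grad c f p"
  unfolding chart_grad_def using gradient_compose_real[OF C1M_differentiable, of f c p h d] by (simp add: o_def cinv_chart)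

lemma chart_grad_sum: "c \<in> A \<Longrightarrow> p \<in> fst c \<Longrightarrow> (\<And>i. i \<in> I \<Longrightarrow> C1M (f i)) \<Longrightarrow> chart_grad c (\<lambda>q. \<Sum>i\<in>I. f i q) p = (\<Sum>i\<in>I. chart_grad c (f i) p)"
proof (induction I rule: infinite_finite_induct)
  case (insert i I) then show ?case using chart_grad_add[of c p "f i" "\<lambda>q. \<Sum>i\<in>I. f i q"] C1M_sum[of I f] by simp
qed (auto simp: chart_grad_def o_def gradient_const)

lemma chart_grad_cong:
  assumes "c \<in> A" "p \<in> fst c" "open W" "p \<in> W" "\<And>q. q \<in> W \<Longrightarrow> f q = h q"
  shows "chart_grad c f p = chart_grad c h p"
  unfolding chart_grad_def
proof (rule gradient_cong[of "snd c ` (W \<inter> fst c)"])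
  show "open (snd c ` (W \<inter> fst c))" using assms by (intro chart_image_open) (auto intro: chart_open)
qed (use assms in \<open>auto simp: cinv_chart\<close>)

lemma gamma_sum_left: 
  assumes "\<And>i. i \<in> I \<Longrightarrow> C1M (f i)" "C1M w" shows "gamma (\<lambda>q. \<Sum>i\<in>I. f i q) w p = (\<Sum>i\<in>I. gamma (f i) w p)"
proof -
  obtain c where c: "c \<in> A" "p \<in> fst c" using ex_chart by blast
  show ?thesis using assms c by (simp add: gamma_chart[OF c] C1M_sum chart_gamma_def chart_grad_sum inner_sum_left)
qed

lemma gamma_mult_left: 
  assumes "C1M f" "C1M h" "C1M w" shows "gamma (\<lambda>q. f q * h q) w p = f p * gamma h w p + h p * gamma f w p"
proof -
  obtain c where c: "c \<in> A" "p \<in> fst c" using ex_chart by blast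
  show ?thesis using assms c by (simp add: gamma_chart[OF c] C1M_mult chart_gamma_def chart_grad_mult inner_add_left)
qed

lemma chart_grad_metric_inv:
  assumes "c \<in> A" "p \<in> fst c"
  shows "v \<bullet> (matrix_inv (g c p) *v w) = (matrix_inv (g c p) *v v) \<bullet> (g c p *v (matrix_inv (g c p) *v w))"
  using metric_inner_commute[OF assms] metric_mult_inv[OF assms] by (metis inner_commute)

lemma gamma_nonneg: assumes "C1M f" shows "gamma f f p \<ge> 0"
proof -
  obtain c where c: "c \<in> A" "p \<in> fst c" using ex_chart by blast
  show ?thesis using assms by (simp add: gamma_chart[OF c] chart_gamma_def chart_grad_metric_inv[OF c] metric_nonneg[OF c])
qed

text \<open>The gradient vector of \<open>w\<close> is itself an admissible test vector, and its squared length is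
  \<open>gamma w w\<close>.\<close>
lemma gamma_bound:
  assumes c: "c \<in> A" "p \<in> fst c" and "C1M f" "C1M w" 
    and bd: "\<And>v. \<bar>chart_grad c f p \<bullet> v\<bar> \<le> B * sqrt (v \<bullet> (g c p *v v))"
  shows "\<bar>gamma f w p\<bar> \<le> B * sqrt (gamma w w p)"
proof -
  have "gamma w w p = (matrix_inv (g c p) *v chart_grad c w p) \<bullet> (g c p *v (matrix_inv (g c p) *v chart_grad c w p))"
    using assms(4) by (simp add: gamma_chart[OF c] chart_gamma_def chart_grad_metric_inv[OF c])
  then show ?thesis using bd[of "matrix_inv (g c p) *v chart_grad c w p"] assms(3,4) by (simp add: gamma_chart[OF c] chart_gamma_def)
qed

text \<open>With \<open>b\<^sub>i\<close> equal to one near the centres, \<open>1 - \<Sum>\<^sub>i \<zeta>\<^sub>i = \<Prod>\<^sub>i (1 - b\<^sub>i)\<close> for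
  \<open>\<zeta>\<^sub>i = b\<^sub>i \<Prod>\<^sub>j\<^sub><\<^sub>i (1 - b\<^sub>j)\<close>, so the \<open>\<zeta>\<^sub>i\<close> sum up to one wherever some \<open>b\<^sub>i\<close> is one.\<close>
lemma partition_of_unity:
  assumes K: "compact K"
    and good: "\<And>p. p \<in> K \<Longrightarrow> \<exists>c x r. c \<in> A \<and> r > 0 \<and> p \<in> fst c \<and> dist x (snd c p) < r \<and> cball x (2 * r) \<subseteq> crange c \<and> P c x r"
  shows "\<exists>(N::nat) c r x \<zeta> W.
    (\<forall>i<N. c i \<in> A \<and> r i > 0 \<and> cball (x i) (2 * r i) \<subseteq> crange (c i) \<and> P (c i) (x i) (r i) \<and> C1M (\<zeta> i) \<and>
       (\<forall>q. 0 \<le> \<zeta> i q) \<and> (\<forall>q. q \<notin> cinv (c i) ` cball (x i) (2 * r i) \<longrightarrow> \<zeta> i q = 0)) \<and>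
    (\<forall>q. (\<Sum>i<N. \<zeta> i q) \<le> 1) \<and> open W \<and> K \<subseteq> W \<and> (\<forall>q\<in>W. (\<Sum>i<N. \<zeta> i q) = 1)"
proof -
  let ?Q = "\<lambda>p c x r. c \<in> A \<and> r > 0 \<and> p \<in> fst c \<and> dist x (snd c p) < r \<and> cball x (2 * r) \<subseteq> crange c \<and> P c x r"
  have "\<forall>p\<in>K. \<exists>t. ?Q p (fst t) (fst (snd t)) (snd (snd t))"
  proof
    fix p assume "p \<in> K"
    then obtain c x r where "?Q p c x r" using good by blast
    then show "\<exists>t. ?Q p (fst t) (fst (snd t)) (snd (snd t))" by (intro exI[of _ "(c, x, r)"]) simp
  qed
  then obtain t where t: "\<forall>p\<in>K. ?Q p (fst (t p)) (fst (snd (t p))) (snd (snd (t p)))"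
    by (rule bchoice[THEN exE])
  define c where "c p = fst (t p)" for p
  define x where "x p = fst (snd (t p))" for p
  define r where "r p = snd (snd (t p))" for p
  have cxr: "\<And>p. p \<in> K \<Longrightarrow> c p \<in> A" "\<And>p. p \<in> K \<Longrightarrow> r p > 0" "\<And>p. p \<in> K \<Longrightarrow> p \<in> fst (c p)" 
      "\<And>p. p \<in> K \<Longrightarrow> dist (x p) (snd (c p) p) < r p" "\<And>p. p \<in> K \<Longrightarrow> cball (x p) (2 * r p) \<subseteq> crange (c p)" "\<And>p. p \<in> K \<Longrightarrow> P (c p) (x p) (r p)"
    using t by (auto simp: c_def x_def r_def)
  define V where "V p = cinv (c p) ` ball (x p) (r p)" for p
  have sub: "ball (x p) (r p) \<subseteq> crange (c p)" if "p \<in> K" for p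
    using cxr(2,5)[OF that] by (auto simp: subset_eq)
  have V: "open (V p)" "p \<in> V p" if "p \<in> K" for p
    using cinv_image_open[OF cxr(1)[OF that] open_ball sub[OF that]] cxr(3,4)[OF that] cinv_chart[OF cxr(1)[OF that]]
    by (auto simp: V_def image_iff intro!: bexI[of _ "snd (c p) p"])
  obtain I where I: "I \<subseteq> K" "finite I" "K \<subseteq> (\<Union>p\<in>I. V p)"
    using compactE_image[OF K, of K V] V by (metis UN_I subsetI)
  obtain e where e: "bij_betw e {..<card I} I" using ex_bij_betw_nat_finite[OF I(2)] by (auto simp: atLeast0LessThan)
  let ?N = "card I"
  have eK: "e i \<in> K" if "i < ?N" for i using e I that by (auto simp: bij_betw_def)
  define b where "b i q = (if q \<in> fst (c (e i)) then bump (x (e i)) (r (e i)) (snd (c (e i)) q) else 0)" for i q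
  have b1: "C1M (b i)" if "i < ?N" for i
    unfolding b_def using cxr(2)[OF eK[OF that]]
    by (intro C1M_extend_by_0[OF cxr(1)[OF eK[OF that]] C1_on_bump compact_cball cxr(5)[OF eK[OF that]]] bump_eq_0) auto
  have brange: "0 \<le> b i q" "b i q \<le> 1" for i q by (auto simp: b_def bump_range)
  have b0: "b i q = 0" if "i < ?N" "q \<notin> cinv (c (e i)) ` cball (x (e i)) (2 * r (e i))" for i q
  proof (cases "q \<in> fst (c (e i))")
    case True
    have "snd (c (e i)) q \<notin> cball (x (e i)) (2 * r (e i))" using that cinv_chart[OF cxr(1)[OF eK[OF that(1)]] True] by (metis image_eqI)
    then show ?thesis using cxr(2)[OF eK[OF that(1)]] by (auto simp: b_def intro!: bump_eq_0)
  qed (simp add: b_def)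
  have bV: "b i q = 1" if "i < ?N" "q \<in> V (e i)" for i q
    using that cxr(2)[OF eK[OF that(1)]] sub[OF eK[OF that(1)]] cinv_in[OF cxr(1)[OF eK[OF that(1)]]] chart_cinv[OF cxr(1)[OF eK[OF that(1)]]]
    by (auto simp: V_def b_def subset_eq intro!: bump_eq_1)
  define \<zeta> where "\<zeta> i q = b i q * (\<Prod>j<i. (1 - b j q))" for i q
  have sum: "(\<Sum>i<n. \<zeta> i q) = 1 - (\<Prod>j<n. (1 - b j q))" for n q
    by (induction n) (auto simp: \<zeta>_def algebra_simps)
  have prnn: "0 \<le> (\<Prod>j<n. (1 - b j q))" for n q by (intro prod_nonneg) (simp add: brange)
  show ?thesis
  proof (intro exI[of _ ?N] exI[of _ "\<lambda>i. c (e i)"] exI[of _ "\<lambda>i. r (e i)"] exI[of _ "\<lambda>i. x (e i)"] exI[of _ \<zeta>]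
      exI[of _ "\<Union>i<?N. V (e i)"] conjI allI impI ballI)
    show "C1M (\<zeta> i)" if "i < ?N" for i
      unfolding \<zeta>_def using that by (intro C1M_mult C1M_prod C1M_diff C1M_const b1) auto
    show "0 \<le> \<zeta> i q" for i q using prnn brange by (simp add: \<zeta>_def)
    show "(\<Sum>i<?N. \<zeta> i q) \<le> 1" for q using sum prnn by simp
    show "(\<Sum>i<?N. \<zeta> i q) = 1" if "q \<in> (\<Union>i<?N. V (e i))" for q
    proof -
      have "(\<Prod>j<?N. (1 - b j q)) = 0" using that bV by (intro prod_zero) auto
      then show ?thesis by (simp add: sum)
    qed
    show "K \<subseteq> (\<Union>i<?N. V (e i))" using I(3) bij_betw_imp_surj_on[OF e] by (metis image_image)
    show "\<zeta> i q = 0" if "i < ?N" "q \<notin> cinv (c (e i)) ` cball (x (e i)) (2 * r (e i))" for i q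
      using b0[OF that] by (simp add: \<zeta>_def)
    show "open (\<Union>i<?N. V (e i))" using V eK by auto
  qed (use cxr eK in auto)
qed

end

section \<open>The Riemannian volume\<close>

context riemannian_manifold begin

definition dens :: "('a, 'n) chart \<Rightarrow> real ^ 'n \<Rightarrow> real" where
  "dens c x = sqrt (det (g c (cinv c x)))"

definition is_volume :: "'a measure \<Rightarrow> bool" where
  "is_volume \<mu> \<longleftrightarrow> sets \<mu> = sets borel \<and>
     (\<forall>c\<in>A. \<forall>E\<in>sets borel. E \<subseteq> fst c \<longrightarrow> emeasure \<mu> E = (\<integral>\<^sup>+x\<in>snd c ` E. ennreal (dens c x) \<partial>lborel))"

lemma riem_volume_eq: "riem_volume A g = (THE \<mu>. is_volume \<mu>)"
  unfolding riem_volume_def is_volume_def dens_def by (rule arg_cong[where f=The]) (auto simp: fun_eq_iff)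

lemma dens_cont: "c \<in> A \<Longrightarrow> continuous_on (crange c) (dens c)"
  unfolding dens_def[abs_def] by (rule C1_on_imp_continuous_on[OF density_C1])

lemma dens_pos: "c \<in> A \<Longrightarrow> x \<in> crange c \<Longrightarrow> dens c x > 0"
  unfolding dens_def using det_metric_pos[of c "cinv c x"] cinv_in by simp

lemma crange_borel: "c \<in> A \<Longrightarrow> crange c \<in> sets borel" by (rule borel_open[OF crange_open])
lemma chart_borel: "c \<in> A \<Longrightarrow> fst c \<in> sets borel" by (rule borel_open[OF chart_open])

lemma cinv_measurable: "c \<in> A \<Longrightarrow> cinv c \<in> borel_measurable (restrict_space borel (crange c))"
  by (intro borel_measurable_continuous_on_restrict cinv_cont)

lemma chart_image_borel: 
  assumes c: "c \<in> A" and E: "E \<in> sets borel" "E \<subseteq> fst c" shows "snd c ` E \<in> sets borel"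
proof -
  have "cinv c -` E \<inter> space (restrict_space borel (crange c)) \<in> sets (restrict_space borel (crange c))"
    by (rule measurable_sets[OF cinv_measurable[OF c] E(1)])
  then have "cinv c -` E \<inter> crange c \<in> sets borel"
    using crange_borel[OF c] by (auto simp: space_restrict_space sets_restrict_space_iff)
  then show ?thesis using chart_image_eq[OF c E(2)] by (simp add: Int_commute)
qed

definition chart_volume :: "('a, 'n) chart \<Rightarrow> 'a measure" where
  "chart_volume c = distr (density (restrict_space lborel (crange c)) (\<lambda>x. ennreal (dens c x))) borel (cinv c)"

lemma dens_measurable: "c \<in> A \<Longrightarrow> (\<lambda>x. ennreal (dens c x)) \<in> borel_measurable (restrict_space lborel (crange c))"
  using borel_measurable_continuous_on_restrict[OF dens_cont]
  by (intro measurable_compose[OF _ measurable_ennreal]) (simp cong: measurable_cong_sets add: sets_restrict_space)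

lemma cinv_measurable': "c \<in> A \<Longrightarrow> cinv c \<in> borel_measurable (density (restrict_space lborel (crange c)) (\<lambda>x. ennreal (dens c x)))"
  using cinv_measurable[of c] by (simp cong: measurable_cong_sets add: sets_restrict_space)

lemma emeasure_chart_volume:
  assumes c: "c \<in> A" and E: "E \<in> sets borel"
  shows "emeasure (chart_volume c) E = (\<integral>\<^sup>+x\<in>snd c ` (E \<inter> fst c). ennreal (dens c x) \<partial>lborel)"
proof -
  let ?N = "restrict_space lborel (crange c)"
  have img: "cinv c -` E \<inter> crange c = snd c ` (E \<inter> fst c)"
    using chart_image_eq[OF c, of "E \<inter> fst c"] cinv_in[OF c] by auto
  have "emeasure (chart_volume c) E = emeasure (density ?N (\<lambda>x. ennreal (dens c x))) (cinv c -` E \<inter> crange c)"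
    unfolding chart_volume_def using E cinv_measurable'[OF c]
    by (subst emeasure_distr) (auto simp: space_restrict_space)
  also have "\<dots> = (\<integral>\<^sup>+x. ennreal (dens c x) * indicator (cinv c -` E \<inter> crange c) x \<partial>?N)"
  proof (rule emeasure_density[OF dens_measurable[OF c]])
    have "snd c ` (E \<inter> fst c) \<in> sets borel" using E chart_borel[OF c] by (intro chart_image_borel[OF c]) auto
    then show "cinv c -` E \<inter> crange c \<in> sets ?N" unfolding img
      using crange_borel[OF c] by (auto simp: sets_restrict_space_iff)
  qed
  also have "\<dots> = (\<integral>\<^sup>+x. ennreal (dens c x) * indicator (cinv c -` E \<inter> crange c) x * indicator (crange c) x \<partial>lborel)"
    using crange_borel[OF c] by (subst nn_integral_restrict_space) auto
  also have "\<dots> = (\<integral>\<^sup>+x\<in>snd c ` (E \<inter> fst c). ennreal (dens c x) \<partial>lborel)"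
    unfolding img by (intro nn_integral_cong) (auto simp: indicator_def)
  finally show ?thesis .
qed

text \<open>The change of variables formula: the volume densities of two charts differ by the modulus of
  the Jacobian determinant of the transition map.\<close>
lemma chart_volume_overlap:
  assumes c: "c \<in> A" "c' \<in> A" and E: "E \<in> sets borel" "E \<subseteq> fst c" "E \<subseteq> fst c'"
  shows "(\<integral>\<^sup>+x\<in>snd c ` E. ennreal (dens c x) \<partial>lborel) = (\<integral>\<^sup>+x\<in>snd c' ` E. ennreal (dens c' x) \<partial>lborel)"
proof -
  let ?S = "snd c ` E" and ?T = "transition c c'" and ?T' = "\<lambda>x v. jac c c' (cinv c x) *v v"
  have TS: "?T ` ?S = snd c' ` E" unfolding image_image
    by (rule image_cong[OF refl]) (use E transition_chart[OF c(1)] in blast)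
  have Sb: "?S \<in> sets borel" "?T ` ?S \<in> sets borel" unfolding TS using E c by (auto intro: chart_image_borel)
  have Tx: "\<exists>p\<in>E. x = snd c p \<and> cinv c x = p \<and> ?T x = snd c' p" if "x \<in> ?S" for x
  proof -
    obtain p where p: "p \<in> E" "x = snd c p" using \<open>x \<in> ?S\<close> by blast
    then have "p \<in> fst c" using E by blast
    then show ?thesis using p cinv_chart[OF c(1)] transition_chart[OF c(1)] by auto
  qed
  have det: "\<bar>det (matrix (?T' x))\<bar> * dens c' (?T x) = dens c x" if x: "x \<in> ?S" for x
  proof -
    obtain p where p: "p \<in> E" "x = snd c p" "cinv c x = p" "?T x = snd c' p" using Tx[OF x] by blast
    have pc: "p \<in> fst c" "p \<in> fst c'" using p E by auto
    have "det (g c p) = (det (jac c c' p))\<^sup>2 * det (g c' p)"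
      unfolding metric_jac[OF c pc] det_mul det_transpose by (simp add: power2_eq_square)
    then have "dens c x = \<bar>det (jac c c' p)\<bar> * dens c' (snd c' p)"
      using cinv_chart[OF c(2) pc(2)] p by (simp add: dens_def real_sqrt_mult)
    then show ?thesis using p by (simp add: matrix_of_matrix_vector_mul)
  qed
  have "(\<integral>\<^sup>+x\<in>?S. ennreal (\<bar>det (matrix (?T' x))\<bar> * dens c' (?T x)) \<partial>lborel) = (\<integral>\<^sup>+y\<in>?T ` ?S. ennreal (dens c' y) \<partial>lborel)"
  proof (rule nn_integral_change_of_variables[OF Sb])
    show "(?T has_derivative ?T' x) (at x within ?S)" if x: "x \<in> ?S" for x
    proof -
      obtain p where p: "p \<in> E" "x = snd c p" "cinv c x = p" using Tx[OF x] by blast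
      have pc: "p \<in> fst c" "p \<in> fst c'" using p E by auto
      show ?thesis using has_derivative_at_withinI[OF transition_derivative[OF c pc]] p by simp
    qed
    show "inj_on ?T ?S"
    proof (rule inj_onI)
      fix x y assume x: "x \<in> ?S" and y: "y \<in> ?S" and eq: "?T x = ?T y"
      obtain p where p: "p \<in> E" "x = snd c p" "?T x = snd c' p" using Tx[OF x] by blast
      obtain q where q: "q \<in> E" "y = snd c q" "?T y = snd c' q" using Tx[OF y] by blast
      have "cinv c' (snd c' p) = p" "cinv c' (snd c' q) = q" using p q E cinv_chart[OF c(2)] by auto
      then have "p = q" using p(3) q(3) eq by metis
      then show "x = y" using p(2) q(2) by simp
    qed
    show "0 \<le> dens c' y" if "y \<in> ?T ` ?S" for y
      using that dens_pos[OF c(2), of y] E unfolding TS by (auto simp: less_imp_le subset_eq)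
    have "continuous_on (snd c' ` E) (dens c')" using continuous_on_subset[OF dens_cont[OF c(2)] image_mono[OF E(3)]] .
    then show "(\<lambda>y. indicator (?T ` ?S) y * dens c' y) \<in> borel_measurable borel"
      using borel_measurable_continuous_on_indicator[of "?T ` ?S" "dens c'"] Sb TS by simp
    have "continuous_on ?S (dens c)" using continuous_on_subset[OF dens_cont[OF c(1)] image_mono[OF E(2)]] .
    then have "(\<lambda>x. indicator ?S x * dens c x) \<in> borel_measurable borel"
      using borel_measurable_continuous_on_indicator[of ?S "dens c"] Sb by simp
    moreover have "(\<lambda>x. indicator ?S x * dens c x) = (\<lambda>x. indicator ?S x * (\<bar>det (matrix (?T' x))\<bar> * dens c' (?T x)))"
      using det by (auto simp: fun_eq_iff indicator_def)
    ultimately show "(\<lambda>x. indicator ?S x * (\<bar>det (matrix (?T' x))\<bar> * dens c' (?T x))) \<in> borel_measurable borel" by simp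
  qed
  moreover have "(\<integral>\<^sup>+x\<in>?S. ennreal (dens c x) \<partial>lborel) = (\<integral>\<^sup>+x\<in>?S. ennreal (\<bar>det (matrix (?T' x))\<bar> * dens c' (?T x)) \<partial>lborel)"
    using det by (intro nn_integral_cong) (auto simp: indicator_def)
  ultimately show ?thesis unfolding TS by simp
qed

lemma countable_atlas:
  obtains c :: "nat \<Rightarrow> ('a, 'n) chart" where "\<And>i. c i \<in> A" "(\<Union>i. fst (c i)) = UNIV"
proof -
  have "\<And>S. S \<in> fst ` A \<Longrightarrow> open S" using chart_open by auto
  then obtain F where F: "F \<subseteq> fst ` A" "countable F" "\<Union>F = \<Union>(fst ` A)" by (rule Lindelof)
  have UN: "\<Union>F = UNIV" using F(3) ex_chart by blast
  then have ne: "F \<noteq> {}" by auto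
  have "\<forall>i. \<exists>c. c \<in> A \<and> fst c = from_nat_into F i" using from_nat_into[OF ne] F(1) by blast
  then obtain c where c: "\<And>i. c i \<in> A \<and> fst (c i) = from_nat_into F i" by metis
  moreover have "(\<Union>i. fst (c i)) = UNIV" using c range_from_nat_into[OF ne F(2)] UN by simp
  ultimately show thesis using that by blast
qed

text \<open>A countable atlas cuts the manifold into disjoint Borel pieces that lie in single charts. On each
  piece the chart determines the measure, which gives uniqueness, and adding up the pieces gives
  a measure that has the right density in every chart because chart densities agree on overlaps.\<close>
lemma ex1_volume: "\<exists>!\<mu>. is_volume \<mu>"
proof -
  obtain c where c: "\<And>i::nat. c i \<in> A" "(\<Union>i. fst (c i)) = UNIV" using countable_atlas by blast
  define D where "D = disjointed (\<lambda>i. fst (c i))"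
  have Dsub: "D i \<subseteq> fst (c i)" for i unfolding D_def by (rule disjointed_subset)
  have Dun: "(\<Union>i. D i) = UNIV" unfolding D_def UN_disjointed_eq by (rule c(2))
  have Ddis: "disjoint_family D" unfolding D_def by (rule disjoint_family_disjointed)
  have Db: "D i \<in> sets borel" for i 
    unfolding D_def disjointed_def using chart_borel[OF c(1)] by (intro sets.Diff sets.finite_UN) auto
  have split: "emeasure \<nu> E = (\<Sum>i. emeasure \<nu> (E \<inter> D i))" if "E \<in> sets borel" "sets \<nu> = sets borel" for \<nu> :: "'a measure" and E
  proof -
    have "(\<Sum>i. emeasure \<nu> (E \<inter> D i)) = emeasure \<nu> (\<Union>i. E \<inter> D i)"
      by (rule suminf_emeasure) (use that Db in \<open>auto intro: disjoint_family_subset[OF Ddis]\<close>)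
    moreover have "(\<Union>i. E \<inter> D i) = E" using Dun by auto
    ultimately show ?thesis by simp
  qed
  have scv: "sets (chart_volume c) = sets borel" for c by (simp add: chart_volume_def)
  define m where "m E = (\<Sum>i. emeasure (chart_volume (c i)) (E \<inter> D i))" for E
  define \<mu> where "\<mu> = measure_of UNIV (sets borel) m"
  have sets_mu: "sets \<mu> = sets borel" unfolding \<mu>_def using sets.sigma_sets_eq[of borel] by (simp add: sets_measure_of space_borel[symmetric] del: space_borel)
  have emu: "emeasure \<mu> E = m E" if "E \<in> sets borel" for E
  proof (rule emeasure_measure_of[OF \<mu>_def])
    show "sets borel \<subseteq> Pow (UNIV :: 'a set)" by simp
    show "E \<in> sets \<mu>" using that sets_mu by simp
    show "positive (sets \<mu>) m" by (simp add: positive_def m_def)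
    show "countably_additive (sets \<mu>) m"
    proof (rule countably_additiveI)
      fix F :: "nat \<Rightarrow> 'a set" assume F: "range F \<subseteq> sets \<mu>" "disjoint_family F"
      have "(\<Sum>n. m (F n)) = (\<integral>\<^sup>+n. (\<Sum>i. emeasure (chart_volume (c i)) (F n \<inter> D i)) \<partial>count_space UNIV)"
        by (simp add: nn_integral_count_space_nat m_def)
      also have "\<dots> = (\<Sum>i. \<integral>\<^sup>+n. emeasure (chart_volume (c i)) (F n \<inter> D i) \<partial>count_space UNIV)"
        by (rule nn_integral_suminf) simp
      also have "\<dots> = (\<Sum>i. emeasure (chart_volume (c i)) ((\<Union>n. F n) \<inter> D i))"
      proof (rule suminf_cong)
        fix i
        have "(\<Sum>n. emeasure (chart_volume (c i)) (F n \<inter> D i)) = emeasure (chart_volume (c i)) (\<Union>n. F n \<inter> D i)"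
          by (rule suminf_emeasure) (use F Db sets_mu scv in \<open>auto intro: disjoint_family_subset[OF F(2)]\<close>)
        moreover have "(\<Union>n. F n \<inter> D i) = (\<Union>n. F n) \<inter> D i" by auto
        ultimately show "(\<integral>\<^sup>+n. emeasure (chart_volume (c i)) (F n \<inter> D i) \<partial>count_space UNIV) = emeasure (chart_volume (c i)) ((\<Union>n. F n) \<inter> D i)"
          by (simp add: nn_integral_count_space_nat)
      qed
      finally show "(\<Sum>n. m (F n)) = m (\<Union>n. F n)" by (simp add: m_def)
    qed
  qed
  have piece: "emeasure (chart_volume (c i)) (E \<inter> D i) = (\<integral>\<^sup>+x\<in>snd c' ` (E \<inter> D i). ennreal (dens c' x) \<partial>lborel)"
    if "c' \<in> A" "E \<in> sets borel" "E \<subseteq> fst c'" for E c' i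
  proof -
    have "E \<inter> D i \<inter> fst (c i) = E \<inter> D i" using Dsub by auto
    then have "emeasure (chart_volume (c i)) (E \<inter> D i) = (\<integral>\<^sup>+x\<in>snd (c i) ` (E \<inter> D i). ennreal (dens (c i) x) \<partial>lborel)"
      using emeasure_chart_volume[OF c(1)[of i], of "E \<inter> D i"] that Db[of i] by simp
    also have "\<dots> = (\<integral>\<^sup>+x\<in>snd c' ` (E \<inter> D i). ennreal (dens c' x) \<partial>lborel)"
      using Dsub[of i] that Db[of i] by (intro chart_volume_overlap c) auto
    finally show ?thesis .
  qed
  have "is_volume \<mu>"
    unfolding is_volume_def
  proof (intro conjI ballI impI sets_mu)
    fix c' E assume c': "c' \<in> A" and E: "E \<in> sets borel" "E \<subseteq> fst c'"
    have "emeasure \<mu> E = (\<Sum>i. emeasure (chart_volume (c i)) (E \<inter> D i))" using emu E by (simp add: m_def)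
    also have "\<dots> = (\<Sum>i. emeasure (chart_volume c') (E \<inter> D i))"
    proof (rule suminf_cong)
      fix i
      have "E \<inter> D i \<inter> fst c' = E \<inter> D i" using E by auto
      then show "emeasure (chart_volume (c i)) (E \<inter> D i) = emeasure (chart_volume c') (E \<inter> D i)"
        using piece[OF c' E, of i] emeasure_chart_volume[OF c', of "E \<inter> D i"] E Db[of i] by simp
    qed
    also have "\<dots> = emeasure (chart_volume c') E" using split[OF E(1) scv] by simp
    also have "\<dots> = (\<integral>\<^sup>+x\<in>snd c' ` E. ennreal (dens c' x) \<partial>lborel)"
      using emeasure_chart_volume[OF c' E(1)] E(2) by (simp add: Int_absorb2)
    finally show "emeasure \<mu> E = (\<integral>\<^sup>+x\<in>snd c' ` E. ennreal (dens c' x) \<partial>lborel)" .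
  qed
  moreover have "\<nu> = \<mu>" if nu: "is_volume \<nu>" for \<nu>
  proof (rule measure_eqI)
    have sn: "sets \<nu> = sets borel" using nu by (simp add: is_volume_def)
    then show "sets \<nu> = sets \<mu>" using sets_mu by simp
    fix E assume "E \<in> sets \<nu>"
    then have E: "E \<in> sets borel" using sn by simp
    have "emeasure \<nu> (E \<inter> D i) = emeasure \<mu> (E \<inter> D i)" for i
    proof -
      have "E \<inter> D i \<in> sets borel" "E \<inter> D i \<subseteq> fst (c i)" using E Db[of i] Dsub[of i] by auto
      then show ?thesis using nu \<open>is_volume \<mu>\<close> c(1)[of i] by (simp add: is_volume_def)
    qed
    then show "emeasure \<nu> E = emeasure \<mu> E" using split[OF E sn] split[OF E sets_mu] by simp
  qed
  ultimately show ?thesis by blast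
qed

abbreviation "vol \<equiv> riem_volume A g"

lemma vol_is_volume: "is_volume vol"
  unfolding riem_volume_eq by (rule theI'[OF ex1_volume])

lemma sets_vol[simp, measurable_cong]: "sets vol = sets borel"
  using vol_is_volume by (simp add: is_volume_def)

lemma space_vol[simp]: "space vol = UNIV"
  using sets_eq_imp_space_eq[OF sets_vol] by simp

lemma vol_chart_volume:
  assumes c: "c \<in> A" shows "density vol (indicator (fst c)) = chart_volume c"
proof (rule measure_eqI)
  fix E assume "E \<in> sets (density vol (indicator (fst c)))"
  then have E: "E \<in> sets borel" by simp
  have fc: "fst c \<in> sets vol" using chart_borel[OF c] by simp
  have "emeasure (density vol (indicator (fst c))) E = (\<integral>\<^sup>+p. indicator (fst c) p * indicator E p \<partial>vol)"
    using E fc by (intro emeasure_density) auto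
  also have "\<dots> = (\<integral>\<^sup>+p. indicator (E \<inter> fst c) p \<partial>vol)" by (intro nn_integral_cong) (auto simp: indicator_def)
  also have "\<dots> = emeasure vol (E \<inter> fst c)" using E fc by (intro nn_integral_indicator) auto
  also have "\<dots> = emeasure (chart_volume c) E"
    using vol_is_volume c E fc by (simp add: is_volume_def emeasure_chart_volume)
  finally show "emeasure (density vol (indicator (fst c))) E = emeasure (chart_volume c) E" .
qed (simp add: chart_volume_def)

lemma vol_integral_chart:
  assumes c: "c \<in> A" and f: "f \<in> borel_measurable borel" and zero: "\<And>p. p \<notin> fst c \<Longrightarrow> f p = (0::real)"
  shows "(\<integral>p. f p \<partial>vol) = (\<integral>x. (if x \<in> crange c then dens c x * f (cinv c x) else 0) \<partial>lborel)"
proof -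
  let ?N = "restrict_space lborel (crange c)"
  have dm: "dens c \<in> borel_measurable ?N"
    using borel_measurable_continuous_on_restrict[OF dens_cont[OF c]] by (simp cong: measurable_cong_sets add: sets_restrict_space)
  have cm: "cinv c \<in> borel_measurable ?N"
    using cinv_measurable[OF c] by (simp cong: measurable_cong_sets add: sets_restrict_space)
  have fcm: "(\<lambda>x. f (cinv c x)) \<in> borel_measurable ?N"
    using measurable_compose[OF cm f] .
  have "(\<integral>p. f p \<partial>vol) = (\<integral>p. indicator (fst c) p *\<^sub>R f p \<partial>vol)"
    using zero by (intro Bochner_Integration.integral_cong) (auto simp: indicator_def)
  also have "\<dots> = (\<integral>p. f p \<partial>density vol (\<lambda>p. ennreal (indicator (fst c) p)))"
    using f chart_borel[OF c] by (intro integral_density[symmetric]) auto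
  also have "\<dots> = (\<integral>p. f p \<partial>chart_volume c)"
    using vol_chart_volume[OF c] by (simp add: ennreal_indicator)
  also have "\<dots> = (\<integral>x. f (cinv c x) \<partial>density ?N (\<lambda>x. ennreal (dens c x)))"
    unfolding chart_volume_def using cinv_measurable'[OF c] f by (intro integral_distr)
  also have "\<dots> = (\<integral>x. dens c x *\<^sub>R f (cinv c x) \<partial>?N)"
    using dm fcm dens_pos[OF c] by (intro integral_density) (auto simp: AE_restrict_space_iff space_restrict_space less_imp_le crange_borel[OF c] intro!: AE_I2)
  also have "\<dots> = (\<integral>x. indicator (crange c) x *\<^sub>R (dens c x *\<^sub>R f (cinv c x)) \<partial>lborel)"
    using crange_borel[OF c] by (intro integral_restrict_space) simp
  also have "\<dots> = (\<integral>x. (if x \<in> crange c then dens c x * f (cinv c x) else 0) \<partial>lborel)"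
    by (intro Bochner_Integration.integral_cong) (auto simp: indicator_def)
  finally show ?thesis .
qed

lemma vol_chart_compact_finite:
  assumes c: "c \<in> A" and K: "compact K" "K \<subseteq> crange c"
  shows "emeasure vol (cinv c ` K) < \<infinity>"
proof -
  have sub: "cinv c ` K \<subseteq> fst c" using K c cinv_in by blast
  have KK: "snd c ` cinv c ` K = K" unfolding image_image
    by (rule trans[OF image_cong[OF refl] image_ident]) (use K chart_cinv[OF c] in blast)
  have comp: "compact (cinv c ` K)" using c K by (rule cinv_image_compact)
  then have "cinv c ` K \<in> sets borel" by (intro borel_closed compact_imp_closed)
  then have "emeasure vol (cinv c ` K) = (\<integral>\<^sup>+x\<in>K. ennreal (dens c x) \<partial>lborel)"
    using vol_is_volume c sub KK by (simp add: is_volume_def)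
  also have "\<dots> < \<infinity>"
  proof -
    have cont: "continuous_on K (dens c)" using continuous_on_subset[OF dens_cont[OF c] K(2)] .
    obtain B where B: "\<And>x. x \<in> K \<Longrightarrow> dens c x \<le> B"
      using compact_imp_bounded[OF compact_continuous_image[OF cont K(1)]] unfolding bounded_iff
      by (metis abs_le_D1 image_eqI real_norm_def)
    have "(\<integral>\<^sup>+x\<in>K. ennreal (dens c x) \<partial>lborel) \<le> (\<integral>\<^sup>+x. ennreal B * indicator K x \<partial>lborel)"
      using B by (intro nn_integral_mono) (auto simp: indicator_def ennreal_leI)
    also have "\<dots> = ennreal B * emeasure lborel K"
      using K(1) by (intro nn_integral_cmult_indicator) (auto intro!: borel_closed compact_imp_closed)
    also have "\<dots> < \<infinity>" using emeasure_compact_finite[OF K(1)] by (simp add: ennreal_mult_less_top)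
    finally show ?thesis .
  qed
  finally show ?thesis .
qed

lemma nbhd_compact:
  obtains c r where "c \<in> A" "p \<in> fst c" "r > 0" "cball (snd c p) (2 * r) \<subseteq> crange c"
proof -
  obtain c where c: "c \<in> A" "p \<in> fst c" using ex_chart by blast
  then obtain e where e: "e > 0" "ball (snd c p) e \<subseteq> crange c" using crange_open[OF c(1)] open_contains_ball by blast
  have "cball (snd c p) (2 * (e / 4)) \<subseteq> crange c" using e by (auto simp: subset_eq)
  then show thesis using that[of c "e/4"] c e by simp
qed

lemma nbhd_finite_volume:
  obtains W C where "open W" "p \<in> W" "W \<subseteq> C" "compact C" "emeasure vol C < \<infinity>"
proof -
  obtain c r where c: "c \<in> A" "p \<in> fst c" "r > 0" "cball (snd c p) (2 * r) \<subseteq> crange c" using nbhd_compact by blast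
  let ?x = "snd c p"
  have sub: "ball ?x (2 * r) \<subseteq> crange c" using c(4) by auto
  show thesis
  proof (rule that[of "cinv c ` ball ?x (2 * r)" "cinv c ` cball ?x (2 * r)"])
    show "open (cinv c ` ball ?x (2 * r))" using cinv_image_open[OF c(1) open_ball sub] .
    show "p \<in> cinv c ` ball ?x (2 * r)" using c cinv_chart by (auto intro!: image_eqI[of _ _ ?x])
    show "compact (cinv c ` cball ?x (2 * r))" using c by (intro cinv_image_compact) auto
    show "emeasure vol (cinv c ` cball ?x (2 * r)) < \<infinity>" using c by (intro vol_chart_compact_finite) auto
  qed auto
qed

lemma vol_compact_finite: assumes K: "compact K" shows "emeasure vol K < \<infinity>"
proof -
  have "\<forall>p. \<exists>W. open W \<and> p \<in> W \<and> emeasure vol W < \<infinity>"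
  proof
    fix p obtain W C where W: "open W" "p \<in> W" "W \<subseteq> C" "compact C" "emeasure vol C < \<infinity>" using nbhd_finite_volume by blast
    then have "emeasure vol W \<le> emeasure vol C" by (intro emeasure_mono) (auto intro!: borel_closed compact_imp_closed)
    then show "\<exists>W. open W \<and> p \<in> W \<and> emeasure vol W < \<infinity>" using W by (meson le_less_trans)
  qed
  then obtain W where W: "\<And>p. open (W p)" "\<And>p. p \<in> W p" "\<And>p. emeasure vol (W p) < \<infinity>" by metis
  obtain I where I: "finite I" "K \<subseteq> (\<Union>p\<in>I. W p)" using compactE_image[OF K, of K W] W by (metis UN_I subsetI)
  have "emeasure vol K \<le> emeasure vol (\<Union>p\<in>I. W p)" using I W(1) by (intro emeasure_mono) auto
  also have "\<dots> \<le> (\<Sum>p\<in>I. emeasure vol (W p))" using I W(1) by (intro emeasure_subadditive_finite) auto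
  also have "\<dots> < \<infinity>" using I W(3) by (simp add: ennreal_sum_less_top)
  finally show ?thesis .
qed

lemma sigma_finite_vol: "sigma_finite_measure vol"
proof
  have "\<forall>p. \<exists>W. open W \<and> p \<in> W \<and> emeasure vol W < \<infinity>"
  proof
    fix p obtain W C where W: "open W" "p \<in> W" "W \<subseteq> C" "compact C" "emeasure vol C < \<infinity>" using nbhd_finite_volume by blast
    then have "emeasure vol W \<le> emeasure vol C" by (intro emeasure_mono) (auto intro!: borel_closed compact_imp_closed)
    then show "\<exists>W. open W \<and> p \<in> W \<and> emeasure vol W < \<infinity>" using W by (meson le_less_trans)
  qed
  then obtain W where W: "\<And>p. open (W p)" "\<And>p. p \<in> W p" "\<And>p. emeasure vol (W p) < \<infinity>" by metis
  have "\<And>S. S \<in> range W \<Longrightarrow> open S" using W by auto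
  then obtain F where F: "F \<subseteq> range W" "countable F" "\<Union>F = \<Union>(range W)" by (rule Lindelof)
  then show "\<exists>F. countable F \<and> F \<subseteq> sets vol \<and> \<Union>F = space vol \<and> (\<forall>a\<in>F. emeasure vol a \<noteq> \<infinity>)"
    using W by (intro exI[of _ F]) (auto dest!: subsetD[OF F(1)] simp: less_top[symmetric])
qed

lemma integrable_continuous_compact_support:
  assumes f: "continuous_on UNIV f" and K: "compact K" and zero: "\<And>p. p \<notin> K \<Longrightarrow> f p = (0::real)"
  shows "integrable vol f"
proof -
  obtain B where B: "\<And>p. p \<in> K \<Longrightarrow> \<bar>f p\<bar> \<le> B"
    using compact_imp_bounded[OF compact_continuous_image[OF continuous_on_subset[OF f subset_UNIV] K]] unfolding bounded_iff by auto
  show ?thesis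
  proof (rule integrableI_bounded_set[where A=K and B=B])
    show "K \<in> sets vol" using K by (auto intro!: borel_closed compact_imp_closed)
    show "f \<in> borel_measurable vol" using borel_measurable_continuous_onI[OF f] by simp
    show "emeasure vol K < \<infinity>" using vol_compact_finite[OF K] .
  qed (use B zero in auto)
qed

end

section \<open>Green's formula\<close>

context riemannian_manifold begin

lemma chart_grad_cont:
  assumes "c \<in> A" "C1M f" shows "continuous_on (fst c) (chart_grad c f)"
  unfolding chart_grad_def[abs_def]
  by (rule continuous_on_chart_compose[OF assms(1) continuous_on_gradient[OF C1M_chart[OF assms(2,1)] crange_open[OF assms(1)]]])

lemma continuous_on_UNIV_charts:
  assumes "\<And>c. c \<in> A \<Longrightarrow> continuous_on (fst c) f" shows "continuous_on UNIV f"
proof -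
  have "continuous_on (\<Union>c\<in>A. fst c) f" by (intro continuous_on_open_UN) (auto simp: chart_open assms)
  moreover have "(\<Union>c\<in>A. fst c) = UNIV" using ex_chart by blast
  ultimately show ?thesis by simp
qed

lemma continuous_on_chart_gamma:
  assumes "c \<in> A" "continuous_on S F" "continuous_on S H" "continuous_on S q" "q ` S \<subseteq> fst c"
  shows "continuous_on S (\<lambda>x. F x \<bullet> (matrix_inv (g c (q x)) *v H x))"
proof -
  have "continuous_on S (\<lambda>x. matrix_inv (g c (q x)))"
    using continuous_on_compose2[OF metric_inv_cont[OF assms(1)] assms(4,5)] .
  then show ?thesis unfolding matrix_vector_mult_def inner_vec_def by (intro continuous_intros assms)
qed

lemma gamma_cont: assumes "C1M f" "C1M h" shows "continuous_on UNIV (gamma f h)"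
proof (rule continuous_on_UNIV_charts)
  fix c assume c: "c \<in> A"
  have "continuous_on (fst c) (chart_gamma c f h)"
    unfolding chart_gamma_def[abs_def]
    by (rule continuous_on_chart_gamma[OF c]) (auto intro: chart_grad_cont c assms)
  then show "continuous_on (fst c) (gamma f h)"
    by (rule continuous_on_eq) (use gamma_chart[OF c] assms in auto)
qed

lemma gamma_zero_off_support:
  assumes "C1M f" "C1M h" "closed K" "\<And>q. q \<notin> K \<Longrightarrow> f q = 0" "p \<notin> K" shows "gamma f h p = 0"
proof -
  obtain c where c: "c \<in> A" "p \<in> fst c" using ex_chart by blast
  have "chart_grad c f p = chart_grad c (\<lambda>q. 0) p"
    by (rule chart_grad_cong[OF c, of "- K"]) (use assms in auto)
  then show ?thesis using assms by (simp add: gamma_chart[OF c] chart_gamma_def) (simp add: chart_grad_def o_def gradient_const)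
qed

definition C2M :: "('a \<Rightarrow> real) \<Rightarrow> bool" where
  "C2M w \<longleftrightarrow> C1M w \<and> (\<forall>c\<in>A. \<forall>i. C1_on (crange c) (\<lambda>x. gradient (w \<circ> cinv c) x $ i))"

text \<open>The vector field \<open>sqrt (det g) g\<^sup>-\<^sup>1 \<nabla>w\<close>, whose Euclidean divergence is the density times the
  Laplacian.\<close>
definition flux :: "('a, 'n) chart \<Rightarrow> ('a \<Rightarrow> real) \<Rightarrow> real ^ 'n \<Rightarrow> real ^ 'n" where
  "flux c w x = dens c x *\<^sub>R (matrix_inv (g c (cinv c x)) *v gradient (w \<circ> cinv c) x)"

lemma flux_component: "flux c w x $ i = dens c x * (\<Sum>j\<in>UNIV. matrix_inv (g c (cinv c x)) $ i $ j * partial_deriv j (w \<circ> cinv c) x)"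
  by (simp add: flux_def matrix_vector_mult_def partial_deriv_gradient)

lemma flux_C1: "c \<in> A \<Longrightarrow> C2M w \<Longrightarrow> C1_on (crange c) (\<lambda>x. flux c w x $ i)"
  unfolding flux_component partial_deriv_gradient using density_C1 unfolding dens_def[symmetric]
  by (intro C1_on_mult C1_on_sum metric_inv_C1) (auto simp: C2M_def)

lemma chart_laplacian_flux:
  "chart_laplacian g c w p = (\<Sum>i\<in>UNIV. partial_deriv i (\<lambda>x. flux c w x $ i) (snd c p)) / dens c (snd c p)"
  unfolding chart_laplacian_def flux_component by (simp add: case_prod_unfold Let_def o_def dens_def)

lemma has_laplacian_chart: "has_laplacian A g w \<omega> \<Longrightarrow> c \<in> A \<Longrightarrow> p \<in> fst c \<Longrightarrow> 
    (\<Sum>i\<in>UNIV. partial_deriv i (\<lambda>x. flux c w x $ i) (snd c p)) = dens c (snd c p) * \<omega> p"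
  using chart_laplacian_flux[of c w p] dens_pos[of c "snd c p"] unfolding has_laplacian_def
  by (auto simp: field_simps case_prod_unfold)

text \<open>In the chart the integrand is the Euclidean divergence of \<open>f\<close> times the flux of \<open>w\<close>, a compactly
  supported field, and each partial derivative of such a field integrates to zero.\<close>
lemma green_in_chart:
  assumes c: "c \<in> A" and K: "compact K" "K \<subseteq> crange c" and f: "C1M f" and zero: "\<And>p. p \<notin> cinv c ` K \<Longrightarrow> f p = 0"
    and w: "C2M w" "has_laplacian A g w \<omega>" and \<omega>: "continuous_on UNIV \<omega>"
  shows "(\<integral>p. f p * \<omega> p + gamma f w p \<partial>vol) = 0"
proof -
  have w1: "C1M w" using w by (simp add: C2M_def)
  let ?F = "f \<circ> cinv c"
  define H where "H i x = (if x \<in> crange c then ?F x * flux c w x $ i else 0)" for i x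
  have F0: "?F x = 0" if "x \<in> crange c" "x \<notin> K" for x
  proof -
    have "cinv c x \<notin> cinv c ` K"
    proof
      assume "cinv c x \<in> cinv c ` K"
      then obtain y where y: "y \<in> K" "cinv c x = cinv c y" by blast
      then have "x = y" using chart_cinv[OF c that(1)] chart_cinv[OF c subsetD[OF K(2) y(1)]] by metis
      then show False using y that by simp
    qed
    then show ?thesis using zero by simp
  qed
  have H0: "H i x = 0" if "x \<notin> K" for i x using F0[of x] that by (auto simp: H_def)
  have loc: "C1_on (crange c) (\<lambda>x. ?F x * flux c w x $ i)" for i
    by (rule C1_on_mult[OF C1M_chart[OF f c] flux_C1[OF c w(1)]])
  have HC1: "C1_on UNIV (H i)" for i
  proof (rule C1_on_local)
    fix x
    show "\<exists>W. open W \<and> x \<in> W \<and> C1_on (W \<inter> UNIV) (H i)"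
    proof (cases "x \<in> K")
      case True
      have "C1_on (crange c) (H i)" by (rule C1_on_cong[THEN iffD2, OF _ loc[of i]]) (simp add: H_def)
      then show ?thesis using True K(2) crange_open[OF c] by (metis inf_top_right subsetD)
    next
      case False
      have "C1_on (- K) (H i)" by (rule C1_on_cong[THEN iffD2, OF _ C1_on_const]) (use H0 in auto)
      then show ?thesis using False K(1) by (metis ComplI compact_imp_closed inf_top_right open_Compl)
    qed
  qed simp
  have Hd: "H i differentiable (at x)" for i x using C1_on_differentiable[OF HC1 open_UNIV] by simp
  have int0: "(\<integral>x. gradient (H i) x $ i \<partial>lborel) = 0" for i
  proof -
    have "(\<integral>x. gradient (H i) x \<bullet> axis i 1 \<partial>lborel) = 0"
    proof (rule integral_directional_derivative_eq_0[OF _ _ K(1) H0])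
      show "(H i has_derivative (\<lambda>v. gradient (H i) x \<bullet> v)) (at x)" for x by (rule has_derivative_gradient[OF Hd])
      show "continuous_on UNIV (\<lambda>x. gradient (H i) x \<bullet> v)" for v
        by (intro continuous_intros continuous_on_gradient[OF HC1]) auto
    qed auto
    then show ?thesis by (simp add: inner_axis)
  qed
  have gH0: "gradient (H i) x = 0" if "x \<notin> K" for i x
  proof -
    have "gradient (H i) x = gradient (\<lambda>x. 0) x"
      by (rule gradient_cong[of "- K"]) (use that K(1) H0 in \<open>auto simp: compact_imp_closed open_Compl\<close>)
    then show ?thesis by (simp add: gradient_const)
  qed
  have inth: "integrable lborel (\<lambda>x. gradient (H i) x $ i)" for i
  proof -
    have "integrable lborel (\<lambda>x. indicator K x *\<^sub>R (gradient (H i) x $ i))"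
      by (intro borel_integrable_compact[OF K(1)] continuous_intros continuous_on_subset[OF continuous_on_gradient[OF HC1]]) auto
    moreover have "(\<lambda>x. indicator K x *\<^sub>R (gradient (H i) x $ i)) = (\<lambda>x. gradient (H i) x $ i)"
      using gH0 by (auto simp: fun_eq_iff indicator_def)
    ultimately show ?thesis by simp
  qed
  have pt: "(\<Sum>i\<in>UNIV. gradient (H i) x $ i) = (if x \<in> crange c then dens c x * (f (cinv c x) * \<omega> (cinv c x) + gamma f w (cinv c x)) else 0)" for x
  proof (cases "x \<in> crange c")
    case False
    then have "x \<notin> K" using K(2) by blast
    then show ?thesis using False by (simp add: gH0)
  next
    case True
    let ?p = "cinv c x"
    have p: "?p \<in> fst c" "snd c ?p = x" using cinv_in[OF c True] chart_cinv[OF c True] by auto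
    have fd: "?F differentiable (at x)" using C1M_differentiable[OF f c p(1)] p(2) by simp
    have Yd: "(\<lambda>x. flux c w x $ i) differentiable (at x)" for i
      using C1_on_differentiable[OF flux_C1[OF c w(1)] crange_open[OF c] True] .
    have "gradient (H i) x = gradient (\<lambda>x. ?F x * flux c w x $ i) x" for i
      by (rule gradient_cong[of "crange c"]) (use True crange_open[OF c] in \<open>auto simp: H_def\<close>)
    then have "(\<Sum>i\<in>UNIV. gradient (H i) x $ i) = (\<Sum>i\<in>UNIV. ?F x * gradient (\<lambda>x. flux c w x $ i) x $ i + flux c w x $ i * gradient ?F x $ i)"
      by (simp add: gradient_mult[OF fd Yd, unfolded o_def] o_def)
    also have "\<dots> = ?F x * (\<Sum>i\<in>UNIV. partial_deriv i (\<lambda>x. flux c w x $ i) x) + gradient ?F x \<bullet> flux c w x"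
      by (simp add: sum.distrib sum_distrib_left partial_deriv_gradient inner_vec_def mult.commute)
    also have "(\<Sum>i\<in>UNIV. partial_deriv i (\<lambda>x. flux c w x $ i) x) = dens c x * \<omega> ?p"
      using has_laplacian_chart[OF w(2) c p(1)] p(2) by simp
    also have "gradient ?F x \<bullet> flux c w x = dens c x * gamma f w ?p"
      using gamma_chart[OF c p(1) f w1] p(2) by (simp add: flux_def chart_gamma_def chart_grad_def)
    finally show ?thesis using True by (simp add: algebra_simps)
  qed
  have "(\<lambda>p. f p * \<omega> p + gamma f w p) \<in> borel_measurable borel"
    by (intro borel_measurable_continuous_onI continuous_intros \<omega> C1M_continuous f gamma_cont w1)
  moreover have "f p * \<omega> p + gamma f w p = 0" if "p \<notin> fst c" for p
  proof -
    have "p \<notin> cinv c ` K" using that K c cinv_in by blast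
    moreover have "closed (cinv c ` K)" by (intro compact_imp_closed cinv_image_compact c K)
    ultimately show ?thesis using gamma_zero_off_support[OF f w1 _ zero] zero by simp
  qed
  ultimately have "(\<integral>p. f p * \<omega> p + gamma f w p \<partial>vol) = (\<integral>x. (\<Sum>i\<in>UNIV. gradient (H i) x $ i) \<partial>lborel)"
    unfolding pt by (rule vol_integral_chart[OF c])
  also have "\<dots> = 0" using inth int0 by simp
  finally show ?thesis .
qed

text \<open>A partition of unity reduces to functions supported in single charts.\<close>
lemma green:
  assumes f: "C1M f" and K: "compact K" and zero: "\<And>p. p \<notin> K \<Longrightarrow> f p = 0"
    and w: "C2M w" "has_laplacian A g w \<omega>" and \<omega>: "continuous_on UNIV \<omega>"
  shows "integrable vol (\<lambda>p. f p * \<omega> p + gamma f w p)" "(\<integral>p. f p * \<omega> p + gamma f w p \<partial>vol) = 0"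
proof -
  have w1: "C1M w" using w by (simp add: C2M_def)
  have good: "\<exists>c x r. c \<in> A \<and> r > 0 \<and> p \<in> fst c \<and> dist x (snd c p) < r \<and> cball x (2 * r) \<subseteq> crange c \<and> True" for p
  proof -
    obtain c r where "c \<in> A" "p \<in> fst c" "r > 0" "cball (snd c p) (2 * r) \<subseteq> crange c" by (rule nbhd_compact[of p])
    then show ?thesis by (intro exI[of _ c] exI[of _ "snd c p"] exI[of _ r]) simp
  qed
  obtain N :: nat and c r x \<zeta> W where pu1:
    "\<forall>i<N. c i \<in> A \<and> r i > 0 \<and> cball (x i) (2 * r i) \<subseteq> crange (c i) \<and> True \<and> C1M (\<zeta> i) \<and>
       (\<forall>q. 0 \<le> \<zeta> i q) \<and> (\<forall>q. q \<notin> cinv (c i) ` cball (x i) (2 * r i) \<longrightarrow> \<zeta> i q = 0)"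
    and pu2: "K \<subseteq> W" "\<forall>q\<in>W. (\<Sum>i<N. \<zeta> i q) = 1"
    using partition_of_unity[OF K, where P="\<lambda>_ _ _. True", OF good] by blast
  have pu: "\<And>i. i < N \<Longrightarrow> c i \<in> A" "\<And>i. i < N \<Longrightarrow> cball (x i) (2 * r i) \<subseteq> crange (c i)" 
    "\<And>i. i < N \<Longrightarrow> C1M (\<zeta> i)" "\<And>i q. i < N \<Longrightarrow> q \<notin> cinv (c i) ` cball (x i) (2 * r i) \<Longrightarrow> \<zeta> i q = 0"
    using pu1 by blast+
  note pu = this pu2(1) pu2(2)[rule_format]
  have sum: "(\<Sum>i<N. \<zeta> i q * f q) = f q" for q
  proof (cases "q \<in> K")
    case True then show ?thesis using pu(5,6) by (simp add: sum_distrib_right[symmetric] subset_eq)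
  qed (simp add: zero)
  have zf: "C1M (\<lambda>q. \<zeta> i q * f q)" if "i < N" for i using pu(3)[OF that] f by (rule C1M_mult)
  have int: "integrable vol (\<lambda>p. f p * \<omega> p + gamma f w p)" if "C1M f" "\<And>p. p \<notin> K \<Longrightarrow> f p = 0" for f
  proof (rule integrable_continuous_compact_support[OF _ K])
    show "continuous_on UNIV (\<lambda>p. f p * \<omega> p + gamma f w p)"
      by (intro continuous_intros \<omega> C1M_continuous that(1) gamma_cont w1)
    show "f p * \<omega> p + gamma f w p = 0" if "p \<notin> K" for p
      using gamma_zero_off_support[OF _ w1 compact_imp_closed[OF K]] \<open>C1M f\<close> \<open>\<And>p. p \<notin> K \<Longrightarrow> f p = 0\<close> that by simp
  qed
  show "integrable vol (\<lambda>p. f p * \<omega> p + gamma f w p)" by (rule int[OF f zero])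
  have "f p * \<omega> p + gamma f w p = (\<Sum>i<N. (\<zeta> i p * f p) * \<omega> p + gamma (\<lambda>q. \<zeta> i q * f q) w p)" for p
  proof -
    have "gamma (\<lambda>q. \<Sum>i<N. \<zeta> i q * f q) w p = (\<Sum>i<N. gamma (\<lambda>q. \<zeta> i q * f q) w p)"
      by (rule gamma_sum_left) (use zf w1 in auto)
    then have 1: "gamma f w p = (\<Sum>i<N. gamma (\<lambda>q. \<zeta> i q * f q) w p)" unfolding sum .
    have 2: "f p * \<omega> p = (\<Sum>i<N. (\<zeta> i p * f p) * \<omega> p)" using sum[of p] by (metis sum_distrib_right)
    show ?thesis unfolding sum.distrib using 1 2 by linarith
  qed
  then have "(\<integral>p. f p * \<omega> p + gamma f w p \<partial>vol) = (\<integral>p. (\<Sum>i<N. (\<zeta> i p * f p) * \<omega> p + gamma (\<lambda>q. \<zeta> i q * f q) w p) \<partial>vol)"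
    by simp
  also have "\<dots> = (\<Sum>i<N. \<integral>p. (\<zeta> i p * f p) * \<omega> p + gamma (\<lambda>q. \<zeta> i q * f q) w p \<partial>vol)"
    by (intro Bochner_Integration.integral_sum int zf) (auto simp: zero)
  also have "\<dots> = 0"
    by (intro sum.neutral ballI green_in_chart[OF pu(1) compact_cball pu(2) zf _ w \<omega>]) (auto simp: pu(4))
  finally show "(\<integral>p. f p * \<omega> p + gamma f w p \<partial>vol) = 0" .
qed

end

section \<open>Lengths of curves\<close>

context riemannian_manifold begin

lemma cinv_image_subset: "c \<in> A \<Longrightarrow> K \<subseteq> crange c \<Longrightarrow> cinv c ` K \<subseteq> fst c"
  by (rule image_subsetI, rule cinv_in) auto

abbreviation met_norm :: "('a, 'n) chart \<Rightarrow> 'a \<Rightarrow> real ^ 'n \<Rightarrow> real" where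
  "met_norm c p v \<equiv> sqrt (v \<bullet> (g c p *v v))"

lemma met_norm_scale: "met_norm c p (a *\<^sub>R v) = \<bar>a\<bar> * met_norm c p v"
proof -
  have "(a *\<^sub>R v) \<bullet> (g c p *v (a *\<^sub>R v)) = a\<^sup>2 * (v \<bullet> (g c p *v v))"
    by (simp add: matrix_vector_mult_scaleR power2_eq_square)
  then show ?thesis by (simp add: real_sqrt_mult)
qed

definition speed_on :: "real set \<Rightarrow> (real \<Rightarrow> 'a) \<Rightarrow> (real \<Rightarrow> real) \<Rightarrow> bool" where
  "speed_on X \<gamma> s \<longleftrightarrow> (\<forall>c\<in>A. (snd c \<circ> \<gamma>) C1_differentiable_on {t \<in> X. \<gamma> t \<in> fst c} \<and>
     (\<forall>t\<in>X. \<gamma> t \<in> fst c \<longrightarrow> s t = met_norm c (\<gamma> t) (vector_derivative (snd c \<circ> \<gamma>) (at t))))"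

text \<open>Lengths over arbitrary parameter intervals, so that curves can be cut and glued.\<close>
definition len_on :: "real \<Rightarrow> real \<Rightarrow> (real \<Rightarrow> 'a) \<Rightarrow> real \<Rightarrow> bool" where
  "len_on a b \<gamma> L \<longleftrightarrow> continuous_on {a..b} \<gamma> \<and> (\<exists>T s. finite T \<and> speed_on ({a..b} - T) \<gamma> s \<and> (s has_integral L) {a..b})"

lemma has_length_len_on: "has_length A g \<gamma> L \<longleftrightarrow> len_on 0 1 \<gamma> L"
proof -
  have "{t \<in> {0..1} - T. \<gamma> t \<in> U} = {t. t \<in> {0..1} - T \<and> \<gamma> t \<in> U}" for T and U :: "'a set" by auto
  then show ?thesis unfolding has_length_def len_on_def speed_on_def
    by (simp add: case_prod_unfold Let_def)
qed

lemma speed_onI: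
  assumes "\<And>c t. c \<in> A \<Longrightarrow> t \<in> X \<Longrightarrow> \<gamma> t \<in> fst c \<Longrightarrow> ((snd c \<circ> \<gamma>) has_vector_derivative D c t) (at t) \<and> s t = met_norm c (\<gamma> t) (D c t)"
    and "\<And>c. c \<in> A \<Longrightarrow> continuous_on {t \<in> X. \<gamma> t \<in> fst c} (D c)"
  shows "speed_on X \<gamma> s"
  unfolding speed_on_def
proof (intro ballI conjI impI)
  fix c assume c: "c \<in> A"
  show "(snd c \<circ> \<gamma>) C1_differentiable_on {t \<in> X. \<gamma> t \<in> fst c}"
    unfolding C1_differentiable_on_def using assms c by (intro exI[of _ "D c"]) auto
  show "s t = met_norm c (\<gamma> t) (vector_derivative (snd c \<circ> \<gamma>) (at t))" if "t \<in> X" "\<gamma> t \<in> fst c" for t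
    using assms(1)[OF c that] vector_derivative_at by metis
qed

lemma speed_on_has_derivative:
  assumes "speed_on X \<gamma> s" "c \<in> A" "t \<in> X" "\<gamma> t \<in> fst c"
  shows "((snd c \<circ> \<gamma>) has_vector_derivative vector_derivative (snd c \<circ> \<gamma>) (at t)) (at t)"
  using assms unfolding speed_on_def C1_differentiable_on_eq vector_derivative_works[symmetric] by blast

lemma speed_on_eq:
  "speed_on X \<gamma> s \<Longrightarrow> c \<in> A \<Longrightarrow> t \<in> X \<Longrightarrow> \<gamma> t \<in> fst c \<Longrightarrow> s t = met_norm c (\<gamma> t) (vector_derivative (snd c \<circ> \<gamma>) (at t))"
  unfolding speed_on_def by blast

lemma speed_nonneg: assumes "speed_on X \<gamma> s" "t \<in> X" shows "s t \<ge> 0"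
proof -
  obtain c where c: "c \<in> A" "\<gamma> t \<in> fst c" using ex_chart by blast
  then show ?thesis using assms metric_nonneg[OF c] by (auto simp: speed_on_def)
qed

lemma speed_on_subset: 
  assumes "speed_on X \<gamma> s" "Y \<subseteq> X" shows "speed_on Y \<gamma> s"
  unfolding speed_on_def
proof (intro ballI conjI impI)
  fix c assume c: "c \<in> A"
  have "(snd c \<circ> \<gamma>) C1_differentiable_on {t \<in> X. \<gamma> t \<in> fst c}" using assms c by (simp add: speed_on_def)
  then show "(snd c \<circ> \<gamma>) C1_differentiable_on {t \<in> Y. \<gamma> t \<in> fst c}"
    by (rule C1_differentiable_on_subset) (use assms in auto)
qed (use assms in \<open>auto simp: speed_on_def\<close>)

text \<open>Velocity is local, so a curve may be changed outside an open set of parameters.\<close>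
lemma speed_on_cong:
  assumes s: "speed_on X \<gamma> s" and "open X" "\<And>t. t \<in> X \<Longrightarrow> \<gamma> t = \<gamma>' t" "\<And>t. t \<in> X \<Longrightarrow> s t = s' t"
  shows "speed_on X \<gamma>' s'"
proof (rule speed_onI[where D="\<lambda>c t. vector_derivative (snd c \<circ> \<gamma>) (at t)"])
  fix c t assume c: "c \<in> A" and t: "t \<in> X" "\<gamma>' t \<in> fst c"
  let ?D = "\<lambda>t. vector_derivative (snd c \<circ> \<gamma>) (at t)"
  note D = speed_on_has_derivative[OF s c] speed_on_eq[OF s c]
  have t': "\<gamma> t \<in> fst c" using t assms(3) by simp
  have "((snd c \<circ> \<gamma>') has_vector_derivative ?D t) (at t)"
    by (rule has_vector_derivative_transform_within_open[OF D(1)[OF t(1) t'] assms(2) t(1)]) (simp add: assms(3))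
  then show "((snd c \<circ> \<gamma>') has_vector_derivative ?D t) (at t) \<and> s' t = met_norm c (\<gamma>' t) (?D t)"
    using D(2)[OF t(1) t'] assms(3,4)[OF t(1)] by simp
next
  fix c assume c: "c \<in> A"
  have "{t \<in> X. \<gamma>' t \<in> fst c} = {t \<in> X. \<gamma> t \<in> fst c}" using assms(3) by auto
  then show "continuous_on {t \<in> X. \<gamma>' t \<in> fst c} (\<lambda>t. vector_derivative (snd c \<circ> \<gamma>) (at t))"
    using s c unfolding speed_on_def C1_differentiable_on_eq by simp
qed

lemma speed_on_Un:
  assumes "speed_on X \<gamma> s" "speed_on Y \<gamma> s" "open X" "open Y" shows "speed_on (X \<union> Y) \<gamma> s"
  unfolding speed_on_def
proof (intro ballI conjI impI)
  fix c assume c: "c \<in> A"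
  let ?S = "{t \<in> X. \<gamma> t \<in> fst c}" and ?S' = "{t \<in> Y. \<gamma> t \<in> fst c}"
  have eq: "{t \<in> X \<union> Y. \<gamma> t \<in> fst c} = ?S \<union> ?S'" by auto
  have "?S = (?S \<union> ?S') \<inter> X" "?S' = (?S \<union> ?S') \<inter> Y" by auto
  then have "openin (top_of_set (?S \<union> ?S')) ?S" "openin (top_of_set (?S \<union> ?S')) ?S'"
    unfolding openin_open using assms(3,4) by blast+
  then show "(snd c \<circ> \<gamma>) C1_differentiable_on {t \<in> X \<union> Y. \<gamma> t \<in> fst c}"
    using assms(1,2) c unfolding eq speed_on_def C1_differentiable_on_eq by (auto intro!: continuous_on_Un_local_open)
qed (use assms in \<open>auto simp: speed_on_def\<close>)

lemma open_interval_Diff: "finite T \<Longrightarrow> open ({a<..<b::real} - T)"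
  by (intro open_Diff finite_imp_closed) auto

lemma len_on_open:
  assumes "len_on a b \<gamma> L"
  obtains T s where "finite T" "speed_on ({a<..<b} - T) \<gamma> s" "(s has_integral L) {a..b}" "continuous_on {a..b} \<gamma>"
proof -
  obtain T s where T: "finite T" "speed_on ({a..b} - T) \<gamma> s" "(s has_integral L) {a..b}" using assms unfolding len_on_def by blast
  have "speed_on ({a<..<b} - T) \<gamma> s" by (rule speed_on_subset[OF T(2)]) auto
  then show thesis using that T assms by (simp add: len_on_def)
qed

lemma len_onI:
  assumes "finite T" "speed_on ({a<..<b} - T) \<gamma> s" "(s has_integral L) {a..b}" "continuous_on {a..b} \<gamma>"
  shows "len_on a b \<gamma> L"
proof -
  have "{a..b} - (T \<union> {a, b}) = {a<..<b} - T \<or> {a..b} - (T \<union> {a, b}) \<subseteq> {a<..<b} - T" by auto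
  then have "speed_on ({a..b} - (T \<union> {a, b})) \<gamma> s" using assms(2) speed_on_subset by metis
  then show ?thesis unfolding len_on_def using assms by (intro conjI exI[of _ "T \<union> {a, b}"] exI[of _ s]) auto
qed

lemma len_on_nonneg: assumes "len_on a b \<gamma> L" shows "L \<ge> 0"
proof -
  obtain T s where T: "finite T" "speed_on ({a<..<b} - T) \<gamma> s" "(s has_integral L) {a..b}" by (rule len_on_open[OF assms])
  have "((\<lambda>t. if t \<in> {a<..<b} - T then s t else 0) has_integral L) {a..b}"
    by (rule has_integral_spike_finite[OF _ _ T(3), of "T \<union> {a, b}"]) (use T in auto)
  then show ?thesis by (rule has_integral_nonneg) (use speed_nonneg[OF T(2)] in auto)
qed

lemma len_on_cong:
  assumes "len_on a b \<gamma> L" "\<And>t. t \<in> {a..b} \<Longrightarrow> \<gamma> t = \<gamma>' t" shows "len_on a b \<gamma>' L"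
proof -
  obtain T s where T: "finite T" "speed_on ({a<..<b} - T) \<gamma> s" "(s has_integral L) {a..b}" "continuous_on {a..b} \<gamma>" by (rule len_on_open[OF assms(1)])
  show ?thesis
  proof (rule len_onI[OF T(1) _ T(3)])
    show "speed_on ({a<..<b} - T) \<gamma>' s" by (rule speed_on_cong[OF T(2) open_interval_Diff[OF T(1)]]) (use assms(2) in auto)
    show "continuous_on {a..b} \<gamma>'" using T(4) assms(2) by (rule continuous_on_eq)
  qed
qed

lemma len_on_glue:
  assumes "len_on a b \<gamma> L" "len_on b c \<gamma> L'" "a \<le> b" "b \<le> c" shows "len_on a c \<gamma> (L + L')"
proof -
  obtain T s where T: "finite T" "speed_on ({a<..<b} - T) \<gamma> s" "(s has_integral L) {a..b}" "continuous_on {a..b} \<gamma>" by (rule len_on_open[OF assms(1)])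
  obtain T' s' where T': "finite T'" "speed_on ({b<..<c} - T') \<gamma> s'" "(s' has_integral L') {b..c}" "continuous_on {b..c} \<gamma>" by (rule len_on_open[OF assms(2)])
  define s'' where "s'' t = (if t < b then s t else s' t)" for t
  show ?thesis
  proof (rule len_onI[of "T \<union> T' \<union> {b}"])
    have "speed_on ({a<..<b} - T) \<gamma> s''" by (rule speed_on_cong[OF T(2) open_interval_Diff[OF T(1)]]) (auto simp: s''_def)
    moreover have "speed_on ({b<..<c} - T') \<gamma> s''" by (rule speed_on_cong[OF T'(2) open_interval_Diff[OF T'(1)]]) (auto simp: s''_def)
    ultimately have "speed_on (({a<..<b} - T) \<union> ({b<..<c} - T')) \<gamma> s''"
      by (intro speed_on_Un open_interval_Diff T(1) T'(1))
    then show "speed_on ({a<..<c} - (T \<union> T' \<union> {b})) \<gamma> s''" by (rule speed_on_subset) auto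
    have "(s'' has_integral L) {a..b}" by (rule has_integral_spike_finite[OF _ _ T(3), of "{b}"]) (auto simp: s''_def)
    moreover have "(s'' has_integral L') {b..c}" by (rule has_integral_spike_finite[OF _ _ T'(3), of "{b}"]) (auto simp: s''_def)
    ultimately show "(s'' has_integral L + L') {a..c}" using has_integral_combine assms(3,4) by blast
    have "{a..c} = {a..b} \<union> {b..c}" using assms by auto
    then show "continuous_on {a..c} \<gamma>" using continuous_on_closed_Un[of "{a..b}" "{b..c}"] T(4) T'(4) by simp
  qed (use T T' in auto)
qed

lemma len_on_restrict:
  assumes "len_on a b \<gamma> L" "a \<le> b"
  obtains l where "continuous_on {a..b} l" "l a = 0" "l b = L" "\<forall>u v. a \<le> u \<longrightarrow> u \<le> v \<longrightarrow> v \<le> b \<longrightarrow> len_on u v \<gamma> (l v - l u)"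
proof -
  obtain T s where T: "finite T" "speed_on ({a<..<b} - T) \<gamma> s" "(s has_integral L) {a..b}" "continuous_on {a..b} \<gamma>" by (rule len_on_open[OF assms(1)])
  have si: "s integrable_on {a..b}" using T(3) by (rule has_integral_integrable)
  define l where "l t = integral {a..t} s" for t
  show thesis
  proof (rule that[of l]; (intro allI impI)?)
    show "continuous_on {a..b} l" unfolding l_def by (rule indefinite_integral_continuous_1[OF si])
    show "l a = 0" by (simp add: l_def)
    show "l b = L" using T(3) by (simp add: l_def integral_unique)
    fix u v assume uv: "a \<le> u" "u \<le> v" "v \<le> b"
    have "l u + integral {u..v} s = l v" unfolding l_def
      by (rule Henstock_Kurzweil_Integration.integral_combine) (use uv in \<open>auto intro: integrable_subinterval_real[OF si]\<close>)
    moreover have "(s has_integral integral {u..v} s) {u..v}" using uv by (intro integrable_integral integrable_subinterval_real[OF si]) auto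
    ultimately have hi: "(s has_integral l v - l u) {u..v}" by (metis add_diff_cancel_left')
    show "len_on u v \<gamma> (l v - l u)"
      by (rule len_onI[OF T(1) speed_on_subset[OF T(2)] hi]) (use uv in \<open>auto intro: continuous_on_subset[OF T(4)]\<close>)
  qed
qed

lemma len_on_affine:
  assumes "len_on a b \<gamma> L" "k \<noteq> 0" "(\<lambda>t. k * t + e) ` {a'..b'} = {a..b}" "(\<lambda>t. k * t + e) ` {a'<..<b'} \<subseteq> {a<..<b}" 
  shows "len_on a' b' (\<lambda>t. \<gamma> (k * t + e)) L"
proof -
  obtain T s where T: "finite T" "speed_on ({a<..<b} - T) \<gamma> s" "(s has_integral L) {a..b}" "continuous_on {a..b} \<gamma>" by (rule len_on_open[OF assms(1)])
  let ?h = "\<lambda>t. k * t + e" and ?T = "(\<lambda>t. k * t + e) -` T"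
  have fin: "finite ?T" using T(1) assms(2) by (intro finite_vimageI) (auto simp: inj_def)
  have hX: "?h t \<in> {a<..<b} - T" if "t \<in> {a'<..<b'} - ?T" for t
  proof -
    have "t \<in> {a'<..<b'}" using that by auto
    then have "?h t \<in> {a<..<b}" using assms(4) by blast
    then show ?thesis using that by auto
  qed
  show ?thesis
  proof (rule len_onI[OF fin, where s="\<lambda>t. \<bar>k\<bar> * s (k * t + e)"])
    show "speed_on ({a'<..<b'} - ?T) (\<lambda>t. \<gamma> (?h t)) (\<lambda>t. \<bar>k\<bar> * s (?h t))"
    proof (rule speed_onI[where D="\<lambda>c t. k *\<^sub>R vector_derivative (snd c \<circ> \<gamma>) (at (?h t))"])
      fix c t assume c: "c \<in> A" and t: "t \<in> {a'<..<b'} - ?T" "\<gamma> (?h t) \<in> fst c"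
      note D = speed_on_has_derivative[OF T(2) c] speed_on_eq[OF T(2) c]
      let ?D = "\<lambda>t. vector_derivative (snd c \<circ> \<gamma>) (at t)"
      have 1: "((snd c \<circ> \<gamma>) has_vector_derivative ?D (?h t)) (at (?h t))" by (rule D(1)[OF hX[OF t(1)] t(2)])
      have "(?h has_vector_derivative k) (at t)"
        by (auto intro!: derivative_eq_intros simp: has_real_derivative_iff_has_vector_derivative[symmetric])
      from vector_diff_chain_at[OF this 1]
      have "((snd c \<circ> (\<lambda>t. \<gamma> (?h t))) has_vector_derivative k *\<^sub>R ?D (?h t)) (at t)" by (simp add: o_def)
      then show "((snd c \<circ> (\<lambda>t. \<gamma> (?h t))) has_vector_derivative k *\<^sub>R ?D (?h t)) (at t) \<and>
         \<bar>k\<bar> * s (?h t) = met_norm c (\<gamma> (?h t)) (k *\<^sub>R ?D (?h t))"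
        using D(2)[OF hX[OF t(1)] t(2)] met_norm_scale by simp
    next
      fix c assume c: "c \<in> A"
      have 1: "continuous_on {t \<in> {a<..<b} - T. \<gamma> t \<in> fst c} (\<lambda>t. vector_derivative (snd c \<circ> \<gamma>) (at t))"
        using T(2) c unfolding speed_on_def C1_differentiable_on_eq by blast
      show "continuous_on {t \<in> {a'<..<b'} - ?T. \<gamma> (?h t) \<in> fst c} (\<lambda>t. k *\<^sub>R vector_derivative (snd c \<circ> \<gamma>) (at (?h t)))"
        by (intro continuous_intros continuous_on_compose2[OF 1, where f="?h"]) (use hX in auto)
    qed
    have "((\<lambda>t. s (k *\<^sub>R t + e)) has_integral (1 / \<bar>k\<bar> ^ DIM(real)) *\<^sub>R L) ((\<lambda>t. (1 / k) *\<^sub>R t + - ((1 / k) *\<^sub>R e)) ` cbox a b)"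
      by (rule has_integral_affinity) (use T assms in auto)
    moreover have "(\<lambda>t. (1 / k) *\<^sub>R t + - ((1 / k) *\<^sub>R e)) ` cbox a b = {a'..b'}"
      unfolding cbox_interval assms(3)[symmetric] image_image using assms(2)
      by (rule_tac trans[OF image_cong[OF refl] image_ident]) (auto simp: field_simps)
    ultimately have "((\<lambda>t. s (?h t)) has_integral L / \<bar>k\<bar>) {a'..b'}" by (simp add: divide_inverse mult.commute)
    from has_integral_mult_right[OF this, of "\<bar>k\<bar>"] show "((\<lambda>t. \<bar>k\<bar> * s (?h t)) has_integral L) {a'..b'}" using assms(2) by simp
    show "continuous_on {a'..b'} (\<lambda>t. \<gamma> (?h t))"
      by (rule continuous_on_compose2[OF T(4)]) (use assms(3) in \<open>auto intro!: continuous_intros\<close>)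
  qed
qed

lemma len_segment:
  assumes c: "c \<in> A" and X: "convex X" "X \<subseteq> crange c" "x \<in> X" "y \<in> X"
    and N: "\<And>z. z \<in> X \<Longrightarrow> met_norm c (cinv c z) (y - x) \<le> N"
  obtains L where "len_on 0 1 (\<lambda>t. cinv c (x + t *\<^sub>R (y - x))) L" "L \<le> N"
proof -
  let ?l = "\<lambda>t. x + t *\<^sub>R (y - x)"
  let ?\<gamma> = "\<lambda>t. cinv c (?l t)"
  have lX: "?l t \<in> X" if "t \<in> {0..1}" for t
  proof -
    have "?l t = (1 - t) *\<^sub>R x + t *\<^sub>R y" by (simp add: algebra_simps)
    then show ?thesis using X(1,3,4) that by (simp add: convexD_alt)
  qed
  have lc: "?l t \<in> crange c" if "t \<in> {0..1}" for t using lX[OF that] X(2) by blast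
  have contl: "continuous_on S ?l" for S by (intro continuous_intros)
  have cont: "continuous_on {0..1} ?\<gamma>" by (rule continuous_on_compose2[OF cinv_cont[OF c] contl]) (use lc in auto)
  define s where "s t = met_norm c (?\<gamma> t) (y - x)" for t
  have "continuous_on {0..1} (\<lambda>t. g c (?\<gamma> t))"
    by (rule continuous_on_compose2[OF metric_cont[OF c] cont]) (use lc cinv_in[OF c] in auto)
  then have sc: "continuous_on {0..1} s" unfolding s_def matrix_vector_mult_def inner_vec_def by (intro continuous_intros)
  have "speed_on ({0<..<1} - {}) ?\<gamma> s"
  proof (rule speed_onI[where D="\<lambda>c' t. jac c c' (?\<gamma> t) *v (y - x)"])
    fix c' t assume c': "c' \<in> A" and t: "t \<in> {0<..<1::real} - {}" "?\<gamma> t \<in> fst c'"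
    have t01: "t \<in> {0..1}" using t by auto
    have p: "?\<gamma> t \<in> fst c" "snd c (?\<gamma> t) = ?l t" using cinv_in[OF c lc[OF t01]] chart_cinv[OF c lc[OF t01]] by auto
    have td: "(transition c c' has_derivative (\<lambda>v. jac c c' (?\<gamma> t) *v v)) (at (?l t))"
      using transition_derivative[OF c c' p(1) t(2)] p(2) by simp
    have "(?l has_derivative (\<lambda>r. r *\<^sub>R (y - x))) (at t)" by (auto intro!: derivative_eq_intros)
    from has_derivative_compose[OF this td]
    have "((\<lambda>t. transition c c' (?l t)) has_derivative (\<lambda>r. jac c c' (?\<gamma> t) *v (r *\<^sub>R (y - x)))) (at t)" .
    then have "((\<lambda>t. transition c c' (?l t)) has_vector_derivative jac c c' (?\<gamma> t) *v (y - x)) (at t)"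
      by (simp add: has_vector_derivative_def matrix_vector_mult_scaleR)
    moreover have "(\<lambda>t. transition c c' (?l t)) = snd c' \<circ> ?\<gamma>" by (simp add: transition_def o_def)
    moreover have "s t = met_norm c' (?\<gamma> t) (jac c c' (?\<gamma> t) *v (y - x))"
      using metric_norm_jac[OF c c' p(1) t(2)] by (simp add: s_def)
    ultimately show "((snd c' \<circ> ?\<gamma>) has_vector_derivative jac c c' (?\<gamma> t) *v (y - x)) (at t) \<and> s t = met_norm c' (?\<gamma> t) (jac c c' (?\<gamma> t) *v (y - x))"
      by metis
  next
    fix c' assume c': "c' \<in> A"
    obtain f' where f': "\<And>z. z \<in> snd c ` (fst c \<inter> fst c') \<Longrightarrow> (transition c c' has_derivative f' z) (at z within snd c ` (fst c \<inter> fst c'))"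
      "\<And>v. continuous_on (snd c ` (fst c \<inter> fst c')) (\<lambda>z. f' z v)" using transition_C1[OF c c'] unfolding C1_on_def by blast
    let ?S = "{t \<in> {0<..<1} - {}. ?\<gamma> t \<in> fst c'}"
    have in_ov: "?l t \<in> snd c ` (fst c \<inter> fst c')" if "t \<in> ?S" for t
    proof -
      have "t \<in> {0..1}" using that by auto
      then show ?thesis using that cinv_in[OF c lc] chart_cinv[OF c lc] by (intro image_eqI[of _ _ "?\<gamma> t"]) auto
    qed
    have "continuous_on ?S (\<lambda>t. f' (?l t) (y - x))"
      by (rule continuous_on_compose2[OF f'(2) contl]) (use in_ov in blast)
    moreover have "f' (?l t) (y - x) = jac c c' (?\<gamma> t) *v (y - x)" if t: "t \<in> ?S" for t
    proof -
      have t01: "t \<in> {0..1}" using t by auto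
      have p: "?\<gamma> t \<in> fst c" "snd c (?\<gamma> t) = ?l t" using cinv_in[OF c lc[OF t01]] chart_cinv[OF c lc[OF t01]] by auto
      have tc: "?\<gamma> t \<in> fst c'" using t by simp
      have "(transition c c' has_derivative f' (?l t)) (at (?l t))"
        using f'(1)[OF in_ov[OF t]] unfolding at_within_open[OF in_ov[OF t] overlap_open[OF c c']] .
      moreover have "(transition c c' has_derivative (\<lambda>v. jac c c' (?\<gamma> t) *v v)) (at (?l t))"
        using transition_derivative[OF c c' p(1) tc] p(2) by simp
      ultimately have "f' (?l t) = (\<lambda>v. jac c c' (?\<gamma> t) *v v)" by (rule has_derivative_unique)
      then show ?thesis by simp
    qed
    ultimately show "continuous_on ?S (\<lambda>t. jac c c' (?\<gamma> t) *v (y - x))" by (rule continuous_on_eq)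
  qed
  moreover have si: "(s has_integral integral {0..1} s) {0..1}" using sc by (intro integrable_integral integrable_continuous_real)
  ultimately have "len_on 0 1 ?\<gamma> (integral {0..1} s)" using cont by (intro len_onI[of "{}"]) auto
  moreover have "integral {0..1} s \<le> N"
  proof -
    have "integral {0..1} s \<le> integral {0..1} (\<lambda>t::real. N)"
    proof (rule integral_le)
      show "s integrable_on {0..1}" by (rule integrable_continuous_real[OF sc])
      show "(\<lambda>t. N) integrable_on {0..1::real}" by (rule integrable_continuous_real) simp
      show "s t \<le> N" if "t \<in> {0..1}" for t unfolding s_def by (rule N[OF lX[OF that]])
    qed
    then show ?thesis by simp
  qed
  ultimately show thesis using that by blast
qed

text \<open>The Euclidean displacement in the chart is at most the integral of the Euclidean speed, and the
  latter is at most the Riemannian speed divided by \<open>m\<close>.\<close>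
lemma chart_displacement_le_length:
  assumes c: "c \<in> A" and C: "C \<subseteq> crange c" and m: "m > 0" "\<And>z v. z \<in> C \<Longrightarrow> m * norm v \<le> met_norm c (cinv c z) v"
    and l: "len_on a b \<gamma> L" and im: "\<gamma> ` {a..b} \<subseteq> cinv c ` C" and ab: "a \<le> b"
  shows "m * norm (snd c (\<gamma> b) - snd c (\<gamma> a)) \<le> L"
proof -
  obtain T s where T: "finite T" "speed_on ({a<..<b} - T) \<gamma> s" "(s has_integral L) {a..b}" "continuous_on {a..b} \<gamma>" by (rule len_on_open[OF l])
  define D where "D t = vector_derivative (snd c \<circ> \<gamma>) (at t)" for t
  note D = speed_on_has_derivative[OF T(2) c, folded D_def] speed_on_eq[OF T(2) c, folded D_def]
  have ic: "\<gamma> t \<in> fst c" if t: "t \<in> {a..b}" for t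
  proof -
    obtain z where "z \<in> C" "\<gamma> t = cinv c z" using im t by blast
    then show ?thesis using cinv_in[OF c subsetD[OF C]] by simp
  qed
  have D0: "(D has_integral (snd c \<circ> \<gamma>) b - (snd c \<circ> \<gamma>) a) {a..b}"
  proof (rule fundamental_theorem_of_calculus_interior_strong[OF T(1) ab])
    show "((snd c \<circ> \<gamma>) has_vector_derivative D t) (at t)" if "t \<in> {a<..<b} - T" for t using D(1)[OF that] ic that by auto
    show "continuous_on {a..b} (snd c \<circ> \<gamma>)"
      unfolding o_def by (rule continuous_on_compose2[OF chart_cont[OF c] T(4)]) (use ic in auto)
  qed
  have D': "((\<lambda>t. if t \<in> {a<..<b} - T then D t else 0) has_integral snd c (\<gamma> b) - snd c (\<gamma> a)) {a..b}"
    by (rule has_integral_spike_finite[OF _ _ D0[unfolded o_apply], of "T \<union> {a, b}"]) (use T in auto)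
  have s': "((\<lambda>t. if t \<in> {a<..<b} - T then s t / m else 0) has_integral L / m) {a..b}"
    by (rule has_integral_spike_finite[OF _ _ has_integral_divide[OF T(3)], of "T \<union> {a, b}"]) (use T in auto)
  have "norm (integral {a..b} (\<lambda>t. if t \<in> {a<..<b} - T then D t else 0)) \<le> integral {a..b} (\<lambda>t. if t \<in> {a<..<b} - T then s t / m else 0)"
  proof (rule integral_norm_bound_integral)
    fix t assume t: "t \<in> {a..b}"
    show "norm (if t \<in> {a<..<b} - T then D t else 0) \<le> (if t \<in> {a<..<b} - T then s t / m else 0)"
    proof (cases "t \<in> {a<..<b} - T")
      case True
      obtain z where z: "z \<in> C" "\<gamma> t = cinv c z" using im t by blast
      have "m * norm (D t) \<le> s t" using m(2)[OF z(1), of "D t"] D(2)[OF True ic[OF t]] z(2) by simp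
      then show ?thesis using True m(1) by (simp add: field_simps)
    next
      case False
      then show ?thesis by (simp only: if_False norm_zero order_refl)
    qed
  qed (use D' s' has_integral_integrable in blast)+
  then have "norm (snd c (\<gamma> b) - snd c (\<gamma> a)) \<le> L / m" unfolding integral_unique[OF D'] integral_unique[OF s'] .
  then show ?thesis using m(1) by (simp add: field_simps)
qed

text \<open>Up to the first exit from the chart ball the displacement is bounded by the length, so a short
  curve never exits.\<close>
lemma short_curve_stays_in_ball:
  assumes c: "c \<in> A" and C: "cball x r \<subseteq> crange c" and r: "r > 0" and m: "m > 0" "\<And>z v. z \<in> cball x r \<Longrightarrow> m * norm v \<le> met_norm c (cinv c z) v"
    and l: "len_on 0 1 \<gamma> L" and start: "\<gamma> 0 = cinv c x" and L: "L < m * r"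
  shows "\<gamma> 1 \<in> cinv c ` ball x r" "m * norm (snd c (\<gamma> 1) - x) \<le> L"
proof -
  let ?V = "cinv c ` ball x r"
  have b: "ball x r \<subseteq> crange c" using C by auto
  have Vsub: "?V \<subseteq> cinv c ` cball x r" by (rule image_mono) auto
  have V: "open ?V" by (rule cinv_image_open[OF c open_ball b])
  have "x \<in> crange c" using C r by (auto simp: subset_eq)
  then have x0: "snd c (\<gamma> 0) = x" using start chart_cinv[OF c] by simp
  have cont: "continuous_on {0..1} \<gamma>" using l by (simp add: len_on_def)
  have closedC: "closed (cinv c ` cball x r)" by (intro compact_imp_closed cinv_image_compact c C compact_cball)
  obtain f where f: "continuous_on {0..1} f" "f 0 = 0" "f 1 = L" "\<forall>u v. 0 \<le> u \<longrightarrow> u \<le> v \<longrightarrow> v \<le> 1 \<longrightarrow> len_on u v \<gamma> (f v - f u)"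
    by (rule len_on_restrict[OF l zero_le_one])
  note f = f(1-3) f(4)[rule_format]
  have disp: "m * norm (snd c (\<gamma> \<tau>) - x) \<le> f \<tau>" "f \<tau> \<le> L" if "\<gamma> ` {0..\<tau>} \<subseteq> cinv c ` cball x r" "\<tau> \<in> {0..1}" for \<tau>
  proof -
    show "m * norm (snd c (\<gamma> \<tau>) - x) \<le> f \<tau>"
      using chart_displacement_le_length[OF c C m f(4)[of 0 \<tau>] that(1)] that(2) f(2) x0 by simp
    show "f \<tau> \<le> L" using len_on_nonneg[OF f(4)[of \<tau> 1]] that(2) f(3) by simp
  qed
  have all: "\<gamma> t \<in> ?V" if t: "t \<in> {0..1}" for t
  proof (rule ccontr)
    assume "\<gamma> t \<notin> ?V"
    let ?B = "{0..1} \<inter> \<gamma> -` (- ?V)"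
    have "closed ?B" by (rule continuous_closed_preimage[OF cont]) (use V in auto)
    then have "compact (?B \<inter> {0..1})" by (rule closed_Int_compact) simp
    moreover have "?B \<inter> {0..1} = ?B" by auto
    ultimately have "compact ?B" by metis
    moreover have "?B \<noteq> {}" using \<open>\<gamma> t \<notin> ?V\<close> t by blast
    ultimately obtain \<tau> where \<tau>: "\<tau> \<in> ?B" "\<And>u. u \<in> ?B \<Longrightarrow> \<tau> \<le> u" using compact_attains_inf by metis
    have before: "\<gamma> u \<in> ?V" if "u \<in> {0..<\<tau>}" for u using \<tau>(2)[of u] \<tau>(1) that by auto
    have "\<gamma> 0 \<in> ?V" using start r by auto
    then have "0 < \<tau>" using \<tau>(1) by (cases "\<tau> = 0") auto
    have cl: "closure {0..<\<tau>} = {0..\<tau>}" using \<open>0 < \<tau>\<close> by simp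
    have "continuous_on (closure {0..<\<tau>}) \<gamma>" unfolding cl by (rule continuous_on_subset[OF cont]) (use \<tau>(1) in auto)
    from image_closure_subset[OF this closedC]
    have im: "\<gamma> ` {0..\<tau>} \<subseteq> cinv c ` cball x r" unfolding cl using before Vsub by blast
    from disp[OF im] have "m * norm (snd c (\<gamma> \<tau>) - x) < m * r" using \<tau>(1) L by auto
    then have nb: "snd c (\<gamma> \<tau>) \<in> ball x r" using m(1) by (simp add: dist_norm norm_minus_commute)
    have "\<gamma> \<tau> \<in> cinv c ` cball x r" using im \<open>0 < \<tau>\<close> by auto
    then have "\<gamma> \<tau> \<in> fst c" using cinv_image_subset[OF c C] by (rule subsetD[rotated])
    then have "cinv c (snd c (\<gamma> \<tau>)) = \<gamma> \<tau>" by (rule cinv_chart[OF c])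
    then have "\<gamma> \<tau> \<in> ?V" using imageI[OF nb, of "cinv c"] by simp
    then show False using \<tau>(1) by blast
  qed
  then show "\<gamma> 1 \<in> ?V" by auto
  have "\<gamma> ` {0..1} \<subseteq> cinv c ` cball x r" using all Vsub by blast
  then show "m * norm (snd c (\<gamma> 1) - x) \<le> L" using disp[of 1] by simp
qed

text \<open>A perturbation of the matrix of the metric by less than half of its minimum on unit vectors changes
  norms by less than a factor two. The coordinate norm is compared with the
  metric frozen at \<open>p\<close>, so that later Lipschitz constants do not depend on the chart.\<close>
lemma metric_comparison:
  assumes c: "c \<in> A" and p: "p \<in> fst c"
  obtains r m where "r > 0" "m > 0" "cball (snd c p) (2 * r) \<subseteq> crange c"
    "\<forall>v. m * norm v \<le> met_norm c p v"
    "\<forall>z\<in>cball (snd c p) (2 * r). \<forall>v. met_norm c (cinv c z) v \<le> 2 * met_norm c p v"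
    "\<forall>z\<in>cball (snd c p) (2 * r). \<forall>v. met_norm c p v \<le> 2 * met_norm c (cinv c z) v"
proof -
  let ?x = "snd c p" and ?G = "\<lambda>z. g c (cinv c z)"
  have xr: "?x \<in> crange c" "cinv c ?x = p" using p cinv_chart[OF c p] by auto
  have sc: "continuous_on (sphere 0 1) (\<lambda>v. v \<bullet> (g c p *v v))"
    unfolding matrix_vector_mult_def inner_vec_def by (intro continuous_intros)
  have "sphere (0::real^'n) 1 \<noteq> {}" by (simp add: sphere_eq_empty)
  from continuous_attains_inf[OF compact_sphere this sc]
  obtain v0 where v0: "v0 \<in> sphere 0 1" "\<And>v. v \<in> sphere 0 1 \<Longrightarrow> v0 \<bullet> (g c p *v v0) \<le> v \<bullet> (g c p *v v)" by blast
  define \<mu> where "\<mu> = v0 \<bullet> (g c p *v v0)"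
  have "v0 \<noteq> 0" using v0(1) by auto
  then have \<mu>: "\<mu> > 0" unfolding \<mu>_def by (rule metric_pos_def[OF c p])
  have low: "\<mu> * (norm v)\<^sup>2 \<le> v \<bullet> (g c p *v v)" for v
  proof (cases "v = 0")
    case False
    let ?u = "(1 / norm v) *\<^sub>R v"
    have "\<mu> \<le> ?u \<bullet> (g c p *v ?u)" unfolding \<mu>_def by (rule v0(2)) (use False in simp)
    also have "\<dots> = (v \<bullet> (g c p *v v)) / (norm v)\<^sup>2" by (simp add: matrix_vector_mult_scaleR power2_eq_square)
    finally show ?thesis using False by (simp add: field_simps)
  qed simp
  define S where "S z = (\<Sum>i\<in>UNIV. \<Sum>j\<in>UNIV. \<bar>?G z $ i $ j - ?G ?x $ i $ j\<bar>)" for z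
  have "continuous_on (crange c) S"
    unfolding S_def by (intro continuous_intros C1_on_imp_continuous_on[OF metric_C1[OF c]])
  then have "continuous (at ?x) S" using continuous_on_eq_continuous_at[OF crange_open[OF c]] xr(1) by blast
  moreover have "S ?x = 0" by (simp add: S_def)
  ultimately have "\<forall>\<^sub>F z in at ?x. S z < \<mu> / 2"
    using \<mu> by (intro order_tendstoD(2)[of S 0]) (auto simp: continuous_at)
  then obtain d where d: "d > 0" "\<And>z. z \<noteq> ?x \<Longrightarrow> dist z ?x < d \<Longrightarrow> S z < \<mu> / 2" unfolding eventually_at by auto
  have d': "S z < \<mu> / 2" if "dist z ?x < d" for z using d(2)[OF _ that] \<open>S ?x = 0\<close> \<mu> by (cases "z = ?x") auto
  obtain e where e: "e > 0" "ball ?x e \<subseteq> crange c" using crange_open[OF c] xr(1) open_contains_ball by blast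
  define r where "r = min d e / 4"
  have r: "r > 0" "\<And>z. z \<in> cball ?x (2 * r) \<Longrightarrow> dist z ?x < d \<and> z \<in> ball ?x e" using d e by (auto simp: r_def dist_commute)
  have diff: "\<bar>v \<bullet> (?G z *v v) - v \<bullet> (g c p *v v)\<bar> \<le> v \<bullet> (g c p *v v) / 2" if z: "z \<in> cball ?x (2 * r)" for z v
  proof -
    have eq: "v \<bullet> (?G z *v v) - v \<bullet> (g c p *v v) = (\<Sum>i\<in>UNIV. \<Sum>j\<in>UNIV. v $ i * ((?G z $ i $ j - ?G ?x $ i $ j) * v $ j))"
      unfolding xr(2) by (simp add: matrix_vector_mult_def inner_vec_def sum_subtractf[symmetric] sum_distrib_left right_diff_distrib left_diff_distrib)
    have "\<bar>v \<bullet> (?G z *v v) - v \<bullet> (g c p *v v)\<bar> \<le> (\<Sum>i\<in>UNIV. \<Sum>j\<in>UNIV. \<bar>v $ i * ((?G z $ i $ j - ?G ?x $ i $ j) * v $ j)\<bar>)"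
      unfolding eq by (intro order_trans[OF sum_abs] sum_mono sum_abs)
    also have "\<dots> \<le> (\<Sum>i\<in>UNIV. \<Sum>j\<in>UNIV. \<bar>?G z $ i $ j - ?G ?x $ i $ j\<bar> * (norm v)\<^sup>2)"
    proof (intro sum_mono)
      fix i j
      have "\<bar>v $ i\<bar> * \<bar>v $ j\<bar> \<le> norm v * norm v" by (intro mult_mono component_le_norm_cart) auto
      then have "\<bar>?G z $ i $ j - ?G ?x $ i $ j\<bar> * (\<bar>v $ i\<bar> * \<bar>v $ j\<bar>) \<le> \<bar>?G z $ i $ j - ?G ?x $ i $ j\<bar> * (norm v * norm v)"
        by (rule mult_left_mono) simp
      then show "\<bar>v $ i * ((?G z $ i $ j - ?G ?x $ i $ j) * v $ j)\<bar> \<le> \<bar>?G z $ i $ j - ?G ?x $ i $ j\<bar> * (norm v)\<^sup>2"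
        by (simp add: abs_mult power2_eq_square mult_ac)
    qed
    also have "\<dots> = S z * (norm v)\<^sup>2" by (simp add: S_def sum_distrib_right)
    also have "\<dots> \<le> \<mu> / 2 * (norm v)\<^sup>2" using d'[of z] r(2)[OF z] by (intro mult_right_mono) auto
    also have "\<dots> \<le> v \<bullet> (g c p *v v) / 2" using low[of v] by simp
    finally show ?thesis .
  qed
  show thesis
  proof (rule that[of r "sqrt \<mu>"]; (intro ballI allI)?)
    show "cball ?x (2 * r) \<subseteq> crange c" using r(2) e(2) by blast
    show "sqrt \<mu> * norm v \<le> met_norm c p v" for v
      using real_sqrt_le_mono[OF low[of v]] by (simp add: real_sqrt_mult)
    fix z v assume z: "z \<in> cball ?x (2 * r)"
    have nn: "0 \<le> v \<bullet> (g c p *v v)" by (rule metric_nonneg[OF c p])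
    have "v \<bullet> (?G z *v v) \<le> 4 * (v \<bullet> (g c p *v v))" using diff[OF z, of v] nn by linarith
    from real_sqrt_le_mono[OF this] show "met_norm c (cinv c z) v \<le> 2 * met_norm c p v" by (simp add: real_sqrt_mult)
    have "v \<bullet> (g c p *v v) \<le> 4 * (v \<bullet> (?G z *v v))" using diff[OF z, of v] nn by linarith
    from real_sqrt_le_mono[OF this] show "met_norm c p v \<le> 2 * met_norm c (cinv c z) v" by (simp add: real_sqrt_mult)
  qed (use r \<mu> in auto)
qed

end

section \<open>The distance and compactness of closed balls\<close>

locale complete_riemannian_manifold = riemannian_manifold A g
  for A :: "('a::{t2_space, second_countable_topology}, 'n::finite) chart set" and g +
  assumes conn: "connected (UNIV :: 'a set)" and compl: "riem_complete A g"
begin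

definition joined :: "'a \<Rightarrow> 'a \<Rightarrow> real \<Rightarrow> bool" where
  "joined p q L \<longleftrightarrow> (\<exists>\<gamma>. len_on 0 1 \<gamma> L \<and> \<gamma> 0 = p \<and> \<gamma> 1 = q)"

abbreviation "d \<equiv> riem_dist A g"

lemma d_eq: "d p q = Inf {L. joined p q L}"
  unfolding riem_dist_def joined_def has_length_len_on ..

lemma joined_nonneg: "joined p q L \<Longrightarrow> L \<ge> 0"
  unfolding joined_def using len_on_nonneg by blast

lemma joined_segment:
  assumes "c \<in> A" "convex X" "X \<subseteq> crange c" "x \<in> X" "y \<in> X" "\<And>z. z \<in> X \<Longrightarrow> met_norm c (cinv c z) (y - x) \<le> N"
  shows "\<exists>L\<le>N. joined (cinv c x) (cinv c y) L"
proof -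
  obtain L where L: "len_on 0 1 (\<lambda>t. cinv c (x + t *\<^sub>R (y - x))) L" "L \<le> N" by (rule len_segment[OF assms])
  then show ?thesis unfolding joined_def by (intro exI[of _ L] conjI exI[of _ "\<lambda>t. cinv c (x + t *\<^sub>R (y - x))"]) auto
qed

lemma joined_refl: "joined p p 0"
proof -
  obtain c where c: "c \<in> A" "p \<in> fst c" using ex_chart by blast
  have "\<exists>L\<le>0. joined (cinv c (snd c p)) (cinv c (snd c p)) L"
    by (rule joined_segment[OF c(1), of "{snd c p}"]) (use c in auto)
  then show ?thesis using joined_nonneg cinv_chart[OF c] by (metis order_antisym)
qed

lemma joined_len_on: assumes "len_on u v \<gamma> L" "u < v" shows "joined (\<gamma> u) (\<gamma> v) L"
proof -
  have im: "(\<lambda>t. (v - u) * t + u) ` {0..1} = {u..v}" 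
    using image_affinity_atLeastAtMost[of "v - u" u 0 1] assms(2) by auto
  have im2: "(\<lambda>t. (v - u) * t + u) ` {0<..<1} \<subseteq> {u<..<v}"
  proof clarify
    fix t :: real assume t: "t \<in> {0<..<1}"
    have "(v - u) * t < (v - u) * 1" using t assms(2) by (intro mult_strict_left_mono) auto
    moreover have "0 < (v - u) * t" using t assms(2) by simp
    ultimately show "(v - u) * t + u \<in> {u<..<v}" by simp
  qed
  have "len_on 0 1 (\<lambda>t. \<gamma> ((v - u) * t + u)) L"
    by (rule len_on_affine[OF assms(1) _ im im2]) (use assms(2) in simp)
  then show ?thesis unfolding joined_def by (intro exI[of _ "\<lambda>t. \<gamma> ((v - u) * t + u)"]) simp
qed

lemma joined_sym: assumes "joined p q L" shows "joined q p L"
proof -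
  obtain \<gamma> where \<gamma>: "len_on 0 1 \<gamma> L" "\<gamma> 0 = p" "\<gamma> 1 = q" using assms unfolding joined_def by blast
  have im: "(\<lambda>t::real. (-1) * t + 1) ` {0..1} = {0..1}" using image_affinity_atLeastAtMost[of "-1::real" 1 0 1] by auto
  have "len_on 0 1 (\<lambda>t. \<gamma> ((-1) * t + 1)) L"
    by (rule len_on_affine[OF \<gamma>(1) _ im]) auto
  then show ?thesis unfolding joined_def using \<gamma> by (intro exI[of _ "\<lambda>t. \<gamma> ((-1) * t + 1)"]) simp
qed

lemma joined_trans: assumes "joined p q L" "joined q r L'" shows "joined p r (L + L')"
proof -
  obtain \<gamma> where \<gamma>: "len_on 0 1 \<gamma> L" "\<gamma> 0 = p" "\<gamma> 1 = q" using assms unfolding joined_def by blast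
  obtain \<gamma>' where \<gamma>': "len_on 0 1 \<gamma>' L'" "\<gamma>' 0 = q" "\<gamma>' 1 = r" using assms unfolding joined_def by blast
  define \<beta> where "\<beta> t = (if t \<le> 1 then \<gamma> t else \<gamma>' (1 * t + (-1)))" for t
  have im: "(\<lambda>t::real. 1 * t + (-1)) ` {1..2} = {0..1}" using image_affinity_atLeastAtMost[of "1::real" "-1" 1 2] by simp
  have 1: "len_on 0 1 \<beta> L" by (rule len_on_cong[OF \<gamma>(1)]) (simp add: \<beta>_def)
  have "len_on 1 2 (\<lambda>t. \<gamma>' (1 * t + (-1))) L'" by (rule len_on_affine[OF \<gamma>'(1) _ im]) auto
  then have 2: "len_on 1 2 \<beta> L'" by (rule len_on_cong) (use \<gamma> \<gamma>' in \<open>auto simp: \<beta>_def\<close>)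
  have "len_on 0 2 \<beta> (L + L')" by (rule len_on_glue[OF 1 2]) auto
  from joined_len_on[OF this] show ?thesis using \<gamma> \<gamma>' by (simp add: \<beta>_def)
qed

text \<open>Points of a chart ball are joined by segments, so the points that can be joined to a given point
  form an open and closed set.\<close>
lemma ex_joined: "\<exists>L. joined p q L"
proof -
  let ?S = "{q. \<exists>L. joined p q L}"
  have nb: "\<exists>W. open W \<and> z \<in> W \<and> (\<forall>w\<in>W. \<exists>L. joined z w L)" for z
  proof -
    obtain c where c: "c \<in> A" "z \<in> fst c" using ex_chart by blast
    obtain r m where rm: "r > 0" "m > 0" "cball (snd c z) (2 * r) \<subseteq> crange c"
    "\<forall>v. m * norm v \<le> met_norm c z v"
    "\<forall>y\<in>cball (snd c z) (2 * r). \<forall>v. met_norm c (cinv c y) v \<le> 2 * met_norm c z v"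
    "\<forall>y\<in>cball (snd c z) (2 * r). \<forall>v. met_norm c z v \<le> 2 * met_norm c (cinv c y) v"
    by (rule metric_comparison[OF c])
    note r = rm(1,3) rm(5)[rule_format]
    let ?B = "ball (snd c z) r"
    have B: "?B \<subseteq> crange c" "?B \<subseteq> cball (snd c z) (2 * r)" using r(1,2) by (auto simp: subset_eq)
    have "\<exists>L. joined z w L" if w: "w \<in> cinv c ` ?B" for w
    proof -
      obtain y where y: "y \<in> ?B" "w = cinv c y" using w by blast
      have "\<exists>L\<le>2 * met_norm c z (y - snd c z). joined (cinv c (snd c z)) (cinv c y) L"
        by (rule joined_segment[OF c(1) convex_ball B(1)]) (use r B y in auto)
      then show ?thesis using y cinv_chart[OF c] by auto
    qed
    moreover have "open (cinv c ` ?B)" by (rule cinv_image_open[OF c(1) open_ball B(1)])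
    moreover have "z \<in> cinv c ` ?B" using r(1) cinv_chart[OF c] by (metis centre_in_ball image_eqI)
    ultimately show ?thesis by blast
  qed
  have "open ?S"
  proof (rule Topological_Spaces.openI)
    fix z assume "z \<in> ?S"
    then obtain L0 where j: "joined p z L0" by blast
    obtain W where W: "open W" "z \<in> W" "\<forall>w\<in>W. \<exists>L. joined z w L" using nb[of z] by blast
    have "W \<subseteq> ?S"
    proof
      fix w assume "w \<in> W"
      then obtain L where "joined z w L" using W(3) by blast
      from joined_trans[OF j this] show "w \<in> ?S" by blast
    qed
    then show "\<exists>T. open T \<and> z \<in> T \<and> T \<subseteq> ?S" using W(1,2) by blast
  qed
  moreover have "open (- ?S)"
  proof (rule Topological_Spaces.openI)
    fix z assume z: "z \<in> - ?S"
    obtain W where W: "open W" "z \<in> W" "\<forall>w\<in>W. \<exists>L. joined z w L" using nb[of z] by blast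
    have "W \<subseteq> - ?S"
    proof
      fix w assume "w \<in> W"
      then obtain L where L: "joined z w L" using W(3) by blast
      have "False" if "w \<in> ?S"
      proof -
        obtain L' where L': "joined p w L'" using \<open>w \<in> ?S\<close> by blast
        from joined_trans[OF L' joined_sym[OF L]] show False using z by blast
      qed
      then show "w \<in> - ?S" by blast
    qed
    then show "\<exists>T. open T \<and> z \<in> T \<and> T \<subseteq> - ?S" using W(1,2) by blast
  qed
  ultimately have "?S \<inter> UNIV = {} \<or> - ?S \<inter> UNIV = {}" using connectedD[OF conn, of ?S "- ?S"] by auto
  then show ?thesis using joined_refl[of p] by auto
qed

lemma d_le: "joined p q L \<Longrightarrow> d p q \<le> L"
  unfolding d_eq by (rule cInf_lower) (auto intro!: bdd_belowI[of _ 0] joined_nonneg)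

lemma d_lessD: "d p q < B \<Longrightarrow> \<exists>L<B. joined p q L"
  unfolding d_eq using cInf_lessD[of "{L. joined p q L}" B] ex_joined[of p q] by auto

lemma d_nonneg: "d p q \<ge> 0"
  unfolding d_eq using ex_joined joined_nonneg by (intro cInf_greatest) auto

lemma d_refl: "d p p = 0" using d_le[OF joined_refl, of p] d_nonneg[of p p] by simp

lemma d_sym: "d p q = d q p"
proof -
  have "joined p q = joined q p" by (auto intro: joined_sym)
  then show ?thesis by (simp add: d_eq)
qed

lemma d_triangle: "d p r \<le> d p q + d q r"
proof (rule field_le_epsilon)
  fix e :: real assume "e > 0"
  then obtain L L' where "L < d p q + e / 2" "joined p q L" "L' < d q r + e / 2" "joined q r L'"
    using d_lessD[of p q "d p q + e / 2"] d_lessD[of q r "d q r + e / 2"] by auto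
  then show "d p r \<le> d p q + d q r + e" using d_le[OF joined_trans] by fastforce
qed

text \<open>Curves whose length is close to the distance are too short to leave the coordinate ball, and inside
  it the length controls the displacement.\<close>
lemma d_lower:
  assumes c: "c \<in> A" and C: "cball x r \<subseteq> crange c" and r: "r > 0" and m: "m > 0" "\<And>z v. z \<in> cball x r \<Longrightarrow> m * norm v \<le> met_norm c (cinv c z) v"
    and L: "d (cinv c x) q < m * r"
  shows "q \<in> cinv c ` ball x r" "m * norm (snd c q - x) \<le> d (cinv c x) q"
proof -
  have *: "q \<in> cinv c ` ball x r \<and> m * norm (snd c q - x) \<le> L" if j: "joined (cinv c x) q L" "L < m * r" for L
    using j short_curve_stays_in_ball[OF c C r m _ _ j(2)] unfolding joined_def by metis
  then show "q \<in> cinv c ` ball x r" using d_lessD[OF L] by blast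
  show "m * norm (snd c q - x) \<le> d (cinv c x) q"
  proof (rule ccontr)
    assume "\<not> m * norm (snd c q - x) \<le> d (cinv c x) q"
    then obtain L' where "L' < min (m * r) (m * norm (snd c q - x))" "joined (cinv c x) q L'"
      using d_lessD[of "cinv c x" q "min (m * r) (m * norm (snd c q - x))"] L by auto
    then show False using *[of L'] by auto
  qed
qed

text \<open>The straight segment in the chart competes in the infimum.\<close>
lemma d_upper:
  assumes c: "c \<in> A" and X: "convex X" "X \<subseteq> crange c" "x \<in> X" "y \<in> X" "\<And>z. z \<in> X \<Longrightarrow> met_norm c (cinv c z) (y - x) \<le> N"
  shows "d (cinv c x) (cinv c y) \<le> N"
  using joined_segment[OF assms] d_le order_trans by blast

lemma d_nbhd:
  assumes c: "c \<in> A" "p \<in> fst c"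
  obtains r m where "r > 0" "m > 0" "cball (snd c p) (2 * r) \<subseteq> crange c"
    "\<forall>s q. 0 < s \<longrightarrow> s \<le> r \<longrightarrow> d p q < m * s \<longrightarrow> q \<in> cinv c ` ball (snd c p) s \<and> m * norm (snd c q - snd c p) \<le> d p q"
    "\<forall>z\<in>cball (snd c p) r. d p (cinv c z) \<le> 2 * met_norm c p (z - snd c p)"
proof -
  let ?x = "snd c p"
  obtain r m where rm: "r > 0" "m > 0" "cball (snd c p) (2 * r) \<subseteq> crange c"
    "\<forall>v. m * norm v \<le> met_norm c p v"
    "\<forall>y\<in>cball (snd c p) (2 * r). \<forall>v. met_norm c (cinv c y) v \<le> 2 * met_norm c p v"
    "\<forall>y\<in>cball (snd c p) (2 * r). \<forall>v. met_norm c p v \<le> 2 * met_norm c (cinv c y) v"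
    by (rule metric_comparison[OF c])
  note r = rm(1-3) rm(4-6)[rule_format]
  have px: "cinv c ?x = p" using cinv_chart[OF c] .
  show thesis
  proof (rule that[of r "m / 2"]; (intro allI impI ballI)?)
    fix s q assume s: "0 < s" "s \<le> r" and dq: "d p q < m / 2 * s"
    have sub: "cball ?x s \<subseteq> cball ?x (2 * r)" using s r(1) by (intro subset_cball) simp
    have m2: "m / 2 * norm v \<le> met_norm c (cinv c z) v" if "z \<in> cball ?x s" for z v
      using r(4)[of v] r(6)[of z v] sub that by (simp add: subset_eq)
    show "q \<in> cinv c ` ball ?x s \<and> m / 2 * norm (snd c q - ?x) \<le> d p q"
      using d_lower[OF c(1) order_trans[OF sub r(3)] s(1) _ m2, of q] dq px r(2) by simp
  next
    fix z assume z: "z \<in> cball ?x r"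
    have "d (cinv c ?x) (cinv c z) \<le> 2 * met_norm c p (z - ?x)"
      by (rule d_upper[OF c(1), of "cball ?x (2 * r)"]) (use r z in auto)
    then show "d p (cinv c z) \<le> 2 * met_norm c p (z - ?x)" using px by simp
  qed (use r in auto)
qed

text \<open>Different points are separated by a small coordinate ball, which no short curve leaves.\<close>
lemma d_eq_0: assumes "d p q = 0" shows "p = q"
proof -
  obtain c where c: "c \<in> A" "p \<in> fst c" using ex_chart by blast
  obtain r m where rm: "r > 0" "m > 0" "cball (snd c p) (2 * r) \<subseteq> crange c"
    "\<forall>s q. 0 < s \<longrightarrow> s \<le> r \<longrightarrow> d p q < m * s \<longrightarrow> q \<in> cinv c ` ball (snd c p) s \<and> m * norm (snd c q - snd c p) \<le> d p q"
    "\<forall>z\<in>cball (snd c p) r. d p (cinv c z) \<le> 2 * met_norm c p (z - snd c p)"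
    by (rule d_nbhd[OF c])
  note r = rm(1,2) rm(4)[rule_format] rm(3)
  have q: "q \<in> cinv c ` ball (snd c p) r" "m * norm (snd c q - snd c p) \<le> 0" using r(3)[of r q] assms r(1,2) by auto
  then have "snd c q = snd c p" using r(2) by (simp add: mult_le_0_iff)
  moreover have "q \<in> fst c" using q(1) r(1,4) cinv_in[OF c(1)] by (auto simp: subset_eq)
  ultimately show ?thesis using cinv_chart[OF c(1)] c(2) by metis
qed

sublocale M: Metric_space "UNIV :: 'a set" d
  by unfold_locales (auto intro: d_nonneg d_sym d_triangle d_eq_0 simp: d_refl)

lemma mball_eq: "M.mball p r = {q. d p q < r}" by (auto simp: M.in_mball)

lemma d_ball_in_open: assumes "open U" "p \<in> U" shows "\<exists>e>0. {q. d p q < e} \<subseteq> U"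
proof -
  obtain c where c: "c \<in> A" "p \<in> fst c" using ex_chart by blast
  obtain r m where rm: "r > 0" "m > 0" "cball (snd c p) (2 * r) \<subseteq> crange c"
    "\<forall>s q. 0 < s \<longrightarrow> s \<le> r \<longrightarrow> d p q < m * s \<longrightarrow> q \<in> cinv c ` ball (snd c p) s \<and> m * norm (snd c q - snd c p) \<le> d p q"
    "\<forall>z\<in>cball (snd c p) r. d p (cinv c z) \<le> 2 * met_norm c p (z - snd c p)"
    by (rule d_nbhd[OF c])
  note r = rm(1,2) rm(4)[rule_format] rm(3)
  have "open (snd c ` (U \<inter> fst c))" using assms(1) c by (intro chart_image_open) (auto intro: chart_open)
  moreover have "snd c p \<in> snd c ` (U \<inter> fst c)" using c assms by blast
  ultimately obtain e where e: "e > 0" "ball (snd c p) e \<subseteq> snd c ` (U \<inter> fst c)" using open_contains_ball by metis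
  define s where "s = min e r"
  have s: "0 < s" "s \<le> r" "s \<le> e" using e r by (auto simp: s_def)
  have "q \<in> U" if dq: "d p q < m * s" for q
  proof -
    obtain z where z: "z \<in> ball (snd c p) s" "q = cinv c z" using r(3)[OF s(1,2) dq] by blast
    then have "z \<in> ball (snd c p) e" using s(3) by auto
    then obtain u where "u \<in> U" "u \<in> fst c" "z = snd c u" using e(2) by blast
    then show ?thesis using z(2) cinv_chart[OF c(1)] by simp
  qed
  then show ?thesis using r(2) s(1) by (intro exI[of _ "m * s"]) auto
qed

lemma open_d_ball: "open {q. d p q < r}"
proof (rule Topological_Spaces.openI)
  fix q assume q: "q \<in> {q. d p q < r}"
  obtain c where c: "c \<in> A" "q \<in> fst c" using ex_chart by blast
  obtain r0 m where rm: "r0 > 0" "m > 0" "cball (snd c q) (2 * r0) \<subseteq> crange c"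
    "\<forall>s u. 0 < s \<longrightarrow> s \<le> r0 \<longrightarrow> d q u < m * s \<longrightarrow> u \<in> cinv c ` ball (snd c q) s \<and> m * norm (snd c u - snd c q) \<le> d q u"
    "\<forall>z\<in>cball (snd c q) r0. d q (cinv c z) \<le> 2 * met_norm c q (z - snd c q)"
    by (rule d_nbhd[OF c])
  note r0 = rm(1,3) rm(5)[rule_format]
  have "continuous_on UNIV (\<lambda>z. 2 * met_norm c q (z - snd c q))"
    unfolding matrix_vector_mult_def inner_vec_def by (intro continuous_intros)
  then have o: "open {z. 2 * met_norm c q (z - snd c q) < r - d p q}" by (intro open_Collect_less continuous_on_const)
  let ?X = "ball (snd c q) r0 \<inter> {z. 2 * met_norm c q (z - snd c q) < r - d p q}"
  have X: "open ?X" "?X \<subseteq> crange c" using o r0 by (auto simp: subset_eq)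
  have "cinv c ` ?X \<subseteq> {q. d p q < r}"
  proof clarify
    fix z assume z: "z \<in> ball (snd c q) r0" "2 * met_norm c q (z - snd c q) < r - d p q"
    then show "d p (cinv c z) < r" using r0(3)[of z] d_triangle[of p "cinv c z" q] by auto
  qed
  moreover have "q \<in> cinv c ` ?X" using q r0 c cinv_chart[OF c] by (intro image_eqI[of _ _ "snd c q"]) auto
  ultimately show "\<exists>T. open T \<and> q \<in> T \<and> T \<subseteq> {q. d p q < r}" using cinv_image_open[OF c(1) X] by blast
qed

text \<open>Metric balls and coordinate balls are comparable at small scales.\<close>
lemma mtopology_eq: "M.mtopology = euclidean"
proof (rule topology_eq[THEN iffD2], intro allI)
  fix S
  have "openin M.mtopology S \<longleftrightarrow> (\<forall>p\<in>S. \<exists>e>0. {q. d p q < e} \<subseteq> S)" by (simp only: M.openin_mtopology mball_eq subset_UNIV simp_thms Ball_def)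
  also have "\<dots> \<longleftrightarrow> open S"
  proof
    assume h: "\<forall>p\<in>S. \<exists>e>0. {q. d p q < e} \<subseteq> S"
    show "open S"
    proof (rule Topological_Spaces.openI)
      fix p assume "p \<in> S"
      then obtain e where "e > 0" "{q. d p q < e} \<subseteq> S" using h by blast
      then show "\<exists>T. open T \<and> p \<in> T \<and> T \<subseteq> S" using open_d_ball d_refl by (intro exI[of _ "{q. d p q < e}"]) simp
    qed
  qed (use d_ball_in_open in blast)
  finally show "openin M.mtopology S = openin euclidean S" by simp
qed

lemma compact_iff: "compact K \<longleftrightarrow> compactin M.mtopology K"
  unfolding mtopology_eq by simp

text \<open>A nearly minimal curve is cut at the parameter where its length reaches an intermediate value.
  This property of length spaces is what makes the theorem of Hopf and Rinow work.\<close>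
lemma d_intermediate:
  assumes "d p q < a + b" "a > 0" "b > 0" shows "\<exists>z. d p z < a \<and> d z q < b"
proof -
  obtain L where L: "L < a + b" "joined p q L" using d_lessD[OF assms(1)] by blast
  have L0: "L \<ge> 0" by (rule joined_nonneg[OF L(2)])
  obtain \<gamma> where \<gamma>: "len_on 0 1 \<gamma> L" "\<gamma> 0 = p" "\<gamma> 1 = q" using L(2) unfolding joined_def by blast
  obtain l where l: "continuous_on {0..1} l" "l 0 = 0" "l 1 = L" "\<forall>u v. 0 \<le> u \<longrightarrow> u \<le> v \<longrightarrow> v \<le> 1 \<longrightarrow> len_on u v \<gamma> (l v - l u)"
    by (rule len_on_restrict[OF \<gamma>(1) zero_le_one])
  note l = l(1-3) l(4)[rule_format]
  have y: "0 \<le> L * (a / (a + b))" "L * (a / (a + b)) \<le> L"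
    using L0 assms mult_left_mono[of "a / (a + b)" 1 L] by (simp_all add: divide_le_eq)
  then obtain t where t: "0 \<le> t" "t \<le> 1" "l t = L * (a / (a + b))" using IVT'[of l 0 "L * (a / (a + b))" 1] l by auto
  have fin: "d (\<gamma> u) (\<gamma> v) \<le> l v - l u" if "0 \<le> u" "u \<le> v" "v \<le> 1" for u v
  proof (cases "u = v")
    case False
    then have "u < v" using that by simp
    then show ?thesis using d_le[OF joined_len_on[OF l(4)[OF that]]] by simp
  qed (simp add: d_refl)
  have "L * a < a * (a + b)" using mult_strict_left_mono[OF L(1) assms(2)] by (simp add: mult.commute)
  then have "L * (a / (a + b)) < a" using assms by (simp add: divide_less_eq)
  then have "d p (\<gamma> t) < a" using fin[of 0 t] t l(2) \<gamma>(2) by simp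
  moreover have "L - L * (a / (a + b)) < b"
  proof -
    have "L - L * (a / (a + b)) = L * b / (a + b)" using assms by (simp add: field_simps)
    moreover have "L * b < b * (a + b)" using mult_strict_left_mono[OF L(1) assms(3)] by (simp add: mult.commute)
    ultimately show ?thesis using assms by (simp add: divide_less_eq)
  qed
  then have "d (\<gamma> t) q < b" using fin[of t 1] t l(3) \<gamma>(3) by simp
  ultimately show ?thesis by blast
qed

lemma d_continuous: "continuous_on UNIV (d p)"
proof -
  have lip: "\<bar>d p x - d p y\<bar> \<le> d y x" for x y using d_triangle[of p x y] d_triangle[of p y x] d_sym[of x y] by linarith
  have "open (d p -` B)" if B: "open B" for B
  proof (rule Topological_Spaces.openI)
    fix x assume "x \<in> d p -` B"
    then obtain e where e: "e > 0" "\<And>y. dist y (d p x) < e \<Longrightarrow> y \<in> B" using B unfolding open_dist by auto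
    have "{q. d x q < e} \<subseteq> d p -` B"
    proof clarify
      fix q assume "d x q < e"
      then have "dist (d p q) (d p x) < e" using lip[of q x] by (simp add: dist_real_def)
      then show "q \<in> d p -` B" using e(2) by simp
    qed
    then show "\<exists>T. open T \<and> x \<in> T \<and> T \<subseteq> d p -` B" using open_d_ball d_refl e(1) by (intro exI[of _ "{q. d x q < e}"]) simp
  qed
  then show ?thesis by (simp add: continuous_on_open_vimage)
qed

lemma closed_d_cball: "closed {q. d p q \<le> r}"
  using continuous_closed_vimage[of "{..r}" "d p"] d_continuous
  by (simp add: vimage_def continuous_on_eq_continuous_at)

lemma mcomplete: "M.mcomplete"
  using compl unfolding riem_complete_def .

lemma compact_closed_totally_bounded:
  assumes "closed C" and tb: "\<And>e. e > 0 \<Longrightarrow> \<exists>F. finite F \<and> F \<subseteq> C \<and> C \<subseteq> (\<Union>x\<in>F. {q. d x q < e})"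
  shows "compact C"
proof -
  have "M.mtotally_bounded C" unfolding M.mtotally_bounded_def mball_eq using tb by simp
  then have "compactin M.mtopology (M.mtopology closure_of C)"
    using M.mtotally_bounded_eq_compact_closure_of[OF mcomplete] by simp
  then show ?thesis using assms(1) unfolding mtopology_eq by (simp add: closure_of_closedin)
qed

text \<open>If the closed balls of smaller radii are compact, the closed ball of radius \<open>r\<close> is totally
  bounded: each of its points is close to a slightly smaller ball.\<close>
lemma compact_cball_limit:
  assumes r: "r > 0" and good: "\<And>s. 0 < s \<Longrightarrow> s < r \<Longrightarrow> compact {q. d p q \<le> s}"
  shows "compact {q. d p q \<le> r}"
proof (rule compact_closed_totally_bounded[OF closed_d_cball])
  fix e :: real assume e: "e > 0"
  show "\<exists>F. finite F \<and> F \<subseteq> {q. d p q \<le> r} \<and> {q. d p q \<le> r} \<subseteq> (\<Union>x\<in>F. {q. d x q < e})"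
  proof (cases "r \<le> e / 4")
    case True
    then show ?thesis using r e by (intro exI[of _ "{p}"]) (auto simp: d_refl)
  next
    case False
    define s where "s = r - e / 4"
    have s: "0 < s" "s < r" using False e by (auto simp: s_def)
    have "M.mtotally_bounded {q. d p q \<le> s}"
      using M.compactin_imp_mtotally_bounded good[OF s] unfolding compact_iff by blast
    then obtain F where F: "finite F" "F \<subseteq> {q. d p q \<le> s}" "{q. d p q \<le> s} \<subseteq> (\<Union>x\<in>F. {q. d x q < e / 2})"
      unfolding M.mtotally_bounded_def mball_eq using e by (meson half_gt_zero)
    have "q \<in> (\<Union>x\<in>F. {q. d x q < e})" if dq: "d p q \<le> r" for q
    proof -
      have "d p q < s + e / 2" using dq e by (simp add: s_def)
      then obtain z where z: "d p z < s" "d z q < e / 2" using d_intermediate[OF _ s(1)] e by (meson half_gt_zero)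
      then have "z \<in> {q. d p q \<le> s}" by simp
      then obtain x where x: "x \<in> F" "d x z < e / 2" using F(3) by blast
      then have "d x q < e" using d_triangle[of x q z] z(2) by simp
      then show ?thesis using x(1) by blast
    qed
    then show ?thesis using F s by (intro exI[of _ F]) (auto simp: subset_eq)
  qed
qed

lemma compact_subset_compact_nbhd:
  fixes K :: "'a set"
  assumes K: "compact K"
  obtains W C where "open W" "K \<subseteq> W" "W \<subseteq> C" "compact C"
proof -
  have "\<forall>p::'a. \<exists>X. open (fst X) \<and> p \<in> fst X \<and> fst X \<subseteq> snd X \<and> compact (snd X)"
  proof
    fix p obtain W C where "open W" "p \<in> W" "W \<subseteq> C" "compact C" "emeasure vol C < \<infinity>" by (rule nbhd_finite_volume[of p])
    then show "\<exists>X. open (fst X) \<and> p \<in> fst X \<and> fst X \<subseteq> snd X \<and> compact (snd X)" by (intro exI[of _ "(W, C)"]) simp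
  qed
  then obtain X where X: "\<forall>p::'a. open (fst (X p)) \<and> p \<in> fst (X p) \<and> fst (X p) \<subseteq> snd (X p) \<and> compact (snd (X p))"
    by (rule choice[THEN exE])
  define W where "W p = fst (X p)" for p
  define C where "C p = snd (X p)" for p
  have W: "\<And>p. open (W p)" "\<And>p. p \<in> W p" "\<And>p. W p \<subseteq> C p" "\<And>p. compact (C p)" using X by (auto simp: W_def C_def)
  obtain I where I: "finite I" "K \<subseteq> (\<Union>p\<in>I. W p)" using compactE_image[OF K, of K W] W by (metis UN_I subsetI)
  show thesis
  proof (rule that[of "\<Union>p\<in>I. W p" "\<Union>p\<in>I. C p"])
    show "(\<Union>p\<in>I. W p) \<subseteq> (\<Union>p\<in>I. C p)" using W(3) by (intro UN_mono) auto
    show "open (\<Union>p\<in>I. W p)" using W(1) by auto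
    show "compact (\<Union>p\<in>I. C p)" by (intro compact_UN I(1) W(4))
  qed (rule I(2))
qed

text \<open>A point slightly farther from \<open>p\<close> than \<open>r\<close> is close to a point of the compact ball, because distances are
  infima of lengths; so for a small increase of the radius the ball stays in a neighbourhood with
  compact closure.\<close>
lemma compact_cball_extend:
  assumes r: "r > 0" and good: "compact {q. d p q \<le> r}"
  shows "\<exists>s>r. compact {q. d p q \<le> s}"
proof -
  let ?K = "{q. d p q \<le> r}"
  obtain W C where W: "open W" "?K \<subseteq> W" "W \<subseteq> C" "compact C" by (rule compact_subset_compact_nbhd[OF good])
  have "\<forall>x\<in>?K. \<exists>e>0. {q. d x q < 2 * e} \<subseteq> W"
  proof
    fix x assume "x \<in> ?K"
    then obtain e where "e > 0" "{q. d x q < e} \<subseteq> W" using d_ball_in_open[OF W(1)] W(2) by blast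
    then show "\<exists>e>0. {q. d x q < 2 * e} \<subseteq> W" by (intro exI[of _ "e / 2"]) simp
  qed
  then obtain e where e: "\<forall>x\<in>?K. 0 < e x \<and> {q. d x q < 2 * e x} \<subseteq> W" by (rule bchoice[THEN exE]) 
  have cov: "?K \<subseteq> (\<Union>x\<in>?K. {q. d x q < e x})"
  proof
    fix x assume "x \<in> ?K" then show "x \<in> (\<Union>x\<in>?K. {q. d x q < e x})" using e d_refl by (intro UN_I[of x]) auto
  qed
  obtain I where I: "I \<subseteq> ?K" "finite I" "?K \<subseteq> (\<Union>x\<in>I. {q. d x q < e x})"
    by (rule compactE_image[OF good _ cov]) (rule open_d_ball)
  have "p \<in> ?K" using r by (simp add: d_refl)
  then have "I \<noteq> {}" using I(3) by blast
  define \<delta> where "\<delta> = Min (e ` I)"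
  have \<delta>: "\<delta> > 0" "\<And>x. x \<in> I \<Longrightarrow> \<delta> \<le> e x" using I \<open>I \<noteq> {}\<close> e by (auto simp: \<delta>_def)
  have "{q. d p q \<le> r + \<delta> / 2} \<subseteq> C"
  proof clarify
    fix q assume "d p q \<le> r + \<delta> / 2"
    then have "d p q < r + \<delta>" using \<delta>(1) by simp
    then obtain z where z: "d p z < r" "d z q < \<delta>" using d_intermediate[OF _ r \<delta>(1)] by blast
    then have "z \<in> ?K" by simp
    then obtain x where x: "x \<in> I" "d x z < e x" using I(3) by blast
    then have "d x q < 2 * e x" using d_triangle[of x q z] z(2) \<delta>(2)[OF x(1)] by simp
    then show "q \<in> C" using e x(1) I(1) W(3) by blast
  qed
  then have "compact {q. d p q \<le> r + \<delta> / 2}" using closed_Int_compact[OF closed_d_cball W(4), of p "r + \<delta> / 2"] by (simp add: Int_absorb2)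
  then show ?thesis using \<delta>(1) by (intro exI[of _ "r + \<delta> / 2"]) simp
qed

text \<open>The theorem of Hopf and Rinow: the radii of compact closed balls form an interval that is
  closed and open in the positive half line.\<close>
theorem compact_d_cball: "compact {q. d p q \<le> R}"
proof (rule ccontr)
  assume bad: "\<not> compact {q. d p q \<le> R}"
  have mono: "compact {q. d p q \<le> s}" if "compact {q. d p q \<le> r}" "s \<le> r" for r s
  proof -
    have "{q. d p q \<le> s} \<inter> {q. d p q \<le> r} = {q. d p q \<le> s}" using that(2) by auto
    then show ?thesis using closed_Int_compact[OF closed_d_cball that(1), of p s] by simp
  qed
  let ?S = "{r. 0 < r \<and> compact {q. d p q \<le> r}}"
  obtain W C where W: "open W" "p \<in> W" "W \<subseteq> C" "compact C" "emeasure vol C < \<infinity>" by (rule nbhd_finite_volume[of p])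
  obtain e where e: "e > 0" "{q. d p q < e} \<subseteq> W" using d_ball_in_open[OF W(1,2)] by blast
  have "{q. d p q \<le> e / 2} \<subseteq> {q. d p q < e}" using e(1) by auto
  then have "{q. d p q \<le> e / 2} \<inter> C = {q. d p q \<le> e / 2}" using e(2) W(3) by blast
  then have "compact {q. d p q \<le> e / 2}" using closed_Int_compact[OF closed_d_cball W(4), of p "e / 2"] by simp
  then have e2: "e / 2 \<in> ?S" using e by simp
  have ub: "r \<le> R" if "r \<in> ?S" for r using bad mono[of r R] that by (cases "r \<le> R") auto
  have bdd: "bdd_above ?S" using ub by (rule bdd_aboveI)
  let ?s = "Sup ?S"
  have s0: "?s > 0" using cSup_upper[OF e2 bdd] e(1) by linarith
  have "compact {q. d p q \<le> t}" if t: "0 < t" "t < ?s" for t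
  proof -
    have "?S \<noteq> {}" using e2 by blast
    then obtain r where "r \<in> ?S" "t < r" using less_cSup_iff[OF _ bdd] t(2) by blast
    then show ?thesis using mono[of r t] by auto
  qed
  then have "compact {q. d p q \<le> ?s}" by (rule compact_cball_limit[OF s0])
  then obtain t where "t > ?s" "compact {q. d p q \<le> t}" using compact_cball_extend[OF s0] by blast
  then have "t \<in> ?S" using s0 by auto
  then show False using cSup_upper[OF _ bdd] \<open>t > ?s\<close> by fastforce
qed

end

section \<open>Cutoff functions\<close>

context complete_riemannian_manifold begin

lemma metric_cauchy_schwarz:
  assumes c: "c \<in> A" "p \<in> fst c"
  shows "\<bar>v \<bullet> (g c p *v w)\<bar> \<le> met_norm c p v * met_norm c p w"
proof (cases "w = 0")
  case False
  let ?a = "v \<bullet> (g c p *v v)" and ?b = "v \<bullet> (g c p *v w)" and ?e = "w \<bullet> (g c p *v w)"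
  have e: "?e > 0" by (rule metric_pos_def[OF c False])
  define t where "t = ?b / ?e"
  have sym: "w \<bullet> (g c p *v v) = ?b" by (rule metric_inner_commute[OF c])
  have "0 \<le> (v - t *\<^sub>R w) \<bullet> (g c p *v (v - t *\<^sub>R w))" by (rule metric_nonneg[OF c])
  also have "\<dots> = ?a - 2 * t * ?b + t * t * ?e"
    by (simp add: matrix_vector_mult_diff_distrib matrix_vector_mult_scaleR inner_diff_left inner_diff_right sym algebra_simps)
  also have "\<dots> = ?a - ?b * ?b / ?e" using e by (simp add: t_def field_simps)
  finally have "?b\<^sup>2 \<le> ?a * ?e" using e by (simp add: field_simps power2_eq_square)
  from real_sqrt_le_mono[OF this] show ?thesis by (simp add: real_sqrt_mult)
qed simp

lemma gamma_cauchy_schwarz: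
  assumes "C1M f" "C1M w" shows "\<bar>gamma f w p\<bar> \<le> sqrt (gamma f f p) * sqrt (gamma w w p)"
proof -
  obtain c where c: "c \<in> A" "p \<in> fst c" using ex_chart by blast
  show ?thesis
  proof (rule gamma_bound[OF c assms])
    fix v
    let ?X = "matrix_inv (g c p) *v chart_grad c f p"
    have "chart_grad c f p \<bullet> v = ?X \<bullet> (g c p *v v)"
      using metric_inner_commute[OF c, of ?X v] metric_mult_inv[OF c] by (simp add: inner_commute)
    moreover have "gamma f f p = ?X \<bullet> (g c p *v ?X)"
      using gamma_chart[OF c assms(1) assms(1)] chart_grad_metric_inv[OF c] by (simp add: chart_gamma_def)
    ultimately show "\<bar>chart_grad c f p \<bullet> v\<bar> \<le> sqrt (gamma f f p) * met_norm c p v"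
      using metric_cauchy_schwarz[OF c, of ?X v] by simp
  qed
qed

lemma gamma_compose_left: 
  assumes "C1M f" "C1M w" "C1_on UNIV h" "(h has_real_derivative h') (at (f p))" shows "gamma (\<lambda>q. h (f q)) w p = h' * gamma f w p"
proof -
  obtain c where c: "c \<in> A" "p \<in> fst c" using ex_chart by blast
  show ?thesis using gamma_chart[OF c C1M_compose[OF assms(1,3)] assms(2)] gamma_chart[OF c assms(1,2)] chart_grad_compose[OF c assms(1,4)]
    by (simp add: chart_gamma_def)
qed

text \<open>Near \<open>x\<close> the distance and the metric are both controlled, up to a factor two, by one norm \<open>N\<close> on
  the coordinate space. The radius \<open>6 r\<close> leaves room for the mollification.\<close>
definition lipschitz_chart :: "('a, 'n) chart \<Rightarrow> real ^ 'n \<Rightarrow> real \<Rightarrow> bool" where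
  "lipschitz_chart c x r \<longleftrightarrow> cball x (6 * r) \<subseteq> crange c \<and> (\<exists>N. (\<forall>s v. s \<ge> 0 \<longrightarrow> N (s *\<^sub>R v) = s * N v) \<and>
     (\<forall>y\<in>cball x (6 * r). \<forall>z\<in>cball x (6 * r). d (cinv c y) (cinv c z) \<le> 2 * N (y - z)) \<and>
     (\<forall>z\<in>cball x (6 * r). \<forall>v. N v \<le> 2 * met_norm c (cinv c z) v))"

lemma ex_lipschitz_chart:
  "\<exists>c x r. c \<in> A \<and> r > 0 \<and> p \<in> fst c \<and> dist x (snd c p) < r \<and> cball x (2 * r) \<subseteq> crange c \<and> lipschitz_chart c x r"
proof -
  obtain c where c: "c \<in> A" "p \<in> fst c" using ex_chart by blast
  obtain r m where rm: "r > 0" "m > 0" "cball (snd c p) (2 * r) \<subseteq> crange c"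
    "\<forall>v. m * norm v \<le> met_norm c p v"
    "\<forall>y\<in>cball (snd c p) (2 * r). \<forall>v. met_norm c (cinv c y) v \<le> 2 * met_norm c p v"
    "\<forall>y\<in>cball (snd c p) (2 * r). \<forall>v. met_norm c p v \<le> 2 * met_norm c (cinv c y) v"
    by (rule metric_comparison[OF c])
  let ?x = "snd c p" and ?N = "met_norm c p"
  have six: "6 * (r / 3) = 2 * r" by simp
  have "d (cinv c y) (cinv c z) \<le> 2 * ?N (y - z)" if "y \<in> cball ?x (2 * r)" "z \<in> cball ?x (2 * r)" for y z
  proof -
    have "d (cinv c y) (cinv c z) \<le> 2 * ?N (z - y)"
      by (rule d_upper[OF c(1) convex_cball rm(3) that]) (use rm(5) in blast)
    moreover have "?N (z - y) = ?N (y - z)" using met_norm_scale[where c=c and p=p and a="-1" and v="y - z"] by simp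
    ultimately show ?thesis by simp
  qed
  then have "lipschitz_chart c ?x (r / 3)"
    unfolding lipschitz_chart_def six using rm(3,6) met_norm_scale[where c=c and p=p]
    by (intro conjI exI[of _ ?N]) (auto simp: abs_of_nonneg)
  moreover have "cball ?x (2 * (r / 3)) \<subseteq> crange c" using rm(1,3) by (auto simp: subset_eq)
  ultimately show ?thesis using c rm(1) by (intro exI[of _ c] exI[of _ ?x] exI[of _ "r / 3"]) simp
qed

text \<open>The closest-point projection extends the function from the coordinate ball to the whole space, where
  it can be mollified. The factor 4 is made of the two comparisons of \<open>N\<close> with distance and metric.\<close>
lemma mollify_in_chart:
  assumes c: "c \<in> A" and r: "r > 0" and L: "lipschitz_chart c x r" and \<delta>: "\<delta> > 0" and k: "k > 0"
    and h: "continuous_on UNIV h" "\<And>p q. \<bar>h p - h q\<bar> \<le> k * d p q"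
  shows "\<exists>f. C1_on UNIV f \<and> (\<forall>z\<in>cball x (2 * r). \<bar>f z - h (cinv c z)\<bar> \<le> \<delta>) \<and>
    (\<forall>z\<in>cball x (2 * r). \<forall>v. \<bar>gradient f z \<bullet> v\<bar> \<le> 4 * k * met_norm c (cinv c z) v)"
proof -
  obtain N where N: "\<forall>s v. s \<ge> 0 \<longrightarrow> N (s *\<^sub>R v) = s * N v"
     "\<forall>y\<in>cball x (6 * r). \<forall>z\<in>cball x (6 * r). d (cinv c y) (cinv c z) \<le> 2 * N (y - z)"
     "\<forall>z\<in>cball x (6 * r). \<forall>v. N v \<le> 2 * met_norm c (cinv c z) v" 
    and sub: "cball x (6 * r) \<subseteq> crange c" using L unfolding lipschitz_chart_def by blast
  let ?B = "cball x (6 * r)"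
  have six: "2 * (3 * r) = 6 * r" by simp
  define F where "F z = h (cinv c (closest_point ?B z))" for z
  have ne: "?B \<noteq> {}" using r by simp
  have "continuous_on UNIV (closest_point ?B)" by (rule continuous_on_closest_point) (use ne in auto)
  then have "continuous_on UNIV (\<lambda>z. cinv c (closest_point ?B z))"
    by (rule continuous_on_compose2[OF continuous_on_subset[OF cinv_cont[OF c] sub]]) (use closest_point_in_set[OF closed_cball ne] in auto)
  then have F: "continuous_on UNIV F" unfolding F_def by (rule continuous_on_compose2[OF h(1)]) simp
  have Feq: "F z = h (cinv c z)" if "z \<in> ?B" for z using closest_point_self[OF that] by (simp add: F_def)
  have "\<exists>f. C1_on UNIV f \<and> (\<forall>z\<in>cball x (3 * r). \<bar>f z - F z\<bar> \<le> \<delta>) \<and> (\<forall>z\<in>ball x (3 * r). \<forall>v. \<bar>gradient f z \<bullet> v\<bar> \<le> 2 * k * N v)"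
  proof (rule mollify_lipschitz[OF F _ \<delta>])
    show "0 < 3 * r" using r by simp
    show "2 * k * N (s *\<^sub>R v) = s * (2 * k * N v)" if "s \<ge> 0" for s v using N(1) that by simp
    fix y z assume "y \<in> cball x (2 * (3 * r))" "z \<in> cball x (2 * (3 * r))"
    then have yz: "y \<in> ?B" "z \<in> ?B" unfolding six .
    have "\<bar>F y - F z\<bar> \<le> k * d (cinv c y) (cinv c z)" using h(2) Feq[OF yz(1)] Feq[OF yz(2)] by simp
    also have "\<dots> \<le> k * (2 * N (y - z))" using N(2) yz k by (intro mult_left_mono) auto
    finally show "\<bar>F y - F z\<bar> \<le> 2 * k * N (y - z)" by simp
  qed
  then obtain f where f: "C1_on UNIV f" "\<forall>z\<in>cball x (3 * r). \<bar>f z - F z\<bar> \<le> \<delta>" "\<forall>z\<in>ball x (3 * r). \<forall>v. \<bar>gradient f z \<bullet> v\<bar> \<le> 2 * k * N v" by blast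
  show ?thesis
  proof (intro exI[of _ f] conjI ballI allI f(1))
    fix z assume "z \<in> cball x (2 * r)"
    then have z: "z \<in> cball x (3 * r)" "z \<in> ball x (3 * r)" "z \<in> ?B" using r by auto
    have "\<bar>f z - F z\<bar> \<le> \<delta>" using f(2) z(1) by blast
    then show "\<bar>f z - h (cinv c z)\<bar> \<le> \<delta>" unfolding Feq[OF z(3)] .
    fix v
    have "\<bar>gradient f z \<bullet> v\<bar> \<le> 2 * k * N v" using f(3) z(2) by blast
    also have "\<dots> \<le> 2 * k * (2 * met_norm c (cinv c z) v)" using N(3) z(3) k by (intro mult_left_mono) auto
    finally show "\<bar>gradient f z \<bullet> v\<bar> \<le> 4 * k * met_norm c (cinv c z) v" by simp
  qed
qed

text \<open>The function is smoothed in each chart and the pieces are glued by a partition of unity. The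
  gradients of the partition functions \<open>\<zeta>\<^sub>i\<close> add up to zero on the support of \<open>h\<close>, so they only
  meet the error \<open>f\<^sub>i - h\<close>, which is chosen small enough to absorb them. This keeps the Lipschitz
  constant up to a factor that does not depend on the manifold.\<close>
lemma exists_smoothing:
  assumes K: "compact K" and k: "k > 0" and h: "continuous_on UNIV h" "\<And>p q. \<bar>h p - h q\<bar> \<le> k * d p q" and zero: "\<And>q. q \<notin> K \<Longrightarrow> h q = 0" and \<epsilon>: "\<epsilon> > 0"
  shows "\<exists>f. C1M f \<and> (\<forall>q. \<bar>f q - h q\<bar> \<le> \<epsilon>) \<and> (\<forall>w q. C1M w \<longrightarrow> \<bar>gamma f w q\<bar> \<le> 5 * k * sqrt (gamma w w q))"
proof -
  obtain N :: nat and c r x \<zeta> W where pu: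
    "\<forall>i<N. c i \<in> A \<and> r i > 0 \<and> cball (x i) (2 * r i) \<subseteq> crange (c i) \<and> lipschitz_chart (c i) (x i) (r i) \<and> C1M (\<zeta> i) \<and>
       (\<forall>q. 0 \<le> \<zeta> i q) \<and> (\<forall>q. q \<notin> cinv (c i) ` cball (x i) (2 * r i) \<longrightarrow> \<zeta> i q = 0)"
    and le1: "\<forall>q. (\<Sum>i<N. \<zeta> i q) \<le> 1" and W: "open W" "K \<subseteq> W" "\<forall>q\<in>W. (\<Sum>i<N. \<zeta> i q) = 1"
    using partition_of_unity[OF K, where P=lipschitz_chart, OF ex_lipschitz_chart] by blast
  have c: "c i \<in> A" and r: "r i > 0" and sub: "cball (x i) (2 * r i) \<subseteq> crange (c i)" and L: "lipschitz_chart (c i) (x i) (r i)"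
    and \<zeta>: "C1M (\<zeta> i)" and \<zeta>nn: "0 \<le> \<zeta> i q" and \<zeta>0: "q \<notin> cinv (c i) ` cball (x i) (2 * r i) \<Longrightarrow> \<zeta> i q = 0" if "i < N" for i q
    using pu that by blast+
  let ?S = "\<lambda>i. cinv (c i) ` cball (x i) (2 * r i)"
  have Scomp: "compact (?S i)" if "i < N" for i using cinv_image_compact[OF c[OF that] compact_cball sub[OF that]] .
  have Scl: "closed (?S i)" if "i < N" for i using Scomp[OF that] by (rule compact_imp_closed)
  have "\<forall>i. \<exists>B. B \<ge> 0 \<and> (i < N \<longrightarrow> (\<forall>q. sqrt (gamma (\<zeta> i) (\<zeta> i) q) \<le> B))"
  proof
    fix i show "\<exists>B. B \<ge> 0 \<and> (i < N \<longrightarrow> (\<forall>q. sqrt (gamma (\<zeta> i) (\<zeta> i) q) \<le> B))"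
    proof (cases "i < N")
      case True
      have "continuous_on (?S i) (\<lambda>q. sqrt (gamma (\<zeta> i) (\<zeta> i) q))"
        by (intro continuous_intros continuous_on_subset[OF gamma_cont[OF \<zeta>[OF True] \<zeta>[OF True]]]) auto
      then have "bounded ((\<lambda>q. sqrt (gamma (\<zeta> i) (\<zeta> i) q)) ` ?S i)" by (rule compact_imp_bounded[OF compact_continuous_image[OF _ Scomp[OF True]]])
      then obtain B where B: "B > 0" "\<forall>q\<in>?S i. \<bar>sqrt (gamma (\<zeta> i) (\<zeta> i) q)\<bar> \<le> B" unfolding bounded_pos by auto
      have "sqrt (gamma (\<zeta> i) (\<zeta> i) q) \<le> B" for q
      proof (cases "q \<in> ?S i")
        case False
        have "gamma (\<zeta> i) (\<zeta> i) q = 0" by (rule gamma_zero_off_support[OF \<zeta>[OF True] \<zeta>[OF True] Scl[OF True] \<zeta>0[OF True] False])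
        then show ?thesis using B(1) by simp
      next
        case True
        then have "\<bar>sqrt (gamma (\<zeta> i) (\<zeta> i) q)\<bar> \<le> B" using B(2) by blast
        then show ?thesis by linarith
      qed
      then show ?thesis using B(1) by (intro exI[of _ B]) simp
    qed (intro exI[of _ 0], simp)
  qed
  then obtain B where B: "\<forall>i. B i \<ge> 0 \<and> (i < N \<longrightarrow> (\<forall>q. sqrt (gamma (\<zeta> i) (\<zeta> i) q) \<le> B i))" by (rule choice[THEN exE])
  define \<delta> where "\<delta> = min \<epsilon> (k / (1 + (\<Sum>i<N. B i)))"
  have Bs: "0 \<le> (\<Sum>i<N. B i)" using B by (intro sum_nonneg) simp
  have \<delta>: "\<delta> > 0" "\<delta> \<le> \<epsilon>" "\<delta> * (\<Sum>i<N. B i) \<le> k"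
  proof -
    show "\<delta> > 0" "\<delta> \<le> \<epsilon>" using \<epsilon> k Bs by (auto simp: \<delta>_def)
    have "\<delta> * (\<Sum>i<N. B i) \<le> (k / (1 + (\<Sum>i<N. B i))) * (1 + (\<Sum>i<N. B i))"
      using Bs k by (intro mult_mono) (auto simp: \<delta>_def)
    also have "\<dots> = k" using Bs by simp
    finally show "\<delta> * (\<Sum>i<N. B i) \<le> k" .
  qed
  have "\<forall>i. \<exists>f. i < N \<longrightarrow> (C1_on UNIV f \<and> (\<forall>z\<in>cball (x i) (2 * r i). \<bar>f z - h (cinv (c i) z)\<bar> \<le> \<delta>) \<and>
    (\<forall>z\<in>cball (x i) (2 * r i). \<forall>v. \<bar>gradient f z \<bullet> v\<bar> \<le> 4 * k * met_norm (c i) (cinv (c i) z) v))"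
  proof
    fix i show "\<exists>f. i < N \<longrightarrow> (C1_on UNIV f \<and> (\<forall>z\<in>cball (x i) (2 * r i). \<bar>f z - h (cinv (c i) z)\<bar> \<le> \<delta>) \<and>
      (\<forall>z\<in>cball (x i) (2 * r i). \<forall>v. \<bar>gradient f z \<bullet> v\<bar> \<le> 4 * k * met_norm (c i) (cinv (c i) z) v))"
      using mollify_in_chart[OF c r L \<delta>(1) k h] by (cases "i < N") blast+
  qed
  then obtain f where f: "\<forall>i. i < N \<longrightarrow> (C1_on UNIV (f i) \<and> (\<forall>z\<in>cball (x i) (2 * r i). \<bar>f i z - h (cinv (c i) z)\<bar> \<le> \<delta>) \<and>
    (\<forall>z\<in>cball (x i) (2 * r i). \<forall>v. \<bar>gradient (f i) z \<bullet> v\<bar> \<le> 4 * k * met_norm (c i) (cinv (c i) z) v))" by (rule choice[THEN exE])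
  have fC1: "C1_on UNIV (f i)" and fclose: "\<And>z. z \<in> cball (x i) (2 * r i) \<Longrightarrow> \<bar>f i z - h (cinv (c i) z)\<bar> \<le> \<delta>"
    and fgrad: "\<And>z v. z \<in> cball (x i) (2 * r i) \<Longrightarrow> \<bar>gradient (f i) z \<bullet> v\<bar> \<le> 4 * k * met_norm (c i) (cinv (c i) z) v" if "i < N" for i
    using f[rule_format, OF that] by (blast, blast, blast)
  define u where "u i q = (if q \<in> fst (c i) then ((\<zeta> i \<circ> cinv (c i)) (snd (c i) q) * f i (snd (c i) q)) else 0)" for i q
  have Sfst: "q \<in> fst (c i)" if "i < N" "q \<in> ?S i" for i q using subsetD[OF cinv_image_subset[OF c[OF that(1)] sub[OF that(1)]] that(2)] .
  have Ssnd: "snd (c i) q \<in> cball (x i) (2 * r i)" if i: "i < N" and q: "q \<in> ?S i" for i q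
  proof -
    obtain z where z: "z \<in> cball (x i) (2 * r i)" "q = cinv (c i) z" using q by blast
    then show ?thesis using chart_cinv[OF c[OF i] subsetD[OF sub[OF i] z(1)]] by simp
  qed
  have u1: "C1M (u i)" if i: "i < N" for i
    unfolding u_def
  proof (rule C1M_extend_by_0[OF c[OF i] _ compact_cball sub[OF i]])
    show "C1_on (crange (c i)) (\<lambda>z. (\<zeta> i \<circ> cinv (c i)) z * f i z)"
      by (intro C1_on_mult C1M_chart[OF \<zeta>[OF i] c[OF i]] C1_on_subset[OF fC1[OF i] subset_UNIV])
    fix z assume z: "z \<in> crange (c i) - cball (x i) (2 * r i)"
    have "cinv (c i) z \<notin> ?S i"
    proof
      assume "cinv (c i) z \<in> ?S i"
      from Ssnd[OF i this] show False using z chart_cinv[OF c[OF i]] by simp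
    qed
    then show "(\<zeta> i \<circ> cinv (c i)) z * f i z = 0" using \<zeta>0[OF i] by simp
  qed
  have ueq: "u i q = \<zeta> i q * f i (snd (c i) q)" if "i < N" "q \<in> ?S i" for i q
    using Sfst[OF that] cinv_chart[OF c[OF that(1)]] by (simp add: u_def)
  have u0: "u i q = 0" if "i < N" "q \<notin> ?S i" for i q
    using \<zeta>0[OF that] cinv_chart[OF c[OF that(1)]] by (simp add: u_def)
  have close: "\<bar>u i q - \<zeta> i q * h q\<bar> \<le> \<zeta> i q * \<delta>" if i: "i < N" for i q
  proof (cases "q \<in> ?S i")
    case True
    have "\<bar>f i (snd (c i) q) - h (cinv (c i) (snd (c i) q))\<bar> \<le> \<delta>" by (rule fclose[OF i Ssnd[OF i True]])
    then have "\<bar>f i (snd (c i) q) - h q\<bar> \<le> \<delta>" using cinv_chart[OF c[OF i] Sfst[OF i True]] by simp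
    then have "\<zeta> i q * \<bar>f i (snd (c i) q) - h q\<bar> \<le> \<zeta> i q * \<delta>" using \<zeta>nn[OF i] by (intro mult_left_mono)
    moreover have "u i q - \<zeta> i q * h q = \<zeta> i q * (f i (snd (c i) q) - h q)" using ueq[OF i True] by (simp add: right_diff_distrib)
    ultimately show ?thesis using \<zeta>nn[OF i, of q] by (simp add: abs_mult)
  qed (simp add: u0[OF i] \<zeta>0[OF i])
  have gu: "\<bar>gamma (u i) w q - h q * gamma (\<zeta> i) w q\<bar> \<le> (\<zeta> i q * (4 * k) + \<delta> * B i) * sqrt (gamma w w q)" if i: "i < N" and w: "C1M w" for i w q
  proof (cases "q \<in> ?S i")
    case False
    have "gamma (u i) w q = 0" by (rule gamma_zero_off_support[OF u1[OF i] w Scl[OF i] u0[OF i] False])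
    moreover have "gamma (\<zeta> i) w q = 0" by (rule gamma_zero_off_support[OF \<zeta>[OF i] w Scl[OF i] \<zeta>0[OF i] False])
    moreover have "0 \<le> (\<zeta> i q * (4 * k) + \<delta> * B i) * sqrt (gamma w w q)"
      using \<zeta>nn[OF i, of q] k \<delta>(1) B gamma_nonneg[OF w] by (intro mult_nonneg_nonneg add_nonneg_nonneg) auto
    ultimately show ?thesis by simp
  next
    case True
    let ?c = "c i" and ?z = "snd (c i) q"
    have q: "q \<in> fst ?c" by (rule Sfst[OF i True])
    have zz: "?z \<in> cball (x i) (2 * r i)" by (rule Ssnd[OF i True])
    have qz: "cinv ?c ?z = q" by (rule cinv_chart[OF c[OF i] q])
    have fd: "f i differentiable (at ?z)" using C1_on_differentiable[OF fC1[OF i] open_UNIV] by simp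
    have "chart_grad ?c (u i) q = gradient (\<lambda>z. (\<zeta> i \<circ> cinv ?c) z * f i z) ?z"
      unfolding chart_grad_def
      by (rule gradient_cong[OF crange_open[OF c[OF i]]]) (use q cinv_in[OF c[OF i]] chart_cinv[OF c[OF i]] in \<open>auto simp: u_def\<close>)
    also have "\<dots> = (\<zeta> i \<circ> cinv ?c) ?z *\<^sub>R gradient (f i) ?z + f i ?z *\<^sub>R gradient (\<zeta> i \<circ> cinv ?c) ?z"
      by (rule gradient_mult[OF C1M_differentiable[OF \<zeta>[OF i] c[OF i] q] fd])
    finally have grad: "chart_grad ?c (u i) q = \<zeta> i q *\<^sub>R gradient (f i) ?z + f i ?z *\<^sub>R chart_grad ?c (\<zeta> i) q"
      using qz by (simp add: chart_grad_def)
    let ?X = "matrix_inv (g ?c q) *v chart_grad ?c w q"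
    have guw: "gamma (u i) w q = \<zeta> i q * (gradient (f i) ?z \<bullet> ?X) + f i ?z * gamma (\<zeta> i) w q"
      unfolding gamma_chart[OF c[OF i] q u1[OF i] w] gamma_chart[OF c[OF i] q \<zeta>[OF i] w] chart_gamma_def grad
      by (simp add: inner_add_left)
    have X: "met_norm ?c q ?X = sqrt (gamma w w q)"
      unfolding gamma_chart[OF c[OF i] q w w] chart_gamma_def chart_grad_metric_inv[OF c[OF i] q] ..
    have a: "\<bar>\<zeta> i q * (gradient (f i) ?z \<bullet> ?X)\<bar> \<le> \<zeta> i q * (4 * k * sqrt (gamma w w q))"
    proof -
      have "\<bar>gradient (f i) ?z \<bullet> ?X\<bar> \<le> 4 * k * met_norm ?c (cinv ?c ?z) ?X" by (rule fgrad[OF i zz])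
      then have "\<bar>gradient (f i) ?z \<bullet> ?X\<bar> \<le> 4 * k * sqrt (gamma w w q)" unfolding qz X .
      then show ?thesis using \<zeta>nn[OF i, of q] by (simp add: abs_mult mult_left_mono)
    qed
    have b: "\<bar>(f i ?z - h q) * gamma (\<zeta> i) w q\<bar> \<le> \<delta> * (B i * sqrt (gamma w w q))"
    proof -
      have 1: "\<bar>f i ?z - h q\<bar> \<le> \<delta>" using fclose[OF i zz] unfolding qz .
      have "\<bar>gamma (\<zeta> i) w q\<bar> \<le> sqrt (gamma (\<zeta> i) (\<zeta> i) q) * sqrt (gamma w w q)" by (rule gamma_cauchy_schwarz[OF \<zeta>[OF i] w])
      also have "\<dots> \<le> B i * sqrt (gamma w w q)" using B i gamma_nonneg[OF w] by (intro mult_right_mono) auto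
      finally show ?thesis unfolding abs_mult using 1 \<delta>(1) by (intro mult_mono) auto
    qed
    have "gamma (u i) w q - h q * gamma (\<zeta> i) w q = \<zeta> i q * (gradient (f i) ?z \<bullet> ?X) + (f i ?z - h q) * gamma (\<zeta> i) w q"
      unfolding guw by (simp add: algebra_simps)
    then have "\<bar>gamma (u i) w q - h q * gamma (\<zeta> i) w q\<bar> \<le> \<zeta> i q * (4 * k * sqrt (gamma w w q)) + \<delta> * (B i * sqrt (gamma w w q))"
      using a b by linarith
    then show ?thesis by (simp add: algebra_simps)
  qed
  define F where "F q = (\<Sum>i<N. u i q)" for q
  have F1: "C1M F" unfolding F_def by (rule C1M_sum) (use u1 in auto)
  have sumh: "(\<Sum>i<N. \<zeta> i q) * h q = h q" for q
    using W zero by (cases "q \<in> K") auto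
  have "\<bar>F q - h q\<bar> \<le> \<epsilon>" for q
  proof -
    have "F q - h q = (\<Sum>i<N. u i q - \<zeta> i q * h q)" unfolding F_def sum_subtractf sum_distrib_right[symmetric] sumh ..
    then have "\<bar>F q - h q\<bar> \<le> (\<Sum>i<N. \<bar>u i q - \<zeta> i q * h q\<bar>)" by simp
    also have "\<dots> \<le> (\<Sum>i<N. \<zeta> i q * \<delta>)" using close by (intro sum_mono) auto
    also have "\<dots> = (\<Sum>i<N. \<zeta> i q) * \<delta>" by (simp add: sum_distrib_right)
    also have "\<dots> \<le> 1 * \<delta>" using le1 \<delta>(1) by (intro mult_right_mono) auto
    finally show ?thesis using \<delta>(2) by simp
  qed
  moreover have "\<bar>gamma F w q\<bar> \<le> 5 * k * sqrt (gamma w w q)" if w: "C1M w" for w q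
  proof -
    have "h q * (\<Sum>i<N. gamma (\<zeta> i) w q) = 0"
    proof (cases "q \<in> K")
      case True
      have "(\<Sum>i<N. gamma (\<zeta> i) w q) = gamma (\<lambda>q. \<Sum>i<N. \<zeta> i q) w q" by (rule gamma_sum_left[symmetric]) (use \<zeta> w in auto)
      also have "\<dots> = 0"
      proof -
        obtain c' where c': "c' \<in> A" "q \<in> fst c'" using ex_chart by blast
        have "C1M (\<lambda>q. \<Sum>i<N. \<zeta> i q)" by (rule C1M_sum) (use \<zeta> in auto)
        moreover have "chart_grad c' (\<lambda>q. \<Sum>i<N. \<zeta> i q) q = chart_grad c' (\<lambda>q. 1) q"
          by (rule chart_grad_cong[OF c' W(1)]) (use W True in auto)
        moreover have "chart_grad c' (\<lambda>q. 1) q = 0" by (simp add: chart_grad_def o_def gradient_const)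
        ultimately show ?thesis using gamma_chart[OF c' _ w] by (simp add: chart_gamma_def)
      qed
      finally show ?thesis by simp
    qed (simp add: zero)
    then have "gamma F w q = (\<Sum>i<N. gamma (u i) w q - h q * gamma (\<zeta> i) w q)"
      unfolding F_def[abs_def] sum_subtractf sum_distrib_left[symmetric] using gamma_sum_left[of "{..<N}" u w q] u1 w by simp
    then have "\<bar>gamma F w q\<bar> \<le> (\<Sum>i<N. \<bar>gamma (u i) w q - h q * gamma (\<zeta> i) w q\<bar>)" by simp
    also have "\<dots> \<le> (\<Sum>i<N. (\<zeta> i q * (4 * k) + \<delta> * B i) * sqrt (gamma w w q))" using gu[OF _ w] by (intro sum_mono) auto
    also have "\<dots> = ((\<Sum>i<N. \<zeta> i q) * (4 * k) + \<delta> * (\<Sum>i<N. B i)) * sqrt (gamma w w q)"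
      by (simp add: sum_distrib_right sum_distrib_left sum.distrib distrib_right)
    also have "\<dots> \<le> (1 * (4 * k) + k) * sqrt (gamma w w q)"
      using le1 k \<delta>(3) gamma_nonneg[OF w] by (intro mult_right_mono add_mono) auto
    finally show ?thesis by simp
  qed
  ultimately show ?thesis using F1 by blast
qed

text \<open>The distance to \<open>p\<close> is only Lipschitz. A clamped affine function of it is smoothed with an error of at most
  a quarter, and a smooth step between the levels \<open>1/4\<close> and \<open>3/4\<close> restores the exact values 0 and 1.
  Completeness enters here: the cutoff has compact support because closed balls are compact.\<close>
lemma exists_cutoff:
  assumes R: "R > 0"
  shows "\<exists>\<eta>. C1M \<eta> \<and> (\<forall>q. 0 \<le> \<eta> q \<and> \<eta> q \<le> 1) \<and> (\<forall>q. d p q \<le> R \<longrightarrow> \<eta> q = 1) \<and> (\<forall>q. d p q > 2 * R \<longrightarrow> \<eta> q = 0) \<and>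
    (\<forall>w q. C1M w \<longrightarrow> \<bar>gamma \<eta> w q\<bar> \<le> 40 / R * sqrt (gamma w w q))"
proof -
  \<comment> \<open>The constant 40 is 8 for the slope of the step times 5 for the smoothing.\<close>
  define h where "h q = max 0 (min 1 (2 - d p q / R))" for q
  have lip: "\<bar>h x - h y\<bar> \<le> (1 / R) * d x y" for x y
  proof -
    have "\<bar>d p x - d p y\<bar> \<le> d x y" using d_triangle[of p x y] d_triangle[of p y x] d_sym[of x y] by linarith
    then have 1: "\<bar>d p x / R - d p y / R\<bar> \<le> 1 / R * d x y" using R by (simp add: diff_divide_distrib[symmetric] abs_divide divide_right_mono)
    have clamp: "\<bar>max 0 (min 1 (2 - X)) - max 0 (min 1 (2 - Y))\<bar> \<le> \<bar>X - Y\<bar>" for X Y :: real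
      by (auto simp: max_def min_def abs_if)
    show ?thesis unfolding h_def by (rule order_trans[OF clamp 1])
  qed
  have "continuous_on UNIV h" unfolding h_def[abs_def] divide_inverse by (intro continuous_intros d_continuous)
  moreover have "h q = 0" if "q \<notin> {q. d p q \<le> 2 * R}" for q
    using that R by (simp add: h_def field_simps)
  ultimately obtain f where f: "C1M f" "\<forall>q. \<bar>f q - h q\<bar> \<le> 1 / 4" "\<forall>w q. C1M w \<longrightarrow> \<bar>gamma f w q\<bar> \<le> 5 * (1 / R) * sqrt (gamma w w q)"
    using exists_smoothing[OF compact_d_cball _ _ lip, of p "2 * R" "1 / 4"] R by auto
  define s where "s t = smooth_step (2 * t - 1 / 2)" for t
  have s1: "C1_on UNIV s" unfolding s_def[abs_def]
    by (rule C1_on_compose[OF _ C1_on_smooth_step subset_UNIV]) (intro C1_on_diff C1_on_cmult C1_on_const C1_on_bounded_linear bounded_linear_ident)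
  have sder: "(s has_real_derivative smooth_step' (2 * t - 1 / 2) * 2) (at t)" for t
    unfolding s_def[abs_def] by (rule DERIV_chain2[OF smooth_step_deriv]) (auto intro!: derivative_eq_intros)
  show ?thesis
  proof (intro exI[of _ "\<lambda>q. s (f q)"] conjI allI impI)
    show "C1M (\<lambda>q. s (f q))" by (rule C1M_compose[OF f(1) s1])
    show "0 \<le> s (f q)" "s (f q) \<le> 1" for q by (auto simp: s_def smooth_step_nonneg smooth_step_le1)
    show "s (f q) = 1" if "d p q \<le> R" for q
    proof -
      have "h q = 1" using that R by (simp add: h_def field_simps)
      then have "f q \<ge> 3 / 4" using f(2)[rule_format, of q] by linarith
      then show ?thesis unfolding s_def by (intro smooth_step_1) simp
    qed
    show "s (f q) = 0" if "d p q > 2 * R" for q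
    proof -
      have "h q = 0" using that R by (simp add: h_def field_simps)
      then have "f q \<le> 1 / 4" using f(2)[rule_format, of q] by linarith
      then show ?thesis unfolding s_def by (intro smooth_step_0) simp
    qed
    fix w q assume w: "C1M w"
    have "\<bar>gamma (\<lambda>q. s (f q)) w q\<bar> = \<bar>smooth_step' (2 * f q - 1 / 2) * 2\<bar> * \<bar>gamma f w q\<bar>"
      using gamma_compose_left[OF f(1) w s1 sder] by (simp add: abs_mult)
    also have "\<dots> \<le> 8 * (5 * (1 / R) * sqrt (gamma w w q))"
      using f(3) w abs_smooth_step'[of "2 * f q - 1 / 2"] by (intro mult_mono) (auto simp: abs_mult)
    finally show "\<bar>gamma (\<lambda>q. s (f q)) w q\<bar> \<le> 40 / R * sqrt (gamma w w q)" by simp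
  qed
qed

end

section \<open>Ancient caloric functions: regularity\<close>

definition time_deriv :: "('a \<times> real \<Rightarrow> real) \<Rightarrow> 'a \<times> real \<Rightarrow> real" where
  "time_deriv w = (\<lambda>(p, t). vector_derivative (\<lambda>s. w (p, s)) (at t within {..0}))"

context complete_riemannian_manifold begin

abbreviation caloric :: "('a \<times> real \<Rightarrow> real) \<Rightarrow> bool" where "caloric \<equiv> ancient_caloric A g"

definition chart_rep :: "('a, 'n) chart \<Rightarrow> ('a \<times> real \<Rightarrow> real) \<Rightarrow> (real ^ 'n) \<times> real \<Rightarrow> real" where
  "chart_rep c w = (\<lambda>(x, t). w (cinv c x, t))"

lemma caloric_Ck: "caloric w \<Longrightarrow> c \<in> A \<Longrightarrow> Ck_on k (crange c \<times> {..0}) (chart_rep c w)"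
  unfolding ancient_caloric_def chart_rep_def smooth_on_def by (auto simp: case_prod_unfold)

lemma caloric_C1: "caloric w \<Longrightarrow> c \<in> A \<Longrightarrow> C1_on (crange c \<times> {..0}) (chart_rep c w)"
  using Ck_on_imp_C1_on[OF caloric_Ck[where k=1]] by simp

lemma time_deriv_chart_rep: "vector_derivative (\<lambda>s. chart_rep c w (x, s)) (at t within {..0}) = time_deriv w (cinv c x, t)"
  by (simp add: chart_rep_def time_deriv_def)

lemma time_deriv_C1: "caloric w \<Longrightarrow> c \<in> A \<Longrightarrow> C1_on (crange c \<times> {..0}) (chart_rep c (time_deriv w))"
  using C1_on_time_derivative(1)[OF crange_open caloric_Ck[where k="Suc (Suc 0)"]] 
  unfolding time_deriv_chart_rep by (simp add: chart_rep_def)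

lemma chart_rep_slice: "(\<lambda>p. w (p, t)) \<circ> cinv c = (\<lambda>x. chart_rep c w (x, t))"
  by (simp add: chart_rep_def o_def)

lemma chart_grad_chart_rep: "chart_grad c (\<lambda>p. w (p, t)) p = gradient (\<lambda>x. chart_rep c w (x, t)) (snd c p)"
  by (simp add: chart_grad_def chart_rep_slice)

lemma C1_cylinder_imp_C1M:
  "(\<And>c. c \<in> A \<Longrightarrow> C1_on (crange c \<times> {..0}) (chart_rep c w)) \<Longrightarrow> t \<le> 0 \<Longrightarrow> C1M (\<lambda>p. w (p, t))"
  unfolding C1M_def chart_rep_slice using C1_on_cylinder_slices(2)[OF crange_open] by blast

lemma caloric_C1M: "caloric w \<Longrightarrow> t \<le> 0 \<Longrightarrow> C1M (\<lambda>p. w (p, t))"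
  by (rule C1_cylinder_imp_C1M[OF caloric_C1])

lemma time_deriv_C1M: "caloric w \<Longrightarrow> t \<le> 0 \<Longrightarrow> C1M (\<lambda>p. time_deriv w (p, t))"
  by (rule C1_cylinder_imp_C1M[OF time_deriv_C1])

lemma caloric_C2M: assumes w: "caloric w" and t: "t \<le> 0" shows "C2M (\<lambda>p. w (p, t))"
  unfolding C2M_def
proof (intro conjI ballI allI caloric_C1M[OF assms])
  fix c i assume c: "c \<in> A"
  have "C1_on (crange c \<times> {..0}) (\<lambda>(x, t). gradient (\<lambda>y. chart_rep c w (y, t)) x $ i)"
    by (rule C1_on_time_derivative(2)[OF crange_open[OF c] caloric_Ck[OF w c]])
  from C1_on_cylinder_slices(2)[OF crange_open[OF c] this t]
  show "C1_on (crange c) (\<lambda>x. gradient ((\<lambda>p. w (p, t)) \<circ> cinv c) x $ i)" unfolding chart_rep_slice by simp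
qed

lemma caloric_laplacian: "caloric w \<Longrightarrow> t \<le> 0 \<Longrightarrow> has_laplacian A g (\<lambda>p. w (p, t)) (\<lambda>p. time_deriv w (p, t))"
  unfolding ancient_caloric_def time_deriv_def by simp

text \<open>Smoothness in a chart up to the terminal time contains the existence of the one-sided derivative.\<close>
lemma caloric_time_derivative:
  assumes w: "caloric w" and t: "t \<le> 0" shows "((\<lambda>s. w (p, s)) has_vector_derivative time_deriv w (p, t)) (at t within {..0})"
proof -
  obtain c where c: "c \<in> A" "p \<in> fst c" using ex_chart by blast
  have "snd c p \<in> crange c" using c by simp
  from C1_on_cylinder_slices(1)[OF crange_open[OF c(1)] caloric_C1[OF w c(1)] this t]
  show ?thesis unfolding time_deriv_chart_rep using cinv_chart[OF c] by (simp add: chart_rep_def)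
qed

lemma continuous_on_cylinder:
  assumes "\<And>c. c \<in> A \<Longrightarrow> continuous_on (fst c \<times> {..0::real}) F" shows "continuous_on (UNIV \<times> {..0}) F"
  unfolding continuous_on_eq_continuous_within
proof
  fix z :: "'a \<times> real" assume z: "z \<in> UNIV \<times> {..0}"
  obtain c where c: "c \<in> A" "fst z \<in> fst c" using ex_chart by blast
  have "continuous (at z within fst c \<times> {..0}) F" 
  proof -
    have "z \<in> fst c \<times> {..0}" using z c(2) by (auto simp: mem_Times_iff)
    then show ?thesis using assms[OF c(1), unfolded continuous_on_eq_continuous_within] by blast
  qed
  moreover have "at z within fst c \<times> {..0} = at z within UNIV \<times> {..0}"
    by (rule at_within_nhd[of _ "fst c \<times> UNIV"]) (use c z in \<open>auto simp: mem_Times_iff intro!: open_Times chart_open\<close>)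
  ultimately show "continuous (at z within UNIV \<times> {..0}) F" by simp
qed

lemma continuous_on_chart_cylinder:
  assumes "c \<in> A" "continuous_on (crange c \<times> {..0}) F" shows "continuous_on (fst c \<times> {..0}) (\<lambda>z. F (snd c (fst z), snd z))"
  using assms(2) 
  by (rule continuous_on_compose2) (auto intro!: continuous_intros continuous_on_compose2[OF chart_cont[OF assms(1)]])

lemma cylinder_continuous:
  assumes "\<And>c. c \<in> A \<Longrightarrow> C1_on (crange c \<times> {..0}) (chart_rep c w)" shows "continuous_on (UNIV \<times> {..0}) w"
proof (rule continuous_on_cylinder)
  fix c assume c: "c \<in> A"
  have "continuous_on (fst c \<times> {..0}) (\<lambda>z. chart_rep c w (snd c (fst z), snd z))"
    by (rule continuous_on_chart_cylinder[OF c C1_on_imp_continuous_on[OF assms[OF c]]])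
  then show "continuous_on (fst c \<times> {..0}) w" by (rule continuous_on_eq) (auto simp: chart_rep_def cinv_chart[OF c])
qed

lemma cylinder_gamma_continuous:
  assumes v: "\<And>c. c \<in> A \<Longrightarrow> C1_on (crange c \<times> {..0}) (chart_rep c v)" and w: "\<And>c. c \<in> A \<Longrightarrow> C1_on (crange c \<times> {..0}) (chart_rep c w)"
  shows "continuous_on (UNIV \<times> {..0}) (\<lambda>z. gamma (\<lambda>p. v (p, snd z)) (\<lambda>p. w (p, snd z)) (fst z))"
proof (rule continuous_on_cylinder)
  fix c assume c: "c \<in> A"
  have G: "continuous_on (fst c \<times> {..0}) (\<lambda>z. chart_grad c (\<lambda>p. u (p, snd z)) (fst z))"
    if u: "C1_on (crange c \<times> {..0}) (chart_rep c u)" for u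
    using continuous_on_chart_cylinder[OF c C1_on_cylinder_slices(4)[OF crange_open[OF c] u]] by (simp add: chart_grad_chart_rep)
  have "continuous_on (fst c \<times> {..0}) (\<lambda>z. chart_gamma c (\<lambda>p. v (p, snd z)) (\<lambda>p. w (p, snd z)) (fst z))"
    unfolding chart_gamma_def
    by (rule continuous_on_chart_gamma[OF c G[OF v[OF c]] G[OF w[OF c]]]) (auto intro!: continuous_intros)
  then show "continuous_on (fst c \<times> {..0}) (\<lambda>z. gamma (\<lambda>p. v (p, snd z)) (\<lambda>p. w (p, snd z)) (fst z))"
    by (rule continuous_on_eq) (use gamma_chart[OF c _ C1_cylinder_imp_C1M[OF v] C1_cylinder_imp_C1M[OF w]] in auto)
qed

text \<open>The metric does not depend on time, so only the two gradients are differentiated, and by symmetry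
  of the metric the two terms agree.\<close>
lemma gamma_time_derivative:
  assumes w: "caloric w" and t: "t \<le> 0"
  shows "((\<lambda>s. gamma (\<lambda>p. w (p, s)) (\<lambda>p. w (p, s)) p) has_vector_derivative 2 * gamma (\<lambda>p. time_deriv w (p, t)) (\<lambda>p. w (p, t)) p) (at t within {..0})"
proof -
  obtain c where c: "c \<in> A" "p \<in> fst c" using ex_chart by blast
  let ?x = "snd c p" and ?M = "matrix_inv (g c p)"
  let ?G = "\<lambda>s. gradient (\<lambda>y. chart_rep c w (y, s)) ?x"
  let ?D = "gradient (\<lambda>y. chart_rep c (time_deriv w) (y, t)) ?x"
  have x: "?x \<in> crange c" using c by simp
  have "((\<lambda>s. ?G s) has_vector_derivative gradient (\<lambda>y. vector_derivative (\<lambda>s. chart_rep c w (y, s)) (at t within {..0})) ?x) (at t within {..0})"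
    by (rule time_derivative_gradient[OF crange_open[OF c(1)] caloric_Ck[OF w c(1)] x t])
  moreover have "(\<lambda>y. vector_derivative (\<lambda>s. chart_rep c w (y, s)) (at t within {..0})) = (\<lambda>y. chart_rep c (time_deriv w) (y, t))"
    unfolding time_deriv_chart_rep by (simp add: chart_rep_def)
  ultimately have G: "(?G has_derivative (\<lambda>r. r *\<^sub>R ?D)) (at t within {..0})"
    by (simp only: has_vector_derivative_def)
  have bl: "bounded_linear (\<lambda>v. ?M *v v)" by (rule matrix_vector_mul_bounded_linear)
  have "((\<lambda>s. ?G s \<bullet> (?M *v ?G s)) has_derivative (\<lambda>r. ?G t \<bullet> (?M *v (r *\<^sub>R ?D)) + (r *\<^sub>R ?D) \<bullet> (?M *v ?G t))) (at t within {..0})"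
    by (rule has_derivative_inner[OF G bounded_linear.has_derivative[OF bl G]])
  moreover have "?G t \<bullet> (?M *v ?D) = ?D \<bullet> (?M *v ?G t)"
    using chart_grad_metric_inv[OF c] metric_inner_commute[OF c] by metis
  then have "(\<lambda>r. ?G t \<bullet> (?M *v (r *\<^sub>R ?D)) + (r *\<^sub>R ?D) \<bullet> (?M *v ?G t)) = (\<lambda>r. r *\<^sub>R (2 * (?D \<bullet> (?M *v ?G t))))"
    by (auto simp: fun_eq_iff matrix_vector_mult_scaleR)
  ultimately have der: "((\<lambda>s. ?G s \<bullet> (?M *v ?G s)) has_vector_derivative 2 * (?D \<bullet> (?M *v ?G t))) (at t within {..0})"
    by (simp only: has_vector_derivative_def)
  have "2 * gamma (\<lambda>p. time_deriv w (p, t)) (\<lambda>p. w (p, t)) p = 2 * (?D \<bullet> (?M *v ?G t))"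
    using gamma_chart[OF c time_deriv_C1M[OF w t] caloric_C1M[OF w t]] by (simp add: chart_gamma_def chart_grad_chart_rep)
  moreover have "gamma (\<lambda>p. w (p, s)) (\<lambda>p. w (p, s)) p = ?G s \<bullet> (?M *v ?G s)" if "s \<in> {..0}" for s
    using gamma_chart[OF c caloric_C1M[OF w] caloric_C1M[OF w], of s s] that by (simp add: chart_gamma_def chart_grad_chart_rep)
  ultimately show ?thesis using has_vector_derivative_transform[OF _ _ der, of "\<lambda>s. gamma (\<lambda>p. w (p, s)) (\<lambda>p. w (p, s)) p"] t by simp
qed

section \<open>The energy estimate\<close>

abbreviation "spacetime \<equiv> vol \<Otimes>\<^sub>M (lborel :: real measure)"

lemma pair_sigma_finite_spacetime: "pair_sigma_finite vol (lborel :: real measure)"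
  by (intro pair_sigma_finite.intro sigma_finite_vol sigma_finite_lborel)

lemma spacetime_integrable:
  assumes F: "continuous_on (UNIV \<times> {..0}) F" and K: "compact K" and T: "T' \<le> 0"
  shows "integrable spacetime (\<lambda>z. indicator (K \<times> {T..T'}) z * (F z :: real))"
proof -
  have clK: "closed (K \<times> {T..T'})" by (intro closed_Times compact_imp_closed K) auto
  have sub: "K \<times> {T..T'} \<subseteq> UNIV \<times> {..0}" using T by auto
  have sets: "sets spacetime = sets (borel :: ('a \<times> real) measure)"
    unfolding borel_prod[symmetric] by (intro sets_pair_measure_cong) auto
  have cF: "continuous_on (K \<times> {T..T'}) F" using continuous_on_subset[OF F sub] .
  have "compact (K \<times> {T..T'})" by (intro compact_Times K) auto
  then obtain B where B: "\<And>z. z \<in> K \<times> {T..T'} \<Longrightarrow> \<bar>F z\<bar> \<le> B"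
    using compact_imp_bounded[OF compact_continuous_image[OF cF]] unfolding bounded_iff by auto
  show ?thesis
  proof (rule integrableI_bounded_set[where A="K \<times> {T..T'}" and B=B])
    show "K \<times> {T..T'} \<in> sets spacetime" unfolding sets using clK by (rule borel_closed)
    have "(\<lambda>z. indicator (K \<times> {T..T'}) z *\<^sub>R F z) \<in> borel_measurable borel"
      by (rule borel_measurable_continuous_on_indicator[OF borel_closed[OF clK] cF])
    then show "(\<lambda>z. indicator (K \<times> {T..T'}) z * F z) \<in> borel_measurable spacetime"
      unfolding measurable_cong_sets[OF sets refl] by simp
    have "emeasure spacetime (K \<times> {T..T'}) = emeasure vol K * emeasure lborel {T..T'}"
      by (rule sigma_finite_measure.emeasure_pair_measure_Times[OF sigma_finite_lborel]) (use K in \<open>auto intro!: borel_closed compact_imp_closed\<close>)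
    also have "\<dots> < \<infinity>" using vol_compact_finite[OF K] emeasure_compact_finite[of "{T..T'}"] by (simp add: ennreal_mult_less_top)
    finally show "emeasure spacetime (K \<times> {T..T'}) < \<infinity>" .
  qed (use B in \<open>auto simp: indicator_def\<close>)
qed

definition cyl :: "'a \<Rightarrow> real \<Rightarrow> real \<Rightarrow> ('a \<times> real) set" where
  "cyl p r T = {q. d p q \<le> r} \<times> {-T..0}"

text \<open>The space-time energy over the parabolic cylinder of radius \<open>R\<close>; time scales like the square of
  distance.\<close>
definition energy :: "'a \<Rightarrow> real \<Rightarrow> ('a \<times> real \<Rightarrow> real) \<Rightarrow> real" where
  "energy p R w = (\<integral>z. indicator (cyl p R (R\<^sup>2)) z * (w z)\<^sup>2 \<partial>spacetime)"

lemma cyl_integrable: "continuous_on (UNIV \<times> {..0}) F \<Longrightarrow> integrable spacetime (\<lambda>z. indicator (cyl p r T) z * (F z :: real))"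
  unfolding cyl_def by (rule spacetime_integrable[OF _ compact_d_cball]) auto

text \<open>With \<open>\<tau> = t + T\<close>, \<open>v = \<partial>\<^sub>t w\<close> and a cutoff \<open>\<eta>\<close> of gradient at most \<open>a\<close>, the time derivative
  of \<open>\<tau>\<^sup>2 \<eta>\<^sup>4 |\<nabla>w|\<^sup>2 + K \<tau> \<eta>\<^sup>2 w\<^sup>2\<close>, after the two applications of Green's formula have been
  subtracted, is controlled by \<open>w\<^sup>2\<close> because each cross term is absorbed by Young's inequality.\<close>
lemma energy_pointwise:
  fixes \<eta> v w gw gwv ge \<tau> a T K :: real
  assumes "0 \<le> \<eta>" "\<eta> \<le> 1" "0 \<le> \<tau>" "\<tau> \<le> T" "gw \<ge> 0" "\<bar>ge\<bar> \<le> a * sqrt gw" "a \<ge> 0" and K: "K = 2 + 16 * T * a\<^sup>2"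
  shows "(2 * \<tau> * (\<eta>^4 * gw) + 2 * \<tau>\<^sup>2 * (\<eta>^4 * gwv) + K * (\<eta>\<^sup>2 * w\<^sup>2) + 2 * K * \<tau> * (\<eta>\<^sup>2 * (w * v)))
     - (2 * \<tau>\<^sup>2 * (\<eta>^4 * v * v + (\<eta>^4 * gwv + 4 * \<eta>^3 * v * ge)) + 2 * K * \<tau> * (\<eta>\<^sup>2 * w * v + (\<eta>\<^sup>2 * gw + 2 * \<eta> * w * ge)))
     \<le> K * (1 + 4 * T * a\<^sup>2) * w\<^sup>2 - \<tau>\<^sup>2 * (\<eta>^4 * v\<^sup>2)"
proof -
  define s where "s = sqrt gw"
  have s: "s \<ge> 0" "gw = s\<^sup>2" using assms by (auto simp: s_def)
  have ge: "ge\<^sup>2 \<le> a\<^sup>2 * s\<^sup>2" using power_mono[OF assms(6), of 2] by (simp add: s_def power_mult_distrib)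
  have K0: "K \<ge> 0" using assms by simp
  have y1: "- 8 * \<eta>^3 * v * ge \<le> \<eta>^4 * v\<^sup>2 + 16 * \<eta>\<^sup>2 * (a\<^sup>2 * s\<^sup>2)"
  proof -
    have "0 \<le> (\<eta>\<^sup>2 * v + 4 * \<eta> * ge)\<^sup>2" by simp
    also have "\<dots> = \<eta>^4 * v\<^sup>2 + 8 * \<eta>^3 * v * ge + 16 * \<eta>\<^sup>2 * ge\<^sup>2" by (simp add: power2_eq_square power3_eq_cube power4_eq_xxxx algebra_simps)
    finally have "- 8 * \<eta>^3 * v * ge \<le> \<eta>^4 * v\<^sup>2 + 16 * \<eta>\<^sup>2 * ge\<^sup>2" by simp
    moreover have "16 * \<eta>\<^sup>2 * ge\<^sup>2 \<le> 16 * \<eta>\<^sup>2 * (a\<^sup>2 * s\<^sup>2)" using ge by (intro mult_left_mono) auto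
    ultimately show ?thesis by linarith
  qed
  have y2: "- 4 * \<eta> * w * ge \<le> \<eta>\<^sup>2 * s\<^sup>2 + 4 * a\<^sup>2 * w\<^sup>2"
  proof (cases "a = 0")
    case True
    then have "ge = 0" using assms(6) by simp
    then show ?thesis by simp
  next
    case False
    have "- 4 * \<eta> * w * ge \<le> 4 * \<eta> * (\<bar>w\<bar> * (a * s))"
    proof -
      have "- (w * ge) \<le> \<bar>w\<bar> * \<bar>ge\<bar>" by (metis abs_ge_minus_self abs_mult)
      also have "\<dots> \<le> \<bar>w\<bar> * (a * s)" using assms(6) by (intro mult_left_mono) (auto simp: s_def)
      finally have "4 * \<eta> * (- (w * ge)) \<le> 4 * \<eta> * (\<bar>w\<bar> * (a * s))" using assms(1) by (intro mult_left_mono) auto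
      then show ?thesis by simp
    qed
    also have "\<dots> \<le> \<eta>\<^sup>2 * s\<^sup>2 + 4 * a\<^sup>2 * w\<^sup>2"
    proof -
      have "0 \<le> (\<eta> * s - 2 * a * \<bar>w\<bar>)\<^sup>2" by simp
      also have "\<dots> = \<eta>\<^sup>2 * s\<^sup>2 - 4 * \<eta> * (\<bar>w\<bar> * (a * s)) + 4 * a\<^sup>2 * \<bar>w\<bar>\<^sup>2" by (simp add: power2_eq_square algebra_simps del: power2_abs abs_mult_self_eq)
      finally show ?thesis by simp
    qed
    finally show ?thesis .
  qed
  have e42: "\<eta>^4 \<le> \<eta>\<^sup>2" using assms(1,2) by (intro power_decreasing) auto
  have e2: "\<eta>\<^sup>2 \<le> 1" using assms(1,2) by (simp add: power_le_one)
  have "(2 * \<tau> * (\<eta>^4 * gw) + 2 * \<tau>\<^sup>2 * (\<eta>^4 * gwv) + K * (\<eta>\<^sup>2 * w\<^sup>2) + 2 * K * \<tau> * (\<eta>\<^sup>2 * (w * v)))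
     - (2 * \<tau>\<^sup>2 * (\<eta>^4 * v * v + (\<eta>^4 * gwv + 4 * \<eta>^3 * v * ge)) + 2 * K * \<tau> * (\<eta>\<^sup>2 * w * v + (\<eta>\<^sup>2 * gw + 2 * \<eta> * w * ge)))
     = 2 * \<tau> * (\<eta>^4 * s\<^sup>2) + K * (\<eta>\<^sup>2 * w\<^sup>2) - 2 * (\<tau>\<^sup>2 * (\<eta>^4 * v\<^sup>2)) + \<tau>\<^sup>2 * (- 8 * \<eta>^3 * v * ge) - 2 * (K * \<tau> * (\<eta>\<^sup>2 * s\<^sup>2)) + K * \<tau> * (- 4 * \<eta> * w * ge)"
    unfolding s(2) by (simp add: power2_eq_square algebra_simps)
  also have "\<dots> \<le> 2 * \<tau> * (\<eta>\<^sup>2 * s\<^sup>2) + K * (1 * w\<^sup>2) - 2 * (\<tau>\<^sup>2 * (\<eta>^4 * v\<^sup>2)) + \<tau>\<^sup>2 * (\<eta>^4 * v\<^sup>2 + 16 * \<eta>\<^sup>2 * (a\<^sup>2 * s\<^sup>2)) - 2 * (K * \<tau> * (\<eta>\<^sup>2 * s\<^sup>2)) + K * \<tau> * (\<eta>\<^sup>2 * s\<^sup>2 + 4 * a\<^sup>2 * w\<^sup>2)"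
    by (intro add_mono diff_mono order_refl mult_left_mono mult_right_mono y1 y2 e42 e2) (use assms K0 in auto)
  also have "\<dots> = (2 * \<tau> + 16 * \<tau> * \<tau> * a\<^sup>2 - K * \<tau>) * (\<eta>\<^sup>2 * s\<^sup>2) + K * (1 + 4 * \<tau> * a\<^sup>2) * w\<^sup>2 - \<tau>\<^sup>2 * (\<eta>^4 * v\<^sup>2)"
    by (simp add: power2_eq_square algebra_simps)
  also have "\<dots> \<le> 0 * (\<eta>\<^sup>2 * s\<^sup>2) + K * (1 + 4 * T * a\<^sup>2) * w\<^sup>2 - \<tau>\<^sup>2 * (\<eta>^4 * v\<^sup>2)"
  proof -
    have "\<tau> * (\<tau> * (16 * a\<^sup>2)) \<le> \<tau> * (T * (16 * a\<^sup>2))" using assms by (intro mult_left_mono mult_right_mono) auto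
    then have "2 * \<tau> + 16 * \<tau> * \<tau> * a\<^sup>2 - K * \<tau> \<le> 0" unfolding K by (simp add: algebra_simps)
    then have 1: "(2 * \<tau> + 16 * \<tau> * \<tau> * a\<^sup>2 - K * \<tau>) * (\<eta>\<^sup>2 * s\<^sup>2) \<le> 0 * (\<eta>\<^sup>2 * s\<^sup>2)" by (intro mult_right_mono) auto
    have "4 * \<tau> * a\<^sup>2 \<le> 4 * T * a\<^sup>2" using assms by (intro mult_right_mono) auto
    then have "K * (1 + 4 * \<tau> * a\<^sup>2) * w\<^sup>2 \<le> K * (1 + 4 * T * a\<^sup>2) * w\<^sup>2" using K0 by (intro mult_right_mono mult_left_mono) auto
    then show ?thesis using 1 by linarith
  qed
  finally show ?thesis by simp
qed

lemma energy_density_derivative: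
  fixes G f :: "real \<Rightarrow> real"
  assumes G: "(G has_real_derivative 2 * G') (at t within S)" and f: "(f has_real_derivative v) (at t within S)"
  shows "((\<lambda>s. (s + T)\<^sup>2 * (e4 * G s) + K * (s + T) * (e2 * (f s)\<^sup>2)) has_real_derivative
     2 * (t + T) * (e4 * G t) + 2 * (t + T)\<^sup>2 * (e4 * G') + K * (e2 * (f t)\<^sup>2) + 2 * K * (t + T) * (e2 * (f t * v))) (at t within S)"
  by (rule derivative_eq_intros refl G f | simp add: algebra_simps power2_eq_square)+

text \<open>The reverse Poincare inequality for the heat equation, with the two gradient steps done at once.
  Integrate in time, from \<open>-T\<close> to 0, the derivative of
  \<open>\<tau>\<^sup>2 \<eta>\<^sup>4 |\<nabla>w|\<^sup>2 + K \<tau> \<eta>\<^sup>2 w\<^sup>2\<close>: the weight \<open>\<tau> = t + T\<close> kills the initial value, the terminal value is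
  nonnegative, and Green's formula with the test functions \<open>\<eta>\<^sup>4 \<partial>\<^sub>t w\<close> and \<open>\<eta>\<^sup>2 w\<close> turns the spatial
  gradients into \<open>- \<tau>\<^sup>2 \<eta>\<^sup>4 (\<partial>\<^sub>t w)\<^sup>2\<close> plus multiples of \<open>w\<^sup>2\<close>. The constants are universal because
  \<open>T a\<^sup>2\<close> is scale invariant.\<close>
lemma energy_time_deriv:
  assumes w: "caloric w" and R: "R > 0"
  shows "R^4 * energy p R (time_deriv w) \<le> (51202 * 12801) * energy p (2 * R) w"
proof -
  obtain \<eta> where \<eta>: "C1M \<eta>" "\<And>q. 0 \<le> \<eta> q" "\<And>q. \<eta> q \<le> 1" "\<And>q. d p q \<le> R \<Longrightarrow> \<eta> q = 1" "\<And>q. d p q > 2 * R \<Longrightarrow> \<eta> q = 0"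
    "\<And>w q. C1M w \<Longrightarrow> \<bar>gamma \<eta> w q\<bar> \<le> 40 / R * sqrt (gamma w w q)"
    using exists_cutoff[OF R, of p] by blast
  \<comment> \<open>The inner cylinder lasts for a time \<open>R\<^sup>2\<close>, half of \<open>T\<close>, so \<open>\<tau> \<ge> R\<^sup>2\<close> on it; and \<open>T \<le> (2 R)\<^sup>2\<close>.\<close>
  define T where "T = 2 * R\<^sup>2"
  define a where "a = 40 / R"
  define K where "K = 2 + 16 * T * a\<^sup>2"
  have T: "T > 0" using R by (simp add: T_def)
  have Ta: "T * a\<^sup>2 = 3200" using R by (simp add: T_def a_def field_simps power2_eq_square)
  have K: "K = 51202" using Ta by (simp add: K_def)
  have a: "a \<ge> 0" using R by (simp add: a_def)
  let ?v = "time_deriv w"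
  let ?w = "\<lambda>t q. w (q, t)" and ?vs = "\<lambda>t q. time_deriv w (q, t)"
  let ?\<tau> = "\<lambda>z::'a \<times> real. snd z + T" and ?e = "\<lambda>z::'a \<times> real. \<eta> (fst z)"
  let ?gw = "\<lambda>z::'a \<times> real. gamma (?w (snd z)) (?w (snd z)) (fst z)"
  let ?gv = "\<lambda>z::'a \<times> real. gamma (?vs (snd z)) (?w (snd z)) (fst z)"
  let ?ge = "\<lambda>z::'a \<times> real. gamma \<eta> (?w (snd z)) (fst z)"
  define H where "H z = 2 * ?\<tau> z * (?e z^4 * ?gw z) + 2 * (?\<tau> z)\<^sup>2 * (?e z^4 * ?gv z) + K * ((?e z)\<^sup>2 * (w z)\<^sup>2) + 2 * K * ?\<tau> z * ((?e z)\<^sup>2 * (w z * ?v z))" for z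
  define G1 where "G1 z = ?e z^4 * ?v z * ?v z + (?e z^4 * ?gv z + 4 * ?e z^3 * ?v z * ?ge z)" for z
  define G2 where "G2 z = (?e z)\<^sup>2 * w z * ?v z + ((?e z)\<^sup>2 * ?gw z + 2 * ?e z * w z * ?ge z)" for z
  define G where "G z = 2 * (?\<tau> z)\<^sup>2 * G1 z + 2 * K * ?\<tau> z * G2 z" for z
  let ?C = "cyl p (2 * R) T"
  let ?X = "UNIV \<times> {..0::real}"
  have cw: "continuous_on ?X w" by (rule cylinder_continuous[OF caloric_C1[OF w]])
  have cv: "continuous_on ?X ?v" by (rule cylinder_continuous[OF time_deriv_C1[OF w]])
  have cgw: "continuous_on ?X ?gw" by (rule cylinder_gamma_continuous[OF caloric_C1[OF w] caloric_C1[OF w]])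
  have cgv: "continuous_on ?X ?gv" by (rule cylinder_gamma_continuous[OF time_deriv_C1[OF w] caloric_C1[OF w]])
  have "C1_on (crange c \<times> {..0}) (chart_rep c (\<lambda>z. \<eta> (fst z)))" if c: "c \<in> A" for c
  proof -
    have "C1_on (crange c \<times> {..0}) (\<lambda>z. (\<eta> \<circ> cinv c) (fst z))"
      by (rule C1_on_compose[OF C1_on_bounded_linear[OF bounded_linear_fst] C1M_chart[OF \<eta>(1) c]]) auto
    then show ?thesis by (simp add: chart_rep_def case_prod_unfold)
  qed
  from cylinder_gamma_continuous[OF this caloric_C1[OF w]] have cge: "continuous_on ?X ?ge" by simp
  have ce: "continuous_on ?X ?e" by (rule continuous_on_compose2[OF C1M_continuous[OF \<eta>(1)]]) (auto intro!: continuous_intros)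
  have cH: "continuous_on ?X H" unfolding H_def by (intro continuous_intros cw cv cgw cgv ce)
  have cG: "continuous_on ?X G" unfolding G_def G1_def G2_def by (intro continuous_intros cw cv cgw cgv cge ce)
  have off: "H (q, t) = 0" "G (q, t) = 0" if "d p q > 2 * R" for q t
    using \<eta>(5)[OF that] by (auto simp: H_def G_def G1_def G2_def)
  interpret pair_sigma_finite vol "lborel :: real measure" by (rule pair_sigma_finite_spacetime)
  have iH: "integrable spacetime (\<lambda>z. indicator ?C z * H z)" by (rule cyl_integrable[OF cH])
  have iG: "integrable spacetime (\<lambda>z. indicator ?C z * G z)" by (rule cyl_integrable[OF cG])
  have indH: "indicator ?C (q, t) * H (q, t) = indicator {-T..0} t *\<^sub>R H (q, t)" for q t
    using off(1)[of q t] by (auto simp: cyl_def indicator_def)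
  have indG: "indicator ?C (q, t) * G (q, t) = indicator {-T..0} t * G (q, t)" for q t
    using off(2)[of q t] by (auto simp: cyl_def indicator_def)
  \<comment> \<open>For a fixed point \<open>q\<close> the function \<open>H\<close> is a time derivative.\<close>
  have "0 \<le> (\<integral>q. (\<integral>t. indicator ?C (q, t) * H (q, t) \<partial>lborel) \<partial>vol)"
  proof (rule integral_nonneg_AE[OF AE_I2])
    fix q
    define F where "F t = (t + T)\<^sup>2 * (\<eta> q^4 * gamma (?w t) (?w t) q) + K * (t + T) * ((\<eta> q)\<^sup>2 * (w (q, t))\<^sup>2)" for t
    have "(\<integral>t. indicator {-T..0} t *\<^sub>R H (q, t) \<partial>lborel) = F 0 - F (-T)"
    proof (rule integral_FTC_Icc)
      show "- T \<le> 0" using T by simp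
      fix t assume t: "- T \<le> t" "t \<le> 0"
      have "((\<lambda>s. w (q, s)) has_real_derivative ?v (q, t)) (at t within {..0})"
        using caloric_time_derivative[OF w t(2)] by (simp add: has_real_derivative_iff_has_vector_derivative)
      moreover have "((\<lambda>s. gamma (?w s) (?w s) q) has_real_derivative 2 * gamma (?vs t) (?w t) q) (at t within {..0})"
        using gamma_time_derivative[OF w t(2)] by (simp add: has_real_derivative_iff_has_vector_derivative)
      ultimately have "(F has_real_derivative H (q, t)) (at t within {..0})"
        unfolding F_def[abs_def] H_def fst_conv snd_conv by (intro energy_density_derivative)
      then show "(F has_vector_derivative H (q, t)) (at t within {-T..0})"
        unfolding has_real_derivative_iff_has_vector_derivative by (rule has_vector_derivative_within_subset) auto
    next
      have "continuous_on {- T..0} (\<lambda>t. H (q, t))" by (rule continuous_on_compose2[OF cH]) (auto intro!: continuous_intros)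
      then show "continuous_on {- T..0} (\<lambda>t. H (q, t))" .
    qed
    moreover have "F (-T) = 0" by (simp add: F_def)
    moreover have "F 0 \<ge> 0" using T K \<eta>(2)[of q] gamma_nonneg[OF caloric_C1M[OF w order_refl]] by (simp add: F_def)
    ultimately show "0 \<le> (\<integral>t. indicator ?C (q, t) * H (q, t) \<partial>lborel)" unfolding indH by simp
  qed
  then have H0: "0 \<le> (\<integral>z. indicator ?C z * H z \<partial>spacetime)"
    using integral_fst'[OF iH] by simp
  \<comment> \<open>For a fixed time Green's formula applies.\<close>
  have comp2: "compact {q. d p q \<le> 2 * R}" by (rule compact_d_cball)
  have "(\<integral>q. indicator ?C (q, t) * G (q, t) \<partial>vol) = 0" for t
  proof (cases "t \<in> {-T..0}")
    case True
    then have t: "t \<le> 0" by simp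
    have e2: "C1M (\<lambda>q. (\<eta> q)\<^sup>2)" using C1M_mult[OF \<eta>(1) \<eta>(1)] by (simp add: power2_eq_square)
    have e4: "C1M (\<lambda>q. \<eta> q^4)" using C1M_mult[OF e2 e2] by (simp add: power2_eq_square power4_eq_xxxx mult_ac)
    have w1: "C1M (?w t)" and v1: "C1M (?vs t)" using caloric_C1M[OF w t] time_deriv_C1M[OF w t] by auto
    have ge2: "gamma (\<lambda>q. (\<eta> q)\<^sup>2) (?w t) q = 2 * \<eta> q * gamma \<eta> (?w t) q" for q
      using gamma_mult_left[OF \<eta>(1) \<eta>(1) w1, of q] by (simp add: power2_eq_square)
    have ge4: "gamma (\<lambda>q. \<eta> q^4) (?w t) q = 4 * \<eta> q^3 * gamma \<eta> (?w t) q" for q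
    proof -
      have "gamma (\<lambda>q. (\<eta> q)\<^sup>2 * (\<eta> q)\<^sup>2) (?w t) q = 4 * \<eta> q^3 * gamma \<eta> (?w t) q"
        unfolding gamma_mult_left[OF e2 e2 w1] ge2 by (simp add: power2_eq_square power3_eq_cube)
      moreover have "(\<lambda>q. (\<eta> q)\<^sup>2 * (\<eta> q)\<^sup>2) = (\<lambda>q. \<eta> q^4)" by (simp add: power2_eq_square power4_eq_xxxx mult_ac)
      ultimately show ?thesis by simp
    qed
    have vcont: "continuous_on UNIV (?vs t)" by (rule C1M_continuous[OF v1])
    have z4: "\<eta> q^4 * ?vs t q = 0" and z2: "(\<eta> q)\<^sup>2 * ?w t q = 0" if "q \<notin> {q. d p q \<le> 2 * R}" for q using \<eta>(5)[of q] that by auto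
    have g1: "gamma (\<lambda>q. \<eta> q^4 * ?vs t q) (?w t) q = \<eta> q^4 * gamma (?vs t) (?w t) q + 4 * \<eta> q^3 * ?vs t q * gamma \<eta> (?w t) q" for q
      unfolding gamma_mult_left[OF e4 v1 w1] ge4 by simp
    have g2: "gamma (\<lambda>q. (\<eta> q)\<^sup>2 * ?w t q) (?w t) q = (\<eta> q)\<^sup>2 * gamma (?w t) (?w t) q + 2 * \<eta> q * ?w t q * gamma \<eta> (?w t) q" for q
      unfolding gamma_mult_left[OF e2 w1 w1] ge2 by simp
    note gr1 = green[OF C1M_mult[OF e4 v1] comp2 z4 caloric_C2M[OF w t] caloric_laplacian[OF w t] vcont, unfolded g1]
    note gr2 = green[OF C1M_mult[OF e2 w1] comp2 z2 caloric_C2M[OF w t] caloric_laplacian[OF w t] vcont, unfolded g2]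
    have "(\<integral>q. indicator ?C (q, t) * G (q, t) \<partial>vol) = (\<integral>q. 2 * (t + T)\<^sup>2 * G1 (q, t) + 2 * K * (t + T) * G2 (q, t) \<partial>vol)"
      unfolding indG using True by (simp add: G_def)
    also have "\<dots> = 2 * (t + T)\<^sup>2 * (\<integral>q. G1 (q, t) \<partial>vol) + 2 * K * (t + T) * (\<integral>q. G2 (q, t) \<partial>vol)"
      using gr1(1) gr2(1) by (simp add: G1_def G2_def)
    also have "\<dots> = 0" using gr1(2) gr2(2) by (simp add: G1_def G2_def)
    finally show ?thesis .
  qed (simp add: indG)
  then have "(\<integral>t. (\<integral>q. indicator ?C (q, t) * G (q, t) \<partial>vol) \<partial>lborel) = 0" by simp
  then have G0: "(\<integral>z. indicator ?C z * G z \<partial>spacetime) = 0"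
    using integral_snd[of "\<lambda>q t. indicator ?C (q, t) * G (q, t)"] iG by (simp add: case_prod_unfold)
  let ?B = "\<lambda>z. indicator ?C z * (w z)\<^sup>2" and ?D = "\<lambda>z. indicator ?C z * ((?\<tau> z)\<^sup>2 * (?e z^4 * (?v z)\<^sup>2))"
  have iB: "integrable spacetime ?B" by (intro cyl_integrable continuous_intros cw)
  have iD: "integrable spacetime ?D" by (intro cyl_integrable continuous_intros cv ce)
  have "(\<integral>z. indicator ?C z * H z \<partial>spacetime) = (\<integral>z. indicator ?C z * H z - indicator ?C z * G z \<partial>spacetime)"
    using iH iG G0 by simp
  also have "\<dots> \<le> (\<integral>z. K * (1 + 4 * T * a\<^sup>2) * ?B z - ?D z \<partial>spacetime)"
  proof (rule integral_mono)
    fix z :: "'a \<times> real"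
    show "indicator ?C z * H z - indicator ?C z * G z \<le> K * (1 + 4 * T * a\<^sup>2) * ?B z - ?D z"
    proof (cases "z \<in> ?C")
      case True
      then have t: "snd z \<le> 0" "- T \<le> snd z" by (auto simp: cyl_def)
      have "H z - G z \<le> K * (1 + 4 * T * a\<^sup>2) * (w z)\<^sup>2 - (?\<tau> z)\<^sup>2 * (?e z^4 * (?v z)\<^sup>2)"
        unfolding H_def G_def G1_def G2_def
        by (rule energy_pointwise[OF _ _ _ _ _ _ a K_def])
           (use \<eta>(2,3) t gamma_nonneg[OF caloric_C1M[OF w t(1)]] \<eta>(6)[OF caloric_C1M[OF w t(1)]] in \<open>auto simp: a_def\<close>)
      then show ?thesis using True by simp
    qed simp
  qed (use iH iG iB iD in auto)
  also have "\<dots> = K * (1 + 4 * T * a\<^sup>2) * (\<integral>z. ?B z \<partial>spacetime) - (\<integral>z. ?D z \<partial>spacetime)" using iB iD by simp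
  finally have main: "(\<integral>z. ?D z \<partial>spacetime) \<le> (51202 * 12801) * (\<integral>z. ?B z \<partial>spacetime)"
    using H0 K Ta by (simp add: mult.assoc)
  have "R^4 * energy p R ?v = (\<integral>z. R^4 * (indicator (cyl p R (R\<^sup>2)) z * (?v z)\<^sup>2) \<partial>spacetime)"
    unfolding energy_def by simp
  also have "\<dots> \<le> (\<integral>z. ?D z \<partial>spacetime)"
  proof (rule integral_mono[OF _ iD])
    show "integrable spacetime (\<lambda>z. R^4 * (indicator (cyl p R (R\<^sup>2)) z * (?v z)\<^sup>2))"
      by (intro integrable_mult_right cyl_integrable continuous_intros cv)
    fix z :: "'a \<times> real"
    show "R^4 * (indicator (cyl p R (R\<^sup>2)) z * (?v z)\<^sup>2) \<le> ?D z"
    proof (cases "z \<in> cyl p R (R\<^sup>2)")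
      case True
      then have z: "d p (fst z) \<le> R" "- (R\<^sup>2) \<le> snd z" "snd z \<le> 0" by (auto simp: cyl_def)
      have "z \<in> ?C" using z R by (auto simp: cyl_def T_def mem_Times_iff intro: order_trans[of _ "R\<^sup>2"]) 
      moreover have "R^4 \<le> (?\<tau> z)\<^sup>2"
      proof -
        have "(R\<^sup>2)\<^sup>2 \<le> (?\<tau> z)\<^sup>2" using z by (intro power_mono) (auto simp: T_def)
        then show ?thesis by simp
      qed
      ultimately show ?thesis using True \<eta>(4)[OF z(1)] by (simp add: mult_right_mono)
    next
      case False
      then show ?thesis by (simp add: indicator_def)
    qed
  qed
  also note main
  also have "(\<integral>z. ?B z \<partial>spacetime) \<le> energy p (2 * R) w"
    unfolding energy_def
  proof (rule integral_mono[OF iB])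
    show "integrable spacetime (\<lambda>z. indicator (cyl p (2 * R) ((2 * R)\<^sup>2)) z * (w z)\<^sup>2)" by (intro cyl_integrable continuous_intros cw)
    have "?C \<subseteq> cyl p (2 * R) ((2 * R)\<^sup>2)" by (auto simp: cyl_def T_def power_mult_distrib)
    then show "?B z \<le> indicator (cyl p (2 * R) ((2 * R)\<^sup>2)) z * (w z)\<^sup>2" for z by (auto simp: indicator_def)
  qed
  finally show ?thesis by simp
qed

end

section \<open>Functions of time with vanishing iterated differences\<close>

definition time_diff :: "real \<Rightarrow> (real \<Rightarrow> real) \<Rightarrow> real \<Rightarrow> real" where
  "time_diff h f t = f t - f (t - h)"

primrec differences_vanish :: "nat \<Rightarrow> (real \<Rightarrow> real) \<Rightarrow> bool" where
  "differences_vanish 0 f \<longleftrightarrow> (\<forall>t\<le>0. f t = 0)"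
| "differences_vanish (Suc m) f \<longleftrightarrow> (\<forall>h>0. differences_vanish m (time_diff h f))"

lemma differences_vanish_cong:
  "(\<And>t. t \<le> 0 \<Longrightarrow> f t = f' t) \<Longrightarrow> differences_vanish m f \<Longrightarrow> differences_vanish m f'"
proof (induction m arbitrary: f f')
  case 0 then show ?case by simp
next
  case (Suc m)
  have "differences_vanish m (time_diff h f')" if h: "h > 0" for h
  proof (rule Suc.IH)
    show "time_diff h f t = time_diff h f' t" if "t \<le> 0" for t
      using Suc.prems(1)[of t] Suc.prems(1)[of "t - h"] that h by (simp add: time_diff_def)
    show "differences_vanish m (time_diff h f)" using Suc.prems(2) h by simp
  qed
  then show ?case by simp
qed

lemma at_within_atMost_nontrivial: "t \<le> 0 \<Longrightarrow> at t within {..0} \<noteq> (bot :: real filter)"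
proof -
  assume "t \<le> 0"
  then have "{..<t} \<subseteq> {..0}" by (intro subsetI) simp
  then show ?thesis using at_le[of "{..<t}" "{..0}" t] trivial_limit_at_left_real[of t] by (auto simp: bot_unique)
qed

lemma time_diff_derivative:
  assumes f: "\<And>t. t \<le> 0 \<Longrightarrow> (f has_real_derivative f' t) (at t within {..0})" and h: "h > 0" and t: "t \<le> 0"
  shows "(time_diff h f has_real_derivative time_diff h f' t) (at t within {..0})"
proof -
  have sub: "(\<lambda>s. s - h) ` {..0} \<subseteq> {..0}" using h by auto
  have "(f has_real_derivative f' (t - h)) (at (t - h) within (\<lambda>s. s - h) ` {..0})"
    using f[of "t - h"] h t by (intro DERIV_subset[OF _ sub]) simp
  moreover have "((\<lambda>s. s - h) has_real_derivative 1) (at t within {..0})" by (auto intro!: derivative_eq_intros)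
  ultimately have "((\<lambda>s. f (s - h)) has_real_derivative f' (t - h)) (at t within {..0})"
    using DERIV_image_chain[of f "f' (t - h)" "\<lambda>s. s - h" t "{..0}" 1] by (simp add: o_def)
  from DERIV_diff[OF f[OF t] this] show ?thesis by (simp add: time_diff_def[abs_def])
qed

text \<open>Differences commute with differentiation, and a function all of whose first differences vanish is
  constant.\<close>
lemma differences_vanish_derivative:
  assumes "differences_vanish (Suc m) f" "\<And>t. t \<le> 0 \<Longrightarrow> (f has_real_derivative f' t) (at t within {..0})"
  shows "differences_vanish m f'"
  using assms
proof (induction m arbitrary: f f')
  case 0
  have "f s = f 0" if "s \<le> 0" for s
  proof (cases "s = 0")
    case False
    then have "differences_vanish 0 (time_diff (- s) f)" using 0(1) that by simp
    then have "time_diff (- s) f 0 = 0" by simp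
    then show ?thesis by (simp add: time_diff_def)
  qed simp
  note const = this
  have "f' t = 0" if t: "t \<le> 0" for t
  proof -
    have D: "(f has_vector_derivative f' t) (at t within {..0})"
      using 0(2)[OF t] by (simp only: has_real_derivative_iff_has_vector_derivative)
    have D0: "((\<lambda>s. f 0) has_vector_derivative f' t) (at t within {..0})"
    proof (rule has_vector_derivative_transform[OF _ _ D])
      show "t \<in> {..0}" using t by simp
      show "f 0 = f s" if "s \<in> {..0}" for s using const[of s] that by (simp only: atMost_iff)
    qed
    show ?thesis by (rule vector_derivative_unique_within[OF at_within_atMost_nontrivial[OF t] D0 has_vector_derivative_const])
  qed
  then show ?case by simp
next
  case (Suc m)
  have "differences_vanish m (time_diff h f')" if h: "h > 0" for h
  proof (rule Suc.IH[of "time_diff h f"])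
    show "differences_vanish (Suc m) (time_diff h f)" using Suc.prems(1) h by (simp only: differences_vanish.simps(2)[of "Suc m"])
    show "(time_diff h f has_real_derivative time_diff h f' t) (at t within {..0})" if "t \<le> 0" for t
      by (rule time_diff_derivative[OF Suc.prems(2) h that])
  qed
  then show ?case by simp
qed

lemma pderiv_sum_finite: "pderiv (\<Sum>i\<in>I. f i) = (\<Sum>i\<in>I. pderiv (f i))"
  by (induction I rule: infinite_finite_induct) (auto simp: pderiv_add)

lemma ex_antiderivative_poly: "\<exists>Q. pderiv Q = (q :: real poly)"
proof -
  let ?Q = "\<Sum>i\<le>degree q. monom (coeff q i / real (Suc i)) (Suc i)"
  have "pderiv ?Q = (\<Sum>i\<le>degree q. monom (coeff q i) i)" by (simp add: pderiv_sum_finite pderiv_monom del: of_nat_Suc)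
  then show ?thesis using poly_as_sum_of_monoms by metis
qed

text \<open>The derivative has vanishing differences of one order less, so it is a polynomial by induction,
  and \<open>f\<close> is one of its antiderivatives.\<close>
lemma differences_vanish_imp_poly:
  assumes "differences_vanish m f" "Ck_on m {..0} f" shows "\<exists>q. \<forall>t\<le>0. f t = poly q t"
  using assms
proof (induction m arbitrary: f)
  case 0 then show ?case by (intro exI[of _ 0]) simp
next
  case (Suc m)
  obtain f' where f': "\<forall>t\<in>{..0}. (f has_derivative f' t) (at t within {..0})" "\<forall>v. Ck_on m {..0} (\<lambda>t. f' t v)"
    using Suc.prems(2) by auto
  have der: "(f has_real_derivative f' t 1) (at t within {..0})" if t: "t \<le> 0" for t
  proof -
    have D: "(f has_derivative f' t) (at t within {..0})" using f'(1) t by simp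
    have "f' t = (\<lambda>r. f' t 1 * r)"
    proof
      fix r show "f' t r = f' t 1 * r" using linear_scale[OF has_derivative_linear[OF D], of r 1] by (simp add: mult.commute)
    qed
    then show ?thesis using D unfolding has_field_derivative_def by metis
  qed
  have "differences_vanish m (\<lambda>t. f' t 1)" by (rule differences_vanish_derivative[OF Suc.prems(1) der])
  then obtain q where q: "\<forall>t\<le>0. f' t 1 = poly q t" using Suc.IH f'(2) by blast
  obtain Q where Q: "pderiv Q = q" using ex_antiderivative_poly by blast
  have zero: "((\<lambda>t. f t - poly Q t) has_real_derivative 0) (at t within {..0})" if t: "t \<in> {..0}" for t
  proof -
    have t0: "t \<le> 0" using t by simp
    have "(poly Q has_real_derivative poly q t) (at t within {..0})" using poly_DERIV[of Q t] unfolding Q by (rule has_field_derivative_at_within)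
    from DERIV_diff[OF der[OF t0] this] show ?thesis using q t0 by simp
  qed
  have "\<exists>c. \<forall>t\<in>{..0}. f t - poly Q t = c"
    by (rule has_field_derivative_zero_constant[OF _ zero]) simp_all
  then obtain c where c: "\<forall>t\<in>{..0}. f t - poly Q t = c" by blast
  have "f t = poly (Q + [:c:]) t" if "t \<le> 0" for t
  proof -
    have "f t - poly Q t = c" using c that by simp
    then show ?thesis by (simp add: algebra_simps)
  qed
  then show ?case by blast
qed

lemma poly_time_diff: "time_diff h (poly q) = poly (q - pcompose q [:- h, 1:])"
  by (auto simp: time_diff_def poly_pcompose)

text \<open>The leading terms of \<open>q\<close> and of its translate cancel.\<close>
lemma degree_poly_time_diff:
  fixes q :: "real poly"
  shows "q - pcompose q [:- h, 1:] = 0 \<or> degree (q - pcompose q [:- h, 1:]) < degree q"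
proof (cases "degree q = 0")
  case True
  then obtain a where "q = [:a:]" by (metis degree_eq_zeroE)
  then show ?thesis by simp
next
  case False
  let ?r = "pcompose q [:- h, 1:]"
  have d: "degree ?r = degree q" by (simp add: degree_pcompose)
  have "lead_coeff ?r = lead_coeff q" by (subst lead_coeff_comp) auto
  then have c: "coeff (q - ?r) (degree q) = 0" using d by simp
  have le: "degree (q - ?r) \<le> degree q" using degree_diff_le[of q "degree q" ?r] d by simp
  show ?thesis
  proof (cases "degree (q - ?r) = degree q")
    case True
    have "lead_coeff (q - ?r) = 0" unfolding True by (rule c)
    then have "q - ?r = 0" by (rule leading_coeff_0_iff[THEN iffD1])
    then show ?thesis ..
  qed (use le in simp)
qed

lemma differences_vanish_poly:
  "q = 0 \<or> degree q < m \<Longrightarrow> differences_vanish m (poly q)"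
proof (induction m arbitrary: q)
  case (Suc m)
  have "differences_vanish m (time_diff h (poly q))" for h
    unfolding poly_time_diff using degree_poly_time_diff[of q h] Suc.prems by (intro Suc.IH) auto
  then show ?case by simp
qed auto

text \<open>Otherwise \<open>\<bar>q\<bar>\<close> minus the bound would be a polynomial at \<open>-\<infinity>\<close> with positive leading coefficient.\<close>
lemma poly_growth_degree:
  fixes q :: "real poly"
  assumes gr: "\<And>t. t \<le> 0 \<Longrightarrow> \<bar>poly q t\<bar> \<le> C * (1 + \<bar>t\<bar>) ^ k"
  shows "degree q \<le> k"
proof (rule ccontr)
  assume deg: "\<not> degree q \<le> k"
  \<comment> \<open>Reflected to the positive half line, where the sign of a polynomial at infinity is that of its
    leading coefficient.\<close>
  define r where "r = pcompose q [:0, - 1:]"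
  have dr: "degree r = degree q" by (simp add: r_def degree_pcompose)
  define s where "s = sgn (lead_coeff r)"
  have r0: "r \<noteq> 0" using dr deg by auto
  have s0: "s \<noteq> 0" "\<bar>s\<bar> = 1" using r0 by (auto simp: s_def sgn_if)
  define b where "b = smult C ([:1, 1:] ^ k)"
  have db: "degree b < degree (smult s r)"
    using degree_smult_le[of C "[:1, 1:] ^ k"] degree_power_le[of "[:1::real, 1:]" k] dr deg s0 by (simp add: b_def)
  have "lead_coeff (smult s r - b) = s * lead_coeff r"
  proof -
    have "degree (smult s r - b) = degree (smult s r)" using degree_add_eq_left[of "- b" "smult s r"] db by simp
    then show ?thesis using db by (simp add: coeff_eq_0)
  qed
  moreover have "lead_coeff r \<noteq> 0" using r0 by simp
  then have "\<bar>lead_coeff r\<bar> > 0" by (rule zero_less_abs_iff[THEN iffD2])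
  then have "s * lead_coeff r > 0" unfolding s_def by (metis abs_sgn mult.commute)
  ultimately have lc: "lead_coeff (smult s r - b) > 0" by (simp only:)
  from poly_pinfty_gt_lc[OF this] obtain n where n: "\<forall>x\<ge>n. poly (smult s r - b) x \<ge> lead_coeff (smult s r - b)" by blast
  define x where "x = max n 0"
  have "poly (smult s r - b) x > 0" using n lc x_def by (meson less_le_trans max.cobounded1)
  moreover have "poly (smult s r - b) x \<le> 0"
  proof -
    have "s * poly q (- x) \<le> \<bar>s\<bar> * \<bar>poly q (- x)\<bar>" by (metis abs_ge_self abs_mult)
    also have "\<dots> \<le> C * (1 + x) ^ k" using gr[of "- x"] s0 by (simp add: x_def)
    finally show ?thesis by (simp add: r_def b_def poly_pcompose)
  qed
  ultimately show False by simp
qed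

lemma time_diff_commute: "time_diff h (time_diff k f) = time_diff k (time_diff h f)"
  by (auto simp: time_diff_def algebra_simps)

lemma iterated_time_diff_commute: "(time_diff k ^^ j) (time_diff h f) = time_diff h ((time_diff k ^^ j) f)"
  by (induction j) (auto simp: time_diff_commute)

lemma iterated_time_diff_poly: "\<exists>r. (time_diff k ^^ j) (poly q) = poly r"
proof (induction j)
  case 0 show ?case by (intro exI[of _ q]) simp
next
  case (Suc j)
  then obtain r where r: "(time_diff k ^^ j) (poly q) = poly r" by blast
  have "(time_diff k ^^ Suc j) (poly q) = poly (r - pcompose r [:- k, 1:])"
    unfolding funpow.simps o_apply r poly_time_diff ..
  then show ?case by blast
qed

text \<open>A polynomial whose unit difference vanishes is periodic, hence constant; so the iterated unit
  difference determines all others.\<close>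
lemma unit_differences_vanish:
  assumes "\<And>t. t \<le> 0 \<Longrightarrow> (time_diff 1 ^^ j) (poly q) t = 0"
  shows "differences_vanish j (poly q)"
  using assms
proof (induction j arbitrary: q)
  case 0 then show ?case by simp
next
  case (Suc j)
  obtain r where r: "(time_diff 1 ^^ j) (poly q) = poly r" using iterated_time_diff_poly by blast
  have per: "poly r t = poly r (t - 1)" if t: "t \<le> 0" for t
  proof -
    have "time_diff 1 (poly r) t = 0" using Suc.prems[OF t] unfolding funpow.simps o_apply r .
    then show ?thesis unfolding time_diff_def by linarith
  qed
  have nat: "poly r (- real n) = poly r 0" for n
  proof (induction n)
    case (Suc n)
    have "- real (Suc n) = - real n - 1" by simp
    then have "poly r (- real (Suc n)) = poly r (- real n - 1)" by (rule arg_cong)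
    also have "\<dots> = poly r (- real n)" by (rule per[symmetric]) simp
    also note Suc
    finally show ?case .
  qed simp
  have "r - [:poly r 0:] = 0"
  proof (rule ccontr)
    assume "r - [:poly r 0:] \<noteq> 0"
    then have fin: "finite {x. poly (r - [:poly r 0:]) x = 0}" by (rule poly_roots_finite)
    have "range (\<lambda>n. - real n) \<subseteq> {x. poly (r - [:poly r 0:]) x = 0}"
    proof clarify
      fix n show "poly (r - [:poly r 0:]) (- real n) = 0" using nat[of n] unfolding poly_diff poly_pCons poly_0 by linarith
    qed
    then have "finite (range (\<lambda>n. - real n))" using fin finite_subset by blast
    moreover have "inj (\<lambda>n. - real n)" by (auto simp: inj_def)
    ultimately show False using finite_imageD infinite_UNIV_nat by blast
  qed
  have rc: "poly r x = poly r 0" for x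
    using arg_cong[OF \<open>r - [:poly r 0:] = 0\<close>, of "\<lambda>p. poly p x"] unfolding poly_diff poly_0 poly_pCons by linarith
  have "differences_vanish j (time_diff h (poly q))" for h
    unfolding poly_time_diff
  proof (rule Suc.IH)
    fix t :: real
    have "(time_diff 1 ^^ j) (time_diff h (poly q)) t = 0"
    proof -
      have "poly r t - poly r (t - h) = 0" using rc[of t] rc[of "t - h"] by linarith
      then show ?thesis unfolding iterated_time_diff_commute r time_diff_def .
    qed
    then show "(time_diff 1 ^^ j) (poly (q - pcompose q [:- h, 1:])) t = 0" unfolding poly_time_diff .
  qed
  then show ?case by simp
qed

lemma integral_cauchy_schwarz:
  fixes f :: "real \<Rightarrow> real"
  assumes f: "continuous_on {a..b} f" and ab: "a < b"
  shows "(integral {a..b} f)\<^sup>2 \<le> (b - a) * integral {a..b} (\<lambda>t. (f t)\<^sup>2)"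
proof -
  define c where "c = integral {a..b} f / (b - a)"
  have i: "f integrable_on {a..b}" "(\<lambda>t. (f t)\<^sup>2) integrable_on {a..b}"
    by (intro integrable_continuous_real continuous_intros f)+
  have "0 \<le> integral {a..b} (\<lambda>t. (f t - c)\<^sup>2)"
    by (intro Henstock_Kurzweil_Integration.integral_nonneg integrable_continuous_real continuous_intros f) auto
  also have "(\<lambda>t. (f t - c)\<^sup>2) = (\<lambda>t. ((f t)\<^sup>2 - 2 * c * f t) + c\<^sup>2)" by (simp add: power2_eq_square algebra_simps)
  also have "integral {a..b} \<dots> = (integral {a..b} (\<lambda>t. (f t)\<^sup>2) - 2 * c * integral {a..b} f) + c\<^sup>2 * (b - a)"
  proof -
    have ic: "(\<lambda>t. 2 * c * f t) integrable_on {a..b}" by (intro integrable_continuous_real continuous_intros f)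
    have "integral {a..b} (\<lambda>t. ((f t)\<^sup>2 - 2 * c * f t) + c\<^sup>2) = integral {a..b} (\<lambda>t. (f t)\<^sup>2 - 2 * c * f t) + integral {a..b} (\<lambda>t. c\<^sup>2)"
      by (intro Henstock_Kurzweil_Integration.integral_add integrable_diff i(2) ic integrable_continuous_real continuous_intros)
    moreover have "integral {a..b} (\<lambda>t. (f t)\<^sup>2 - 2 * c * f t) = integral {a..b} (\<lambda>t. (f t)\<^sup>2) - integral {a..b} (\<lambda>t. 2 * c * f t)"
      by (rule Henstock_Kurzweil_Integration.integral_diff[OF i(2) ic])
    ultimately show ?thesis using ab by (simp add: mult.commute)
  qed
  also have "\<dots> = integral {a..b} (\<lambda>t. (f t)\<^sup>2) - (integral {a..b} f)\<^sup>2 / (b - a)"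
  proof -
    have cA: "c * (b - a) = integral {a..b} f" using ab by (simp add: c_def)
    have "c\<^sup>2 * (b - a) = c * integral {a..b} f" by (simp only: power2_eq_square mult.assoc cA)
    moreover have "(integral {a..b} f)\<^sup>2 / (b - a) = c * integral {a..b} f" by (simp add: c_def power2_eq_square)
    ultimately show ?thesis by simp
  qed
  finally show ?thesis using ab by (simp add: field_simps)
qed

section \<open>Linear combinations and time differences of ancient caloric functions\<close>

lemma gradient_lincomb:
  fixes f h :: "real ^ 'n::finite \<Rightarrow> real"
  assumes "f differentiable (at x)" "h differentiable (at x)"
  shows "gradient (\<lambda>x. a * f x + b * h x) x = a *\<^sub>R gradient f x + b *\<^sub>R gradient h x"
  by (rule gradient_eqI) (auto intro!: derivative_eq_intros has_derivative_gradient assms simp: inner_add_left)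

definition space_time_diff :: "real \<Rightarrow> ('a \<times> real \<Rightarrow> real) \<Rightarrow> 'a \<times> real \<Rightarrow> real" where
  "space_time_diff h w = (\<lambda>(p, t). if t \<le> 0 then w (p, t) - w (p, t - h) else 0)"

context complete_riemannian_manifold begin

text \<open>Linearity is not visible in the coordinate expression, whose partial derivatives are total functions
  with arbitrary values where a function is not differentiable; the regularity of both summands
  is what makes every derivative in it additive.\<close>
lemma has_laplacian_lincomb:
  assumes u: "C2M u" "has_laplacian A g u \<alpha>" and v: "C2M v" "has_laplacian A g v \<beta>"
  shows "has_laplacian A g (\<lambda>p. a * u p + b * v p) (\<lambda>p. a * \<alpha> p + b * \<beta> p)"
proof -
  let ?w = "\<lambda>p. a * u p + b * v p"
  have "chart_laplacian g c ?w p = a * \<alpha> p + b * \<beta> p" if c: "c \<in> A" "p \<in> fst c" for c p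
  proof -
    let ?x = "snd c p"
    have xr: "?x \<in> crange c" using c by simp
    have fl: "flux c ?w x = a *\<^sub>R flux c u x + b *\<^sub>R flux c v x" if x: "x \<in> crange c" for x
    proof -
      have "gradient (?w \<circ> cinv c) x = a *\<^sub>R gradient (u \<circ> cinv c) x + b *\<^sub>R gradient (v \<circ> cinv c) x"
        using gradient_lincomb[of "u \<circ> cinv c" x "v \<circ> cinv c" a b]
          C1_on_differentiable[OF C1M_chart crange_open x] c(1) u(1) v(1) by (simp add: o_def C2M_def)
      then show ?thesis by (simp add: flux_def matrix_vector_right_distrib matrix_vector_mult_scaleR algebra_simps)
    qed
    have "gradient (\<lambda>x. flux c ?w x $ i) ?x = a *\<^sub>R gradient (\<lambda>x. flux c u x $ i) ?x + b *\<^sub>R gradient (\<lambda>x. flux c v x $ i) ?x" for i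
    proof -
      have "gradient (\<lambda>x. flux c ?w x $ i) ?x = gradient (\<lambda>x. a * (flux c u x $ i) + b * (flux c v x $ i)) ?x"
        by (rule gradient_cong[OF crange_open[OF c(1)] xr]) (simp add: fl)
      also have "\<dots> = a *\<^sub>R gradient (\<lambda>x. flux c u x $ i) ?x + b *\<^sub>R gradient (\<lambda>x. flux c v x $ i) ?x"
        by (rule gradient_lincomb; rule C1_on_differentiable[OF flux_C1[OF c(1)] crange_open[OF c(1)] xr]) (use u v in auto)
      finally show ?thesis .
    qed
    then have "(\<Sum>i\<in>UNIV. partial_deriv i (\<lambda>x. flux c ?w x $ i) ?x) =
        a * (\<Sum>i\<in>UNIV. partial_deriv i (\<lambda>x. flux c u x $ i) ?x) + b * (\<Sum>i\<in>UNIV. partial_deriv i (\<lambda>x. flux c v x $ i) ?x)"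
      by (simp add: partial_deriv_gradient sum.distrib sum_distrib_left)
    also have "\<dots> = dens c ?x * (a * \<alpha> p + b * \<beta> p)"
      using has_laplacian_chart[OF u(2) c] has_laplacian_chart[OF v(2) c] by (simp add: algebra_simps)
    finally show ?thesis using chart_laplacian_flux[of c ?w p] dens_pos[OF c(1) xr] by simp
  qed
  then show ?thesis unfolding has_laplacian_def by (auto simp: case_prod_unfold)
qed

lemma caloric_lincomb:
  assumes u: "caloric u" and v: "caloric v" shows "caloric (\<lambda>z. a * u z + b * v z)"
proof -
  let ?w = "\<lambda>z. a * u z + b * v z"
  have td: "time_deriv ?w (p, t) = a * time_deriv u (p, t) + b * time_deriv v (p, t)" if t: "t \<le> 0" for p t
  proof -
    have "((\<lambda>s. a *\<^sub>R u (p, s) + b *\<^sub>R v (p, s)) has_vector_derivative a *\<^sub>R time_deriv u (p, t) + b *\<^sub>R time_deriv v (p, t)) (at t within {..0})"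
      by (intro has_vector_derivative_add bounded_linear.has_vector_derivative[OF bounded_linear_scaleR_right] caloric_time_derivative[OF u t] caloric_time_derivative[OF v t])
    from vector_derivative_within[OF at_within_atMost_nontrivial[OF t] this] show ?thesis by (simp add: time_deriv_def)
  qed
  show ?thesis
    unfolding ancient_caloric_def
  proof (intro conjI allI impI)
    show "?w (p, t) = 0" if "t > 0" for p t using u v that by (simp add: ancient_caloric_def)
    show "\<forall>(U, \<phi>)\<in>A. smooth_on (\<phi> ` U \<times> {..0}) (\<lambda>(x, t). ?w (inv_into U \<phi> x, t))"
    proof (clarify)
      fix U \<phi> assume c: "(U, \<phi>) \<in> A"
      show "smooth_on (\<phi> ` U \<times> {..0}) (\<lambda>(x, t). ?w (inv_into U \<phi> x, t))"
        unfolding smooth_on_def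
        using Ck_on_lincomb[OF caloric_Ck[OF u c] caloric_Ck[OF v c], of _ a b] by (simp add: chart_rep_def case_prod_unfold)
    qed
    fix t :: real assume t: "t \<le> 0"
    have "has_laplacian A g (\<lambda>p. a * u (p, t) + b * v (p, t)) (\<lambda>p. a * time_deriv u (p, t) + b * time_deriv v (p, t))"
      by (rule has_laplacian_lincomb[OF caloric_C2M[OF u t] caloric_laplacian[OF u t] caloric_C2M[OF v t] caloric_laplacian[OF v t]])
    then show "has_laplacian A g (\<lambda>p. ?w (p, t)) (\<lambda>p. vector_derivative (\<lambda>s. ?w (p, s)) (at t within {..0}))"
      using td[OF t] by (simp add: time_deriv_def)
  qed
qed

lemma space_time_diff_slice: "t \<le> 0 \<Longrightarrow> space_time_diff h w (p, t) = time_diff h (\<lambda>s. w (p, s)) t"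
  by (simp add: space_time_diff_def time_diff_def)

text \<open>The metric does not depend on time, so a translate of a solution into the past is a solution.\<close>
lemma caloric_space_time_diff:
  assumes w: "caloric w" and h: "h > 0" shows "caloric (space_time_diff h w)"
proof -
  let ?S = "space_time_diff h w"
  have td: "time_deriv ?S (p, t) = 1 * time_deriv w (p, t) + (- 1) * time_deriv w (p, t - h)" if t: "t \<le> 0" for p t
  proof -
    have 1: "(time_diff h (\<lambda>s. w (p, s)) has_real_derivative time_diff h (\<lambda>s. time_deriv w (p, s)) t) (at t within {..0})"
      by (rule time_diff_derivative[OF _ h t]) (use caloric_time_derivative[OF w] in \<open>simp add: has_real_derivative_iff_has_vector_derivative\<close>)
    then have "((\<lambda>s. ?S (p, s)) has_vector_derivative time_diff h (\<lambda>s. time_deriv w (p, s)) t) (at t within {..0})"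
      unfolding has_real_derivative_iff_has_vector_derivative
      by (rule has_vector_derivative_transform[rotated 2]) (use t space_time_diff_slice in auto)
    from vector_derivative_within[OF at_within_atMost_nontrivial[OF t] this] show ?thesis by (simp add: time_deriv_def time_diff_def)
  qed
  show ?thesis
    unfolding ancient_caloric_def
  proof (intro conjI allI impI)
    show "?S (p, t) = 0" if "t > 0" for p t using that by (simp add: space_time_diff_def)
    show "\<forall>(U, \<phi>)\<in>A. smooth_on (\<phi> ` U \<times> {..0}) (\<lambda>(x, t). ?S (inv_into U \<phi> x, t))"
    proof (clarify)
      fix U \<phi> assume "(U, \<phi>) \<in> A"
      then obtain c where c: "c \<in> A" "U = fst c" "\<phi> = snd c" by force
      have "Ck_on k (crange c \<times> {..0}) (\<lambda>(x, t). ?S (cinv c x, t))" for k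
      proof -
        have sh: "Ck_on k (crange c \<times> {..0}) (\<lambda>z. chart_rep c w ((0, - h) + z))"
          by (rule Ck_on_affine[OF bounded_linear_ident _ caloric_Ck[OF w c(1)]]) (use h in auto)
        show ?thesis
          by (rule Ck_on_cong[OF _ Ck_on_lincomb[OF caloric_Ck[OF w c(1)] sh, of 1 "-1"]])
             (auto simp: chart_rep_def space_time_diff_def)
      qed
      then show "smooth_on (\<phi> ` U \<times> {..0}) (\<lambda>(x, t). ?S (inv_into U \<phi> x, t))" by (simp add: smooth_on_def c)
    qed
    fix t :: real assume t: "t \<le> 0"
    have t': "t - h \<le> 0" using t h by simp
    have "has_laplacian A g (\<lambda>p. 1 * w (p, t) + (- 1) * w (p, t - h)) (\<lambda>p. 1 * time_deriv w (p, t) + (- 1) * time_deriv w (p, t - h))"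
      by (rule has_laplacian_lincomb[OF caloric_C2M[OF w t] caloric_laplacian[OF w t] caloric_C2M[OF w t'] caloric_laplacian[OF w t']])
    then show "has_laplacian A g (\<lambda>p. ?S (p, t)) (\<lambda>p. vector_derivative (\<lambda>s. ?S (p, s)) (at t within {..0}))"
      using td[OF t] t by (simp add: time_deriv_def space_time_diff_def)
  qed
qed

lemma caloric_continuous: "caloric w \<Longrightarrow> continuous_on (UNIV \<times> {..0}) w"
  by (rule cylinder_continuous[OF caloric_C1])

lemma time_deriv_continuous: "caloric w \<Longrightarrow> continuous_on (UNIV \<times> {..0}) (time_deriv w)"
  by (rule cylinder_continuous[OF time_deriv_C1])

lemma slice_continuous: "continuous_on (UNIV \<times> {..0}) w \<Longrightarrow> S \<subseteq> {..0} \<Longrightarrow> continuous_on S (\<lambda>t. w (q, t))"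
  by (rule continuous_on_compose2[where t="UNIV \<times> {..0}" and g=w]) (auto intro!: continuous_intros)

section \<open>Decay of the energy\<close>

text \<open>A difference over a step \<open>h\<close> is the integral of the time derivative, so by Cauchy--Schwarz its
  square is at most \<open>h\<close> times the energy of the derivative along the time line; integrating over
  a time interval of length \<open>R\<^sup>2\<close> gives the factor.\<close>
lemma energy_space_time_diff:
  assumes w: "caloric w" and h: "h > 0" and R: "R > 0" and hR: "h \<le> 3 * R\<^sup>2"
  shows "energy p R (space_time_diff h w) \<le> R\<^sup>2 * h * energy p (2 * R) (time_deriv w)"
proof -
  let ?S = "space_time_diff h w" and ?v = "time_deriv w"
  interpret pair_sigma_finite vol "lborel :: real measure" by (rule pair_sigma_finite_spacetime)
  have cS: "continuous_on (UNIV \<times> {..0}) ?S" by (rule caloric_continuous[OF caloric_space_time_diff[OF w h]])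
  have cv: "continuous_on (UNIV \<times> {..0}) ?v" by (rule time_deriv_continuous[OF w])
  let ?f = "\<lambda>q t. indicator (cyl p R (R\<^sup>2)) (q, t) * (?S (q, t))\<^sup>2"
  let ?g = "\<lambda>q t. indicator (cyl p (2 * R) ((2 * R)\<^sup>2)) (q, t) * (?v (q, t))\<^sup>2"
  have if': "integrable spacetime (\<lambda>z. indicator (cyl p R (R\<^sup>2)) z * (?S z)\<^sup>2)" by (intro cyl_integrable continuous_intros cS)
  have ig: "integrable spacetime (\<lambda>z. indicator (cyl p (2 * R) ((2 * R)\<^sup>2)) z * (?v z)\<^sup>2)" by (intro cyl_integrable continuous_intros cv)
  have pt: "(\<integral>t. ?f q t \<partial>lborel) \<le> R\<^sup>2 * h * (\<integral>t. ?g q t \<partial>lborel)" for q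
  proof (cases "d p q \<le> R")
    case False
    then have "?f q = (\<lambda>t. 0)" by (auto simp: cyl_def indicator_def)
    then have "(\<integral>t. ?f q t \<partial>lborel) = 0" by simp
    moreover have "0 \<le> R\<^sup>2 * h * (\<integral>t. ?g q t \<partial>lborel)" using h by (intro mult_nonneg_nonneg integral_nonneg_AE AE_I2) auto
    ultimately show ?thesis by linarith
  next
    case True
    let ?I = "{-((2 * R)\<^sup>2)..0}"
    let ?E = "integral ?I (\<lambda>t. (?v (q, t))\<^sup>2)"
    have vc: "continuous_on S (\<lambda>t. (?v (q, t))\<^sup>2)" if "S \<subseteq> {..0}" for S by (intro continuous_intros slice_continuous[OF cv that])
    have E: "(\<integral>t. ?g q t \<partial>lborel) = ?E"
    proof -
      have "(\<integral>t. ?g q t \<partial>lborel) = (LINT t:?I|lborel. (?v (q, t))\<^sup>2)"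
        unfolding set_lebesgue_integral_def using True R by (intro Bochner_Integration.integral_cong) (auto simp: cyl_def indicator_def)
      also have "\<dots> = ?E"
      proof (rule set_borel_integral_eq_integral(2))
        show "set_integrable lborel ?I (\<lambda>t. (?v (q, t))\<^sup>2)"
          unfolding set_integrable_def by (intro borel_integrable_compact vc) auto
      qed
      finally show ?thesis .
    qed
    have bd: "(?S (q, t))\<^sup>2 \<le> h * ?E" if t: "t \<in> {-(R\<^sup>2)..0}" for t
    proof -
      have sub: "{t - h..t} \<subseteq> ?I" using t hR by (auto simp: power_mult_distrib)
      have "((\<lambda>s. ?v (q, s)) has_integral w (q, t) - w (q, t - h)) {t - h..t}"
        by (rule fundamental_theorem_of_calculus)
           (use h t in \<open>auto intro!: has_vector_derivative_within_subset[OF caloric_time_derivative[OF w]]\<close>)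
      then have "?S (q, t) = integral {t - h..t} (\<lambda>s. ?v (q, s))" using t by (simp add: space_time_diff_def integral_unique)
      then have "(?S (q, t))\<^sup>2 \<le> (t - (t - h)) * integral {t - h..t} (\<lambda>s. (?v (q, s))\<^sup>2)"
        using integral_cauchy_schwarz[OF slice_continuous[OF cv], of "t - h" t q] h t by auto
      also have "\<dots> \<le> h * ?E"
      proof -
        have "integral {t - h..t} (\<lambda>s. (?v (q, s))\<^sup>2) \<le> ?E"
          by (rule integral_subset_le[OF sub]) (use t h in \<open>auto intro!: integrable_continuous_real vc\<close>)
        then show ?thesis using h by (simp add: mult_left_mono)
      qed
      finally show ?thesis .
    qed
    have "(\<integral>t. ?f q t \<partial>lborel) \<le> (\<integral>t. indicator {-(R\<^sup>2)..0} t * (h * ?E) \<partial>lborel)"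
    proof (rule integral_mono)
      have "integrable lborel (\<lambda>t. indicator {-(R\<^sup>2)..0} t *\<^sub>R (?S (q, t))\<^sup>2)"
        by (intro borel_integrable_compact continuous_intros slice_continuous[OF cS]) auto
      moreover have "(\<lambda>t. indicator {-(R\<^sup>2)..0} t *\<^sub>R (?S (q, t))\<^sup>2) = ?f q" using True by (auto simp: fun_eq_iff cyl_def indicator_def)
      ultimately show "integrable lborel (?f q)" by simp
      show "integrable lborel (\<lambda>t. indicator {-(R\<^sup>2)..0} t * (h * ?E))" by (intro integrable_mult_left integrable_real_indicator) auto
      show "?f q t \<le> indicator {-(R\<^sup>2)..0} t * (h * ?E)" for t using bd[of t] True by (auto simp: cyl_def indicator_def)
    qed
    also have "\<dots> = R\<^sup>2 * h * (\<integral>t. ?g q t \<partial>lborel)" unfolding E by simp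
    finally show ?thesis .
  qed
  have "energy p R ?S = (\<integral>q. (\<integral>t. ?f q t \<partial>lborel) \<partial>vol)" unfolding energy_def using integral_fst'[OF if'] by simp
  also have "\<dots> \<le> (\<integral>q. R\<^sup>2 * h * (\<integral>t. ?g q t \<partial>lborel) \<partial>vol)"
    by (rule integral_mono[OF integrable_fst'[OF if'] integrable_mult_right[OF integrable_fst'[OF ig]] pt])
  also have "\<dots> = R\<^sup>2 * h * energy p (2 * R) ?v" unfolding energy_def using integral_fst'[OF ig] by simp
  finally show ?thesis .
qed

definition energy_growth :: "'a \<Rightarrow> ('a \<times> real \<Rightarrow> real) \<Rightarrow> real \<Rightarrow> bool" where
  "energy_growth p w n \<longleftrightarrow> (\<exists>C R0. \<forall>R\<ge>R0. energy p R w \<le> C * R powr n)"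

text \<open>Estimating the difference by the time derivative costs a factor \<open>R\<^sup>2\<close>, and the energy estimate for
  the time derivative gains \<open>R\<^sup>-\<^sup>4\<close>.\<close>
lemma energy_growth_diff:
  assumes w: "caloric w" and h: "h > 0" and gr: "energy_growth p w n"
  shows "energy_growth p (space_time_diff h w) (n - 2)"
proof -
  obtain C R0 where C: "\<And>R. R \<ge> R0 \<Longrightarrow> energy p R w \<le> C * R powr n" using gr unfolding energy_growth_def by blast
  let ?c = "51202 * 12801 :: real"
  have "energy p R (space_time_diff h w) \<le> (h * ?c / 16 * C * 4 powr n) * R powr (n - 2)" if R: "R \<ge> max (max R0 1) h" for R
  proof -
    have R': "R > 0" "R \<ge> 1" "R \<ge> R0" "R \<ge> h" using R by auto
    have "h \<le> 3 * R\<^sup>2" using R' h mult_mono[of 1 R h R] by (simp add: power2_eq_square)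
    then have "energy p R (space_time_diff h w) \<le> R\<^sup>2 * h * energy p (2 * R) (time_deriv w)" by (rule energy_space_time_diff[OF w h R'(1)])
    also have "\<dots> = h / (16 * R\<^sup>2) * ((2 * R)^4 * energy p (2 * R) (time_deriv w))" using R'(1) by (simp add: field_simps power2_eq_square power4_eq_xxxx)
    also have "\<dots> \<le> h / (16 * R\<^sup>2) * (?c * energy p (2 * (2 * R)) w)"
      using energy_time_deriv[OF w, of "2 * R" p] R'(1) h by (intro mult_left_mono) auto
    also have "\<dots> \<le> h / (16 * R\<^sup>2) * (?c * (C * (2 * (2 * R)) powr n))"
      using C[of "2 * (2 * R)"] R' h by (intro mult_left_mono) auto
    also have "\<dots> = (h * ?c / 16 * C * 4 powr n) * (R powr n / R\<^sup>2)"
      using R'(1) by (simp add: powr_mult field_simps)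
    also have "R powr n / R\<^sup>2 = R powr (n - 2)" using R'(1) by (simp add: powr_diff powr_numeral)
    finally show ?thesis .
  qed
  then show ?thesis unfolding energy_growth_def by blast
qed

text \<open>In a chart the volume has a positive density with respect to Lebesgue measure.\<close>
lemma vol_open_pos: assumes U: "open U" "U \<noteq> {}" shows "emeasure vol U > 0"
proof -
  obtain p where p: "p \<in> U" using U by blast
  obtain c where c: "c \<in> A" "p \<in> fst c" using ex_chart by blast
  let ?V = "U \<inter> fst c" and ?X = "snd c ` (U \<inter> fst c)"
  have V: "open ?V" using U c chart_open by blast
  have X: "open ?X" "?X \<noteq> {}" using chart_image_open[OF c(1) V] p c by auto
  have eV: "emeasure vol ?V = (\<integral>\<^sup>+x\<in>?X. ennreal (dens c x) \<partial>lborel)"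
    using vol_is_volume c V unfolding is_volume_def by auto
  have "emeasure vol ?V \<noteq> 0"
  proof
    assume "emeasure vol ?V = 0"
    have cd: "continuous_on ?X (dens c)" by (rule continuous_on_subset[OF dens_cont[OF c(1)]]) auto
    have "(\<lambda>x. indicator ?X x *\<^sub>R dens c x) \<in> borel_measurable borel" by (rule borel_measurable_continuous_on_indicator[OF borel_open[OF X(1)] cd])
    then have m: "(\<lambda>x. ennreal (indicator ?X x *\<^sub>R dens c x)) \<in> borel_measurable lborel" by simp
    have "(\<integral>\<^sup>+x\<in>?X. ennreal (dens c x) \<partial>lborel) = (\<integral>\<^sup>+x. ennreal (indicator ?X x *\<^sub>R dens c x) \<partial>lborel)"
      by (intro nn_integral_cong) (auto simp: indicator_def)
    then have "(\<integral>\<^sup>+x. ennreal (indicator ?X x *\<^sub>R dens c x) \<partial>lborel) = 0" using eV \<open>emeasure vol ?V = 0\<close> by simp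
    then have "AE x in lborel. ennreal (indicator ?X x *\<^sub>R dens c x) = 0" using nn_integral_0_iff_AE[OF m] by simp
    then have "AE x in lborel. x \<notin> ?X"
    proof (rule AE_mp, intro AE_I2 impI notI)
      fix x assume "ennreal (indicator ?X x *\<^sub>R dens c x) = 0" "x \<in> ?X"
      moreover have "dens c x > 0" using dens_pos[OF c(1), of x] \<open>x \<in> ?X\<close> by auto
      ultimately show False by simp
    qed
    then have "emeasure lborel ?X = 0" using X(1) AE_iff_null[of lborel "\<lambda>x. x \<notin> ?X"] by (auto simp: null_sets_def)
    then have "?X \<in> null_sets lborel" using X(1) by auto
    then have "negligible ?X" by (simp add: negligible_iff_null_sets null_sets_completionI)
    then show False using X open_not_negligible by blast
  qed
  moreover have "emeasure vol ?V \<le> emeasure vol U" using U(1) by (intro emeasure_mono) auto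
  ultimately show ?thesis using not_gr_zero by fastforce
qed

lemma energy_mono:
  assumes w: "continuous_on (UNIV \<times> {..0}) w" and R: "0 \<le> R" "R \<le> R'" shows "energy p R w \<le> energy p R' w"
  unfolding energy_def
proof (rule integral_mono)
  have "R\<^sup>2 \<le> R'\<^sup>2" using R by (intro power_mono)
  then have "cyl p R (R\<^sup>2) \<subseteq> cyl p R' (R'\<^sup>2)" using R unfolding cyl_def by (intro Sigma_mono atLeastatMost_subset_iff[THEN iffD2]) auto
  then show "indicator (cyl p R (R\<^sup>2)) z * (w z)\<^sup>2 \<le> indicator (cyl p R' (R'\<^sup>2)) z * (w z)\<^sup>2" for z by (auto simp: indicator_def)
qed (intro cyl_integrable continuous_intros w)+

text \<open>A value different from zero would persist on a product of an open set and a time interval, which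
  has positive measure and lies in a large cylinder. The interval ends at \<open>t\<close> and not after it, since
  \<open>t\<close> may be the terminal time.\<close>
lemma zero_energy_imp_zero:
  assumes w: "continuous_on (UNIV \<times> {..0}) w" and E: "\<And>R. R > 0 \<Longrightarrow> energy p R w \<le> 0" and t: "t \<le> 0"
  shows "w (q, t) = 0"
proof (rule ccontr)
  assume nz: "w (q, t) \<noteq> 0"
  define c where "c = \<bar>w (q, t)\<bar> / 2"
  have c: "c > 0" "c < \<bar>w (q, t)\<bar>" using nz by (auto simp: c_def)
  have "continuous_on (UNIV \<times> {..0}) (\<lambda>z. \<bar>w z\<bar>)" by (intro continuous_intros w)
  then obtain O' where O': "open O'" "O' \<inter> (UNIV \<times> {..0}) = (\<lambda>z. \<bar>w z\<bar>) -` {c<..} \<inter> (UNIV \<times> {..0})"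
    unfolding continuous_on_open_invariant by (metis open_greaterThan)
  have "(q, t) \<in> O'" using O'(2) c(2) t by auto
  then obtain U I where UI: "open U" "open I" "q \<in> U" "t \<in> I" "U \<times> I \<subseteq> O'" using open_prod_elim[OF O'(1)] by (metis SigmaE2)
  obtain e where e: "e > 0" "ball t e \<subseteq> I" using UI(2,4) open_contains_ball by blast
  let ?J = "{t - e / 2..t}"
  let ?V = "U \<inter> {x. d q x < 1}"
  have V: "open ?V" "q \<in> ?V" using UI(1,3) open_d_ball d_refl by auto
  define R where "R = d p q + 1 + \<bar>t\<bar> + e"
  have R: "R \<ge> 1" using d_nonneg[of p q] e(1) by (simp add: R_def)
  have sub: "?V \<times> ?J \<subseteq> cyl p R (R\<^sup>2)"
  proof clarify
    fix x s assume x: "x \<in> U" "d q x < 1" and s: "s \<in> ?J"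
    have "d p x \<le> R" using d_triangle[of p x q] x e(1) by (simp add: R_def)
    moreover have "R \<le> R\<^sup>2" using R by (simp add: power2_eq_square)
    moreover have "- R \<le> s" using s t e(1) d_nonneg[of p q] unfolding R_def atLeastAtMost_iff by linarith
    ultimately show "(x, s) \<in> cyl p R (R\<^sup>2)" using s t by (auto simp: cyl_def)
  qed
  have big: "c\<^sup>2 \<le> (w z)\<^sup>2" if z: "z \<in> ?V \<times> ?J" for z
  proof -
    have "snd z \<in> ball t e" using z e(1) by (auto simp: dist_real_def)
    then have "snd z \<in> I" using e(2) by blast
    then have "z \<in> U \<times> I" using z by (simp add: mem_Times_iff)
    then have "z \<in> O'" using UI(5) by blast
    then have "z \<in> O' \<inter> (UNIV \<times> {..0})" using z t by (auto simp: mem_Times_iff)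
    then have "c < \<bar>w z\<bar>" unfolding O'(2) by simp
    then show ?thesis using c(1) by (metis abs_le_square_iff abs_of_pos less_imp_le)
  qed
  have meas: "?V \<times> ?J \<in> sets spacetime" using V(1) by (intro pair_measureI) auto
  have em: "emeasure spacetime (?V \<times> ?J) = emeasure vol ?V * emeasure lborel ?J"
    by (rule sigma_finite_measure.emeasure_pair_measure_Times[OF sigma_finite_lborel]) (use V(1) in auto)
  have vfin: "emeasure vol ?V < \<infinity>"
  proof -
    have "emeasure vol ?V \<le> emeasure vol {x. d q x \<le> 1}"
      by (intro emeasure_mono) (auto intro!: borel_closed closed_d_cball)
    then show ?thesis using vol_compact_finite[OF compact_d_cball] by (meson le_less_trans)
  qed
  have J: "emeasure lborel ?J = ennreal (e / 2)" using e(1) by simp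
  have fin: "emeasure spacetime (?V \<times> ?J) < \<infinity>" unfolding em J using vfin by (simp add: ennreal_mult_less_top)
  have "?V \<noteq> {}" using V(2) by blast
  then have "emeasure vol ?V > 0" by (rule vol_open_pos[OF V(1)])
  then have pos: "emeasure spacetime (?V \<times> ?J) > 0" unfolding em J using e(1) by (auto simp: ennreal_zero_less_mult_iff)
  have "c\<^sup>2 * measure spacetime (?V \<times> ?J) = (\<integral>z. c\<^sup>2 * indicator (?V \<times> ?J) z \<partial>spacetime)" using meas by simp
  also have "\<dots> \<le> energy p R w"
    unfolding energy_def
  proof (rule integral_mono)
    show "integrable spacetime (\<lambda>z. c\<^sup>2 * indicator (?V \<times> ?J) z)" using meas fin by (intro integrable_mult_right integrable_real_indicator)
    show "integrable spacetime (\<lambda>z. indicator (cyl p R (R\<^sup>2)) z * (w z)\<^sup>2)" by (intro cyl_integrable continuous_intros w)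
    show "c\<^sup>2 * indicator (?V \<times> ?J) z \<le> indicator (cyl p R (R\<^sup>2)) z * (w z)\<^sup>2" for z
      using big[of z] sub by (cases "z \<in> ?V \<times> ?J") auto
  qed
  also have "\<dots> \<le> 0" using E R by simp
  finally have "measure spacetime (?V \<times> ?J) \<le> 0" using c(1) by (simp add: mult_le_0_iff)
  then have "ennreal (measure spacetime (?V \<times> ?J)) = 0" by (rule ennreal_neg)
  moreover have "emeasure spacetime (?V \<times> ?J) = ennreal (measure spacetime (?V \<times> ?J))"
    by (rule emeasure_eq_ennreal_measure) (use fin in simp)
  ultimately show False using pos by simp
qed

text \<open>The energy is increasing in \<open>R\<close> and tends to zero.\<close>
lemma negative_growth_imp_zero:
  assumes w: "continuous_on (UNIV \<times> {..0}) w" and gr: "energy_growth p w n" and n: "n < 0" and t: "t \<le> 0"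
  shows "w (q, t) = 0"
proof (rule zero_energy_imp_zero[OF w _ t])
  fix R :: real assume R: "R > 0"
  obtain C R0 where C: "\<And>R. R \<ge> R0 \<Longrightarrow> energy p R w \<le> C * R powr n" using gr unfolding energy_growth_def by blast
  have "((\<lambda>R. R powr n) \<longlongrightarrow> 0) at_top" using n by (intro tendsto_neg_powr filterlim_ident)
  then have "((\<lambda>R. C * R powr n) \<longlongrightarrow> C * 0) at_top" by (intro tendsto_intros)
  moreover have "\<forall>\<^sub>F R' in at_top. energy p R w \<le> C * R' powr n"
    using eventually_ge_at_top[of "max R0 R"]
  proof eventually_elim
    case (elim R')
    then show ?case using energy_mono[OF w, of R R' p] C[of R'] R by simp
  qed
  ultimately have "energy p R w \<le> C * 0" by (intro tendsto_lowerbound) auto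
  then show "energy p R w \<le> 0" by simp
qed

text \<open>After \<open>m\<close> differences the growth exponent is \<open>n - 2 m < 0\<close>. The steps of the differences are
  arbitrary, which is why the conclusion is strong enough to give a polynomial.\<close>
lemma energy_growth_imp_differences_vanish:
  assumes "caloric w" "energy_growth p w n" "n < 2 * real m"
  shows "differences_vanish m (\<lambda>t. w (q, t))"
  using assms
proof (induction m arbitrary: w n)
  case 0
  then show ?case using negative_growth_imp_zero[OF caloric_continuous[OF 0(1)] 0(2)] by simp
next
  case (Suc m)
  have "differences_vanish m (time_diff h (\<lambda>t. w (q, t)))" if h: "h > 0" for h
  proof (rule differences_vanish_cong)
    show "space_time_diff h w (q, t) = time_diff h (\<lambda>t. w (q, t)) t" if "t \<le> 0" for t by (rule space_time_diff_slice[OF that])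
    show "differences_vanish m (\<lambda>t. space_time_diff h w (q, t))"
      by (rule Suc.IH[OF caloric_space_time_diff[OF Suc.prems(1) h] energy_growth_diff[OF Suc.prems(1) h Suc.prems(2)]])
         (use Suc.prems(3) in simp)
  qed
  then show ?case by simp
qed

end

section \<open>Iterated differences in time\<close>

lemma iterated_time_diff_vanish: "differences_vanish j f \<Longrightarrow> t \<le> 0 \<Longrightarrow> (time_diff 1 ^^ j) f t = 0"
proof (induction j arbitrary: f)
  case (Suc j)
  then have "differences_vanish j (time_diff 1 f)" by simp
  then show ?case using Suc.IH[of "time_diff 1 f"] Suc.prems(2) by (simp add: funpow_swap1)
qed simp

lemma iterated_time_diff_constant:
  assumes f: "differences_vanish (Suc j) f" and t: "t \<le> 0"
  shows "(time_diff 1 ^^ j) f t = (time_diff 1 ^^ j) f 0"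
proof (cases "t = 0")
  case False
  then have "differences_vanish j (time_diff (- t) f)" using f t by simp
  from iterated_time_diff_vanish[OF this order_refl]
  have "time_diff (- t) ((time_diff 1 ^^ j) f) 0 = 0" unfolding iterated_time_diff_commute .
  then show ?thesis by (simp add: time_diff_def)
qed (simp only:)

lemma iterated_time_diff_cong:
  assumes "\<And>t. t \<le> 0 \<Longrightarrow> f t = f' t" shows "t \<le> 0 \<Longrightarrow> (time_diff 1 ^^ j) f t = (time_diff 1 ^^ j) f' t"
proof (induction j arbitrary: t)
  case 0 then show ?case using assms by simp
next
  case (Suc j) then show ?case using Suc.IH[of t] Suc.IH[of "t - 1"] by (simp add: time_diff_def)
qed

lemma iterated_space_time_diff_slice:
  "t \<le> 0 \<Longrightarrow> (space_time_diff 1 ^^ j) u (p, t) = (time_diff 1 ^^ j) (\<lambda>s. u (p, s)) t"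
proof (induction j arbitrary: t)
  case (Suc j) then show ?case using Suc.IH[of t] Suc.IH[of "t - 1"] by (simp add: time_diff_def space_time_diff_def)
qed simp

lemma iterated_space_time_diff_lincomb:
  "(space_time_diff h ^^ j) (\<lambda>z. a * u z + b * v z) = (\<lambda>z. a * (space_time_diff h ^^ j) u z + b * (space_time_diff h ^^ j) v z)"
proof (induction j)
  case (Suc j)
  show ?case unfolding funpow.simps o_apply Suc by (auto simp: space_time_diff_def fun_eq_iff algebra_simps)
qed simp

section \<open>Dimension counting\<close>

lemma fun_subspace_iff:
  "fun_space.subspace S \<longleftrightarrow> S \<noteq> {} \<and> (\<forall>a b. \<forall>u\<in>S. \<forall>v\<in>S. (\<lambda>z. a * u z + b * v z) \<in> S)"
proof
  assume S: "fun_space.subspace S"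
  have "(\<lambda>z. a * u z + b * v z) \<in> S" if uv: "u \<in> S" "v \<in> S" for a b u v
    using fun_space.subspace_add[OF S fun_space.subspace_scale[OF S uv(1), of a] fun_space.subspace_scale[OF S uv(2), of b]]
    by (simp add: plus_fun_def)
  then show "S \<noteq> {} \<and> (\<forall>a b. \<forall>u\<in>S. \<forall>v\<in>S. (\<lambda>z. a * u z + b * v z) \<in> S)"
    using fun_space.subspace_0[OF S] by blast
next
  assume S: "S \<noteq> {} \<and> (\<forall>a b. \<forall>u\<in>S. \<forall>v\<in>S. (\<lambda>z. a * u z + b * v z) \<in> S)"
  then have L: "(\<lambda>z. a * u z + b * v z) \<in> S" if "u \<in> S" "v \<in> S" for a b u v using that by blast
  obtain u0 where u0: "u0 \<in> S" using S by blast
  show "fun_space.subspace S"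
  proof (rule fun_space.subspaceI)
    show "0 \<in> S" using L[OF u0 u0, of 0 0] by (simp add: zero_fun_def)
    show "u + v \<in> S" if "u \<in> S" "v \<in> S" for u v using L[OF that, of 1 1] by (simp add: plus_fun_def)
    show "(\<lambda>z. c * u z) \<in> S" if "u \<in> S" for c u using L[OF that that, of c 0] by simp
  qed
qed

text \<open>The rank inequality: preimages of a basis of the image, together with a spanning set of the
  kernel, span the domain.\<close>
lemma fun_span_kernel_image:
  fixes T :: "('x \<Rightarrow> real) \<Rightarrow> 'y \<Rightarrow> real"
  assumes V: "fun_space.subspace V"
    and T: "\<And>a b u v. T (\<lambda>z. a * u z + b * v z) = (\<lambda>p. a * T u p + b * T v p)"
    and im: "T ` V \<subseteq> fun_space.span C" "finite C"
    and ker: "{v \<in> V. T v = 0} \<subseteq> fun_space.span B" "finite B" "B \<subseteq> V"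
  shows "\<exists>B'\<subseteq>V. finite B' \<and> card B' \<le> card B + card C \<and> V \<subseteq> fun_space.span B'"
proof -
  have VL: "(\<lambda>z. a * u z + b * v z) \<in> V" if "u \<in> V" "v \<in> V" for a b u v
    using V that unfolding fun_subspace_iff by blast
  obtain D where D: "D \<subseteq> T ` V" "fun_space.independent D" "T ` V \<subseteq> fun_space.span D"
    using fun_space.maximal_independent_subset[of "T ` V"] by blast
  have "D \<subseteq> fun_space.span C" using D(1) im(1) by blast
  then have Dfin: "finite D" "card D \<le> card C" using fun_space.independent_span_bound[OF im(2) D(2)] by auto
  have "\<forall>y\<in>D. \<exists>v. v \<in> V \<and> T v = y" using D(1) by blast
  from bchoice[OF this] obtain s where s: "\<forall>y\<in>D. s y \<in> V \<and> T (s y) = y" by (rule exE)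
  let ?B = "B \<union> s ` D"
  let ?S = "T ` (V \<inter> fun_space.span (s ` D))"
  have sub: "fun_space.subspace (V \<inter> fun_space.span (s ` D))" by (rule fun_space.subspace_inter[OF V fun_space.subspace_span])
  then have subL: "(\<lambda>z. a * u z + b * v z) \<in> V \<inter> fun_space.span (s ` D)"
    if "u \<in> V \<inter> fun_space.span (s ` D)" "v \<in> V \<inter> fun_space.span (s ` D)" for a b u v
    using that unfolding fun_subspace_iff by blast
  have "fun_space.subspace ?S"
    unfolding fun_subspace_iff
  proof (intro conjI allI ballI)
    show "?S \<noteq> {}" using sub unfolding fun_subspace_iff by blast
    fix a b x y assume "x \<in> ?S" "y \<in> ?S"
    then obtain u v where uv: "u \<in> V \<inter> fun_space.span (s ` D)" "v \<in> V \<inter> fun_space.span (s ` D)" "x = T u" "y = T v" by blast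
    show "(\<lambda>z. a * x z + b * y z) \<in> ?S" unfolding uv(3,4) T[symmetric] by (rule imageI[OF subL[OF uv(1,2)]])
  qed
  moreover have "D \<subseteq> ?S"
  proof
    fix y assume y: "y \<in> D"
    then have "s y \<in> V \<inter> fun_space.span (s ` D)" using s by (auto intro: fun_space.span_base)
    then have "T (s y) \<in> ?S" by (rule imageI)
    then show "y \<in> ?S" using s y by simp
  qed
  ultimately have DS: "fun_space.span D \<subseteq> ?S" by (intro fun_space.span_minimal)
  have "V \<subseteq> fun_space.span ?B"
  proof
    fix v assume v: "v \<in> V"
    then have "T v \<in> ?S" using D(3) DS by blast
    then obtain v' where v': "v' \<in> V" "v' \<in> fun_space.span (s ` D)" "T v = T v'" by blast
    \<comment> \<open>Subtracting a combination of chosen preimages leaves an element of the kernel.\<close>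
    let ?w = "\<lambda>z. 1 * v z + (- 1) * v' z"
    have "T ?w = 0" unfolding T v'(3) by (simp add: zero_fun_def)
    then have "?w \<in> {v \<in> V. T v = 0}" using VL[OF v v'(1)] by blast
    then have w: "?w \<in> fun_space.span ?B" using ker(1) fun_space.span_mono[of B ?B] by blast
    have "v' \<in> fun_space.span ?B" using v'(2) fun_space.span_mono[of "s ` D" ?B] by blast
    from fun_space.span_add[OF w this] show "v \<in> fun_space.span ?B" by (simp add: plus_fun_def)
  qed
  moreover have "card ?B \<le> card B + card C"
    using card_Un_le[of B "s ` D"] card_image_le[OF Dfin(1), of s] Dfin(2) by linarith
  moreover have "?B \<subseteq> V" using ker(3) s by blast
  ultimately show ?thesis using ker(2) Dfin(1) by blast
qed

lemma fun_dim_finite: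
  assumes "fun_dim H \<noteq> \<infinity>"
  shows "\<exists>C. finite C \<and> H \<subseteq> fun_space.span C \<and> fun_dim H = enat (card C)"
proof -
  obtain B where B: "B \<subseteq> H" "finite B" "H \<subseteq> fun_space.span B" using assms unfolding fun_dim_def by (auto split: if_splits)
  then have dim: "fun_dim H = enat (fun_space.dim H)" unfolding fun_dim_def by auto
  obtain C where C: "C \<subseteq> H" "fun_space.independent C" "H \<subseteq> fun_space.span C" "card C = fun_space.dim H"
    using fun_space.basis_exists[of H] by blast
  have "C \<subseteq> fun_space.span B" using B(3) C(1) by blast
  then have "finite C" using fun_space.independent_span_bound[OF B(2) C(2)] by blast
  then show ?thesis using C(3,4) dim by auto
qed

lemma fun_dim_le:
  assumes "B \<subseteq> V" "finite B" "V \<subseteq> fun_space.span B" shows "fun_dim V \<le> enat (card B)"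
  using assms fun_space.dim_le_card[OF assms(3,2)] unfolding fun_dim_def by auto

section \<open>Functions of polynomial growth\<close>

lemma powr_scale_bound:
  fixes v :: real
  assumes "\<bar>v\<bar> \<le> C * y powr a" "0 \<le> y" "y \<le> K * z" "0 \<le> K" "0 \<le> z" "0 \<le> a"
  shows "\<bar>v\<bar> \<le> (\<bar>C\<bar> * K powr a) * z powr a"
proof -
  have "C * y powr a \<le> \<bar>C\<bar> * y powr a" by (intro mult_right_mono) auto
  also have "\<dots> \<le> \<bar>C\<bar> * (K * z) powr a" using assms by (intro mult_left_mono powr_mono2) auto
  also have "\<dots> = (\<bar>C\<bar> * K powr a) * z powr a" using assms by (simp add: powr_mult)
  finally show ?thesis using assms(1) by linarith
qed

context complete_riemannian_manifold begin

text \<open>The growth condition over all parabolic cylinders is a pointwise bound in terms of the parabolic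
  distance to \<open>(p, 0)\<close>: each point is tested with a cylinder of comparable radius. In this form
  the base point can be changed by the triangle inequality.\<close>
lemma ancient_space_bound:
  assumes a: "a \<ge> 0" and "u \<in> ancient_space A g a"
  shows "\<exists>C\<ge>0. \<forall>q. \<forall>t\<le>0. \<bar>u (q, t)\<bar> \<le> C * (1 + d p q + sqrt \<bar>t\<bar>) powr a"
proof -
  from assms(2) obtain p' C where *: "\<forall>R>0. \<forall>q\<in>geodesic_ball A g p' R. \<forall>t\<in>{-(R\<^sup>2)..0}. \<bar>u (q, t)\<bar> \<le> C * (1 + R) powr a"
    unfolding ancient_space_def by blast
  have C: "\<bar>u (q, t)\<bar> \<le> C * (1 + R) powr a" if "R > 0" "d p' q < R" "- (R\<^sup>2) \<le> t" "t \<le> 0" for R q t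
    using * that unfolding geodesic_ball_def by auto
  let ?K = "2 * (1 + d p' p)"
  have "\<bar>u (q, t)\<bar> \<le> (\<bar>C\<bar> * ?K powr a) * (1 + d p q + sqrt \<bar>t\<bar>) powr a" if t: "t \<le> 0" for q t
  proof (rule powr_scale_bound)
    let ?r = "1 + d p' q + sqrt \<bar>t\<bar>"
    have r: "?r \<ge> 1" "d p' q < ?r" "sqrt \<bar>t\<bar> \<le> ?r" using d_nonneg[of p' q] real_sqrt_ge_zero[of "\<bar>t\<bar>"] by linarith+
    have "(sqrt \<bar>t\<bar>)\<^sup>2 \<le> ?r\<^sup>2" using r(3) by (intro power_mono) auto
    then have "- (?r\<^sup>2) \<le> t" using t by simp
    then show "\<bar>u (q, t)\<bar> \<le> C * (1 + ?r) powr a" using C[of ?r q t] r t by linarith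
    have "?K * (1 + d p q + sqrt \<bar>t\<bar>) = 2 + 2 * d p' p + 2 * d p q + 2 * sqrt \<bar>t\<bar> + 2 * (d p' p * (d p q + sqrt \<bar>t\<bar>))"
      by (simp add: algebra_simps)
    moreover have "d p' p * (d p q + sqrt \<bar>t\<bar>) \<ge> 0" "sqrt \<bar>t\<bar> \<ge> 0" by (simp_all add: d_nonneg)
    ultimately show "1 + ?r \<le> ?K * (1 + d p q + sqrt \<bar>t\<bar>)"
      using d_triangle[of p' q p] d_nonneg[of p' p] d_nonneg[of p q] by linarith
  qed (use a d_nonneg[of p' p] d_nonneg[of p q] d_nonneg[of p' q] in auto)
  then show ?thesis by (intro exI[of _ "\<bar>C\<bar> * ?K powr a"]) auto
qed

lemma ancient_spaceI:
  assumes u: "caloric u" and C: "\<And>q t. t \<le> 0 \<Longrightarrow> \<bar>u (q, t)\<bar> \<le> C * (1 + d p q + sqrt \<bar>t\<bar>) powr a" and a: "a \<ge> 0"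
  shows "u \<in> ancient_space A g a"
proof -
  have "\<bar>u (q, t)\<bar> \<le> (\<bar>C\<bar> * 2 powr a) * (1 + R) powr a" if R: "R > 0" "d p q < R" and t: "- (R\<^sup>2) \<le> t" "t \<le> 0" for R q t
  proof (rule powr_scale_bound[OF C[OF t(2)]])
    have "sqrt \<bar>t\<bar> \<le> R" using t R(1) by (intro real_le_lsqrt) auto
    then show "1 + d p q + sqrt \<bar>t\<bar> \<le> 2 * (1 + R)" using R by simp
    show "0 \<le> 1 + R" using R(1) by simp
    show "0 \<le> 1 + d p q + sqrt \<bar>t\<bar>" using d_nonneg[of p q] real_sqrt_ge_zero[of "\<bar>t\<bar>"] by linarith
  qed (use a in auto)
  then show ?thesis unfolding ancient_space_def mem_Collect_eq
    by (intro conjI u exI[of _ p] exI[of _ "\<bar>C\<bar> * 2 powr a"] allI impI ballI) (simp add: geodesic_ball_def)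
qed

lemma harmonic_spaceI:
  assumes u: "harmonic A g u" and C: "\<And>q. \<bar>u q\<bar> \<le> C * (1 + d p q) powr a" and a: "a \<ge> 0"
  shows "u \<in> harmonic_space A g a"
proof -
  have "\<bar>u q\<bar> \<le> (\<bar>C\<bar> * 1 powr a) * (1 + R) powr a" if "d p q < R" for R q
  proof -
    have "0 \<le> 1 + R" using that d_nonneg[of p q] by linarith
    moreover have "0 \<le> 1 + d p q" using d_nonneg[of p q] by linarith
    ultimately show ?thesis using that by (intro powr_scale_bound[OF C _ _ _ _ a]) (assumption | simp)+
  qed
  then show ?thesis unfolding harmonic_space_def mem_Collect_eq
    by (intro conjI u exI[of _ p] exI[of _ "\<bar>C\<bar> * 1 powr a"] allI impI ballI) (simp add: geodesic_ball_def)
qed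

lemma ancient_space_lincomb:
  assumes a: "a \<ge> 0" and u: "u \<in> ancient_space A g a" and v: "v \<in> ancient_space A g a"
  shows "(\<lambda>z. \<alpha> * u z + \<beta> * v z) \<in> ancient_space A g a"
proof -
  fix p
  obtain C where C: "C \<ge> 0" "\<And>q t. t \<le> 0 \<Longrightarrow> \<bar>u (q, t)\<bar> \<le> C * (1 + d p q + sqrt \<bar>t\<bar>) powr a"
    using ancient_space_bound[OF a u, of p] by blast
  obtain C' where C': "C' \<ge> 0" "\<And>q t. t \<le> 0 \<Longrightarrow> \<bar>v (q, t)\<bar> \<le> C' * (1 + d p q + sqrt \<bar>t\<bar>) powr a"
    using ancient_space_bound[OF a v, of p] by blast
  have bd: "\<bar>\<alpha> * u (q, t) + \<beta> * v (q, t)\<bar> \<le> (\<bar>\<alpha>\<bar> * C + \<bar>\<beta>\<bar> * C') * (1 + d p q + sqrt \<bar>t\<bar>) powr a" if t: "t \<le> 0" for q t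
  proof -
    have "\<bar>\<alpha> * u (q, t) + \<beta> * v (q, t)\<bar> \<le> \<bar>\<alpha>\<bar> * \<bar>u (q, t)\<bar> + \<bar>\<beta>\<bar> * \<bar>v (q, t)\<bar>" using abs_triangle_ineq[of "\<alpha> * u (q, t)" "\<beta> * v (q, t)"] by (simp add: abs_mult)
    also have "\<dots> \<le> \<bar>\<alpha>\<bar> * (C * (1 + d p q + sqrt \<bar>t\<bar>) powr a) + \<bar>\<beta>\<bar> * (C' * (1 + d p q + sqrt \<bar>t\<bar>) powr a)"
      by (intro add_mono mult_left_mono C(2) C'(2) t) auto
    also have "\<dots> = (\<bar>\<alpha>\<bar> * C + \<bar>\<beta>\<bar> * C') * (1 + d p q + sqrt \<bar>t\<bar>) powr a" by (simp add: algebra_simps)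
    finally show ?thesis .
  qed
  have "caloric (\<lambda>z. \<alpha> * u z + \<beta> * v z)" using u v by (intro caloric_lincomb) (auto simp: ancient_space_def)
  then show ?thesis by (rule ancient_spaceI[OF _ bd a])
qed

lemma ancient_space_time_diff:
  assumes a: "a \<ge> 0" and u: "u \<in> ancient_space A g a" and h: "h > 0"
  shows "space_time_diff h u \<in> ancient_space A g a"
proof -
  fix p
  obtain C where C: "C \<ge> 0" "\<And>q t. t \<le> 0 \<Longrightarrow> \<bar>u (q, t)\<bar> \<le> C * (1 + d p q + sqrt \<bar>t\<bar>) powr a"
    using ancient_space_bound[OF a u, of p] by blast
  let ?C' = "\<bar>C\<bar> * (1 + sqrt h) powr a"
  have bd: "\<bar>space_time_diff h u (q, t)\<bar> \<le> (C + ?C') * (1 + d p q + sqrt \<bar>t\<bar>) powr a" if t: "t \<le> 0" for q t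
  proof -
    have t': "t - h \<le> 0" using t h by simp
    have "\<bar>u (q, t - h)\<bar> \<le> ?C' * (1 + d p q + sqrt \<bar>t\<bar>) powr a"
    proof (rule powr_scale_bound[OF C(2)[OF t']])
      have "sqrt \<bar>t - h\<bar> = sqrt (\<bar>t\<bar> + h)" using t h by (intro arg_cong[where f=sqrt]) simp
      also have "\<dots> \<le> sqrt \<bar>t\<bar> + sqrt h" using h by (intro sqrt_add_le_add_sqrt) auto
      finally have 1: "sqrt \<bar>t - h\<bar> \<le> sqrt \<bar>t\<bar> + sqrt h" .
      have "sqrt h * (d p q + sqrt \<bar>t\<bar>) \<ge> 0" using h by (simp add: d_nonneg)
      then show "1 + d p q + sqrt \<bar>t - h\<bar> \<le> (1 + sqrt h) * (1 + d p q + sqrt \<bar>t\<bar>)" using 1 by (simp add: algebra_simps)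
    qed (use a h d_nonneg[of p q] in auto)
    moreover have "space_time_diff h u (q, t) = u (q, t) - u (q, t - h)" using t by (simp add: space_time_diff_def)
    ultimately show ?thesis using C(2)[OF t, of q] unfolding distrib_right by linarith
  qed
  have "caloric (space_time_diff h u)" using u by (intro caloric_space_time_diff h) (auto simp: ancient_space_def)
  then show ?thesis by (rule ancient_spaceI[OF _ bd a])
qed

lemma ancient_space_iterated_time_diff:
  assumes a: "a \<ge> 0" and u: "u \<in> ancient_space A g a"
  shows "(space_time_diff 1 ^^ j) u \<in> ancient_space A g a"
  by (induction j) (simp_all add: u ancient_space_time_diff[OF a])

text \<open>The energy over a cylinder is at most the square of the supremum times the measure of the cylinder,
  and both grow polynomially.\<close>
lemma ancient_space_energy_growth:
  assumes a: "a \<ge> 0" and u: "u \<in> ancient_space A g a" and vg: "polynomial_volume_growth A g"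
  shows "\<exists>p n. energy_growth p u n"
proof -
  obtain V e p where V: "\<And>R. R > 0 \<Longrightarrow> emeasure vol {q. d p q < R} \<le> ennreal (V * (1 + R) powr e)"
    using vg unfolding polynomial_volume_growth_def geodesic_ball_def by blast
  obtain C where C: "C \<ge> 0" "\<And>q t. t \<le> 0 \<Longrightarrow> \<bar>u (q, t)\<bar> \<le> C * (1 + d p q + sqrt \<bar>t\<bar>) powr a"
    using ancient_space_bound[OF a u, of p] by blast
  let ?e = "max e 0"
  have cu: "continuous_on (UNIV \<times> {..0}) u" using u by (intro caloric_continuous) (auto simp: ancient_space_def)
  have "energy p R u \<le> ((C * 3 powr a)\<^sup>2 * (\<bar>V\<bar> * 3 powr ?e)) * R powr (2 * a + ?e + 2)" if R: "R \<ge> 1" for R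
  proof -
    let ?Z = "cyl p R (R\<^sup>2)" and ?M = "C * 3 powr a * R powr a" and ?W = "\<bar>V\<bar> * 3 powr ?e * R powr ?e"
    have Zm: "?Z \<in> sets spacetime" unfolding cyl_def by (intro pair_measureI) (auto intro!: borel_closed closed_d_cball)
    have "emeasure vol {q. d p q \<le> R} \<le> emeasure vol {q. d p q < R + 1}"
      by (intro emeasure_mono) (auto intro!: borel_open open_d_ball)
    also have "\<dots> \<le> ennreal (V * (1 + (R + 1)) powr e)" using V[of "R + 1"] R by simp
    also have "\<dots> \<le> ennreal ?W"
    proof (rule ennreal_leI)
      have "V * (1 + (R + 1)) powr e \<le> \<bar>V\<bar> * (1 + (R + 1)) powr e" by (intro mult_right_mono) auto
      also have "\<dots> \<le> \<bar>V\<bar> * (1 + (R + 1)) powr ?e" using R by (intro mult_left_mono powr_mono) auto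
      also have "\<dots> \<le> \<bar>V\<bar> * (3 * R) powr ?e" using R by (intro mult_left_mono powr_mono2) auto
      finally show "V * (1 + (R + 1)) powr e \<le> ?W" using R by (simp add: powr_mult)
    qed
    finally have W: "emeasure vol {q. d p q \<le> R} \<le> ennreal ?W" .
    have "emeasure spacetime ?Z = emeasure vol {q. d p q \<le> R} * emeasure lborel {-(R\<^sup>2)..0}" unfolding cyl_def
      by (rule sigma_finite_measure.emeasure_pair_measure_Times[OF sigma_finite_lborel]) (auto intro!: borel_closed closed_d_cball)
    also have "\<dots> \<le> ennreal ?W * ennreal (R\<^sup>2)" using W by (intro mult_mono) auto
    also have "\<dots> = ennreal (?W * R\<^sup>2)" by (simp add: ennreal_mult')
    finally have Z: "emeasure spacetime ?Z \<le> ennreal (?W * R\<^sup>2)" .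
    then have Zfin: "emeasure spacetime ?Z < \<infinity>" using ennreal_less_top le_less_trans by (metis infinity_ennreal_def)
    have Zr: "measure spacetime ?Z \<le> ?W * R\<^sup>2" unfolding measure_def by (rule enn2real_leI[OF _ Z]) simp
    have bd: "(u z)\<^sup>2 \<le> ?M\<^sup>2" if "z \<in> ?Z" for z
    proof -
      obtain q t where z: "z = (q, t)" by (cases z)
      then have t: "t \<le> 0" "- (R\<^sup>2) \<le> t" "d p q \<le> R" using that by (auto simp: cyl_def)
      have "sqrt \<bar>t\<bar> \<le> R" using t R by (intro real_le_lsqrt) auto
      then have "\<bar>u (q, t)\<bar> \<le> (\<bar>C\<bar> * 3 powr a) * R powr a"
        by (intro powr_scale_bound[OF C(2)[OF t(1)]]) (use a R t d_nonneg[of p q] in auto)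
      then have "\<bar>u (q, t)\<bar> \<le> \<bar>?M\<bar>" using C(1) by simp
      then show ?thesis unfolding z abs_le_square_iff .
    qed
    have "energy p R u \<le> (\<integral>z. ?M\<^sup>2 * indicator ?Z z \<partial>spacetime)"
      unfolding energy_def
    proof (rule integral_mono)
      show "integrable spacetime (\<lambda>z. indicator ?Z z * (u z)\<^sup>2)" by (intro cyl_integrable continuous_intros cu)
      show "integrable spacetime (\<lambda>z. ?M\<^sup>2 * indicator ?Z z)" using Zm Zfin by (intro integrable_mult_right integrable_real_indicator)
      show "indicator ?Z z * (u z)\<^sup>2 \<le> ?M\<^sup>2 * indicator ?Z z" for z using bd[of z] by (cases "z \<in> ?Z") auto
    qed
    also have "\<dots> = ?M\<^sup>2 * measure spacetime ?Z" using Zm by simp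
    also have "\<dots> \<le> ?M\<^sup>2 * (?W * R\<^sup>2)" by (intro mult_left_mono Zr) simp
    also have "\<dots> = ((C * 3 powr a)\<^sup>2 * (\<bar>V\<bar> * 3 powr ?e)) * (R powr a * R powr a * R powr ?e * R powr 2)"
      using R by (simp add: power2_eq_square powr_numeral)
    also have "\<dots> = ((C * 3 powr a)\<^sup>2 * (\<bar>V\<bar> * 3 powr ?e)) * R powr (2 * a + ?e + 2)"
      by (simp only: powr_add[symmetric]) (simp add: algebra_simps)
    finally show ?thesis .
  qed
  then show ?thesis unfolding energy_growth_def by blast
qed

lemma caloric_slice_Ck:
  assumes u: "caloric u" shows "Ck_on m {..0} (\<lambda>t. u (p, t))"
proof -
  obtain c where c: "c \<in> A" "p \<in> fst c" using ex_chart by blast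
  have "Ck_on m {..0} (\<lambda>t. chart_rep c u ((snd c p, 0) + (0, t)))"
    by (rule Ck_on_affine[OF _ _ caloric_Ck[OF u c(1)]]) (use c in \<open>auto intro!: bounded_linear_Pair bounded_linear_zero bounded_linear_ident\<close>)
  then show ?thesis using cinv_chart[OF c] by (simp add: chart_rep_def)
qed

text \<open>The energy grows at some polynomial rate, so some iterated difference vanishes and the solution is
  a polynomial in time. Its degree, a priori large, is then cut down by the pointwise growth:
  \<open>(1 + sqrt \<bar>t\<bar>)\<^sup>2\<^sup>k\<close> is comparable with \<open>(1 + \<bar>t\<bar>)\<^sup>k\<close>.\<close>
lemma ancient_space_polynomial_in_time:
  assumes u: "u \<in> ancient_space A g (real (2 * k))" and vg: "polynomial_volume_growth A g"
  shows "\<exists>r. degree r \<le> k \<and> (\<forall>t\<le>0. u (p, t) = poly r t)"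
proof -
  have a: "real (2 * k) \<ge> 0" by simp
  obtain p0 n where n: "energy_growth p0 u n" using ancient_space_energy_growth[OF a u vg] by blast
  have cu: "caloric u" using u by (simp add: ancient_space_def)
  \<comment> \<open>Each difference lowers the growth exponent \<open>n\<close> of the energy by two.\<close>
  obtain m :: nat where "n / 2 < real m" using reals_Archimedean2 by blast
  then have "differences_vanish m (\<lambda>t. u (p, t))" by (intro energy_growth_imp_differences_vanish[OF cu n]) simp
  from differences_vanish_imp_poly[OF this caloric_slice_Ck[OF cu]] obtain r where r: "\<forall>t\<le>0. u (p, t) = poly r t" by (rule exE)
  obtain C where C: "C \<ge> 0" "\<And>q t. t \<le> 0 \<Longrightarrow> \<bar>u (q, t)\<bar> \<le> C * (1 + d p q + sqrt \<bar>t\<bar>) powr (real (2 * k))"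
    using ancient_space_bound[OF a u, of p] by blast
  have "\<bar>poly r t\<bar> \<le> (C * 2 ^ k) * (1 + \<bar>t\<bar>) ^ k" if t: "t \<le> 0" for t
  proof -
    have pos: "1 + sqrt \<bar>t\<bar> > 0" using real_sqrt_ge_zero[of "\<bar>t\<bar>"] by linarith
    have "poly r t = u (p, t)" using r t by simp
    then have "\<bar>poly r t\<bar> \<le> C * (1 + sqrt \<bar>t\<bar>) powr (real (2 * k))" using C(2)[OF t, of p] d_refl[of p] by simp
    also have "\<dots> = C * ((1 + sqrt \<bar>t\<bar>)\<^sup>2) ^ k" using powr_realpow[OF pos, of "2 * k"] by (simp add: power_mult)
    also have "\<dots> \<le> C * (2 * (1 + \<bar>t\<bar>)) ^ k"
    proof (intro mult_left_mono power_mono C(1))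
      have "(1 + sqrt \<bar>t\<bar>)\<^sup>2 + (1 - sqrt \<bar>t\<bar>)\<^sup>2 = 2 * (1 + (sqrt \<bar>t\<bar>)\<^sup>2)" by (simp only: power2_eq_square) (simp add: algebra_simps)
      then have "(1 + sqrt \<bar>t\<bar>)\<^sup>2 \<le> 2 * (1 + (sqrt \<bar>t\<bar>)\<^sup>2)" using zero_le_power2[of "1 - sqrt \<bar>t\<bar>"] by linarith
      then show "(1 + sqrt \<bar>t\<bar>)\<^sup>2 \<le> 2 * (1 + \<bar>t\<bar>)" by simp
    qed simp
    also have "\<dots> = (C * 2 ^ k) * (1 + \<bar>t\<bar>) ^ k" by (simp only: power_mult_distrib mult.assoc)
    finally show ?thesis .
  qed
  then show ?thesis using poly_growth_degree[of r "C * 2 ^ k" k] r by blast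
qed

section \<open>The filtration by degree in time\<close>

text \<open>The ancient solutions that are polynomials of degree less than \<open>j\<close> in time.\<close>
definition ancient_degree_less :: "nat \<Rightarrow> real \<Rightarrow> ('a \<times> real \<Rightarrow> real) set" where
  "ancient_degree_less j a = {u \<in> ancient_space A g a. \<forall>p. differences_vanish j (\<lambda>t. u (p, t))}"

text \<open>For a polynomial of degree at most \<open>j\<close> in time this is \<open>j!\<close> times the coefficient of \<open>t\<^sup>j\<close>. The iterated
  difference is preferred to the coefficient because it is manifestly a solution of the heat equation.\<close>
definition leading_coefficient :: "nat \<Rightarrow> ('a \<times> real \<Rightarrow> real) \<Rightarrow> 'a \<Rightarrow> real" where
  "leading_coefficient j u = (\<lambda>p. (space_time_diff 1 ^^ j) u (p, 0))"

lemma leading_coefficient_lincomb: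
  "leading_coefficient j (\<lambda>z. a * u z + b * v z) = (\<lambda>p. a * leading_coefficient j u p + b * leading_coefficient j v p)"
  by (simp add: leading_coefficient_def iterated_space_time_diff_lincomb)

lemma iterated_space_time_diff_constant:
  assumes u: "u \<in> ancient_degree_less (Suc j) a" and t: "t \<le> 0"
  shows "(space_time_diff 1 ^^ j) u (p, t) = leading_coefficient j u p"
proof -
  have "differences_vanish (Suc j) (\<lambda>t. u (p, t))" using u unfolding ancient_degree_less_def by blast
  from iterated_time_diff_constant[OF this t]
  show ?thesis unfolding leading_coefficient_def iterated_space_time_diff_slice[OF t] iterated_space_time_diff_slice[OF order_refl] .
qed

text \<open>The iterated difference solves the heat equation, has the same growth as \<open>u\<close> and is constant in
  time, so its time derivative and therefore its Laplacian vanish.\<close>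
lemma leading_coefficient_harmonic:
  assumes a: "a \<ge> 0" and u: "u \<in> ancient_degree_less (Suc j) a"
  shows "leading_coefficient j u \<in> harmonic_space A g a"
proof -
  define w where "w = (space_time_diff 1 ^^ j) u"
  let ?h = "leading_coefficient j u"
  have h: "?h = (\<lambda>p. w (p, 0))" by (simp add: leading_coefficient_def w_def)
  have const: "w (p, t) = w (p, 0)" if "t \<le> 0" for p t
    using iterated_space_time_diff_constant[OF u that, of p] unfolding h w_def[symmetric] .
  have "u \<in> ancient_space A g a" using u unfolding ancient_degree_less_def by blast
  then have ws: "w \<in> ancient_space A g a" unfolding w_def by (rule ancient_space_iterated_time_diff[OF a])
  then have w: "caloric w" by (simp add: ancient_space_def)
  have "time_deriv w (p, 0) = 0" for p
  proof -
    have "((\<lambda>s. w (p, s)) has_vector_derivative 0) (at 0 within {..0})"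
      by (rule has_vector_derivative_transform[OF _ _ has_vector_derivative_const[of "w (p, 0)"]]) (auto intro: const)
    from vector_derivative_within[OF at_within_atMost_nontrivial[OF order_refl] this] show ?thesis by (simp add: time_deriv_def)
  qed
  then have "has_laplacian A g ?h (\<lambda>_. 0)" using caloric_laplacian[OF w order_refl] unfolding h by simp
  moreover have "smooth_on (\<phi> ` U) (?h \<circ> inv_into U \<phi>)" if c: "(U, \<phi>) \<in> A" for U \<phi>
  proof -
    have "Ck_on m (\<phi> ` U) (\<lambda>x. chart_rep (U, \<phi>) w ((0, 0) + (x, 0)))" for m
      by (rule Ck_on_affine[OF _ _ caloric_Ck[OF w c]]) (auto intro!: bounded_linear_Pair bounded_linear_zero bounded_linear_ident)
    then show ?thesis unfolding smooth_on_def by (simp add: chart_rep_def h o_def)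
  qed
  ultimately have "harmonic A g ?h" unfolding harmonic_def by blast
  moreover fix p
  obtain C where C: "\<And>q t. t \<le> 0 \<Longrightarrow> \<bar>w (q, t)\<bar> \<le> C * (1 + d p q + sqrt \<bar>t\<bar>) powr a"
    using ancient_space_bound[OF a ws, of p] by blast
  have "\<bar>?h q\<bar> \<le> C * (1 + d p q) powr a" for q using C[of 0 q] unfolding h by simp
  ultimately show ?thesis by (rule harmonic_spaceI[OF _ _ a])
qed

text \<open>If the leading coefficient vanishes, so does the iterated unit difference at all times, and for
  polynomials the unit step decides about all steps.\<close>
lemma leading_coefficient_kernel:
  assumes u: "u \<in> ancient_degree_less (Suc j) (real (2 * k))" and z: "leading_coefficient j u = 0"
    and vg: "polynomial_volume_growth A g"
  shows "u \<in> ancient_degree_less j (real (2 * k))"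
proof -
  have us: "u \<in> ancient_space A g (real (2 * k))" using u unfolding ancient_degree_less_def by blast
  have "differences_vanish j (\<lambda>t. u (p, t))" for p
  proof -
    obtain r where r: "\<forall>t\<le>0. u (p, t) = poly r t" using ancient_space_polynomial_in_time[OF us vg] by blast
    have "(time_diff 1 ^^ j) (poly r) t = 0" if t: "t \<le> 0" for t
    proof -
      have "(time_diff 1 ^^ j) (poly r) t = (time_diff 1 ^^ j) (\<lambda>s. u (p, s)) t"
        by (rule iterated_time_diff_cong[OF _ t]) (use r in simp)
      also have "\<dots> = (space_time_diff 1 ^^ j) u (p, t)" by (rule iterated_space_time_diff_slice[OF t, symmetric])
      also have "\<dots> = 0" unfolding iterated_space_time_diff_constant[OF u t] z by simp
      finally show ?thesis .
    qed
    then have "differences_vanish j (poly r)" by (rule unit_differences_vanish)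
    then show ?thesis by (rule differences_vanish_cong[rotated]) (use r in simp)
  qed
  then show ?thesis using us unfolding ancient_degree_less_def by blast
qed

lemma differences_vanish_lincomb:
  "differences_vanish j f \<Longrightarrow> differences_vanish j f' \<Longrightarrow> differences_vanish j (\<lambda>t. a * f t + b * f' t)"
proof (induction j arbitrary: f f')
  case (Suc j)
  have "differences_vanish j (time_diff h (\<lambda>t. a * f t + b * f' t))" if "h > 0" for h
  proof -
    have "time_diff h (\<lambda>t. a * f t + b * f' t) = (\<lambda>t. a * time_diff h f t + b * time_diff h f' t)"
      by (auto simp: time_diff_def algebra_simps)
    then show ?thesis using Suc.IH[of "time_diff h f" "time_diff h f'"] Suc.prems that by simp
  qed
  then show ?case by simp
qed simp

lemma differences_vanish_Suc: "differences_vanish j f \<Longrightarrow> differences_vanish (Suc j) f"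
proof (induction j arbitrary: f)
  case 0 then show ?case by (simp add: time_diff_def)
next
  case (Suc j)
  have "differences_vanish (Suc j) (time_diff h f)" if "h > 0" for h using Suc.IH[of "time_diff h f"] Suc.prems that by simp
  then show ?case unfolding differences_vanish.simps(2)[of "Suc j"] by blast
qed

lemma differences_vanish_zero: "differences_vanish j (\<lambda>t. 0)"
  using differences_vanish_poly[of 0 j] by (simp add: poly_0[abs_def])

lemma ancient_degree_less_subspace:
  assumes a: "a \<ge> 0" and ne: "ancient_space A g a \<noteq> {}" shows "fun_space.subspace (ancient_degree_less j a)"
  unfolding fun_subspace_iff
proof (intro conjI allI ballI)
  obtain u where "u \<in> ancient_space A g a" using ne by blast
  then have "(\<lambda>z. 0 * u z + 0 * u z) \<in> ancient_space A g a" by (rule ancient_space_lincomb[OF a]) fact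
  then have "(\<lambda>z. 0) \<in> ancient_degree_less j a" unfolding ancient_degree_less_def by (simp add: differences_vanish_zero)
  then show "ancient_degree_less j a \<noteq> {}" by blast
  fix b c u v assume uv: "u \<in> ancient_degree_less j a" "v \<in> ancient_degree_less j a"
  then have "(\<lambda>z. b * u z + c * v z) \<in> ancient_space A g a"
    unfolding ancient_degree_less_def by (intro ancient_space_lincomb[OF a]) blast+
  moreover have "differences_vanish j (\<lambda>t. b * u (p, t) + c * v (p, t))" for p
    using uv unfolding ancient_degree_less_def by (intro differences_vanish_lincomb) blast+
  ultimately show "(\<lambda>z. b * u z + c * v z) \<in> ancient_degree_less j a" unfolding ancient_degree_less_def by simp
qed

text \<open>Each step of the filtration maps to the harmonic functions by the leading coefficient with kernel in
  the previous step, so each step adds at most the dimension of the space of harmonic functions.\<close>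
lemma ancient_degree_less_spanning:
  assumes C: "finite C" "harmonic_space A g (real (2 * k)) \<subseteq> fun_space.span C"
    and vg: "polynomial_volume_growth A g"
    and ne: "ancient_space A g (real (2 * k)) \<noteq> {}"
  shows "\<exists>B\<subseteq>ancient_degree_less j (real (2 * k)).
    finite B \<and> card B \<le> j * card C \<and> ancient_degree_less j (real (2 * k)) \<subseteq> fun_space.span B"
proof (induction j)
  case 0
  have "u = 0" if u: "u \<in> ancient_degree_less 0 (real (2 * k))" for u
  proof
    fix z :: "'a \<times> real"
    show "u z = 0 z" using u by (cases z; cases "snd z \<le> 0") (auto simp: ancient_degree_less_def ancient_space_def ancient_caloric_def)
  qed
  then have "ancient_degree_less 0 (real (2 * k)) \<subseteq> fun_space.span {}" by auto
  then show ?case by (intro exI[of _ "{}"]) simp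
next
  case (Suc j)
  let ?V = "\<lambda>j. ancient_degree_less j (real (2 * k))" and ?T = "leading_coefficient j"
  from Suc obtain B where B: "B \<subseteq> ?V j" "finite B" "card B \<le> j * card C" "?V j \<subseteq> fun_space.span B" by blast
  have inc: "?V j \<subseteq> ?V (Suc j)"
  proof
    fix u assume u: "u \<in> ?V j"
    then have us: "u \<in> ancient_space A g (real (2 * k))" unfolding ancient_degree_less_def by blast
    have "differences_vanish (Suc j) (\<lambda>t. u (p, t))" for p
    proof -
      have "differences_vanish j (\<lambda>t. u (p, t))" using u unfolding ancient_degree_less_def by blast
      then show ?thesis by (rule differences_vanish_Suc)
    qed
    then show "u \<in> ?V (Suc j)" using us unfolding ancient_degree_less_def by blast
  qed
  have "\<exists>B'\<subseteq>?V (Suc j). finite B' \<and> card B' \<le> card B + card C \<and> ?V (Suc j) \<subseteq> fun_space.span B'"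
  proof (rule fun_span_kernel_image[OF ancient_degree_less_subspace[OF _ ne] leading_coefficient_lincomb _ C(1) _ B(2)])
    show "?T ` ?V (Suc j) \<subseteq> fun_space.span C" using leading_coefficient_harmonic[of "real (2 * k)"] C(2) by auto
    show "{v \<in> ?V (Suc j). ?T v = 0} \<subseteq> fun_space.span B" using leading_coefficient_kernel[OF _ _ vg] B(4) by blast
    show "B \<subseteq> ?V (Suc j)" using B(1) inc by blast
  qed simp
  then obtain B' where "B' \<subseteq> ?V (Suc j)" "finite B'" "card B' \<le> card B + card C" "?V (Suc j) \<subseteq> fun_space.span B'" by blast
  then show ?case using B(3) by (intro exI[of _ B']) simp
qed

lemma ancient_space_degree: 
  assumes "polynomial_volume_growth A g" 
  shows "ancient_degree_less (k + 1) (real (2 * k)) = ancient_space A g (real (2 * k))"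
proof -
  have "differences_vanish (k + 1) (\<lambda>t. u (p, t))" if u: "u \<in> ancient_space A g (real (2 * k))" for u p
  proof -
    obtain r where r: "degree r \<le> k" "\<forall>t\<le>0. u (p, t) = poly r t" using ancient_space_polynomial_in_time[OF u assms] by blast
    show ?thesis
      by (rule differences_vanish_cong[OF _ differences_vanish_poly[of r "k + 1"]]) (use r in auto)
  qed
  then show ?thesis unfolding ancient_degree_less_def by blast
qed

end

theorem corollary1p5:
  fixes A :: "('a::{t2_space, second_countable_topology}, 'n::finite) chart set"
    and g :: "('a, 'n) metric"
    and k :: nat
  assumes "riemannian_manifold A g"
    and "connected (UNIV :: 'a set)"
    and "riem_complete A g"
    and "polynomial_volume_growth A g"
    and "k \<ge> 1"
  shows "fun_dim (ancient_space A g (real (2 * k)))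
           \<le> of_nat (k + 1) * fun_dim (harmonic_space A g (real (2 * k)))"
proof (cases "fun_dim (harmonic_space A g (real (2 * k))) = \<infinity> \<or> ancient_space A g (real (2 * k)) = {}")
  case True
  moreover have "fun_dim ({} :: ('a \<times> real \<Rightarrow> real) set) \<le> enat (card ({} :: ('a \<times> real \<Rightarrow> real) set))"
    by (rule fun_dim_le) auto
  ultimately show ?thesis by (auto simp: of_nat_eq_enat zero_enat_def[symmetric])
next
  case False
  interpret complete_riemannian_manifold A g
    using assms by (simp add: complete_riemannian_manifold_def complete_riemannian_manifold_axioms_def)
  obtain C where C: "finite C" "harmonic_space A g (real (2 * k)) \<subseteq> fun_space.span C"
    "fun_dim (harmonic_space A g (real (2 * k))) = enat (card C)" using fun_dim_finite False by blast
  obtain B where B: "B \<subseteq> ancient_space A g (real (2 * k))" "finite B" "card B \<le> (k + 1) * card C"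
    "ancient_space A g (real (2 * k)) \<subseteq> fun_space.span B"
    using ancient_degree_less_spanning[OF C(1,2) assms(4), of "k + 1"] False unfolding ancient_space_degree[OF assms(4)] by blast
  have "fun_dim (ancient_space A g (real (2 * k))) \<le> enat (card B)" by (rule fun_dim_le[OF B(1,2,4)])
  also have "\<dots> \<le> enat ((k + 1) * card C)" using B(3) by simp
  also have "\<dots> = of_nat (k + 1) * fun_dim (harmonic_space A g (real (2 * k)))"
    unfolding C(3) of_nat_eq_enat times_enat_simps(1) ..
  finally show ?thesis .
qed

end
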